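(* Let $C$ be a curve over an algebraically closed field $k$ and let $p\in C$ be a singular point. If $p\in C$ is Gorenstein with $m$ branches and genus one, then $p$ is an elliptic $m$-fold point, i.e. $$\hat{\mathcal O}_{C,p}\simeq\begin{cases}k[[x,y]]/(y^2-x^3)&m=1\\ k[[x,y]]/y(y-x^2)&m=2\\ k[[x,y]]/xy(y-x)&m=3\\ k[[x_1,\ldots,x_{m-1}]]/I_m&m\ge4,\end{cases}$$ where $I_m$ is the ideal generated by all quadrics of the form $x_h(x_i-x_j)$ with $i,j,h\in\{1,\ldots,m-1\}$ distinct.
   Context: A curve is a reduced connected 1-dimensional scheme of finite type over $k$. Let $\pi:\tilde C\to C$ be the normalization of $C$ at $p$. The number of branches is $m(p)=|\pi^{-1}(p)|$, the $\delta$-invariant is $\delta(p)=\dim_k(\pi_*\mathcal O_{\tilde C,p}/\mathcal O_{C,p})$, and the genus of the singularity is $g(p)=\delta(p)-m(p)+1$. The singularity $p$ is Gorenstein if the dualizing sheaf $\omega_C$ is invertible near $p$. *)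

theory Defs
  imports "HOL-Analysis.Analysis" "HOL-Algebra.Algebra"
begin

section \<open>Ringed spaces and schemes\<close>

text \<open>All section rings of one space live in a common type \<^typ>\<open>'r\<close>;
  \<open>restr Z U V\<close> is the restriction from \<open>U\<close> to \<open>V\<close>.\<close>

record ('p, 'r) ringed_space =
  base :: "'p topology"
  sections :: "'p set \<Rightarrow> 'r ring"
  restr :: "'p set \<Rightarrow> 'p set \<Rightarrow> 'r \<Rightarrow> 'r"

definition presheaf_of_rings :: "('p, 'r) ringed_space \<Rightarrow> bool" where
  "presheaf_of_rings Z \<longleftrightarrow>
     (\<forall>U. openin (base Z) U \<longrightarrow> cring (sections Z U)) \<and>
     (\<forall>U V. openin (base Z) U \<longrightarrow> openin (base Z) V \<longrightarrow> V \<subseteq> U \<longrightarrow>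
        restr Z U V \<in> ring_hom (sections Z U) (sections Z V)) \<and>
     (\<forall>U. openin (base Z) U \<longrightarrow> (\<forall>s\<in>carrier (sections Z U). restr Z U U s = s)) \<and>
     (\<forall>U V W. openin (base Z) U \<longrightarrow> openin (base Z) V \<longrightarrow> openin (base Z) W \<longrightarrow>
        V \<subseteq> U \<longrightarrow> W \<subseteq> V \<longrightarrow>
        (\<forall>s\<in>carrier (sections Z U). restr Z V W (restr Z U V s) = restr Z U W s))"

definition sheaf_of_rings :: "('p, 'r) ringed_space \<Rightarrow> bool" where
  "sheaf_of_rings Z \<longleftrightarrow> presheaf_of_rings Z \<and>
     (\<forall>\<U>. (\<forall>V\<in>\<U>. openin (base Z) V) \<longrightarrow>
        (\<forall>s\<in>carrier (sections Z (\<Union>\<U>)). \<forall>t\<in>carrier (sections Z (\<Union>\<U>)).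
           (\<forall>V\<in>\<U>. restr Z (\<Union>\<U>) V s = restr Z (\<Union>\<U>) V t) \<longrightarrow> s = t) \<and>
        (\<forall>s. (\<forall>V\<in>\<U>. s V \<in> carrier (sections Z V)) \<longrightarrow>
           (\<forall>V\<in>\<U>. \<forall>W\<in>\<U>. restr Z V (V \<inter> W) (s V) = restr Z W (V \<inter> W) (s W)) \<longrightarrow>
           (\<exists>t\<in>carrier (sections Z (\<Union>\<U>)). \<forall>V\<in>\<U>. restr Z (\<Union>\<U>) V t = s V)))"

text \<open>A germ is the equivalence class of a pair (neighbourhood, section).\<close>

definition germ :: "('p, 'r) ringed_space \<Rightarrow> 'p \<Rightarrow> 'p set \<Rightarrow> 'r \<Rightarrow> ('p set \<times> 'r) set" where
  "germ Z x U s = {(V, t). openin (base Z) V \<and> x \<in> V \<and> t \<in> carrier (sections Z V) \<and>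
     (\<exists>W. openin (base Z) W \<and> x \<in> W \<and> W \<subseteq> U \<inter> V \<and> restr Z U W s = restr Z V W t)}"

text \<open>The unions below range over equal sets: they pick the germ computed from
  arbitrary representatives on a common neighbourhood.\<close>

definition stalk :: "('p, 'r) ringed_space \<Rightarrow> 'p \<Rightarrow> ('p set \<times> 'r) set ring" where
  "stalk Z x =
    \<lparr>carrier = {germ Z x U s | U s. openin (base Z) U \<and> x \<in> U \<and> s \<in> carrier (sections Z U)},
     monoid.mult = (\<lambda>a b. \<Union>{germ Z x U (s \<otimes>\<^bsub>sections Z U\<^esub> t) | U s t. (U, s) \<in> a \<and> (U, t) \<in> b}),
     one = germ Z x (topspace (base Z)) \<one>\<^bsub>sections Z (topspace (base Z))\<^esub>,
     ring.zero = germ Z x (topspace (base Z)) \<zero>\<^bsub>sections Z (topspace (base Z))\<^esub>,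
     ring.add = (\<lambda>a b. \<Union>{germ Z x U (s \<oplus>\<^bsub>sections Z U\<^esub> t) | U s t. (U, s) \<in> a \<and> (U, t) \<in> b})\<rparr>"

definition nonunits :: "('a, 'b) ring_scheme \<Rightarrow> 'a set" where
  "nonunits R = carrier R - Units R"

definition vanishing_ideal :: "('p, 'r) ringed_space \<Rightarrow> 'p set \<Rightarrow> 'p \<Rightarrow> 'r set" where
  "vanishing_ideal Z U x =
     {s \<in> carrier (sections Z U). germ Z x U s \<in> nonunits (stalk Z x)}"

definition spec_topology :: "('a, 'b) ring_scheme \<Rightarrow> 'a set topology" where
  "spec_topology A =
     topology_generated_by {{P. primeideal P A \<and> f \<notin> P} | f. f \<in> carrier A}"

definition is_localization_away ::
  "('a, 'c) ring_scheme \<Rightarrow> 'a \<Rightarrow> ('b, 'd) ring_scheme \<Rightarrow> ('a \<Rightarrow> 'b) \<Rightarrow> bool" where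
  "is_localization_away A f B \<rho> \<longleftrightarrow>
     \<rho> \<in> ring_hom A B \<and> \<rho> f \<in> Units B \<and>
     (\<forall>b\<in>carrier B. \<exists>a\<in>carrier A. \<exists>n::nat. b \<otimes>\<^bsub>B\<^esub> (\<rho> f [^]\<^bsub>B\<^esub> n) = \<rho> a) \<and>
     (\<forall>a\<in>carrier A. \<rho> a = \<zero>\<^bsub>B\<^esub> \<longrightarrow> (\<exists>n::nat. (f [^]\<^bsub>A\<^esub> n) \<otimes>\<^bsub>A\<^esub> a = \<zero>\<^bsub>A\<^esub>))"

text \<open>\<open>U\<close> is affine iff the canonical morphism from \<open>U\<close> to the spectrum of its ring \<open>A\<close> of
  sections is an isomorphism: it is a homeomorphism, and on each basic open set
  \<open>D(f)\<close> the structure sheaf takes the value \<open>A\<^sub>f\<close>.\<close>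

definition affine_open :: "('p, 'r) ringed_space \<Rightarrow> 'p set \<Rightarrow> bool" where
  "affine_open Z U \<longleftrightarrow> openin (base Z) U \<and>
     homeomorphic_map (subtopology (base Z) U) (spec_topology (sections Z U))
       (vanishing_ideal Z U) \<and>
     (\<forall>f\<in>carrier (sections Z U).
        let D = {x \<in> U. f \<notin> vanishing_ideal Z U x}
        in is_localization_away (sections Z U) f (sections Z D) (restr Z U D))"

definition is_scheme :: "('p, 'r) ringed_space \<Rightarrow> bool" where
  "is_scheme Z \<longleftrightarrow> sheaf_of_rings Z \<and>
     (\<forall>x\<in>topspace (base Z). \<exists>U. affine_open Z U \<and> x \<in> U)"

definition reduced_scheme :: "('p, 'r) ringed_space \<Rightarrow> bool" where
  "reduced_scheme Z \<longleftrightarrow> (\<forall>U. openin (base Z) U \<longrightarrow>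
     (\<forall>s\<in>carrier (sections Z U). \<forall>n::nat.
        s [^]\<^bsub>sections Z U\<^esub> n = \<zero>\<^bsub>sections Z U\<^esub> \<longrightarrow> s = \<zero>\<^bsub>sections Z U\<^esub>))"

definition irreducible_closed :: "'p topology \<Rightarrow> 'p set \<Rightarrow> bool" where
  "irreducible_closed T Z \<longleftrightarrow> closedin T Z \<and> Z \<noteq> {} \<and>
     (\<forall>A B. closedin T A \<longrightarrow> closedin T B \<longrightarrow> Z \<subseteq> A \<union> B \<longrightarrow> Z \<subseteq> A \<or> Z \<subseteq> B)"

definition topological_dim :: "'p topology \<Rightarrow> enat" where
  "topological_dim T = Sup {enat n | n. \<exists>F :: nat \<Rightarrow> 'p set.
     (\<forall>i\<le>n. irreducible_closed T (F i)) \<and> (\<forall>i<n. F i \<subset> F (Suc i))}"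

definition krull_dim :: "('a, 'b) ring_scheme \<Rightarrow> enat" where
  "krull_dim R = Sup {enat n | n. \<exists>P :: nat \<Rightarrow> 'a set.
     (\<forall>i\<le>n. primeideal (P i) R) \<and> (\<forall>i<n. P i \<subset> P (Suc i))}"


section \<open>Curves over a field\<close>

text \<open>A \<open>K\<close>-scheme is a scheme \<open>Z\<close> with a ring homomorphism \<open>\<kappa>\<close> from \<open>K\<close> to the global
  sections of \<open>Z\<close>; this is the same as a morphism from \<open>Z\<close> to the spectrum of \<open>K\<close>.\<close>

definition scalar :: "('p, 'r) ringed_space \<Rightarrow> ('k \<Rightarrow> 'r) \<Rightarrow> 'p set \<Rightarrow> 'k \<Rightarrow> 'r" where
  "scalar Z \<kappa> U c = restr Z (topspace (base Z)) U (\<kappa> c)"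

definition finite_type :: "'k ring \<Rightarrow> ('k \<Rightarrow> 'r) \<Rightarrow> ('p, 'r) ringed_space \<Rightarrow> bool" where
  "finite_type K \<kappa> Z \<longleftrightarrow> (\<exists>\<U>. finite \<U> \<and> \<Union>\<U> = topspace (base Z) \<and>
     (\<forall>U\<in>\<U>. affine_open Z U \<and>
        (\<exists>S. finite S \<and> S \<subseteq> carrier (sections Z U) \<and>
           generate_ring (sections Z U) (scalar Z \<kappa> U ` carrier K \<union> S)
             = carrier (sections Z U))))"

definition curve_over :: "'k ring \<Rightarrow> ('k \<Rightarrow> 'r) \<Rightarrow> ('p, 'r) ringed_space \<Rightarrow> bool" where
  "curve_over K \<kappa> C \<longleftrightarrow> is_scheme C \<and>
     \<kappa> \<in> ring_hom K (sections C (topspace (base C))) \<and> finite_type K \<kappa> C \<and>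
     reduced_scheme C \<and> connected_space (base C) \<and> topological_dim (base C) = 1"

text \<open>Regularity is only applied to local rings of curves, which are Noetherian.\<close>

definition regular_local_ring :: "('a, 'b) ring_scheme \<Rightarrow> bool" where
  "regular_local_ring R \<longleftrightarrow> (\<exists>S. finite S \<and> S \<subseteq> carrier R \<and>
     Idl\<^bsub>R\<^esub> S = nonunits R \<and> enat (card S) = krull_dim R)"

definition singular_point :: "('p, 'r) ringed_space \<Rightarrow> 'p \<Rightarrow> bool" where
  "singular_point Z p \<longleftrightarrow> p \<in> topspace (base Z) \<and> \<not> regular_local_ring (stalk Z p)"


section \<open>Morphisms and the normalization at a point\<close>

record ('q, 's, 'p, 'r) scheme_map =
  pt :: "'q \<Rightarrow> 'p"
  pull :: "'p set \<Rightarrow> 'r \<Rightarrow> 's"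

definition preim :: "('q, 's) ringed_space \<Rightarrow> ('q, 's, 'p, 'r) scheme_map \<Rightarrow> 'p set \<Rightarrow> 'q set"
  where "preim Y \<pi> U = {y \<in> topspace (base Y). pt \<pi> y \<in> U}"

definition scheme_morphism ::
  "('q, 's) ringed_space \<Rightarrow> ('p, 'r) ringed_space \<Rightarrow> ('q, 's, 'p, 'r) scheme_map \<Rightarrow> bool" where
  "scheme_morphism Y Z \<pi> \<longleftrightarrow> continuous_map (base Y) (base Z) (pt \<pi>) \<and>
     (\<forall>U. openin (base Z) U \<longrightarrow>
        pull \<pi> U \<in> ring_hom (sections Z U) (sections Y (preim Y \<pi> U))) \<and>
     (\<forall>U V. openin (base Z) U \<longrightarrow> openin (base Z) V \<longrightarrow> V \<subseteq> U \<longrightarrow>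
        (\<forall>s\<in>carrier (sections Z U).
           pull \<pi> V (restr Z U V s) = restr Y (preim Y \<pi> U) (preim Y \<pi> V) (pull \<pi> U s))) \<and>
     (\<forall>U. openin (base Z) U \<longrightarrow> (\<forall>y\<in>preim Y \<pi> U. \<forall>s\<in>carrier (sections Z U).
        germ Y y (preim Y \<pi> U) (pull \<pi> U s) \<in> Units (stalk Y y) \<longrightarrow>
        germ Z (pt \<pi> y) U s \<in> Units (stalk Z (pt \<pi> y))))"

definition finite_over :: "('a, 'b) ring_scheme \<Rightarrow> 'a set \<Rightarrow> bool" where
  "finite_over B P \<longleftrightarrow> (\<exists>S. finite S \<and> S \<subseteq> carrier B \<and>
     (\<forall>b\<in>carrier B. \<exists>c\<in>S \<rightarrow> P. b = finsum B (\<lambda>s. c s \<otimes>\<^bsub>B\<^esub> s) S))"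

definition finite_morphism ::
  "('q, 's) ringed_space \<Rightarrow> ('p, 'r) ringed_space \<Rightarrow> ('q, 's, 'p, 'r) scheme_map \<Rightarrow> bool" where
  "finite_morphism Y Z \<pi> \<longleftrightarrow> scheme_morphism Y Z \<pi> \<and>
     (\<forall>U. affine_open Z U \<longrightarrow> affine_open Y (preim Y \<pi> U) \<and>
        finite_over (sections Y (preim Y \<pi> U)) (pull \<pi> U ` carrier (sections Z U)))"

text \<open>Every fraction \<open>a/b\<close> that is integral over \<open>R\<close> lies in \<open>R\<close>; the monic equation for
  \<open>a/b\<close> is written after multiplication by \<open>b\<^sup>n\<close>.\<close>

definition integrally_closed_domain :: "('a, 'b) ring_scheme \<Rightarrow> bool" where
  "integrally_closed_domain R \<longleftrightarrow> domain R \<and>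
     (\<forall>a\<in>carrier R. \<forall>b\<in>carrier R - {\<zero>\<^bsub>R\<^esub>}. \<forall>n::nat. \<forall>c\<in>{..<n} \<rightarrow> carrier R.
        n > 0 \<longrightarrow> (a [^]\<^bsub>R\<^esub> n) \<oplus>\<^bsub>R\<^esub>
          finsum R (\<lambda>i. c i \<otimes>\<^bsub>R\<^esub> ((a [^]\<^bsub>R\<^esub> i) \<otimes>\<^bsub>R\<^esub> (b [^]\<^bsub>R\<^esub> (n - i)))) {..<n} = \<zero>\<^bsub>R\<^esub>
        \<longrightarrow> (\<exists>d\<in>carrier R. a = d \<otimes>\<^bsub>R\<^esub> b))"

text \<open>The normalization of \<open>C\<close> at a closed point \<open>p\<close>: a finite birational morphism that is an
  isomorphism away from \<open>p\<close> and whose source is normal at all points over \<open>p\<close>. Density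
  excludes components of the source that are contracted to \<open>p\<close>.\<close>

definition normalization_at ::
  "('q, 's) ringed_space \<Rightarrow> ('q, 's, 'p, 'r) scheme_map \<Rightarrow> ('p, 'r) ringed_space \<Rightarrow> 'p \<Rightarrow> bool"
  where
  "normalization_at Y \<pi> C p \<longleftrightarrow> is_scheme Y \<and> finite_morphism Y C \<pi> \<and>
     homeomorphic_map (subtopology (base Y) (preim Y \<pi> (topspace (base C) - {p})))
       (subtopology (base C) (topspace (base C) - {p})) (pt \<pi>) \<and>
     (\<forall>V. openin (base C) V \<longrightarrow> p \<notin> V \<longrightarrow>
        pull \<pi> V \<in> ring_iso (sections C V) (sections Y (preim Y \<pi> V))) \<and>
     base Y closure_of (preim Y \<pi> (topspace (base C) - {p})) = topspace (base Y) \<and>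
     (\<forall>q\<in>preim Y \<pi> {p}. integrally_closed_domain (stalk Y q))"


section \<open>Invariants of a singularity\<close>

definition pushforward ::
  "('q, 's) ringed_space \<Rightarrow> ('q, 's, 'p, 'r) scheme_map \<Rightarrow> ('p, 'r) ringed_space
     \<Rightarrow> ('p, 's) ringed_space" where
  "pushforward Y \<pi> Z =
     \<lparr>base = base Z,
      sections = (\<lambda>U. sections Y (preim Y \<pi> U)),
      restr = (\<lambda>U V. restr Y (preim Y \<pi> U) (preim Y \<pi> V))\<rparr>"

text \<open>The quotient of \<open>M\<close> by \<open>W\<close> has dimension \<open>n\<close> over \<open>K\<close>, where \<open>\<gamma>\<close> is the structure map
  of the \<open>K\<close>-algebra \<open>M\<close>: some \<open>n\<close> elements of \<open>M\<close> represent a basis of the quotient.\<close>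

definition quotient_has_dim ::
  "'k ring \<Rightarrow> ('k \<Rightarrow> 'a) \<Rightarrow> ('a, 'b) ring_scheme \<Rightarrow> 'a set \<Rightarrow> nat \<Rightarrow> bool" where
  "quotient_has_dim K \<gamma> M W n \<longleftrightarrow> (\<exists>b\<in>{..<n} \<rightarrow> carrier M. \<forall>x\<in>carrier M.
     \<exists>!c. c \<in> {..<n} \<rightarrow>\<^sub>E carrier K \<and>
       x \<ominus>\<^bsub>M\<^esub> finsum M (\<lambda>i. \<gamma> (c i) \<otimes>\<^bsub>M\<^esub> b i) {..<n} \<in> W)"

definition has_delta_invariant ::
  "'k ring \<Rightarrow> ('k \<Rightarrow> 'r) \<Rightarrow> ('p, 'r) ringed_space \<Rightarrow> ('q, 's) ringed_space
     \<Rightarrow> ('q, 's, 'p, 'r) scheme_map \<Rightarrow> 'p \<Rightarrow> nat \<Rightarrow> bool" where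
  "has_delta_invariant K \<kappa> C Y \<pi> p d \<longleftrightarrow>
     (let F = pushforward Y \<pi> C; T = topspace (base C)
      in quotient_has_dim K (\<lambda>c. germ F p T (pull \<pi> T (\<kappa> c))) (stalk F p)
           {germ F p U (pull \<pi> U s) | U s.
              openin (base C) U \<and> p \<in> U \<and> s \<in> carrier (sections C U)} d)"

definition branches :: "('q, 's) ringed_space \<Rightarrow> ('q, 's, 'p, 'r) scheme_map \<Rightarrow> 'p \<Rightarrow> 'q set"
  where "branches Y \<pi> p = preim Y \<pi> {p}"

definition has_genus ::
  "'k ring \<Rightarrow> ('k \<Rightarrow> 'r) \<Rightarrow> ('p, 'r) ringed_space \<Rightarrow> ('q, 's) ringed_space
     \<Rightarrow> ('q, 's, 'p, 'r) scheme_map \<Rightarrow> 'p \<Rightarrow> int \<Rightarrow> bool" where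
  "has_genus K \<kappa> C Y \<pi> p g \<longleftrightarrow> finite (branches Y \<pi> p) \<and>
     (\<exists>d. has_delta_invariant K \<kappa> C Y \<pi> p d \<and> g = int d - int (card (branches Y \<pi> p)) + 1)"


section \<open>The dualizing sheaf and Gorenstein points\<close>

text \<open>Let \<open>A\<close> be finite over a polynomial subring \<open>P\<close> in one variable over the ground field,
  giving a finite surjective morphism \<open>h\<close> from the affine curve with ring \<open>A\<close> to the line.
  The dualizing sheaf of the curve is \<open>h\<^sup>!\<close> of that of the line; as the latter is trivial
  (generated by \<open>dt\<close>), it is the sheaf associated with the \<open>A\<close>-module
  \<open>Hom\<^sub>P(A, P)\<close>, where \<open>a\<close> acts by \<open>(a\<phi>)(x) = \<phi>(ax)\<close>. The fields \<open>mult\<close> and \<open>one\<close> of the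
  module record carry no information.\<close>

definition dualizing_module ::
  "('a, 'b) ring_scheme \<Rightarrow> 'a set \<Rightarrow> ('a, 'a \<Rightarrow> 'a) module" where
  "dualizing_module A P =
    \<lparr>carrier = {\<phi> \<in> carrier A \<rightarrow>\<^sub>E P.
       (\<forall>x\<in>carrier A. \<forall>y\<in>carrier A. \<phi> (x \<oplus>\<^bsub>A\<^esub> y) = \<phi> x \<oplus>\<^bsub>A\<^esub> \<phi> y) \<and>
       (\<forall>r\<in>P. \<forall>x\<in>carrier A. \<phi> (r \<otimes>\<^bsub>A\<^esub> x) = r \<otimes>\<^bsub>A\<^esub> \<phi> x)},
     monoid.mult = (\<lambda>\<phi> \<psi>. undefined), one = undefined,
     ring.zero = (\<lambda>x\<in>carrier A. \<zero>\<^bsub>A\<^esub>),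
     ring.add = (\<lambda>\<phi> \<psi>. \<lambda>x\<in>carrier A. \<phi> x \<oplus>\<^bsub>A\<^esub> \<psi> x),
     smult = (\<lambda>a \<phi>. \<lambda>x\<in>carrier A. \<phi> (a \<otimes>\<^bsub>A\<^esub> x))\<rparr>"

definition free_of_rank_one :: "('a, 'b) ring_scheme \<Rightarrow> ('a, 'm, 'd) module_scheme \<Rightarrow> bool" where
  "free_of_rank_one A M \<longleftrightarrow>
     (\<exists>e\<in>carrier M. bij_betw (\<lambda>a. a \<odot>\<^bsub>M\<^esub> e) (carrier A) (carrier M))"

text \<open>The dualizing sheaf is invertible near \<open>p\<close> iff its restriction to some affine open
  neighbourhood of \<open>p\<close> is free of rank one. Every nonempty affine open subset of a curve has
  a parameter \<open>t\<close> as below (Noether normalization), and \<open>Hom\<^sub>P(A, P)\<close> does not depend on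
  it up to isomorphism.\<close>

definition gorenstein_at :: "'k ring \<Rightarrow> ('k \<Rightarrow> 'r) \<Rightarrow> ('p, 'r) ringed_space \<Rightarrow> 'p \<Rightarrow> bool" where
  "gorenstein_at K \<kappa> C p \<longleftrightarrow> (\<exists>U. affine_open C U \<and> p \<in> U \<and>
     (let A = sections C U; L = scalar C \<kappa> U ` carrier K
      in \<exists>t\<in>carrier A. ring.transcendental A L t \<and>
           finite_over A (ring.simple_extension A L t) \<and>
           free_of_rank_one A (dualizing_module A (ring.simple_extension A L t))))"


section \<open>Completed local rings and elliptic \<open>m\<close>-fold points\<close>

primrec ideal_power :: "('a, 'b) ring_scheme \<Rightarrow> 'a set \<Rightarrow> nat \<Rightarrow> 'a set" where
  "ideal_power R I 0 = carrier R"
| "ideal_power R I (Suc n) = ideal_prod R I (ideal_power R I n)"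

text \<open>The inverse limit of the quotients of \<open>R\<close> by the powers of \<open>I\<close>: the transition maps
  send a coset to the unique coset of the larger ideal that contains it.\<close>

definition completion :: "('a, 'b) ring_scheme \<Rightarrow> 'a set \<Rightarrow> (nat \<Rightarrow> 'a set) ring" where
  "completion R I =
    \<lparr>carrier = {x. (\<forall>n. x n \<in> carrier (R Quot ideal_power R I n)) \<and> (\<forall>n. x (Suc n) \<subseteq> x n)},
     monoid.mult = (\<lambda>x y n. x n \<otimes>\<^bsub>R Quot ideal_power R I n\<^esub> y n),
     one = (\<lambda>n. \<one>\<^bsub>R Quot ideal_power R I n\<^esub>),
     ring.zero = (\<lambda>n. \<zero>\<^bsub>R Quot ideal_power R I n\<^esub>),
     ring.add = (\<lambda>x y n. x n \<oplus>\<^bsub>R Quot ideal_power R I n\<^esub> y n)\<rparr>"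

definition completed_local_ring ::
  "('p, 'r) ringed_space \<Rightarrow> 'p \<Rightarrow> (nat \<Rightarrow> ('p set \<times> 'r) set set) ring" where
  "completed_local_ring Z p = completion (stalk Z p) (nonunits (stalk Z p))"

definition completed_scalar ::
  "('p, 'r) ringed_space \<Rightarrow> ('k \<Rightarrow> 'r) \<Rightarrow> 'p \<Rightarrow> 'k \<Rightarrow> nat \<Rightarrow> ('p set \<times> 'r) set set" where
  "completed_scalar Z \<kappa> p c = (\<lambda>n.
     ideal_power (stalk Z p) (nonunits (stalk Z p)) n
       +>\<^bsub>stalk Z p\<^esub> germ Z p (topspace (base Z)) (\<kappa> c))"

text \<open>Power series over \<open>K\<close> in the variables \<open>x\<^sub>i\<close>, \<open>i \<in> V\<close>, for a finite set \<open>V\<close>, as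
  coefficient functions on exponent vectors; these are functions vanishing outside \<open>V\<close>.\<close>

definition exponents :: "nat set \<Rightarrow> (nat \<Rightarrow> nat) set" where
  "exponents V = {e. \<forall>i. i \<notin> V \<longrightarrow> e i = 0}"

definition power_series :: "('k, 'b) ring_scheme \<Rightarrow> nat set \<Rightarrow> ((nat \<Rightarrow> nat) \<Rightarrow> 'k) ring" where
  "power_series K V =
    \<lparr>carrier = {f. (\<forall>e. f e \<in> carrier K) \<and> (\<forall>e. e \<notin> exponents V \<longrightarrow> f e = \<zero>\<^bsub>K\<^esub>)},
     monoid.mult = (\<lambda>f g e. if e \<in> exponents V
       then finsum K (\<lambda>a. f a \<otimes>\<^bsub>K\<^esub> g (\<lambda>i. e i - a i)) {a. \<forall>i. a i \<le> e i} else \<zero>\<^bsub>K\<^esub>),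
     one = (\<lambda>e. if e = (\<lambda>i. 0) then \<one>\<^bsub>K\<^esub> else \<zero>\<^bsub>K\<^esub>),
     ring.zero = (\<lambda>e. \<zero>\<^bsub>K\<^esub>),
     ring.add = (\<lambda>f g e. f e \<oplus>\<^bsub>K\<^esub> g e)\<rparr>"

definition ps_const :: "('k, 'b) ring_scheme \<Rightarrow> 'k \<Rightarrow> (nat \<Rightarrow> nat) \<Rightarrow> 'k" where
  "ps_const K c = (\<lambda>e. if e = (\<lambda>i. 0) then c else \<zero>\<^bsub>K\<^esub>)"

definition ps_var :: "('k, 'b) ring_scheme \<Rightarrow> nat \<Rightarrow> (nat \<Rightarrow> nat) \<Rightarrow> 'k" where
  "ps_var K i = (\<lambda>e. if e = (\<lambda>j. if j = i then 1 else 0) then \<one>\<^bsub>K\<^esub> else \<zero>\<^bsub>K\<^esub>)"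

text \<open>For \<open>m \<le> 3\<close> the variables \<open>x\<close> and \<open>y\<close> have index 1 and 2. The case \<open>m = 0\<close> is
  irrelevant: a singularity has at least one branch.\<close>

definition elliptic_vars :: "nat \<Rightarrow> nat set" where
  "elliptic_vars m = (if m \<le> 3 then {1, 2} else {1..m - 1})"

definition elliptic_ideal :: "('k, 'b) ring_scheme \<Rightarrow> nat \<Rightarrow> ((nat \<Rightarrow> nat) \<Rightarrow> 'k) set" where
  "elliptic_ideal K m =
    (let R = power_series K (elliptic_vars m); v = ps_var K; x = v 1; y = v 2 in
     Idl\<^bsub>R\<^esub>
      (if m = 1 then {(y [^]\<^bsub>R\<^esub> (2::nat)) \<ominus>\<^bsub>R\<^esub> (x [^]\<^bsub>R\<^esub> (3::nat))}
       else if m = 2 then {y \<otimes>\<^bsub>R\<^esub> (y \<ominus>\<^bsub>R\<^esub> (x [^]\<^bsub>R\<^esub> (2::nat)))}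
       else if m = 3 then {x \<otimes>\<^bsub>R\<^esub> y \<otimes>\<^bsub>R\<^esub> (y \<ominus>\<^bsub>R\<^esub> x)}
       else {v h \<otimes>\<^bsub>R\<^esub> (v i \<ominus>\<^bsub>R\<^esub> v j) | h i j.
               h \<in> elliptic_vars m \<and> i \<in> elliptic_vars m \<and> j \<in> elliptic_vars m \<and>
               h \<noteq> i \<and> h \<noteq> j \<and> i \<noteq> j}))"

text \<open>The isomorphism is required to be one of \<open>K\<close>-algebras.\<close>

definition elliptic_fold_point ::
  "'k ring \<Rightarrow> ('k \<Rightarrow> 'r) \<Rightarrow> ('p, 'r) ringed_space \<Rightarrow> 'p \<Rightarrow> nat \<Rightarrow> bool" where
  "elliptic_fold_point K \<kappa> C p m \<longleftrightarrow> m \<ge> 1 \<and>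
     (let R = power_series K (elliptic_vars m); I = elliptic_ideal K m in
      \<exists>\<phi>\<in>ring_iso (completed_local_ring C p) (R Quot I).
        \<forall>c\<in>carrier K. \<phi> (completed_scalar C \<kappa> p c) = I +>\<^bsub>R\<^esub> ps_const K c)"

end

theory Submission
 imports Defs
begin

text \<open>Let \<open>L\<close> be the local ring of \<open>p\<close>, with maximal ideal \<open>M\<close>, and let \<open>N\<close> be its normalization, a semilocal
 ring with one discrete valuation ring for each of the \<open>m\<close> branches and with Jacobson radical \<open>J\<close>. Genus one
 means \<open>dim N/L = m\<close>. All residue fields are \<open>K\<close>, so \<open>M\<close> has codimension one in \<open>J\<close>, and this forces \<open>J J \<subseteq> M\<close>.
 Hence an element of \<open>N\<close> lies in \<open>L\<close> iff its constant terms on the branches agree and its linear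
 terms satisfy a single equation \<open>\<Sum>i. h i * l i = 0\<close>. If some \<open>h i\<close> vanished, then the socle of
 \<open>L/tL\<close> would have dimension at least two for a parameter \<open>t\<close>; but a generator \<open>E\<close> of the dualizing module turns the
 socle into the functionals on a one-dimensional space. So all \<open>h i\<close> are nonzero, and after rescaling the branch parameters the
 completion of \<open>L\<close> depends on \<open>m\<close> only. The elliptic \<open>m\<close>-fold point is parametrized by explicit branches
 that satisfy the same conditions, and the kernel of this parametrization is the elliptic ideal.\<close>

\<comment> \<open>Nearly every finiteness argument is linear algebra over \<open>K\<close>: finitely
  many elements span an algebra modulo a subspace (\<open>spans_mod\<close>), so sufficiently many
  elements are dependent. This yields the residue fields, the uniformizers on the branches and the
  dimension of \<open>J/M\<close>. On the line \<open>J/M\<close> an element of \<open>M\<close>,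
  and also a spanning vector itself, acts by a scalar; a nonzero scalar would produce a unit that
  carries the spanning vector into \<open>M\<close> and hence the vector itself into
  \<open>L\<close>. This is why \<open>J J \<subseteq> M\<close>. Two obstacles shape the rest.
  Neither \<open>L\<close> nor \<open>N\<close> need be complete, so only finitely many expansion
  coefficients are prescribed at once. If \<open>F n\<close> is the set of elements of
  \<open>N\<close> of order at least \<open>n\<close> on every branch, then inside \<open>L\<close>
  the inclusions of \<open>F (2n)\<close> in \<open>M^n\<close> and of \<open>M^n\<close> in
  \<open>F n\<close> carry the approximations over to the completion. Moreover, the Gorenstein
  hypothesis concerns an affine chart with a parameter \<open>t\<close>, whereas the socle is local:
  elements of \<open>L\<close> that \<open>M\<close> annihilates modulo \<open>u = t - t(p)\<close>
  must be represented in the chart, with one denominator that serves all of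
  \<open>M\<close>.\<close>
text \<open>Compact notation: \<open>x **\<^sub>A y\<close> stands for \<open>x \<otimes>\<^bsub>A\<^esub> y\<close>.\<close>

syntax "_index" :: "logic => index" ("\<^sub>_" [1000] 1000)
no_notation matrix_matrix_mult (infixl "**" 70)
notation monoid.mult (infixl "**\<index>" 70)

section \<open>Linear algebra and polynomial values\<close>

lemma (in abelian_monoid) finsum_swap:
 assumes "finite I" "finite J" "\<And>i j. i \<in> I ==> j \<in> J ==> f i j \<in> carrier G"
 shows "(\<Oplus>i\<in>I. \<Oplus>j\<in>J. f i j) = (\<Oplus>j\<in>J. \<Oplus>i\<in>I. f i j)" using assms(1,3)
proof (induction I rule: finite_induct)
 case empty
 thus ?case using assms(2) by simp
next
 case (insert i I)
 have "(\<Oplus>j\<in>J. \<Oplus>i\<in>insert i I. f i j) = (\<Oplus>j\<in>J. f i j \<oplus> (\<Oplus>i\<in>I. f i j))"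
  using insert by (intro finsum_cong') (auto simp: finsum_insert Pi_iff)
 also have "... = (\<Oplus>j\<in>J. f i j) \<oplus> (\<Oplus>j\<in>J. \<Oplus>i\<in>I. f i j)" using insert by (intro finsum_addf) (auto simp: Pi_iff)
 finally show ?case using insert by (simp add: finsum_insert Pi_iff)
qed

text \<open>One coordinate is eliminated at a time. A vector \<open>v l\<close> with nonzero entry
  at \<open>k\<close> serves as pivot: the modified vectors \<open>w j\<close> have entry zero at
  \<open>k\<close>, induction gives a relation among them, and the coefficient of the pivot is
  chosen so as to balance the entry at \<open>k\<close>.\<close>

lemma (in field) linear_dependence:
 assumes "finite I" "finite J" "card I < card J"
  and "\<And>i j. i \<in> I ==> j \<in> J ==> v j i \<in> carrier R"
 shows "\<exists>c\<in>J \<rightarrow> carrier R. (\<exists>j\<in>J. c j \<noteq> \<zero>) \<and> (\<forall>i\<in>I. (\<Oplus>j\<in>J. c j ** v j i) = \<zero>)"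
 using assms
proof (induction I arbitrary: J v rule: finite_induct)
 case empty
 then obtain j where "j \<in> J" by fastforce
 thus ?case by (intro bexI[of _ "\<lambda>_. \<one>"]) auto
next
 case (insert k I)
 show ?case
 proof (cases "\<forall>j\<in>J. v j k = \<zero>")
  case True
  have "card I < card J" using insert.prems insert.hyps by simp
  hence "\<exists>c\<in>J \<rightarrow> carrier R. (\<exists>j\<in>J. c j \<noteq> \<zero>) \<and> (\<forall>i\<in>I. (\<Oplus>j\<in>J. c j ** v j i) = \<zero>)"
   by (intro insert.IH insert.prems) auto
  then obtain c where
   c: "c \<in> J \<rightarrow> carrier R" "\<exists>j\<in>J. c j \<noteq> \<zero>" "\<forall>i\<in>I. (\<Oplus>j\<in>J. c j ** v j i) = \<zero>"
   by blast
  have "(\<Oplus>j\<in>J. c j ** v j k) = (\<Oplus>j\<in>J. \<zero>)" using True c(1) by (intro finsum_cong') (auto simp: Pi_iff)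
  with c show ?thesis by (intro bexI[of _ c]) auto
 next
  case False
  then obtain l where l: "l \<in> J" "v l k \<noteq> \<zero>" by blast
  define J' where "J' = J - {l}"
  have J: "J = insert l J'" "l \<notin> J'" "finite J'" using l insert.prems by (auto simp: J'_def)
  define p where "p = inv (v l k)"
  have vl: "v l k \<in> carrier R" using l insert.prems by auto
  have p: "p \<in> carrier R" "v l k ** p = \<one>" "p ** v l k = \<one>" using field_Units l vl by (auto simp: p_def)
  define w where "w = (\<lambda>j i. v j i \<oplus> v j k ** (\<ominus> (p ** v l i)))"
  have v: "v j i \<in> carrier R" if "j \<in> J" "i \<in> insert k I" for i j using that insert.prems by auto
  have "card I < card J'" using insert.prems insert.hyps J by simp
  moreover have "w j i \<in> carrier R" if "i \<in> I" "j \<in> J'" for i j unfolding w_def using that v[of j i] v[of j k] v[of l i] p(1) l J by simp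
  ultimately have "\<exists>c\<in>J' \<rightarrow> carrier R. (\<exists>j\<in>J'. c j \<noteq> \<zero>) \<and> (\<forall>i\<in>I. (\<Oplus>j\<in>J'. c j ** w j i) = \<zero>)"
   by (intro insert.IH J(3))
  then obtain c where
   c: "c \<in> J' \<rightarrow> carrier R" "\<exists>j\<in>J'. c j \<noteq> \<zero>" "\<forall>i\<in>I. (\<Oplus>j\<in>J'. c j ** w j i) = \<zero>"
   by blast
  define S where "S = (\<Oplus>j\<in>J'. c j ** v j k)"
  have S: "S \<in> carrier R" unfolding S_def using c v J by (auto simp: Pi_iff)
  define d where "d = c(l := \<ominus> (S ** p))"
  have dJ: "(\<Oplus>j\<in>J. d j ** v j i) = \<ominus> (S ** p) ** v l i \<oplus> (\<Oplus>j\<in>J'. c j ** v j i)"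
   if "i \<in> insert k I" for i
  proof -
   have "(\<Oplus>j\<in>J. d j ** v j i) = d l ** v l i \<oplus> (\<Oplus>j\<in>J'. d j ** v j i)"
    using J v[OF _ that] S p c by (simp add: finsum_insert Pi_iff d_def)
   also have "(\<Oplus>j\<in>J'. d j ** v j i) = (\<Oplus>j\<in>J'. c j ** v j i)"
    using J v[OF _ that] c by (intro finsum_cong') (auto simp: d_def Pi_iff)
   finally show ?thesis by (simp add: d_def)
  qed
  have 1: "(\<Oplus>j\<in>J. d j ** v j i) = \<zero>" if "i \<in> I" for i
  proof -
   have vli: "v l i \<in> carrier R" using l v that by auto
   have "\<zero> = (\<Oplus>j\<in>J'. c j ** w j i)" using c that by simp
   also have "... = (\<Oplus>j\<in>J'. c j ** v j i \<oplus> c j ** v j k ** (\<ominus> (p ** v l i)))"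
    using c v p that vli J by (intro finsum_cong') (auto simp: w_def Pi_iff r_distr m_assoc)
   also have "... = (\<Oplus>j\<in>J'. c j ** v j i) \<oplus> (\<Oplus>j\<in>J'. c j ** v j k ** (\<ominus> (p ** v l i)))"
    using c v p that vli J by (intro finsum_addf) (auto simp: Pi_iff)
   also have "(\<Oplus>j\<in>J'. c j ** v j k ** (\<ominus> (p ** v l i))) = S ** (\<ominus> (p ** v l i))"
    unfolding S_def using c v p that vli J by (intro finsum_ldistr[symmetric]) (auto simp: Pi_iff)
   finally have 0: "(\<Oplus>j\<in>J'. c j ** v j i) \<oplus> S ** (\<ominus> (p ** v l i)) = \<zero>" ..
   have "(\<Oplus>j\<in>J'. c j ** v j i) \<in> carrier R" using c v that J by (auto simp: Pi_iff)
   moreover have "\<ominus> (S ** p) ** v l i = S ** (\<ominus> (p ** v l i))" using S p(1) vli by (simp add: r_minus l_minus m_assoc)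
   ultimately show ?thesis using 0 dJ[of i] that S p(1) vli a_comm by simp
  qed
  have 2: "(\<Oplus>j\<in>J. d j ** v j k) = \<zero>" using dJ[of k] S p vl by (simp add: S_def[symmetric] l_minus m_assoc l_neg)
  have "d \<in> J \<rightarrow> carrier R" using c S p J by (auto simp: d_def)
  moreover have "\<exists>j\<in>J. d j \<noteq> \<zero>" using c(2) J by (auto simp: d_def)
  ultimately show ?thesis using 1 2 by blast
 qed
qed

lemma (in cring) distrib_diff_add:
 assumes "c \<in> carrier R" "y \<in> carrier R" "l \<in> carrier R"
 shows "c ** y = c ** (y \<ominus> l) \<oplus> c ** l" using assms by algebra

text \<open>Synthetic division by \<open>a - m\<close>: if the tail of a polynomial has value
  \<open>(a - m) g + r\<close>, then prepending the constant term \<open>c\<close> changes the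
  quotient to \<open>r + a g\<close> and the remainder to \<open>c + m r\<close>.\<close>

lemma (in cring) horner_step:
 assumes "c \<in> carrier R" "m \<in> carrier R" "r \<in> carrier R" "g \<in> carrier R" "a \<in> carrier R"
 shows "c \<oplus> a ** ((a \<ominus> m) ** g \<oplus> r) = (a \<ominus> m) ** (r \<oplus> a ** g) \<oplus> (c \<oplus> m ** r)"
 using assms by algebra

section \<open>Algebras over a field: subspaces, spanning families and polynomial values\<close>

locale kalgebra = ring_hom_cring K A emb + K: field K
 for K :: "('k, 'kk) ring_scheme" and A :: "('x, 'xx) ring_scheme" (structure) and emb :: "'k => 'x"

definition ksubspace where
 "ksubspace K A emb W \<longleftrightarrow> W \<subseteq> carrier A \<and> \<zero>\<^sub>A \<in> W \<and> (\<forall>x\<in>W. \<forall>y\<in>W. x \<oplus>\<^sub>A y \<in> W) \<and>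
   (\<forall>c\<in>carrier K. \<forall>x\<in>W. emb c **\<^sub>A x \<in> W)"

text \<open>The classes of the finite family \<open>b\<close> span the quotient of \<open>A\<close>
  by \<open>W\<close>. The family may be redundant, so \<open>card I\<close> is an upper bound for
  the dimension; the quotient space itself is never formed.\<close>

definition spans_mod where
 "spans_mod K A emb W I b \<longleftrightarrow> finite I \<and> b \<in> I \<rightarrow> carrier A \<and>
   (\<forall>x\<in>carrier A. \<exists>c\<in>I \<rightarrow> carrier K.
    x \<ominus>\<^sub>A (\<Oplus>\<^sub>A i\<in>I. emb (c i) **\<^sub>A b i) \<in> W)"

text \<open>Coefficients start with the constant term, the reverse of the order in
  \<open>eval\<close>. Induction on the list thus splits off the constant term, which decides
  whether the value at a nonunit of a local ring is a unit.\<close>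

primrec horner :: "('a, 'b) ring_scheme => ('k => 'a) => 'k list => 'a => 'a" where
 "horner A emb [] a = \<zero>\<^sub>A"
| "horner A emb (c # cs) a = emb c \<oplus>\<^sub>A a **\<^sub>A horner A emb cs a"

lemma (in ring) horner_id_closed:
 "set cs \<subseteq> carrier R ==> a \<in> carrier R ==> horner R (\<lambda>x. x) cs a \<in> carrier R" by (induction cs) auto

context kalgebra
begin

abbreviation "lincomb I c b \<equiv> finsum A (\<lambda>i. emb (c i) ** b i) I"

lemma ksubspace_finsum:
 assumes "ksubspace K A emb W" "finite I" "f \<in> I \<rightarrow> W"
 shows "finsum A f I \<in> W" using assms(2,3)
proof (induction I rule: finite_induct)
 case empty
 thus ?case using assms(1) by (simp add: ksubspace_def)
next
 case (insert i I)
 hence "f i \<in> carrier A" "f \<in> I \<rightarrow> carrier A" using assms(1) by (auto simp: ksubspace_def)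
 thus ?case using insert assms(1) by (simp add: S.finsum_insert) (auto simp: ksubspace_def)
qed

lemma ksubspace_minus:
 assumes "ksubspace K A emb W" "x \<in> W"
 shows "\<ominus> x \<in> W"
proof -
 have x: "x \<in> carrier A" using assms by (auto simp: ksubspace_def)
 have "emb (\<ominus>\<^sub>K \<one>\<^sub>K) ** x \<in> W" using assms R.one_closed R.a_inv_closed unfolding ksubspace_def by blast
 thus ?thesis using x by (simp add: S.l_minus)
qed

lemma ksubspace_diff:
 assumes "ksubspace K A emb W" "x \<in> W" "y \<in> W"
 shows "x \<ominus> y \<in> W" using assms ksubspace_minus[OF assms(1,3)] by (auto simp: ksubspace_def a_minus_def)

lemma lincomb_closed [simp]:
 assumes "c \<in> I \<rightarrow> carrier K" "b \<in> I \<rightarrow> carrier A"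
 shows "lincomb I c b \<in> carrier A" using assms by (intro S.finsum_closed) (auto simp: Pi_iff)

text \<open>Each \<open>y j\<close> has coordinates \<open>v j\<close> with respect to
  \<open>b\<close>, up to an error in \<open>W\<close>. A relation among the coordinate vectors
  turns the combination of the \<open>y j\<close> into the same combination of the errors, which
  stays in \<open>W\<close>. The polynomial relations used later all arise from this.\<close>

lemma quotient_dependence:
 assumes W: "ksubspace K A emb W" and b: "spans_mod K A emb W I b"
  and J: "finite J" "card I < card J" and y: "y \<in> J \<rightarrow> carrier A"
 shows "\<exists>c\<in>J \<rightarrow> carrier K. (\<exists>j\<in>J. c j \<noteq> \<zero>\<^sub>K) \<and> lincomb J c y \<in> W"
proof -
 have I: "finite I" and bI: "b \<in> I \<rightarrow> carrier A" using b by (auto simp: spans_mod_def)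
 have "\<forall>j\<in>J. \<exists>c. c \<in> I \<rightarrow> carrier K \<and> y j \<ominus> lincomb I c b \<in> W"
  using b y unfolding spans_mod_def Pi_iff by blast
 then obtain v where v: "\<And>j. j \<in> J ==> v j \<in> I \<rightarrow> carrier K"
  "\<And>j. j \<in> J ==> y j \<ominus> lincomb I (v j) b \<in> W" by metis
 obtain c where c: "c \<in> J \<rightarrow> carrier K" "\<exists>j\<in>J. c j \<noteq> \<zero>\<^sub>K"
  "\<forall>i\<in>I. (\<Oplus>\<^sub>K j\<in>J. c j **\<^sub>K v j i) = \<zero>\<^sub>K" using K.linear_dependence[OF I J, of v] v(1) by blast
 have vK: "v j i \<in> carrier K" if "j \<in> J" "i \<in> I" for i j using v(1)[OF that(1)] that by auto
 have bX: "b i \<in> carrier A" if "i \<in> I" for i using bI that by auto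
 have yX: "y i \<in> carrier A" if "i \<in> J" for i using y that by auto
 have cK: "c i \<in> carrier K" if "i \<in> J" for i using c(1) that by auto
 have "lincomb J c (\<lambda>j. lincomb I (v j) b) = (\<Oplus>j\<in>J. \<Oplus>i\<in>I. emb (c j) ** (emb (v j i) ** b i))"
  using vK bX cK by (intro S.finsum_cong') (auto simp: S.finsum_rdistr[OF I] Pi_iff)
 also have "... = (\<Oplus>i\<in>I. \<Oplus>j\<in>J. emb (c j) ** (emb (v j i) ** b i))" using vK bX cK I J by (intro S.finsum_swap) auto
 also have "... = (\<Oplus>i\<in>I. \<zero>)"
 proof (intro S.finsum_cong')
  fix i assume i: "i \<in> I"
  have "(\<Oplus>j\<in>J. emb (c j) ** (emb (v j i) ** b i)) = (\<Oplus>j\<in>J. emb (c j **\<^sub>K v j i) ** b i)"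
   using vK bX cK i by (intro S.finsum_cong') (auto simp: S.m_assoc)
  also have "... = (\<Oplus>j\<in>J. emb (c j **\<^sub>K v j i)) ** b i" using vK bX cK i J by (intro S.finsum_ldistr[symmetric]) auto
  also have "(\<Oplus>j\<in>J. emb (c j **\<^sub>K v j i)) = emb (\<Oplus>\<^sub>K j\<in>J. c j **\<^sub>K v j i)"
   using vK cK i J by (subst hom_finsum) (auto simp: o_def)
  finally show "(\<Oplus>j\<in>J. emb (c j) ** (emb (v j i) ** b i)) = \<zero>" using c i bX by simp
 qed auto
 finally have 0: "lincomb J c (\<lambda>j. lincomb I (v j) b) = \<zero>" by simp
 have cl: "lincomb I (v j) b \<in> carrier A" if "j \<in> J" for j using v(1)[OF that] bI by simp
 have "emb (c j) ** y j = emb (c j) ** (y j \<ominus> lincomb I (v j) b) \<oplus> emb (c j) ** lincomb I (v j) b"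
  if "j \<in> J" for j
 proof -
  have "emb (c j) \<in> carrier A" using cK[OF that] by simp
  thus ?thesis using yX[OF that] cl[OF that] by (rule S.distrib_diff_add)
 qed
 hence "lincomb J c y = (\<Oplus>j\<in>J. emb (c j) ** (y j \<ominus> lincomb I (v j) b) \<oplus> emb (c j) ** lincomb I (v j) b)"
  using cK yX cl by (intro S.finsum_cong') (auto simp: Pi_iff)
 also have "... = lincomb J c (\<lambda>j. y j \<ominus> lincomb I (v j) b) \<oplus> lincomb J c (\<lambda>j. lincomb I (v j) b)"
  using cK yX cl by (intro S.finsum_addf) (auto simp: Pi_iff)
 also have "... = lincomb J c (\<lambda>j. y j \<ominus> lincomb I (v j) b)" using 0 cK yX cl by (simp add: Pi_iff)
 also have "... \<in> W" using W cK v(2) J by (intro ksubspace_finsum) (auto simp: ksubspace_def)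
 finally show ?thesis using c by blast
qed

lemma horner_closed [simp]:
 "set cs \<subseteq> carrier K ==> a \<in> carrier A ==> horner A emb cs a \<in> carrier A" by (induction cs) auto

lemma horner_zero: "set cs \<subseteq> {\<zero>\<^sub>K} ==> a \<in> carrier A ==> horner A emb cs a = \<zero>" by (induction cs) auto

lemma horner_upt:
 assumes "\<And>i. c i \<in> carrier K" "a \<in> carrier A"
 shows "horner A emb (map c [k..<k + n]) a = (\<Oplus>i\<in>{..<n}. emb (c (k + i)) ** (a [^] i))"
proof (induction n arbitrary: k)
 case 0
 thus ?case by simp
next
 case (Suc n)
 have "[k..<k + Suc n] = k # [Suc k..<Suc k + n]" by (simp add: upt_rec)
 hence "horner A emb (map c [k..<k + Suc n]) a =
   emb (c k) \<oplus> a ** (\<Oplus>i\<in>{..<n}. emb (c (Suc k + i)) ** (a [^] i))" using Suc[of "Suc k"] by simp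
 also have "... = emb (c k) \<oplus> (\<Oplus>i\<in>{..<n}. emb (c (k + Suc i)) ** (a [^] Suc i))" using assms by (subst S.finsum_rdistr)
   (auto intro!: arg_cong2[where f="add A"] S.finsum_cong' simp: S.m_lcomm S.m_comm)
 also have "... = (\<Oplus>i\<in>{..<Suc n}. emb (c (k + i)) ** (a [^] i))" unfolding lessThan_Suc_eq_insert_0 using assms
  by (subst S.finsum_insert) (auto simp: S.finsum_reindex)
 finally show ?case .
qed

lemma horner_snoc:
 assumes "set (cs @ [c]) \<subseteq> carrier K" "a \<in> carrier A"
 shows "horner A emb (cs @ [c]) a = horner A emb cs a \<oplus> emb c ** a [^] length cs" using assms
proof (induction cs)
 case Nil
 thus ?case by simp
next
 case (Cons b cs)
 let ?h = "horner A emb cs a" and ?p = "a [^] length cs"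
 have *: "emb b \<in> carrier A" "emb c \<in> carrier A" "?h \<in> carrier A" "?p \<in> carrier A" "a \<in> carrier A" using Cons by auto
 have "horner A emb ((b # cs) @ [c]) a = emb b \<oplus> a ** (?h \<oplus> emb c ** ?p)" using Cons by simp
 also have "... = (emb b \<oplus> a ** ?h) \<oplus> emb c ** (?p ** a)" using * by algebra
 finally show ?case by simp
qed

text \<open>The remainder of the division by \<open>a - \<mu>\<close> is the value at
  \<open>\<mu>\<close>, computed in \<open>K\<close>. The clause on \<open>last\<close> records that
  the leading coefficient survives, so that the quotient of a nonzero polynomial is again
  nonzero.\<close>

lemma horner_divide:
 assumes "set cs \<subseteq> carrier K" "\<mu> \<in> carrier K" "a \<in> carrier A"
 shows "\<exists>ds. set ds \<subseteq> carrier K \<and> length ds = length cs - 1 \<and> (ds \<noteq> [] --> last ds = last cs) \<and>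
  horner A emb cs a = (a \<ominus> emb \<mu>) ** horner A emb ds a \<oplus> emb (horner K (\<lambda>x. x) cs \<mu>)" using assms
proof (induction cs)
 case Nil
 thus ?case by (intro exI[of _ "[]"]) simp
next
 case (Cons c cs)
 show ?case
 proof (cases "cs = []")
  case True
  thus ?thesis using Cons.prems by (intro exI[of _ "[]"]) simp
 next
  case False
  obtain ds where ds: "set ds \<subseteq> carrier K" "length ds = length cs - 1" "ds \<noteq> [] --> last ds = last cs"
   "horner A emb cs a = (a \<ominus> emb \<mu>) ** horner A emb ds a \<oplus> emb (horner K (\<lambda>x. x) cs \<mu>)" using Cons by auto
  let ?r = "horner K (\<lambda>x. x) cs \<mu>"
  have r: "?r \<in> carrier K" using Cons.prems by (intro R.horner_id_closed) auto
  show ?thesis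
  proof (intro exI[of _ "?r # ds"] conjI)
   show "set (?r # ds) \<subseteq> carrier K" using r ds(1) by simp
   show "length (?r # ds) = length (c # cs) - 1" using ds(2) False by (cases cs) auto
   show "?r # ds \<noteq> [] --> last (?r # ds) = last (c # cs)"
   proof (cases "ds = []")
    case True
    then obtain b where "cs = [b]" using ds(2) False by (cases cs) auto
    thus ?thesis using True Cons.prems by simp
   qed (use ds(3) False in auto)
   let ?g = "horner A emb ds a"
   have *: "emb c \<in> carrier A" "emb \<mu> \<in> carrier A" "emb ?r \<in> carrier A" "?g \<in> carrier A" "a \<in> carrier A"
    using Cons.prems r ds(1) by auto
   have "horner A emb (c # cs) a = emb c \<oplus> a ** ((a \<ominus> emb \<mu>) ** ?g \<oplus> emb ?r)" using ds(4) by simp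
   also have "... = (a \<ominus> emb \<mu>) ** (emb ?r \<oplus> a ** ?g) \<oplus> (emb c \<oplus> emb \<mu> ** emb ?r)"
    using * by (rule S.horner_step)
   also have "emb c \<oplus> emb \<mu> ** emb ?r = emb (horner K (\<lambda>x. x) (c # cs) \<mu>)" using r Cons.prems by simp
   finally show "horner A emb (c # cs) a = (a \<ominus> emb \<mu>) ** horner A emb (?r # ds) a \<oplus>
     emb (horner K (\<lambda>x. x) (c # cs) \<mu>)" by simp
  qed
 qed
qed

lemma scalar_unit: "c \<in> carrier K ==> c \<noteq> \<zero>\<^sub>K ==> emb c \<in> Units A"
proof -
 assume c: "c \<in> carrier K" "c \<noteq> \<zero>\<^sub>K"
 hence u: "c \<in> Units K" by (simp add: K.field_Units)
 have "emb (inv\<^bsub>K\<^esub> c) ** emb c = emb (inv\<^bsub>K\<^esub> c **\<^sub>K c)" using u c by (intro hom_mult[symmetric]) auto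
 also have "... = \<one>" using u by (simp add: R.Units_l_inv)
 finally have *: "emb (inv\<^bsub>K\<^esub> c) ** emb c = \<one>" .
 have "emb (inv\<^bsub>K\<^esub> c) \<in> carrier A" using u by simp
 with * c show ?thesis unfolding Units_def by (auto intro!: bexI[of _ "emb (inv\<^bsub>K\<^esub> c)"] simp: S.m_comm)
qed

end

section \<open>Roots over an algebraically closed field\<close>

lemma (in ring) eval_snoc:
 assumes "set (ps @ [c]) \<subseteq> carrier R" "a \<in> carrier R"
 shows "eval (ps @ [c]) a = eval ps a ** a \<oplus> c" using assms by (induction ps) (auto simp: l_distr m_assoc a_assoc eval_in_carrier)

lemma (in cring) horner_eq_eval:
 assumes "set cs \<subseteq> carrier R" "a \<in> carrier R"
 shows "horner R (\<lambda>x. x) cs a = eval (rev cs) a" using assms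
proof (induction cs)
 case (Cons c cs)
 hence "eval (rev cs) a \<in> carrier R" by (intro eval_in_carrier) auto
 with Cons show ?case by (simp add: eval_snoc a_comm m_comm)
qed simp

lemma (in algebraically_closed) horner_root:
 assumes "set cs \<subseteq> carrier L" "length cs \<ge> 2" "last cs \<noteq> \<zero>\<^sub>L"
 shows "\<exists>\<mu>\<in>carrier L. horner L (\<lambda>x. x) cs \<mu> = \<zero>\<^sub>L"
proof -
 let ?p = "rev cs"
 have "hd ?p \<noteq> \<zero>\<^sub>L" using assms by (cases cs rule: rev_cases) auto
 hence p: "?p \<in> carrier (poly_ring L)" using assms by (auto simp: univ_poly_def polynomial_def)
 have "size (roots ?p) = degree ?p" using roots_over_carrier[OF p] by (simp add: splitted_def)
 also have "degree ?p > 0" using assms by simp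
 finally obtain \<mu> where "\<mu> \<in># roots ?p" by (metis size_empty less_irrefl multiset_nonemptyE)
 hence "is_root ?p \<mu>" using roots_mem_iff_is_root[OF p] by blast
 hence "\<mu> \<in> carrier L" "eval ?p \<mu> = \<zero>\<^sub>L" by (auto simp: is_root_def)
 thus ?thesis using horner_eq_eval[OF assms(1)] by auto
qed

text \<open>The polynomial splits into linear factors over \<open>K\<close>, and a product of units
  is a unit; so one of the linear factors takes a nonunit value. The induction either drops a
  vanishing leading coefficient or divides by a root.\<close>

lemma (in kalgebra) nonunit_polynomial_value:
 assumes K: "algebraically_closed K" and "set cs \<subseteq> carrier K" "\<not> set cs \<subseteq> {\<zero>\<^sub>K}"
  "a \<in> carrier A" "horner A emb cs a \<notin> Units A"
 shows "\<exists>\<mu>\<in>carrier K. a \<ominus> emb \<mu> \<notin> Units A" using assms(2-)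
proof (induction "length cs" arbitrary: cs rule: less_induct)
 case less
 hence "cs \<noteq> []" by auto
 then obtain bs b where cs: "cs = bs @ [b]" by (metis append_butlast_last_id)
 show ?case
 proof (cases "b = \<zero>\<^sub>K")
  case True
  with less.prems have "horner A emb cs a = horner A emb bs a" unfolding cs by (subst horner_snoc) auto
  with less True show ?thesis by (auto simp: cs)
 next
  case False
  show ?thesis
  proof (cases "bs = []")
   case True
   hence "horner A emb cs a = emb b" using less.prems by (simp add: cs)
   with less.prems False scalar_unit[of b] show ?thesis by (simp add: cs)
  next
   case bs: False
   hence "length cs \<ge> 2" "last cs \<noteq> \<zero>\<^sub>K" using False by (auto simp: cs Suc_le_eq)
   then obtain \<mu> where \<mu>: "\<mu> \<in> carrier K" "horner K (\<lambda>x. x) cs \<mu> = \<zero>\<^sub>K"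
    using algebraically_closed.horner_root[OF K] less.prems by blast
   obtain ds where ds: "set ds \<subseteq> carrier K" "length ds = length cs - 1" "ds \<noteq> [] --> last ds = last cs"
    "horner A emb cs a = (a \<ominus> emb \<mu>) ** horner A emb ds a \<oplus> emb (horner K (\<lambda>x. x) cs \<mu>)"
    using horner_divide[of cs \<mu> a] less.prems \<mu> by blast
   have "ds \<noteq> []" using ds(2) bs by (auto simp: cs)
   hence "last cs \<in> set ds" using ds(3) last_in_set by metis
   hence nz: "\<not> set ds \<subseteq> {\<zero>\<^sub>K}" using False by (auto simp: cs)
   have "horner A emb cs a = (a \<ominus> emb \<mu>) ** horner A emb ds a" using ds \<mu> less.prems by simp
   then consider "a \<ominus> emb \<mu> \<notin> Units A" | "horner A emb ds a \<notin> Units A" using less.prems(4) S.Units_m_closed by metis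
   thus ?thesis
   proof cases
    case 1
    thus ?thesis using \<mu> by blast
   next
    case 2
    show ?thesis using less.hyps[of ds] 2 ds nz less.prems \<open>ds \<noteq> []\<close> by (auto simp: cs)
   qed
  qed
 qed
qed

section \<open>Local algebras\<close>

definition multiples where
 "multiples A t = (\<lambda>x. t **\<^sub>A x) ` carrier A"

context kalgebra
begin

lemma ksubspace_multiples:
 assumes "t \<in> carrier A"
 shows "ksubspace K A emb (multiples A t)" unfolding ksubspace_def
proof (intro conjI ballI)
 show "multiples A t \<subseteq> carrier A" using assms by (auto simp: multiples_def)
 show "\<zero> \<in> multiples A t" using assms by (auto simp: multiples_def intro!: image_eqI[of _ _ "\<zero>"])
next
 fix x y assume "x \<in> multiples A t" "y \<in> multiples A t"
 then obtain a b where "a \<in> carrier A" "b \<in> carrier A" "x = t ** a" "y = t ** b" by (auto simp: multiples_def)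
 with assms show "x \<oplus> y \<in> multiples A t" by (auto simp: multiples_def S.r_distr intro!: image_eqI[of _ _ "a \<oplus> b"])
next
 fix c x assume "c \<in> carrier K" "x \<in> multiples A t"
 then obtain a where "a \<in> carrier A" "c \<in> carrier K" "x = t ** a" by (auto simp: multiples_def)
 with assms show "emb c ** x \<in> multiples A t" by (auto simp: multiples_def S.m_lcomm intro!: image_eqI[of _ _ "emb c ** a"])
qed

lemma multiples_mult:
 assumes "t \<in> carrier A" "x \<in> multiples A t" "y \<in> carrier A"
 shows "x ** y \<in> multiples A t" "y ** x \<in> multiples A t"
proof -
 obtain a where a: "a \<in> carrier A" "x = t ** a" using assms by (auto simp: multiples_def)
 thus 1: "x ** y \<in> multiples A t" using assms by (auto simp: multiples_def S.m_assoc intro!: image_eqI[of _ _ "a ** y"])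
 thus "y ** x \<in> multiples A t" using a assms S.m_comm[of x y] by simp
qed

text \<open>The \<open>card I + 1\<close> elements \<open>a^j n\<close> are dependent modulo
  \<open>W\<close>, so a nonzero polynomial in \<open>a\<close> multiplies \<open>n\<close> into
  \<open>W\<close>. The factor \<open>n\<close> matters when \<open>W\<close> is only a subring:
  there the relation for \<open>n = 1\<close> may be trivial, while the one for some
  \<open>n\<close> outside \<open>W\<close> carries information.\<close>

lemma algebraic_mod:
 assumes W: "ksubspace K A emb W" and b: "spans_mod K A emb W I b" and a: "a \<in> carrier A" "n \<in> carrier A"
 shows "\<exists>cs. set cs \<subseteq> carrier K \<and> \<not> set cs \<subseteq> {\<zero>\<^sub>K} \<and> horner A emb cs a ** n \<in> W"
proof -
 let ?J = "{..<Suc (card I)}"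
 obtain c where c: "c \<in> ?J \<rightarrow> carrier K" "\<exists>j\<in>?J. c j \<noteq> \<zero>\<^sub>K"
  "lincomb ?J c (\<lambda>j. a [^] j ** n) \<in> W" using quotient_dependence[OF W b, of ?J "\<lambda>j. a [^] j ** n"] a by auto
 define d where "d = (\<lambda>j. if j \<in> ?J then c j else \<zero>\<^sub>K)"
 have d: "d j \<in> carrier K" for j using c(1) by (auto simp: d_def)
 let ?cs = "map d [0..<0 + Suc (card I)]"
 have "horner A emb ?cs a ** n = lincomb ?J d (\<lambda>j. a [^] j) ** n" using horner_upt[of d a 0 "Suc (card I)"] d a by simp
 also have "... = lincomb ?J c (\<lambda>j. a [^] j ** n)"
  using a d c(1) by (subst S.finsum_ldistr) (auto simp: Pi_iff S.m_assoc d_def intro!: S.finsum_cong')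
 finally have "horner A emb ?cs a ** n \<in> W" using c by simp
 moreover have "set ?cs \<subseteq> carrier K" using d by auto
 moreover have "\<not> set ?cs \<subseteq> {\<zero>\<^sub>K}"
 proof -
  obtain j where "j \<in> ?J" "c j \<noteq> \<zero>\<^sub>K" using c by blast
  have "d j \<in> set ?cs" unfolding set_map using \<open>j \<in> ?J\<close> by (intro imageI) auto
  moreover have "d j \<noteq> \<zero>\<^sub>K" using \<open>j \<in> ?J\<close> \<open>c j \<noteq> \<zero>\<^sub>K \<close> by (auto simp: d_def)
  ultimately show ?thesis by blast
 qed
 ultimately show ?thesis by blast
qed

end

text \<open>A ring is local when its nonunits are closed under addition; closure under multiples is
  automatic. The residue field is left open here and is shown to be \<open>K\<close> separately for
  the point and for each branch.\<close>

locale local_algebra = kalgebra +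
 assumes zero_nonunit: "\<zero> \<notin> Units A"
  and nonunits_add: "x \<in> nonunits A ==> y \<in> nonunits A ==> x \<oplus> y \<in> nonunits A"
begin

lemma nonunits_closed: "x \<in> nonunits A ==> x \<in> carrier A" by (simp add: nonunits_def)

lemma nonunits_zero: "\<zero> \<in> nonunits A" using zero_nonunit by (simp add: nonunits_def)

lemma nonunits_mult:
 assumes "x \<in> nonunits A" "y \<in> carrier A"
 shows "x ** y \<in> nonunits A" "y ** x \<in> nonunits A"
proof -
 have x: "x \<in> carrier A" "x \<notin> Units A" using assms by (auto simp: nonunits_def)
 thus "x ** y \<in> nonunits A" using assms(2) S.unit_factor[of x y] by (auto simp: nonunits_def)
 thus "y ** x \<in> nonunits A" using x assms(2) S.m_comm by simp
qed

lemma nonunits_minus: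
 assumes "x \<in> nonunits A" shows "\<ominus> x \<in> nonunits A"
proof -
 have "\<ominus> x = (\<ominus> \<one>) ** x" using nonunits_closed[OF assms] by (simp add: S.l_minus)
 thus ?thesis using nonunits_mult(2)[OF assms, of "\<ominus> \<one>"] by simp
qed

lemma nonunits_diff:
 "x \<in> nonunits A ==> y \<in> nonunits A ==> x \<ominus> y \<in> nonunits A" by (simp add: a_minus_def nonunits_add nonunits_minus)

lemma unit_add_nonunit:
 assumes "u \<in> Units A" "x \<in> nonunits A"
 shows "u \<oplus> x \<in> Units A"
proof (rule ccontr)
 have c: "u \<in> carrier A" "x \<in> carrier A" using assms nonunits_closed by auto
 assume "u \<oplus> x \<notin> Units A"
 hence "u \<oplus> x \<in> nonunits A" using c by (simp add: nonunits_def)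
 hence "u \<oplus> x \<ominus> x \<in> nonunits A" using assms nonunits_diff by blast
 also have "u \<oplus> x \<ominus> x = u" using c by (simp add: a_minus_def S.a_assoc S.r_neg)
 finally show False using assms by (simp add: nonunits_def)
qed

lemma nonunits_finsum:
 assumes "finite I" "f \<in> I \<rightarrow> nonunits A"
 shows "finsum A f I \<in> nonunits A" using assms
proof (induction I rule: finite_induct)
 case empty
 thus ?case using nonunits_zero by simp
next
 case (insert i I)
 hence "f i \<in> carrier A" "f \<in> I \<rightarrow> carrier A" using nonunits_closed by auto
 thus ?case using insert nonunits_add by (simp add: S.finsum_insert)
qed

lemma scalar_nonunit: "c \<in> carrier K ==> emb c \<in> nonunits A ==> c = \<zero>\<^sub>K" using scalar_unit[of c] by (auto simp: nonunits_def)

lemma residue_unique: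
 assumes "a \<in> carrier A" "c \<in> carrier K" "d \<in> carrier K"
  "a \<ominus> emb c \<in> nonunits A" "a \<ominus> emb d \<in> nonunits A"
 shows "c = d"
proof -
 have "(a \<ominus> emb d) \<ominus> (a \<ominus> emb c) = emb c \<ominus> emb d"
  using assms(1) hom_closed[OF assms(2)] hom_closed[OF assms(3)] by algebra
 also have "... = emb (c \<ominus>\<^sub>K d)" using assms by (simp add: a_minus_def)
 finally have "emb (c \<ominus>\<^sub>K d) \<in> nonunits A" using nonunits_diff[OF assms(5,4)] by simp
 hence "c \<ominus>\<^sub>K d = \<zero>\<^sub>K" using assms by (intro scalar_nonunit) auto
 thus ?thesis using assms by simp
qed

text \<open>The power of \<open>g\<close> belonging to the lowest nonzero coefficient can be split
  off. What remains is a nonzero scalar plus a multiple of \<open>g\<close>, hence a unit.\<close>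

lemma horner_nonunit:
 assumes "set cs \<subseteq> carrier K" "\<not> set cs \<subseteq> {\<zero>\<^sub>K}" "g \<in> nonunits A"
 shows "\<exists>k::nat. \<exists>u\<in>Units A. horner A emb cs g = g [^] k ** u" using assms(1,2)
proof (induction cs)
 case (Cons c cs)
 have g: "g \<in> carrier A" using assms nonunits_closed by auto
 show ?case
 proof (cases "c = \<zero>\<^sub>K")
  case True
  then obtain k u where u: "u \<in> Units A" "horner A emb cs g = g [^] (k::nat) ** u" using Cons by auto
  hence "horner A emb (c # cs) g = g [^] Suc k ** u" using True g S.Units_closed[OF u(1)] by (simp add: S.m_ac)
  thus ?thesis using u by blast
 next
  case False
  hence "emb c \<in> Units A" using scalar_unit Cons by auto
  moreover have "g ** horner A emb cs g \<in> nonunits A" using assms Cons g by (intro nonunits_mult) auto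
  ultimately have "horner A emb (c # cs) g \<in> Units A" by (simp add: unit_add_nonunit)
  thus ?thesis using g S.Units_closed by (intro exI[of _ 0] bexI[of _ "horner A emb (c # cs) g"]) auto
 qed
qed simp

text \<open>Since \<open>W\<close> has finite codimension, a nonzero polynomial in \<open>a\<close>
  takes its value in \<open>W\<close>, that is, among the nonunits. Over an algebraically closed
  field some linear factor \<open>a - c\<close> is then a nonunit already.\<close>

lemma residue_exists:
 assumes "algebraically_closed K" and W: "ksubspace K A emb W" "W \<subseteq> nonunits A"
  and b: "spans_mod K A emb W I b" and a: "a \<in> carrier A"
 shows "\<exists>c\<in>carrier K. a \<ominus> emb c \<in> nonunits A"
proof -
 obtain cs where cs: "set cs \<subseteq> carrier K" "\<not> set cs \<subseteq> {\<zero>\<^sub>K}" "horner A emb cs a ** \<one> \<in> W"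
  using algebraic_mod[OF W(1) b a] by blast
 hence "horner A emb cs a \<notin> Units A" using W(2) a by (auto simp: nonunits_def)
 then obtain c where "c \<in> carrier K" "a \<ominus> emb c \<notin> Units A" using nonunit_polynomial_value[OF assms(1) cs(1,2) a] by blast
 thus ?thesis using a by (auto simp: nonunits_def)
qed

text \<open>The residue field acts on the nonzero finite-dimensional space \<open>B/A\<close>, so every element of
 it is algebraic over \<open>K\<close>.\<close>

lemma residue_exists_extension:
 assumes K: "algebraically_closed K" and B: "kalgebra K B emb'" and \<psi>: "\<psi> \<in> ring_hom A B"
  and sc: "\<And>c. c \<in> carrier K ==> emb' c = \<psi> (emb c)"
  and b: "spans_mod K B emb' (\<psi> ` carrier A) I b" and n: "n \<in> carrier B" "n \<notin> \<psi> ` carrier A"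
  and a: "a \<in> carrier A"
 shows "\<exists>c\<in>carrier K. a \<ominus> emb c \<in> nonunits A"
proof -
 interpret B: kalgebra K B emb' by fact
 interpret h: ring_hom_cring A B \<psi> using \<psi> by unfold_locales auto
 have W: "ksubspace K B emb' (\<psi> ` carrier A)" unfolding ksubspace_def
 proof (intro conjI ballI)
  show "\<zero>\<^sub>B \<in> \<psi> ` carrier A" by (rule image_eqI[of _ _ "\<zero>"]) auto
 next
  fix x y assume "x \<in> \<psi> ` carrier A" "y \<in> \<psi> ` carrier A"
  then obtain a b where ab: "a \<in> carrier A" "b \<in> carrier A" "x = \<psi> a" "y = \<psi> b" by blast
  thus "x \<oplus>\<^sub>B y \<in> \<psi> ` carrier A" by (intro image_eqI[of _ _ "a \<oplus> b"]) auto
 next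
  fix c x assume c: "c \<in> carrier K" and "x \<in> \<psi> ` carrier A"
  then obtain a where a: "a \<in> carrier A" "x = \<psi> a" by blast
  with c show "emb' c **\<^sub>B x \<in> \<psi> ` carrier A" by (intro image_eqI[of _ _ "emb c ** a"]) (auto simp: sc)
 qed auto
 obtain cs where cs: "set cs \<subseteq> carrier K" "\<not> set cs \<subseteq> {\<zero>\<^sub>K}"
  "horner B emb' cs (\<psi> a) **\<^sub>B n \<in> \<psi> ` carrier A" using B.algebraic_mod[OF W b _ n(1)] a by (metis h.hom_closed)
 have "horner B emb' cs (\<psi> a) = \<psi> (horner A emb cs a)" using cs(1) by (induction cs) (auto simp: sc a)
 then obtain y where y: "y \<in> carrier A" "\<psi> (horner A emb cs a) **\<^sub>B n = \<psi> y" using cs by auto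
 have "horner A emb cs a \<notin> Units A"
 proof
  assume u: "horner A emb cs a \<in> Units A"
  let ?u = "horner A emb cs a" and ?v = "inv\<^bsub>A\<^esub> horner A emb cs a"
  have uv: "?u \<in> carrier A" "?v \<in> carrier A" "?v ** ?u = \<one>" using u by auto
  have "n = \<psi> (?v ** ?u) **\<^sub>B n" using uv n by simp
  also have "... = (\<psi> ?v **\<^sub>B \<psi> ?u) **\<^sub>B n" using h.hom_mult[OF uv(2,1)] by simp
  also have "... = \<psi> ?v **\<^sub>B (\<psi> ?u **\<^sub>B n)" using uv(1,2) n by (intro B.S.m_assoc) auto
  also have "... = \<psi> (?v ** y)" using y(1) uv(2) unfolding y(2) by simp
  finally show False using n(2) y(1) uv(2) S.m_closed by blast
 qed
 then obtain c where "c \<in> carrier K" "a \<ominus> emb c \<notin> Units A" using nonunit_polynomial_value[OF K cs(1,2) a] by blast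
 thus ?thesis using a by (auto simp: nonunits_def)
qed

end

section \<open>Discrete valuation rings\<close>

lemma (in cring) diff_eq_imp_eq_add:
 assumes "a \<ominus> h = y" "a \<in> carrier R" "h \<in> carrier R"
 shows "a = y \<oplus> h"
proof -
 have "a = (a \<ominus> h) \<oplus> h" using assms(2,3) by algebra
 thus ?thesis using assms(1) by simp
qed

lemma (in cring) add_diff_cancel:
 "c \<in> carrier R ==> x \<in> carrier R ==> (c \<oplus> x) \<ominus> c = x" by algebra

lemma (in cring) minus_mult_cancel:
 "e \<in> carrier R ==> d \<in> carrier R ==> t \<in> carrier R ==> (\<ominus> (e ** d)) ** t \<oplus> e ** (t ** d) = \<zero>" by algebra

context local_algebra
begin

text \<open>Some nonzero polynomial in \<open>g\<close> lies in the ideal of \<open>t\<close>. Its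
  value is a power of \<open>g\<close> times a unit, so the power itself lies there: the maximal
  ideal consists of nilpotent elements modulo \<open>t\<close>.\<close>

lemma power_in_multiples:
 assumes t: "t \<in> carrier A" and b: "spans_mod K A emb (multiples A t) I b" and g: "g \<in> nonunits A"
 shows "\<exists>k::nat. g [^] k \<in> multiples A t"
proof -
 have gc: "g \<in> carrier A" using g nonunits_closed by auto
 obtain cs where cs: "set cs \<subseteq> carrier K" "\<not> set cs \<subseteq> {\<zero>\<^sub>K}"
  "horner A emb cs g ** \<one> \<in> multiples A t" using algebraic_mod[OF ksubspace_multiples[OF t] b gc S.one_closed] by blast
 obtain k u where u: "u \<in> Units A" "horner A emb cs g = g [^] (k::nat) ** u" using horner_nonunit[OF cs(1,2) g] by blast
 have uc: "u \<in> carrier A" "inv\<^bsub>A\<^esub> u \<in> carrier A" "u ** inv\<^bsub>A\<^esub> u = \<one>" using u(1) by auto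
 have "g [^] k ** u \<in> multiples A t" using cs(3) u uc(1) gc by simp
 hence "(g [^] k ** u) ** inv\<^bsub>A\<^esub> u \<in> multiples A t" using multiples_mult(1)[OF t] uc by blast
 also have "(g [^] k ** u) ** inv\<^bsub>A\<^esub> u = g [^] k" using uc gc by (simp add: S.m_assoc)
 finally show ?thesis ..
qed

text \<open>The nonunits are treated one after another, starting with \<open>\<beta> = 1\<close>.
  For a new \<open>g\<close>, the last product \<open>g^j \<beta>\<close> outside the ideal of
  \<open>t\<close> is annihilated by \<open>g\<close> modulo \<open>t\<close>, and it is still
  annihilated by the earlier ones, being a multiple of \<open>\<beta>\<close>.\<close>

lemma annihilated_element:
 assumes t: "t \<in> nonunits A" and b: "spans_mod K A emb (multiples A t) I b"
  and "finite G" "G \<subseteq> nonunits A"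
 shows "\<exists>\<beta>\<in>carrier A. \<beta> \<notin> multiples A t \<and> (\<forall>g\<in>G. g ** \<beta> \<in> multiples A t)" using assms(3,4)
proof (induction G rule: finite_induct)
 case empty
 have "\<one> \<notin> multiples A t"
 proof
  assume "\<one> \<in> multiples A t"
  hence "\<one> \<in> nonunits A" using nonunits_mult(1)[OF t] unfolding multiples_def by auto
  thus False by (simp add: nonunits_def)
 qed
 thus ?case by blast
next
 case (insert g G)
 have tc: "t \<in> carrier A" using t nonunits_closed by auto
 have g: "g \<in> carrier A" using insert.prems nonunits_closed by auto
 obtain \<beta> where \<beta>: "\<beta> \<in> carrier A" "\<beta> \<notin> multiples A t" "\<And>x. x \<in> G ==> x ** \<beta> \<in> multiples A t"
  using insert by auto
 define Q where "Q = (\<lambda>k::nat. g [^] k ** \<beta> \<in> multiples A t)"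
 have "\<exists>k. Q k" using power_in_multiples[OF tc b, of g] insert.prems multiples_mult(1)[OF tc] \<beta>(1) by (auto simp: Q_def)
 then obtain k where k: "Q k" "\<And>j. j < k ==> \<not> Q j" using exists_least_iff[of Q] by blast
 have "k \<noteq> 0" using k(1) \<beta> by (auto simp: Q_def intro: ccontr)
 then obtain j where j: "k = Suc j" by (cases k) auto
 let ?\<beta> = "g [^] j ** \<beta>"
 have "?\<beta> \<notin> multiples A t" using k(2)[of j] j by (simp add: Q_def)
 moreover have "g ** ?\<beta> \<in> multiples A t" using k(1) g \<beta>(1) by (simp add: Q_def j S.m_ac)
 moreover have "x ** ?\<beta> \<in> multiples A t" if "x \<in> G" for x
 proof -
  have x: "x \<in> carrier A" using that insert.prems nonunits_closed by auto
  have "x ** ?\<beta> = g [^] j ** (x ** \<beta>)" using x g \<beta>(1) by (simp add: S.m_lcomm)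
  thus ?thesis using multiples_mult(2)[OF tc \<beta>(3)[OF that]] g by simp
 qed
 ultimately show ?case using g \<beta>(1) by (intro bexI[of _ ?\<beta>]) auto
qed

text \<open>It suffices to annihilate the finitely many elements \<open>b i - l i\<close>, the
  spanning family minus its residues. Modulo \<open>t\<close> every nonunit is a combination of them
  plus a scalar, and that scalar is a difference of nonunits and therefore zero.\<close>

lemma socle_element:
 assumes t: "t \<in> nonunits A" and b: "spans_mod K A emb (multiples A t) I b"
  and res: "\<And>a. a \<in> carrier A ==> \<exists>c\<in>carrier K. a \<ominus> emb c \<in> nonunits A"
 shows "\<exists>\<beta>\<in>carrier A. \<beta> \<notin> multiples A t \<and> (\<forall>g\<in>nonunits A. g ** \<beta> \<in> multiples A t)"
proof -
 have tc: "t \<in> carrier A" using t nonunits_closed by auto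
 have I: "finite I" "\<And>i. i \<in> I ==> b i \<in> carrier A" using b by (auto simp: spans_mod_def)
 obtain l where l: "\<And>i. i \<in> I ==> l i \<in> carrier K" "\<And>i. i \<in> I ==> b i \<ominus> emb (l i) \<in> nonunits A"
  using bchoice[of I "\<lambda>i c. c \<in> carrier K \<and> b i \<ominus> emb c \<in> nonunits A"] res I(2) by blast
 define g where "g i = b i \<ominus> emb (l i)" for i
 have g: "g i \<in> nonunits A" "g i \<in> carrier A" if "i \<in> I" for i using l(2)[OF that] nonunits_closed by (auto simp: g_def)
 obtain \<beta> where \<beta>: "\<beta> \<in> carrier A" "\<beta> \<notin> multiples A t" "\<And>i. i \<in> I ==> g i ** \<beta> \<in> multiples A t"
  using annihilated_element[OF t b, of "g ` I"] I(1) g(1) by blast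
 have "a ** \<beta> \<in> multiples A t" if a: "a \<in> nonunits A" for a
 proof -
  have ac: "a \<in> carrier A" using a nonunits_closed by auto
  obtain c where c: "c \<in> I \<rightarrow> carrier K" "a \<ominus> lincomb I c b \<in> multiples A t" using b ac unfolding spans_mod_def by blast
  have ci: "c i \<in> carrier K" if "i \<in> I" for i using c(1) that by auto
  define s where "s = (\<Oplus>\<^sub>K i\<in>I. c i **\<^sub>K l i)"
  have s: "s \<in> carrier K" unfolding s_def using ci l(1) by (intro R.finsum_closed) auto
  have bi: "emb (c i) ** b i = emb (c i) ** g i \<oplus> emb (c i **\<^sub>K l i)" if "i \<in> I" for i
   using S.distrib_diff_add[of "emb (c i)" "b i" "emb (l i)"] ci[OF that] l(1)[OF that] I(2)[OF that] by (simp add: g_def)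
  have "lincomb I c b = (\<Oplus>i\<in>I. emb (c i) ** g i \<oplus> emb (c i **\<^sub>K l i))" using bi g ci l by (intro S.finsum_cong') auto
  also have "... = lincomb I c g \<oplus> (\<Oplus>i\<in>I. emb (c i **\<^sub>K l i))" using g ci l by (intro S.finsum_addf) auto
  also have "(\<Oplus>i\<in>I. emb (c i **\<^sub>K l i)) = emb s" unfolding s_def using ci l I by (subst hom_finsum) (auto simp: o_def)
  finally have L: "lincomb I c b = lincomb I c g \<oplus> emb s" .
  have G: "lincomb I c g \<in> nonunits A" using I(1) ci g nonunits_mult by (intro nonunits_finsum) auto
  obtain z where z: "z \<in> carrier A" "a \<ominus> (lincomb I c g \<oplus> emb s) = t ** z" using c(2) unfolding L multiples_def by blast
  define h where "h = lincomb I c g"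
  have hc: "h \<in> carrier A" "h \<in> nonunits A" using G nonunits_closed by (auto simp: h_def)
  have gs: "emb s \<in> carrier A" using s by simp
  have z': "a \<ominus> (h \<oplus> emb s) = t ** z" using z(2) by (simp add: h_def)
  have "emb s = a \<ominus> h \<ominus> (a \<ominus> (h \<oplus> emb s))" using ac hc(1) gs by algebra
  also have "... \<in> nonunits A" unfolding z' using a hc z(1) t by (intro nonunits_diff nonunits_mult(1)) auto
  finally have "s = \<zero>\<^sub>K" using scalar_nonunit s by blast
  hence "a \<ominus> h = t ** z" using z' hc(1) ac by simp
  hence "a = t ** z \<oplus> h" using S.diff_eq_imp_eq_add ac hc(1) by blast
  hence "a ** \<beta> = t ** (z ** \<beta>) \<oplus> h ** \<beta>" using hc(1) z(1) tc \<beta>(1) by (simp add: S.l_distr S.m_assoc)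
  moreover have "h ** \<beta> = (\<Oplus>i\<in>I. emb (c i) ** (g i ** \<beta>))"
   unfolding h_def using ci g \<beta>(1) I by (subst S.finsum_ldistr) (auto simp: Pi_iff S.m_assoc intro!: S.finsum_cong')
  moreover have "... \<in> multiples A t" using ksubspace_multiples[OF tc] I ci \<beta>(3) by (intro ksubspace_finsum) (auto simp: ksubspace_def)
  moreover have "t ** (z ** \<beta>) \<in> multiples A t" using z(1) \<beta>(1) by (auto simp: multiples_def)
  ultimately show ?thesis using ksubspace_multiples[OF tc] by (auto simp: ksubspace_def)
 qed
 thus ?thesis using \<beta> by blast
qed

text \<open>With \<open>x = \<beta>/t\<close> and \<open>M\<close> the maximal ideal, \<open>x M\<close> is an ideal. If it is contained in
 \<open>M\<close>, then all \<open>x\<^sup>k t\<close> lie in the ring; a linear dependence between them modulo \<open>t\<close> makes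
 \<open>x\<close> integral. This replaces the determinant trick.\<close>

lemma socle_element_not_integral:
 assumes ic: "integrally_closed_domain A" and t: "t \<in> nonunits A" "t \<noteq> \<zero>"
  and b: "spans_mod K A emb (multiples A t) I b"
  and \<beta>: "\<beta> \<in> carrier A" "\<beta> \<notin> multiples A t"
 shows "\<not> (\<forall>g\<in>nonunits A. \<exists>d\<in>nonunits A. g ** \<beta> = t ** d)"
proof
 interpret D: domain A using ic by (simp add: integrally_closed_domain_def)
 have tc: "t \<in> carrier A" using t nonunits_closed by auto
 assume "\<forall>g\<in>nonunits A. \<exists>d\<in>nonunits A. g ** \<beta> = t ** d"
 then obtain f where f: "\<And>g. g \<in> nonunits A ==> f g \<in> nonunits A"
  "\<And>g. g \<in> nonunits A ==> g ** \<beta> = t ** f g" by metis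
 \<comment> \<open>This is the element \<open>(\<beta>/t)^k t\<close>, written without
   fractions.\<close>
 define y where "y k = (f ^^ k) t" for k :: nat
 have yn: "y k \<in> nonunits A" for k by (induction k) (auto simp: y_def t f)
 hence yc [simp]: "y k \<in> carrier A" for k using nonunits_closed by auto
 have ys: "y k ** \<beta> = t ** y (Suc k)" for k using f(2)[OF yn] by (simp add: y_def)
 have \<beta>y: "\<beta> [^] k ** t = t [^] k ** y k" for k :: nat
 proof (induction k)
  case 0
  thus ?case using tc by (simp add: y_def)
 next
  case (Suc k)
  have "\<beta> [^] Suc k ** t = (\<beta> [^] k ** t) ** \<beta>" using \<beta> tc by (simp add: S.m_ac)
  also have "... = t [^] k ** (y k ** \<beta>)" using Suc \<beta> tc by (simp add: S.m_assoc)
  also have "... = t [^] Suc k ** y (Suc k)" unfolding ys using tc by (simp add: S.m_assoc)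
  finally show ?case .
 qed
 \<comment> \<open>The index starts at 1 because \<open>y 0 = t\<close> lies in the ideal of
   \<open>t\<close> anyway; the coefficient of degree 0 in the integral equation will come from the
   factor \<open>d\<close> of the relation.\<close>
 let ?J = "{1..Suc (card I)}"
 obtain c where c: "c \<in> ?J \<rightarrow> carrier K" "\<exists>j\<in>?J. c j \<noteq> \<zero>\<^sub>K" "lincomb ?J c y \<in> multiples A t"
  using quotient_dependence[OF ksubspace_multiples[OF tc] b, of ?J y] by auto
 then obtain d where d: "d \<in> carrier A" "lincomb ?J c y = t ** d" by (auto simp: multiples_def)
 define N where "N = {j \<in> ?J. c j \<noteq> \<zero>\<^sub>K}"
 define n where "n = Max N"
 have N: "finite N" "N \<noteq> {}" using c(2) by (auto simp: N_def)
 hence nN: "n \<in> N" unfolding n_def by (rule Max_in)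
 hence n: "n \<in> ?J" "c n \<noteq> \<zero>\<^sub>K" by (auto simp: N_def)
 have big: "c j = \<zero>\<^sub>K" if "j \<in> ?J" "j > n" for j
 proof (rule ccontr)
  assume "c j \<noteq> \<zero>\<^sub>K"
  hence "j \<in> N" using that by (simp add: N_def)
  hence "j \<le> n" using Max_ge[OF N(1)] by (simp add: n_def)
  thus False using that by simp
 qed
 have cJ: "c j \<in> carrier K" if "j \<in> ?J" for j using c(1) that by auto
 define e where "e = inv\<^bsub>K\<^esub> (c n)"
 have e: "e \<in> carrier K" "e **\<^sub>K c n = \<one>\<^sub>K" using n cJ K.field_Units by (auto simp: e_def)
 define q where "q i = (if i = 0 then \<ominus> (emb e ** d) else emb (e **\<^sub>K c i))" for i
 have q: "q i \<in> carrier A" if "i \<le> n" for i using that n(1) cJ[of i] e d(1) by (auto simp: q_def)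
 \<comment> \<open>The monomials of the integral equation for \<open>\<beta>/t\<close> after
   multiplication by \<open>t^n\<close>, the form that \<open>integrally_closed_domain\<close> asks
   for.\<close>
 define F where "F i = \<beta> [^] i ** t [^] (n - i)" for i
 have F: "F i \<in> carrier A" for i using \<beta> tc by (simp add: F_def)
 have tF: "t ** F i = t [^] n ** y i" if "i \<le> n" for i
 proof -
  have "t ** F i = (\<beta> [^] i ** t) ** t [^] (n - i)" using \<beta> tc by (simp add: F_def S.m_ac)
  also have "... = (t [^] i ** t [^] (n - i)) ** y i" unfolding \<beta>y using tc by (simp add: S.m_ac)
  also have "t [^] i ** t [^] (n - i) = t [^] n" using that tc by (simp add: S.nat_pow_mult)
  finally show ?thesis .
 qed
 define E where "E = (\<Oplus>i\<in>{..n}. q i ** F i)"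
 have Ec: "E \<in> carrier A" unfolding E_def using q F by (intro S.finsum_closed) auto
 have "{..n} = insert 0 {1..n}" by auto
 hence "(\<Oplus>i\<in>{..n}. q i ** y i) = q 0 ** y 0 \<oplus> (\<Oplus>i\<in>{1..n}. q i ** y i)" using q by (simp add: S.finsum_insert Pi_iff)
 also have "(\<Oplus>i\<in>{1..n}. q i ** y i) = (\<Oplus>i\<in>{1..n}. emb e ** (emb (c i) ** y i))"
  using n(1) cJ e by (intro S.finsum_cong') (auto simp: q_def S.m_assoc)
 also have "... = emb e ** lincomb {1..n} c y" using n(1) cJ e by (intro S.finsum_rdistr[symmetric]) auto
 also have "lincomb {1..n} c y = lincomb ?J c y" using n(1) cJ big by (intro S.add.finprod_mono_neutral_cong_left) auto
 also have "... = t ** d" by (rule d(2))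
 also have "q 0 ** y 0 \<oplus> emb e ** (t ** d) = \<zero>"
 proof -
  have *: "emb e \<in> carrier A" using e by simp
  have "q 0 ** y 0 = \<ominus> (emb e ** d) ** t" by (simp add: q_def y_def)
  thus ?thesis using S.minus_mult_cancel[OF * d(1) tc] by simp
 qed
 finally have qy: "(\<Oplus>i\<in>{..n}. q i ** y i) = \<zero>" .
 have "t ** E = (\<Oplus>i\<in>{..n}. t ** (q i ** F i))" unfolding E_def using q F tc by (intro S.finsum_rdistr) auto
 also have "... = (\<Oplus>i\<in>{..n}. t [^] n ** (q i ** y i))"
 proof (intro S.finsum_cong' refl)
  fix i assume "i \<in> {..n}"
  hence "t ** (q i ** F i) = q i ** (t [^] n ** y i)" using S.m_lcomm[OF tc q F, of i i] tF[of i] by simp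
  also have "... = t [^] n ** (q i ** y i)" using q[of i] \<open>i \<in> {..n}\<close> tc by (intro S.m_lcomm) auto
  finally show "t ** (q i ** F i) = t [^] n ** (q i ** y i)" .
 qed (use q tc in auto)
 also have "... = t [^] n ** (\<Oplus>i\<in>{..n}. q i ** y i)" using q tc by (intro S.finsum_rdistr[symmetric]) auto
 also have "... = \<zero>" using qy tc by simp
 finally have "E = \<zero>" using D.integral[OF _ tc Ec] t(2) by auto
 moreover have "E = \<beta> [^] n \<oplus> (\<Oplus>i\<in>{..<n}. q i ** F i)"
 proof -
  have "{..n} = insert n {..<n}" by auto
  moreover have "q n ** F n = \<beta> [^] n" using n e \<beta> by (auto simp: q_def F_def)
  ultimately show ?thesis unfolding E_def using q F \<beta>(1) by (simp add: S.finsum_insert Pi_iff)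
 qed
 ultimately have "\<beta> [^] n \<oplus> (\<Oplus>i\<in>{..<n}. q i ** (\<beta> [^] i ** t [^] (n - i))) = \<zero>" by (simp add: F_def)
 moreover have "q \<in> {..<n} \<rightarrow> carrier A" "n > 0" using q n by auto
 ultimately obtain d' where "d' \<in> carrier A" "\<beta> = d' ** t" using ic \<beta>(1) tc t(2) unfolding integrally_closed_domain_def by blast
 thus False using \<beta>(2) tc by (auto simp: multiples_def S.m_comm)
qed

text \<open>For a socle element \<open>\<beta>\<close> some nonunit \<open>g\<close> satisfies
  \<open>g \<beta> = t u\<close> with \<open>u\<close> a unit, as otherwise \<open>\<beta>/t\<close>
  would map the maximal ideal into itself and be integral. With \<open>p = g/u\<close> this reads
  \<open>p \<beta> = t\<close>, and then \<open>a \<beta> = t x\<close> forces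
  \<open>a = p x\<close>.\<close>

lemma maximal_ideal_principal:
 assumes ic: "integrally_closed_domain A" and t: "t \<in> nonunits A" "t \<noteq> \<zero>"
  and b: "spans_mod K A emb (multiples A t) I b"
  and res: "\<And>a. a \<in> carrier A ==> \<exists>c\<in>carrier K. a \<ominus> emb c \<in> nonunits A"
 shows "\<exists>p\<in>nonunits A. p \<noteq> \<zero> \<and> (\<forall>g\<in>nonunits A. \<exists>x\<in>carrier A. g = p ** x)"
proof -
 interpret D: domain A using ic by (simp add: integrally_closed_domain_def)
 have tc: "t \<in> carrier A" using t nonunits_closed by auto
 obtain \<beta> where \<beta>: "\<beta> \<in> carrier A" "\<beta> \<notin> multiples A t" "\<And>g. g \<in> nonunits A ==> g ** \<beta> \<in> multiples A t"
  using socle_element[OF t(1) b res] by blast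
 obtain g where g: "g \<in> nonunits A" "\<And>d. d \<in> nonunits A ==> g ** \<beta> \<noteq> t ** d"
  using socle_element_not_integral[OF ic t b \<beta>(1,2)] by blast
 have gc: "g \<in> carrier A" using g nonunits_closed by auto
 obtain u where u: "u \<in> carrier A" "g ** \<beta> = t ** u" using \<beta>(3)[OF g(1)] by (auto simp: multiples_def)
 with g(2) have uU: "u \<in> Units A" by (auto simp: nonunits_def)
 define p where "p = g ** inv\<^bsub>A\<^esub> u"
 have iu: "inv\<^bsub>A\<^esub> u \<in> carrier A" "u ** inv\<^bsub>A\<^esub> u = \<one>" using uU by auto
 have p: "p \<in> nonunits A" unfolding p_def using nonunits_mult(1)[OF g(1) iu(1)] .
 hence pc: "p \<in> carrier A" using nonunits_closed by auto
 have "p ** \<beta> = (g ** \<beta>) ** inv\<^bsub>A\<^esub> u" using gc \<beta>(1) iu(1) by (simp add: p_def S.m_ac)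
 also have "... = t" unfolding u(2) using tc u(1) iu by (simp add: S.m_assoc)
 finally have p\<beta>: "p ** \<beta> = t" .
 have \<beta>0: "\<beta> \<noteq> \<zero>" using p\<beta> pc t(2) by auto
 have "\<exists>x\<in>carrier A. a = p ** x" if a: "a \<in> nonunits A" for a
 proof -
  have ac: "a \<in> carrier A" using a nonunits_closed by auto
  obtain x where x: "x \<in> carrier A" "a ** \<beta> = t ** x" using \<beta>(3)[OF a] by (auto simp: multiples_def)
  have "a ** \<beta> = (p ** x) ** \<beta>" unfolding x(2) p\<beta>[symmetric] using pc x(1) \<beta>(1) by (simp add: S.m_ac)
  hence "a = p ** x" using D.m_rcancel[OF \<beta>0 \<beta>(1) ac] pc x(1) by simp
  thus ?thesis using x(1) by blast
 qed
 moreover have "p \<noteq> \<zero>" using p\<beta> \<beta>(1) t(2) by auto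
 ultimately show ?thesis using p by blast
qed

end

section \<open>Taylor coefficients with respect to a uniformizer\<close>

locale uniformized_algebra = local_algebra + domain A +
 fixes p
 assumes p: "p \<in> nonunits A" "p \<noteq> \<zero>"
  and uniformizer: "g \<in> nonunits A ==> \<exists>x\<in>carrier A. g = p ** x"
  and residue: "a \<in> carrier A ==> \<exists>c\<in>carrier K. a \<ominus> emb c \<in> nonunits A"
begin

text \<open>Every \<open>a\<close> splits as \<open>res a + p * quo a\<close>, and repeating this on
  the quotient produces the coefficients of the expansion of \<open>a\<close> in powers of
  \<open>p\<close>. The splitting is unique (\<open>res_quo_unique\<close>), which makes the
  arbitrary choice harmless.\<close>

definition res where "res a = (SOME c. c \<in> carrier K \<and> a \<ominus> emb c \<in> nonunits A)"
definition quo where "quo a = (SOME x. x \<in> carrier A \<and> a \<ominus> emb (res a) = p ** x)"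
definition taylor where "taylor a k = res ((quo ^^ k) a)"

lemma p_closed [simp]: "p \<in> carrier A" using p nonunits_closed by auto

lemma res: "a \<in> carrier A ==> res a \<in> carrier K" "a \<in> carrier A ==> a \<ominus> emb (res a) \<in> nonunits A"
proof -
 assume "a \<in> carrier A"
 hence "\<exists>c. c \<in> carrier K \<and> a \<ominus> emb c \<in> nonunits A" using residue by blast
 hence "res a \<in> carrier K \<and> a \<ominus> emb (res a) \<in> nonunits A" unfolding res_def by (rule someI_ex)
 thus "res a \<in> carrier K" "a \<ominus> emb (res a) \<in> nonunits A" by auto
qed

lemma quo:
 assumes "a \<in> carrier A"
 shows "quo a \<in> carrier A" "a = emb (res a) \<oplus> p ** quo a"
proof -
 have "\<exists>x. x \<in> carrier A \<and> a \<ominus> emb (res a) = p ** x" using uniformizer[OF res(2)[OF assms]] by blast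
 hence q: "quo a \<in> carrier A \<and> a \<ominus> emb (res a) = p ** quo a" unfolding quo_def by (rule someI_ex)
 thus "quo a \<in> carrier A" ..
 have "a = emb (res a) \<oplus> (a \<ominus> emb (res a))" using assms hom_closed[OF res(1)[OF assms]] by algebra
 thus "a = emb (res a) \<oplus> p ** quo a" using q by simp
qed

lemma res_quo_unique:
 assumes "a \<in> carrier A" "c \<in> carrier K" "x \<in> carrier A" "a = emb c \<oplus> p ** x"
 shows "res a = c" "quo a = x"
proof -
 have c: "emb c \<in> carrier A" "p ** x \<in> carrier A" using assms by auto
 have "a \<ominus> emb c = p ** x" unfolding assms(4) using c by (rule S.add_diff_cancel)
 also have "... \<in> nonunits A" using nonunits_mult(1)[OF p(1)] assms by simp
 finally show 1: "res a = c" using residue_unique assms res[OF assms(1)] by blast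
 have "emb c \<oplus> p ** quo a = emb c \<oplus> p ** x" using quo(2)[OF assms(1)] assms(4) 1 by simp
 hence "p ** quo a = p ** x" using c quo(1)[OF assms(1)] by simp
 thus "quo a = x" using m_lcancel[OF p(2)] quo(1)[OF assms(1)] assms(3) by simp
qed

lemma taylor_0: "taylor a 0 = res a" by (simp add: taylor_def)

lemma taylor_Suc: "taylor a (Suc k) = taylor (quo a) k" by (simp add: taylor_def funpow_Suc_right del: funpow.simps)

lemma taylor_closed [simp]: "a \<in> carrier A ==> taylor a k \<in> carrier K" by (induction k arbitrary: a) (auto simp: taylor_0 taylor_Suc res quo)

lemma taylor_0_iff: "a \<in> carrier A ==> taylor a 0 = \<zero>\<^sub>K \<longleftrightarrow> a \<in> nonunits A"
proof
 assume a: "a \<in> carrier A"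
 show "a \<in> nonunits A" if "taylor a 0 = \<zero>\<^sub>K" using res(2)[OF a] that a by (simp add: taylor_0 a_minus_def)
 show "taylor a 0 = \<zero>\<^sub>K" if "a \<in> nonunits A"
  using residue_unique[OF a _ _ res(2)[OF a], of "\<zero>\<^sub>K"] a that res(1)[OF a] by (simp add: taylor_0 a_minus_def)
qed

lemma taylor_add:
 assumes "a \<in> carrier A" "b \<in> carrier A"
 shows "taylor (a \<oplus> b) k = taylor a k \<oplus>\<^sub>K taylor b k" using assms
proof (induction k arbitrary: a b)
 case (0 a b)
 have "emb (res a) \<in> carrier A" "emb (res b) \<in> carrier A" "quo a \<in> carrier A" "quo b \<in> carrier A" using 0 quo res by auto
 hence "a \<oplus> b = emb (res a \<oplus>\<^sub>K res b) \<oplus> p ** (quo a \<oplus> quo b)"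
  using 0 res by (subst quo(2)[OF 0(1)], subst quo(2)[OF 0(2)]) (simp add: S.r_distr S.a_ac)
 thus ?case using res_quo_unique(1)[of "a \<oplus> b" "res a \<oplus>\<^sub>K res b" "quo a \<oplus> quo b"] 0 res(1) quo(1)
  unfolding taylor_0 by blast
next
 case (Suc k a b)
 have "emb (res a) \<in> carrier A" "emb (res b) \<in> carrier A" "quo a \<in> carrier A" "quo b \<in> carrier A" using Suc quo res by auto
 hence "a \<oplus> b = emb (res a \<oplus>\<^sub>K res b) \<oplus> p ** (quo a \<oplus> quo b)"
  using Suc.prems res by (subst quo(2)[OF Suc.prems(1)], subst quo(2)[OF Suc.prems(2)]) (simp add: S.r_distr S.a_ac)
 hence "quo (a \<oplus> b) = quo a \<oplus> quo b"
  using res_quo_unique(2)[of "a \<oplus> b" "res a \<oplus>\<^sub>K res b" "quo a \<oplus> quo b"] Suc.prems res(1) quo(1) by blast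
 thus ?case using Suc quo by (simp add: taylor_Suc)
qed

lemma taylor_uniformizer_mult:
 assumes "x \<in> carrier A"
 shows "taylor (p ** x) 0 = \<zero>\<^sub>K" "taylor (p ** x) (Suc k) = taylor x k"
proof -
 have "p ** x = emb \<zero>\<^sub>K \<oplus> p ** x" using assms by simp
 hence "res (p ** x) = \<zero>\<^sub>K" "quo (p ** x) = x" using res_quo_unique[of "p ** x" "\<zero>\<^sub>K" x] assms by auto
 thus "taylor (p ** x) 0 = \<zero>\<^sub>K" "taylor (p ** x) (Suc k) = taylor x k" by (auto simp: taylor_0 taylor_Suc)
qed

lemma taylor_scalar_mult:
 assumes "x \<in> carrier A" "c \<in> carrier K"
 shows "taylor (emb c ** x) k = c **\<^sub>K taylor x k" using assms(1)
proof (induction k arbitrary: x)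
 case (0 x)
 have *: "emb c \<in> carrier A" "emb (res x) \<in> carrier A" "quo x \<in> carrier A" using 0 quo res assms by auto
 have "emb c ** x = emb (c **\<^sub>K res x) \<oplus> p ** (emb c ** quo x)"
  using * res[OF 0] assms(2) by (subst quo(2)[OF 0]) (simp add: S.r_distr S.m_ac)
 thus ?case using res_quo_unique(1)[of "emb c ** x" "c **\<^sub>K res x" "emb c ** quo x"] 0 res(1) assms(2) * unfolding taylor_0 by blast
next
 case (Suc k x)
 have *: "emb c \<in> carrier A" "emb (res x) \<in> carrier A" "quo x \<in> carrier A" using Suc quo res assms by auto
 have "emb c ** x = emb (c **\<^sub>K res x) \<oplus> p ** (emb c ** quo x)"
  using * res[OF Suc.prems] assms(2) by (subst quo(2)[OF Suc.prems]) (simp add: S.r_distr S.m_ac)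
 hence "quo (emb c ** x) = emb c ** quo x" using res_quo_unique(2)[of "emb c ** x" "c **\<^sub>K res x" "emb c ** quo x"] Suc.prems res(1) assms(2) *
  by blast
 thus ?case using Suc quo by (simp add: taylor_Suc)
qed

lemma taylor_scalar:
 assumes "c \<in> carrier K"
 shows "taylor (emb c) k = (if k = 0 then c else \<zero>\<^sub>K)"
proof -
 have z: "taylor \<zero> k = \<zero>\<^sub>K" for k using taylor_scalar_mult[of "\<zero>" "\<zero>\<^sub>K" k] by simp
 have "emb c = emb c \<oplus> p ** \<zero>" using assms by simp
 hence "res (emb c) = c" "quo (emb c) = \<zero>" using res_quo_unique[of "emb c" c "\<zero>"] assms by auto
 thus ?thesis using z by (cases k) (auto simp: taylor_0 taylor_Suc)
qed

text \<open>Induction on the degree with \<open>a\<close> varying and \<open>b\<close> fixed: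
  \<open>a b = res a * b + p * (quo a * b)\<close>, and a factor \<open>p\<close> shifts the
  coefficients by one.\<close>

lemma taylor_mult:
 assumes "a \<in> carrier A" "b \<in> carrier A"
 shows "taylor (a ** b) k = (\<Oplus>\<^sub>K i\<in>{..k}. taylor a i **\<^sub>K taylor b (k - i))" using assms(1)
proof (induction k arbitrary: a)
 case (0 a)
 have *: "emb (res a) \<in> carrier A" "quo a \<in> carrier A" using 0 quo res by auto
 have "a ** b = emb (res a) ** b \<oplus> p ** (quo a ** b)" using * assms(2) by (subst quo(2)[OF 0]) (simp add: S.l_distr S.m_assoc)
 hence "taylor (a ** b) 0 = res a **\<^sub>K taylor b 0"
  using * assms(2) res[OF 0] by (simp add: taylor_add taylor_uniformizer_mult taylor_scalar_mult)
 thus ?case using 0 assms res by (simp add: taylor_0)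
next
 case (Suc k a)
 have *: "emb (res a) \<in> carrier A" "quo a \<in> carrier A" using Suc quo res by auto
 have "a ** b = emb (res a) ** b \<oplus> p ** (quo a ** b)" using * assms(2) by (subst quo(2)[OF Suc.prems]) (simp add: S.l_distr S.m_assoc)
 hence "taylor (a ** b) (Suc k) = res a **\<^sub>K taylor b (Suc k) \<oplus>\<^sub>K taylor (quo a ** b) k"
  using * assms(2) res[OF Suc.prems] by (simp add: taylor_add taylor_uniformizer_mult taylor_scalar_mult)
 also have "taylor (quo a ** b) k = (\<Oplus>\<^sub>K i\<in>{..k}. taylor a (Suc i) **\<^sub>K taylor b (Suc k - Suc i))"
  using Suc.IH[OF *(2)] by (simp add: taylor_Suc)
 also have "res a **\<^sub>K taylor b (Suc k) \<oplus>\<^sub>K ... = (\<Oplus>\<^sub>K i\<in>{..Suc k}. taylor a i **\<^sub>K taylor b (Suc k - i))"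
  using Suc.prems assms(2) res by (subst R.finsum_Suc2) (auto simp: taylor_0 R.a_comm Pi_iff)
 finally show ?case .
qed

end

section \<open>Approximation on the branches\<close>

text \<open>The interface between geometry and algebra. \<open>A\<close> is the local ring,
  \<open>B\<close> the semilocal normalization, \<open>\<tau> i b k\<close> the coefficient of
  degree \<open>k\<close> of \<open>b\<close> on branch \<open>i\<close>, and \<open>\<pi> i\<close>
  a uniformizer of that branch. The local rings of the branches are not part of the data, so
  \<open>local_divides\<close> expresses division by \<open>\<pi> i\<close> there through a
  denominator \<open>s\<close> that does not vanish on the branch. The number \<open>m\<close> in
  \<open>delta\<close> encodes genus one. The Gorenstein condition enters through
  \<open>socle\<close>, whose conclusion speaks of the coefficients on all branches.\<close>

locale curve_singularity = local_algebra K A emb + B: kalgebra K B emb'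
 for K :: "'k ring" and A :: "('a, 'aa) ring_scheme"
  and emb and B :: "('b, 'bb) ring_scheme" (structure) and emb' +
 fixes \<psi> :: "'a => 'b" and m :: nat and \<tau> :: "nat => 'b => nat => 'k" and \<pi> :: "nat => 'b"
 assumes psi: "\<psi> \<in> ring_hom A B" and psi_inj: "inj_on \<psi> (carrier A)"
  and psi_scalar: "x \<in> carrier K ==> emb' x = \<psi> (emb x)"
  and m_pos: "m > 0"
  and tau_closed [simp]: "i < m ==> b \<in> carrier B ==> \<tau> i b k \<in> carrier K"
  and tau_add: "i < m ==> b \<in> carrier B ==> c \<in> carrier B ==> \<tau> i (b \<oplus> c) k = \<tau> i b k \<oplus>\<^sub>K \<tau> i c k"
  and tau_mult: "i < m ==> b \<in> carrier B ==> c \<in> carrier B ==>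
   \<tau> i (b ** c) k = (\<Oplus>\<^sub>K j\<in>{..k}. \<tau> i b j **\<^sub>K \<tau> i c (k - j))"
  and tau_scalar: "i < m ==> x \<in> carrier K ==> \<tau> i (emb' x) k = (if k = 0 then x else \<zero>\<^sub>K)"
  and tau_scalar_mult: "i < m ==> x \<in> carrier K ==> b \<in> carrier B ==>
   \<tau> i (emb' x ** b) k = x **\<^sub>K \<tau> i b k"
  and residue: "a \<in> carrier A ==> \<exists>x\<in>carrier K. a \<ominus>\<^sub>A emb x \<in> nonunits A"
  and tau_nonunit: "i < m ==> a \<in> nonunits A ==> \<tau> i (\<psi> a) 0 = \<zero>\<^sub>K"
  and distinct: "i < m ==> j < m ==> i \<noteq> j ==> \<exists>b\<in>carrier B. \<tau> i b 0 \<noteq> \<zero>\<^sub>K \<and> \<tau> j b 0 = \<zero>\<^sub>K"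
  and pi_closed [simp]: "i < m ==> \<pi> i \<in> carrier B"
  and tau_pi_0: "i < m ==> b \<in> carrier B ==> \<tau> i (\<pi> i ** b) 0 = \<zero>\<^sub>K"
  and tau_pi_Suc: "i < m ==> b \<in> carrier B ==> \<tau> i (\<pi> i ** b) (Suc k) = \<tau> i b k"
  and local_divides: "i < m ==> b \<in> carrier B ==> \<tau> i b 0 = \<zero>\<^sub>K ==>
   \<exists>s\<in>carrier B. \<exists>c\<in>carrier B. \<tau> i s 0 \<noteq> \<zero>\<^sub>K \<and> s ** b = \<pi> i ** c"
  and unitI: "b \<in> carrier B ==> (\<And>i. i < m ==> \<tau> i b 0 \<noteq> \<zero>\<^sub>K) ==> b \<in> Units B"
  and delta: "quotient_has_dim K emb' B (\<psi> ` carrier A) m"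
  and socle: "u \<in> carrier B ==> w \<in> carrier B ==>
   (\<And>a. a \<in> nonunits A ==> \<psi> a ** u \<in> \<psi> ` carrier A) ==>
   (\<And>a. a \<in> nonunits A ==> \<psi> a ** w \<in> \<psi> ` carrier A) ==>
   \<exists>x\<in>carrier K. \<exists>y\<in>carrier K. \<exists>z\<in>carrier A. (x \<noteq> \<zero>\<^sub>K \<or> y \<noteq> \<zero>\<^sub>K) \<and>
    (\<forall>i<m. \<forall>k. \<tau> i (emb' x ** u \<oplus> emb' y ** w \<ominus> \<psi> z) k = \<zero>\<^sub>K)"
begin

sublocale \<psi>: ring_hom_cring A B \<psi> using psi by unfold_locales auto

definition W where "W = \<psi> ` carrier A"

lemma W_sub: "x \<in> W ==> x \<in> carrier B" by (auto simp: W_def)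

lemma W_mult: "x \<in> W ==> y \<in> W ==> x ** y \<in> W"
 unfolding W_def using \<psi>.hom_mult S.m_closed by (metis (no_types, lifting) imageE image_eqI)

lemma W_scalar: "c \<in> carrier K ==> emb' c \<in> W" by (auto simp: W_def psi_scalar)

lemma W_ksubspace: "ksubspace K B emb' W" unfolding ksubspace_def
proof (intro conjI ballI)
 show "W \<subseteq> carrier B" using W_sub by blast
 show "\<zero> \<in> W" unfolding W_def by (rule image_eqI[of _ _ "\<zero>\<^sub>A"]) auto
next
 fix x y assume "x \<in> W" "y \<in> W"
 then obtain a b where "a \<in> carrier A" "b \<in> carrier A" "x = \<psi> a" "y = \<psi> b" by (auto simp: W_def)
 thus "x \<oplus> y \<in> W" unfolding W_def by (intro image_eqI[of _ _ "a \<oplus>\<^sub>A b"]) auto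
next
 fix c x assume "c \<in> carrier K" "x \<in> W"
 thus "emb' c ** x \<in> W" using W_mult W_scalar by blast
qed

lemma W_add: "x \<in> W ==> y \<in> W ==> x \<oplus> y \<in> W" using W_ksubspace by (auto simp: ksubspace_def)

lemma W_smult: "c \<in> carrier K ==> x \<in> W ==> emb' c ** x \<in> W" using W_mult W_scalar by blast

lemma W_diff: "x \<in> W ==> y \<in> W ==> x \<ominus> y \<in> W" using B.ksubspace_diff[OF W_ksubspace] .

lemma W_smult_cancel:
 assumes "c \<in> carrier K" "c \<noteq> \<zero>\<^sub>K" "x \<in> carrier B" "emb' c ** x \<in> W"
 shows "x \<in> W"
proof -
 have c: "inv\<^bsub>K\<^esub> c \<in> carrier K" "inv\<^bsub>K\<^esub> c **\<^sub>K c = \<one>\<^sub>K" using assms K.field_Units by auto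
 have "emb' (inv\<^bsub>K\<^esub> c) ** (emb' c ** x) = emb' (inv\<^bsub>K\<^esub> c **\<^sub>K c) ** x" using assms c(1) by (simp add: B.S.m_assoc)
 also have "... = x" using c assms by simp
 finally show ?thesis using W_smult[OF c(1) assms(4)] by simp
qed

lemma tau_zero [simp]: "i < m ==> \<tau> i \<zero> k = \<zero>\<^sub>K" using tau_scalar[of i "\<zero>\<^sub>K" k] by simp

lemma tau_one: "i < m ==> \<tau> i \<one> k = (if k = 0 then \<one>\<^sub>K else \<zero>\<^sub>K)" using tau_scalar[of i "\<one>\<^sub>K" k] by simp

lemma tau_minus: "i < m ==> b \<in> carrier B ==> \<tau> i (\<ominus> b) k = \<ominus>\<^sub>K \<tau> i b k"
 using tau_scalar_mult[of i "\<ominus>\<^sub>K \<one>\<^sub>K" b k] by (simp add: B.S.l_minus R.l_minus)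

lemma tau_diff: "i < m ==> b \<in> carrier B ==> c \<in> carrier B ==> \<tau> i (b \<ominus> c) k = \<tau> i b k \<ominus>\<^sub>K \<tau> i c k"
 by (simp add: a_minus_def tau_add tau_minus)

lemma tau_mult_0: "i < m ==> b \<in> carrier B ==> c \<in> carrier B ==> \<tau> i (b ** c) 0 = \<tau> i b 0 **\<^sub>K \<tau> i c 0"
 by (simp add: tau_mult)

lemma tau_mult_1: "i < m ==> b \<in> carrier B ==> c \<in> carrier B ==>
  \<tau> i (b ** c) (Suc 0) = \<tau> i b 0 **\<^sub>K \<tau> i c (Suc 0) \<oplus>\<^sub>K \<tau> i b (Suc 0) **\<^sub>K \<tau> i c 0"
 by (simp add: tau_mult R.a_comm numeral_eq_Suc atMost_Suc)

lemma tau_finsum: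
 assumes "finite I" "f \<in> I \<rightarrow> carrier B" "i < m"
 shows "\<tau> i (finsum B f I) k = (\<Oplus>\<^sub>K j\<in>I. \<tau> i (f j) k)" using assms(1,2)
proof (induction I rule: finite_induct)
 case (insert j I)
 hence "f j \<in> carrier B" "f \<in> I \<rightarrow> carrier B" by auto
 thus ?case using insert assms(3) by (simp add: B.S.finsum_insert R.finsum_insert tau_add Pi_iff)
qed (use assms in simp)

section \<open>Orders of vanishing and simultaneous approximation\<close>

definition vanish where "vanish i N b \<longleftrightarrow> (\<forall>k<N. \<tau> i b k = \<zero>\<^sub>K)"

lemma vanish_mult:
 assumes "i < m" "b \<in> carrier B" "c \<in> carrier B" "vanish i M b" "vanish i N c"
 shows "vanish i (M + N) (b ** c)" unfolding vanish_def
proof (intro allI impI)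
 fix k assume k: "k < M + N"
 have "(\<Oplus>\<^sub>K j\<in>{..k}. \<tau> i b j **\<^sub>K \<tau> i c (k - j)) = (\<Oplus>\<^sub>K j\<in>{..k}. \<zero>\<^sub>K)"
 proof (intro R.finsum_cong' refl)
  fix j assume "j \<in> {..k}"
  hence "j < M \<or> k - j < N" using k by auto
  thus "\<tau> i b j **\<^sub>K \<tau> i c (k - j) = \<zero>\<^sub>K" using assms by (auto simp: vanish_def)
 qed auto
 thus "\<tau> i (b ** c) k = \<zero>\<^sub>K" using assms by (simp add: tau_mult)
qed

lemma vanish_mono: "vanish i N b ==> M \<le> N ==> vanish i M b" by (auto simp: vanish_def)

lemma vanish_add: "i < m ==> b \<in> carrier B ==> c \<in> carrier B ==> vanish i N b ==> vanish i N c ==> vanish i N (b \<oplus> c)"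
 by (auto simp: vanish_def tau_add)

lemma vanish_diff: "i < m ==> b \<in> carrier B ==> c \<in> carrier B ==> vanish i N b ==> vanish i N c ==> vanish i N (b \<ominus> c)"
 by (auto simp: vanish_def tau_diff)

lemma separate:
 assumes i: "i < m" and "finite S" "S \<subseteq> {..<m} - {i}"
 shows "\<exists>b\<in>carrier B. \<tau> i b 0 \<noteq> \<zero>\<^sub>K \<and> (\<forall>j\<in>S. \<tau> j b 0 = \<zero>\<^sub>K)" using assms(2,3)
proof (induction S rule: finite_induct)
 case empty
 show ?case using i tau_one[OF i, of 0] by (intro bexI[of _ "\<one>"]) auto
next
 case (insert j S)
 then obtain b where b: "b \<in> carrier B" "\<tau> i b 0 \<noteq> \<zero>\<^sub>K" "\<And>j. j \<in> S ==> \<tau> j b 0 = \<zero>\<^sub>K" by auto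
 have j: "j < m" "i \<noteq> j" "\<And>k. k \<in> S ==> k < m" using insert by auto
 obtain c where c: "c \<in> carrier B" "\<tau> i c 0 \<noteq> \<zero>\<^sub>K" "\<tau> j c 0 = \<zero>\<^sub>K" using distinct[OF i j(1,2)] by blast
 have "\<tau> i (b ** c) 0 \<noteq> \<zero>\<^sub>K" using b c i by (simp add: tau_mult_0 K.integral_iff)
 moreover have "\<forall>k\<in>insert j S. \<tau> k (b ** c) 0 = \<zero>\<^sub>K" using b c j by (auto simp: tau_mult_0)
 ultimately show ?case using b c by blast
qed

text \<open>Newton lifting of an idempotent of the product of the residue fields.\<close>

lemma approx_idempotent:
 assumes i: "i < m"
 shows "\<exists>e\<in>carrier B. vanish i N (\<one> \<ominus> e) \<and> (\<forall>j<m. j \<noteq> i --> vanish j N e)"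
proof (induction N)
 case 0
 thus ?case by (auto simp: vanish_def)
next
 case (Suc N)
 show ?case
 \<comment> \<open>Doubling gains nothing at order 0, so the first approximation is a separating
   element, scaled to the value 1 on branch \<open>i\<close>.\<close>
 proof (cases "N = 0")
  case True
  obtain b where b: "b \<in> carrier B" "\<tau> i b 0 \<noteq> \<zero>\<^sub>K" "\<And>j. j < m ==> j \<noteq> i ==> \<tau> j b 0 = \<zero>\<^sub>K"
   using separate[OF i, of "{..<m} - {i}"] by auto
  let ?c = "inv\<^bsub>K\<^esub> (\<tau> i b 0)"
  have c: "?c \<in> carrier K" "?c **\<^sub>K \<tau> i b 0 = \<one>\<^sub>K" using b i K.field_Units by auto
  show ?thesis using True b c i by (intro bexI[of _ "emb' ?c ** b"]) (auto simp: vanish_def tau_diff tau_one tau_scalar_mult)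
 next
  case False
  obtain e where e: "e \<in> carrier B" "vanish i N (\<one> \<ominus> e)" "\<And>j. j < m ==> j \<noteq> i ==> vanish j N e" using Suc by blast
  \<comment> \<open>The new element \<open>e ** e ** ?g\<close> is \<open>3 e^2 - 2 e^3\<close>. It
    is divisible by \<open>e^2\<close>, and 1 minus it equals \<open>(1 - e)^2 (1 + 2 e)\<close>; so
    the order of approximation doubles on every branch.\<close>
  let ?g = "\<one> \<oplus> ((\<one> \<ominus> e) \<oplus> (\<one> \<ominus> e))" and ?h = "\<one> \<oplus> (e \<oplus> e)"
  have v0: "vanish j 0 x" for j x by (simp add: vanish_def)
  have "\<one> \<ominus> e ** e ** ?g = (\<one> \<ominus> e) ** (\<one> \<ominus> e) ** ?h" using e(1) by algebra
  moreover have "vanish i (N + N + 0) ((\<one> \<ominus> e) ** (\<one> \<ominus> e) ** ?h)" using e i v0 by (intro vanish_mult) auto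
  ultimately have 1: "vanish i (Suc N) (\<one> \<ominus> e ** e ** ?g)" using vanish_mono False by (metis One_nat_def add.right_neutral add_Suc_right add_le_mono Suc_leI le_refl neq0_conv)
  have 2: "vanish j (Suc N) (e ** e ** ?g)" if "j < m" "j \<noteq> i" for j
  proof -
   have "vanish j (N + N + 0) (e ** e ** ?g)" using e that v0 by (intro vanish_mult) auto
   thus ?thesis using vanish_mono[of j "N + N + 0" _ "Suc N"] False by simp
  qed
  show ?thesis using 1 2 e(1) by (intro bexI[of _ "e ** e ** ?g"]) auto
 qed
qed

lemma approx_single:
 assumes i: "i < m" and f: "\<And>k. f k \<in> carrier K"
 shows "\<exists>s\<in>carrier B. \<forall>k<N. \<tau> i s k = f k" using f
proof (induction N arbitrary: f)
 case 0
 thus ?case by auto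
next
 case (Suc N f)
 obtain s where s: "s \<in> carrier B" "\<And>k. k < N ==> \<tau> i s k = f (Suc k)" using Suc.IH[of "\<lambda>k. f (Suc k)"] Suc.prems by auto
 let ?s = "emb' (f 0) \<oplus> \<pi> i ** s"
 have "\<tau> i ?s k = f k" if "k < Suc N" for k using that s i Suc.prems by (cases k) (auto simp: tau_add tau_scalar tau_pi_0 tau_pi_Suc)
 thus ?case using s i Suc.prems by (intro bexI[of _ ?s]) auto
qed

text \<open>An element \<open>s\<close> with the right coefficients on branch \<open>i\<close> is
  multiplied by an approximate idempotent \<open>e\<close>: the error \<open>(1 - e) s\<close> is
  invisible on branch \<open>i\<close> up to order \<open>N\<close>, and \<open>e s\<close> is
  invisible on the others.\<close>

lemma approx_branch:
 assumes i: "i < m" and f: "\<And>k. f k \<in> carrier K"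
 shows "\<exists>b\<in>carrier B. \<forall>j<m. \<forall>k<N. \<tau> j b k = (if j = i then f k else \<zero>\<^sub>K)"
proof -
 obtain e where e: "e \<in> carrier B" "vanish i N (\<one> \<ominus> e)" "\<And>j. j < m ==> j \<noteq> i ==> vanish j N e"
  using approx_idempotent[OF i] by blast
 obtain s where s: "s \<in> carrier B" "\<And>k. k < N ==> \<tau> i s k = f k" using approx_single[of i f N, OF i f] by blast
 have v0: "vanish j 0 x" for j x by (simp add: vanish_def)
 have "vanish i (N + 0) ((\<one> \<ominus> e) ** s)" using e s i v0 by (intro vanish_mult) auto
 hence 1: "\<tau> i ((\<one> \<ominus> e) ** s) k = \<zero>\<^sub>K" if "k < N" for k using that by (auto simp: vanish_def)
 have es: "e ** s = s \<ominus> (\<one> \<ominus> e) ** s" using e(1) s(1) by algebra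
 have i': "\<tau> i (e ** s) k = f k" if "k < N" for k
 proof -
  have "\<tau> i (e ** s) k = \<tau> i s k \<ominus>\<^sub>K \<tau> i ((\<one> \<ominus> e) ** s) k"
   by (subst es) (use i e(1) s(1) in "simp add: tau_diff")
  thus ?thesis using 1[OF that] s(2)[OF that] f by (simp add: a_minus_def)
 qed
 have "vanish j (N + 0) (e ** s)" if "j < m" "j \<noteq> i" for j using that e s v0 by (intro vanish_mult) auto
 hence "\<tau> j (e ** s) k = \<zero>\<^sub>K" if "j < m" "j \<noteq> i" "k < N" for j k using that by (auto simp: vanish_def)
 with i' show ?thesis using e(1) s(1) by (intro bexI[of _ "e ** s"]) auto
qed

lemma approx:
 assumes f: "\<And>i k. f i k \<in> carrier K"
 shows "\<exists>b\<in>carrier B. \<forall>i<m. \<forall>k<N. \<tau> i b k = f i k"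
proof -
 have "\<forall>i\<in>{..<m}. \<exists>b. b \<in> carrier B \<and> (\<forall>j<m. \<forall>k<N. \<tau> j b k = (if j = i then f i k else \<zero>\<^sub>K))"
  using approx_branch[of _ "f _" N, OF _ f] by (fastforce simp: Bex_def)
 from bchoice[OF this] obtain b where
  "\<forall>i\<in>{..<m}. b i \<in> carrier B \<and> (\<forall>j<m. \<forall>k<N. \<tau> j (b i) k = (if j = i then f i k else \<zero>\<^sub>K))"
  by blast
 hence b: "\<And>i. i < m ==> b i \<in> carrier B"
  "\<And>i j k. i < m ==> j < m ==> k < N ==> \<tau> j (b i) k = (if j = i then f i k else \<zero>\<^sub>K)" by auto
 have "\<tau> j (finsum B b {..<m}) k = f j k" if "j < m" "k < N" for j k
 proof -
  have "\<tau> j (finsum B b {..<m}) k = (\<Oplus>\<^sub>K i\<in>{..<m}. \<tau> j (b i) k)" using b that by (intro tau_finsum) auto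
  also have "... = (\<Oplus>\<^sub>K i\<in>{..<m}. if j = i then f i k else \<zero>\<^sub>K)" using b that f by (intro R.finsum_cong') auto
  also have "... = f j k" using that f by (intro R.finsum_singleton) auto
  finally show ?thesis .
 qed
 thus ?thesis using b by (intro bexI[of _ "finsum B b {..<m}"] B.S.finsum_closed) auto
qed

text \<open>The filtration of \<open>B\<close> by the order of vanishing on all branches at once.
  \<open>F_Suc_divides\<close> will write its elements as multiples of powers of
  \<open>pp\<close>.\<close>

definition F where "F N = {b \<in> carrier B. \<forall>i<m. vanish i N b}"

lemma F_closed: "b \<in> F N ==> b \<in> carrier B" by (simp add: F_def)

text \<open>A uniformizer common to all branches, normalized to leading coefficient one; by
  \<open>divides_varpi\<close> it generates \<open>F 1\<close>.\<close>

definition pp where "pp = (SOME b. b \<in> carrier B \<and> (\<forall>i<m. \<tau> i b 0 = \<zero>\<^sub>K \<and> \<tau> i b 1 = \<one>\<^sub>K))"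

lemma varpi: "pp \<in> carrier B" "i < m ==> \<tau> i pp 0 = \<zero>\<^sub>K" "i < m ==> \<tau> i pp 1 = \<one>\<^sub>K"
proof -
 have "\<exists>b\<in>carrier B. \<forall>i<m. \<forall>k<2. \<tau> i b k = (if k = 1 then \<one>\<^sub>K else \<zero>\<^sub>K)" by (rule approx) auto
 then obtain b where "b \<in> carrier B" "\<And>i k. i < m ==> k < 2 ==> \<tau> i b k = (if k = 1 then \<one>\<^sub>K else \<zero>\<^sub>K)" by blast
 hence "\<exists>b. b \<in> carrier B \<and> (\<forall>i<m. \<tau> i b 0 = \<zero>\<^sub>K \<and> \<tau> i b 1 = \<one>\<^sub>K)" by (intro exI[of _ b]) auto
 hence *: "pp \<in> carrier B \<and> (\<forall>i<m. \<tau> i pp 0 = \<zero>\<^sub>K \<and> \<tau> i pp 1 = \<one>\<^sub>K)"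
  unfolding pp_def by (rule someI_ex)
 thus "pp \<in> carrier B" "i < m ==> \<tau> i pp 0 = \<zero>\<^sub>K" "i < m ==> \<tau> i pp 1 = \<one>\<^sub>K" by auto
qed

lemma tau_varpi_mult:
 assumes "i < m" "c \<in> carrier B" "vanish i k c"
 shows "\<tau> i (pp ** c) (Suc k) = \<tau> i c k"
proof -
 have "\<tau> i (pp ** c) (Suc k) = (\<Oplus>\<^sub>K j\<in>{..Suc k}. \<tau> i pp j **\<^sub>K \<tau> i c (Suc k - j))"
  using assms varpi by (simp add: tau_mult)
 also have "... = (\<Oplus>\<^sub>K j\<in>{..Suc k}. if 1 = j then \<tau> i c (Suc k - j) else \<zero>\<^sub>K)"
 proof (intro R.finsum_cong' refl)
  fix j assume "j \<in> {..Suc k}"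
  show "\<tau> i pp j **\<^sub>K \<tau> i c (Suc k - j) = (if 1 = j then \<tau> i c (Suc k - j) else \<zero>\<^sub>K)"
  proof (cases "j \<le> 1")
   case True
   thus ?thesis using assms varpi(2,3)[of i] varpi(1) by (cases j) auto
  next
   case False
   hence "Suc k - j < k" using \<open>j \<in> {..Suc k}\<close> by auto
   thus ?thesis using False assms varpi by (auto simp: vanish_def)
  qed
 qed (use assms in auto)
 also have "... = \<tau> i c k" using assms by (subst R.finsum_singleton) auto
 finally show ?thesis .
qed

text \<open>Up to factors that do not vanish on branch \<open>i\<close>, \<open>pp\<close> and
  \<open>\<pi> i\<close> agree: in \<open>s' ** pp = \<pi> i ** c'\<close>, comparing linear terms
  shows that \<open>c'\<close> has nonzero constant term. Multiplying the divisibility by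
  \<open>\<pi> i\<close> with \<open>c'\<close> replaces \<open>\<pi> i\<close> by
  \<open>pp\<close>.\<close>

lemma divides_varpi_local:
 assumes i: "i < m" and b: "b \<in> carrier B" "\<tau> i b 0 = \<zero>\<^sub>K"
 shows "\<exists>s\<in>carrier B. \<exists>c\<in>carrier B. \<tau> i s 0 \<noteq> \<zero>\<^sub>K \<and> s ** b = pp ** c"
proof -
 obtain s c where s: "s \<in> carrier B" "c \<in> carrier B" "\<tau> i s 0 \<noteq> \<zero>\<^sub>K" "s ** b = \<pi> i ** c"
  using local_divides[OF i b] by blast
 obtain s' c' where s': "s' \<in> carrier B" "c' \<in> carrier B" "\<tau> i s' 0 \<noteq> \<zero>\<^sub>K" "s' ** pp = \<pi> i ** c'"
  using local_divides[OF i varpi(1) varpi(2)[OF i]] by blast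
 have "\<tau> i c' 0 = \<tau> i (s' ** pp) 1" unfolding s'(4) using tau_pi_Suc[OF i s'(2), of 0] by simp
 also have "... = \<tau> i s' 0" using i s'(1) varpi(1) varpi(2,3)[OF i] by (simp add: tau_mult_1)
 finally have c'0: "\<tau> i c' 0 \<noteq> \<zero>\<^sub>K" using s' by simp
 have "(c' ** s) ** b = c' ** (\<pi> i ** c)" using s s' b by (simp add: B.S.m_assoc)
 also have "... = (\<pi> i ** c') ** c" using s s' i by (simp add: B.S.m_ac)
 also have "... = pp ** (s' ** c)" unfolding s'(4)[symmetric] using s(1,2) s'(1,2) varpi(1) by (simp add: B.S.m_ac)
 finally have "(c' ** s) ** b = pp ** (s' ** c)" .
 moreover have "\<tau> i (c' ** s) 0 \<noteq> \<zero>\<^sub>K" using i s s' c'0 by (simp add: tau_mult_0 K.integral_iff)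
 ultimately show ?thesis using s s' by (intro bexI[of _ "c' ** s"] bexI[of _ "s' ** c"]) auto
qed

text \<open>The denominators \<open>s i\<close> of the single branches are glued with approximate
  idempotents: \<open>u = \<Sum> e i * s i\<close> has nonzero constant term on every branch and is
  therefore a unit, while \<open>u b\<close> is a multiple of \<open>pp\<close>.\<close>

lemma divides_varpi:
 assumes b: "b \<in> F 1"
 shows "\<exists>c\<in>carrier B. b = pp ** c"
proof -
 have bc: "b \<in> carrier B" using b by (simp add: F_def)
 have b0: "\<tau> i b 0 = \<zero>\<^sub>K" if "i < m" for i using b that by (auto simp: F_def vanish_def)
 have "\<forall>i\<in>{..<m}. \<exists>p. fst p \<in> carrier B \<and> snd p \<in> carrier B \<and> \<tau> i (fst p) 0 \<noteq> \<zero>\<^sub>K \<and> fst p ** b = pp ** snd p"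
  using divides_varpi_local[OF _ bc b0] by fastforce
 from bchoice[OF this] obtain q where
  q: "\<forall>i\<in>{..<m}. fst (q i) \<in> carrier B \<and> snd (q i) \<in> carrier B \<and> \<tau> i (fst (q i)) 0 \<noteq> \<zero>\<^sub>K \<and> fst (q i) ** b = pp ** snd (q i)"
  by blast
 define s where "s i = fst (q i)" for i
 define c where "c i = snd (q i)" for i
 have sc: "\<And>i. i < m ==> s i \<in> carrier B" "\<And>i. i < m ==> c i \<in> carrier B"
  "\<And>i. i < m ==> \<tau> i (s i) 0 \<noteq> \<zero>\<^sub>K" "\<And>i. i < m ==> s i ** b = pp ** c i" using q by (auto simp: s_def c_def)
 have "\<forall>i\<in>{..<m}. \<exists>e. e \<in> carrier B \<and> vanish i 1 (\<one> \<ominus> e) \<and> (\<forall>j<m. j \<noteq> i --> vanish j 1 e)"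
  using approx_idempotent by blast
 from bchoice[OF this] obtain e where
  "\<forall>i\<in>{..<m}. e i \<in> carrier B \<and> vanish i 1 (\<one> \<ominus> e i) \<and> (\<forall>j<m. j \<noteq> i --> vanish j 1 (e i))"
  by blast
 hence e: "\<And>i. i < m ==> e i \<in> carrier B" "\<And>i. i < m ==> vanish i 1 (\<one> \<ominus> e i)"
  "\<And>i j. i < m ==> j < m ==> j \<noteq> i ==> vanish j 1 (e i)" by auto
 have e0: "\<tau> j (e i) 0 = (if j = i then \<one>\<^sub>K else \<zero>\<^sub>K)" if "i < m" "j < m" for i j
  using e(2)[of i] e(3)[of i j] e(1)[of i] that by (auto simp: vanish_def tau_diff tau_one)
 define u where "u = (\<Oplus>i\<in>{..<m}. e i ** s i)"
 have uc: "u \<in> carrier B" unfolding u_def using e sc by (intro B.S.finsum_closed) auto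
 have "\<tau> j u 0 \<noteq> \<zero>\<^sub>K" if j: "j < m" for j
 proof -
  have "\<tau> j u 0 = (\<Oplus>\<^sub>K i\<in>{..<m}. \<tau> j (e i ** s i) 0)" unfolding u_def using e sc j by (intro tau_finsum) auto
  also have "... = (\<Oplus>\<^sub>K i\<in>{..<m}. if j = i then \<tau> i (s i) 0 else \<zero>\<^sub>K)"
   using e sc e0 j by (intro R.finsum_cong') (auto simp: tau_mult_0)
  also have "... = \<tau> j (s j) 0" using sc j by (intro R.finsum_singleton) auto
  finally show ?thesis using sc(3)[OF j] by simp
 qed
 hence "u \<in> Units B" using unitI uc by blast
 hence iu: "inv\<^bsub>B\<^esub> u \<in> carrier B" "inv\<^bsub>B\<^esub> u ** u = \<one>" by auto
 define d where "d = (\<Oplus>i\<in>{..<m}. e i ** c i)"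
 have dc: "d \<in> carrier B" unfolding d_def using e sc by (intro B.S.finsum_closed) auto
 have "u ** b = (\<Oplus>i\<in>{..<m}. (e i ** s i) ** b)" unfolding u_def using e sc bc by (intro B.S.finsum_ldistr) auto
 also have "... = (\<Oplus>i\<in>{..<m}. pp ** (e i ** c i))" using e sc bc varpi(1) by (intro B.S.finsum_cong') (auto simp: B.S.m_assoc B.S.m_lcomm)
 also have "... = pp ** d" unfolding d_def using e sc varpi(1) by (intro B.S.finsum_rdistr[symmetric]) auto
 finally have ub: "u ** b = pp ** d" .
 have "b = inv\<^bsub>B\<^esub> u ** (u ** b)" using iu uc bc by (simp add: B.S.m_assoc[symmetric])
 also have "... = pp ** (inv\<^bsub>B\<^esub> u ** d)" unfolding ub using iu dc varpi(1) by (simp add: B.S.m_lcomm)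
 finally show ?thesis using iu dc by blast
qed

lemma F_Suc_divides:
 assumes b: "b \<in> F (Suc N)"
 shows "\<exists>c\<in>F N. b = pp ** c"
proof -
 have "b \<in> F 1" using b vanish_mono[of _ "Suc N" b 1] by (auto simp: F_def)
 then obtain c where c: "c \<in> carrier B" "b = pp ** c" using divides_varpi by blast
 have "vanish i k c" if "i < m" "k \<le> N" for i k using that(2)
 proof (induction k)
  case (Suc k)
  hence "\<tau> i c k = \<tau> i b (Suc k)" using tau_varpi_mult[OF that(1) c(1)] c(2) by simp
  also have "... = \<zero>\<^sub>K" using b Suc.prems that(1) by (auto simp: F_def vanish_def)
  finally show ?case using Suc less_Suc_eq by (auto simp: vanish_def)
 qed (simp add: vanish_def)
 thus ?thesis using c by (auto simp: F_def)
qed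

end

section \<open>The hyperplane of linear terms\<close>

context curve_singularity
begin

lemma tau_psi_0:
 assumes "a \<in> carrier A" "x \<in> carrier K" "a \<ominus>\<^sub>A emb x \<in> nonunits A" "i < m"
 shows "\<tau> i (\<psi> a) 0 = x"
proof -
 have "\<psi> (a \<ominus>\<^sub>A emb x) = \<psi> a \<ominus> emb' x" using assms by (simp add: a_minus_def psi_scalar)
 hence "\<tau> i (\<psi> a) 0 \<ominus>\<^sub>K \<tau> i (emb' x) 0 = \<zero>\<^sub>K" using tau_nonunit[OF assms(4,3)] assms by (simp add: tau_diff)
 thus ?thesis using assms by (simp add: tau_scalar)
qed

lemma tau_psi_eq:
 assumes "a \<in> carrier A" "i < m" "j < m"
 shows "\<tau> i (\<psi> a) 0 = \<tau> j (\<psi> a) 0" using residue[OF assms(1)] tau_psi_0 assms by blast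

lemma W_tau_eq: "x \<in> W ==> i < m ==> j < m ==> \<tau> i x 0 = \<tau> j x 0" using tau_psi_eq by (auto simp: W_def)

lemma psi_nonunit_in_F1: "a \<in> nonunits A ==> \<psi> a \<in> F (Suc 0)" using tau_nonunit nonunits_closed by (auto simp: F_def vanish_def)

lemma F1_iff: "b \<in> F (Suc 0) \<longleftrightarrow> b \<in> carrier B \<and> (\<forall>i<m. \<tau> i b 0 = \<zero>\<^sub>K)"
 by (auto simp: F_def vanish_def)

lemma F2_iff: "b \<in> F 2 \<longleftrightarrow> b \<in> carrier B \<and> (\<forall>i<m. \<tau> i b 0 = \<zero>\<^sub>K \<and> \<tau> i b (Suc 0) = \<zero>\<^sub>K)"
 by (auto simp: F_def vanish_def numeral_2_eq_2 less_Suc_eq)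

lemma W_F1:
 assumes "b \<in> W" "b \<in> F (Suc 0)"
 shows "\<exists>a\<in>nonunits A. b = \<psi> a"
proof -
 obtain a where a: "a \<in> carrier A" "b = \<psi> a" using assms by (auto simp: W_def)
 obtain x where x: "x \<in> carrier K" "a \<ominus>\<^sub>A emb x \<in> nonunits A" using residue[OF a(1)] by blast
 have "x = \<zero>\<^sub>K" using tau_psi_0[OF a(1) x m_pos] assms(2) m_pos a(2) by (simp add: F1_iff)
 thus ?thesis using x a by (auto simp: a_minus_def)
qed

lemma F_add: "x \<in> F N ==> y \<in> F N ==> x \<oplus> y \<in> F N" by (auto simp: F_def vanish_add)

lemma F_diff: "x \<in> F N ==> y \<in> F N ==> x \<ominus> y \<in> F N" by (auto simp: F_def vanish_diff)

lemma F_mult: "x \<in> F N ==> y \<in> carrier B ==> x ** y \<in> F N" using vanish_mult[of _ x y N 0] by (auto simp: F_def) (simp add: vanish_def)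

lemma F_smult: "x \<in> carrier K ==> y \<in> F N ==> emb' x ** y \<in> F N" using F_mult[of y N "emb' x"] F_closed[of y N] by (simp add: B.S.m_comm)

text \<open>The idempotents of the product of the residue fields, lifted with vanishing linear
  terms. Multiplying an element of \<open>F 1\<close> by \<open>idem i\<close> therefore keeps its
  linear term on branch \<open>i\<close> and removes it on all others.\<close>

definition idem where
 "idem = (SOME e. \<forall>i<m. e i \<in> carrier B \<and> (\<forall>j<m. \<tau> j (e i) 0 = (if j = i then \<one>\<^sub>K else \<zero>\<^sub>K) \<and> \<tau> j (e i) 1 = \<zero>\<^sub>K))"

lemma idem:
 assumes "i < m"
 shows "idem i \<in> carrier B" "j < m ==> \<tau> j (idem i) 0 = (if j = i then \<one>\<^sub>K else \<zero>\<^sub>K)"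
  "j < m ==> \<tau> j (idem i) (Suc 0) = \<zero>\<^sub>K"
proof -
 let ?P = "\<lambda>i b. b \<in> carrier B \<and> (\<forall>j<m. \<tau> j b 0 = (if j = i then \<one>\<^sub>K else \<zero>\<^sub>K) \<and> \<tau> j b 1 = \<zero>\<^sub>K)"
 have "\<exists>b. ?P i b" if i: "i < m" for i
 proof -
  obtain b where "b \<in> carrier B" "\<forall>j<m. \<forall>k<2. \<tau> j b k = (if j = i then if k = 0 then \<one>\<^sub>K else \<zero>\<^sub>K else \<zero>\<^sub>K)"
   using approx_branch[OF i, of "\<lambda>k. if k = 0 then \<one>\<^sub>K else \<zero>\<^sub>K" 2] by fastforce
  thus ?thesis by (intro exI[of _ b]) auto
 qed
 hence "\<forall>i. \<exists>b. i < m --> ?P i b" by blast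
 hence "\<exists>e. \<forall>i. i < m --> ?P i (e i)" by (rule choice)
 hence "\<forall>i<m. ?P i (idem i)" unfolding idem_def by (rule someI_ex)
 with assms show "idem i \<in> carrier B" "j < m ==> \<tau> j (idem i) 0 = (if j = i then \<one>\<^sub>K else \<zero>\<^sub>K)"
  "j < m ==> \<tau> j (idem i) (Suc 0) = \<zero>\<^sub>K" by auto
qed

lemma delta_basis:
 "\<exists>b. b \<in> {..<m} \<rightarrow> carrier B \<and> spans_mod K B emb' W {..<m} b \<and>
  (\<forall>c\<in>{..<m} \<rightarrow> carrier K. B.lincomb {..<m} c b \<in> W --> (\<forall>i<m. c i = \<zero>\<^sub>K))"
proof -
 obtain b where b: "b \<in> {..<m} \<rightarrow> carrier B"
  "\<forall>x\<in>carrier B. \<exists>!c. c \<in> {..<m} \<rightarrow>\<^sub>E carrier K \<and> x \<ominus> B.lincomb {..<m} c b \<in> W"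
  using delta unfolding quotient_has_dim_def W_def by blast
 have "spans_mod K B emb' W {..<m} b" unfolding spans_mod_def using b by (fastforce simp: PiE_def)
 moreover have "c i = \<zero>\<^sub>K" if c: "c \<in> {..<m} \<rightarrow> carrier K" "B.lincomb {..<m} c b \<in> W" and i: "i < m" for c i
 proof -
  let ?c = "restrict c {..<m}" and ?z = "\<lambda>i\<in>{..<m}. \<zero>\<^sub>K"
  have "B.lincomb {..<m} ?c b = B.lincomb {..<m} c b" using b(1) c(1) by (intro B.S.finsum_cong') (auto simp: Pi_iff)
  hence "\<zero> \<ominus> B.lincomb {..<m} ?c b \<in> W" using W_diff c(2) W_ksubspace by (auto simp: ksubspace_def)
  moreover have "B.lincomb {..<m} ?z b = (\<Oplus>i\<in>{..<m}. \<zero>)" using b(1) by (intro B.S.finsum_cong') (auto simp: Pi_iff)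
  hence "\<zero> \<ominus> B.lincomb {..<m} ?z b \<in> W" using W_ksubspace by (simp add: ksubspace_def a_minus_def)
  moreover have "?c \<in> {..<m} \<rightarrow>\<^sub>E carrier K" "?z \<in> {..<m} \<rightarrow>\<^sub>E carrier K" using c(1) by auto
  ultimately have "?c = ?z" using b(2) B.S.zero_closed by blast
  hence "?c i = ?z i" by (rule fun_cong)
  thus ?thesis using i by simp
 qed
 ultimately show ?thesis using b(1) by blast
qed

text \<open>The quotient of the Jacobson radical \<open>F 1\<close> by the maximal ideal of \<open>A\<close> has
 dimension one: the other \<open>m - 1\<close> dimensions of \<open>B/A\<close> come from the residue fields.\<close>

lemma F1_pair_dependent:
 assumes u: "u \<in> F (Suc 0)" "w \<in> F (Suc 0)"
 shows "\<exists>x\<in>carrier K. \<exists>y\<in>carrier K. (x \<noteq> \<zero>\<^sub>K \<or> y \<noteq> \<zero>\<^sub>K) \<and> emb' x ** u \<oplus> emb' y ** w \<in> W"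
proof -
 obtain b where b: "spans_mod K B emb' W {..<m} b" using delta_basis by blast
 define n where "n = m - 1"
 have n: "Suc n = m" "n < m" using m_pos by (auto simp: n_def)
 \<comment> \<open>The idempotents of all branches but the last, together with \<open>u\<close> and
   \<open>w\<close>, are \<open>m + 1\<close> elements, one more than the dimension of
   \<open>B/W\<close>. In a relation modulo \<open>W\<close> the idempotents drop out, because an
   element of \<open>W\<close> has equal constant terms on all branches and the one on the last
   branch is zero.\<close>
 define y where "y k = (if k < n then idem k else if k = n then u else w)" for k
 have yc: "y k \<in> carrier B" for k using idem(1)[of k] u n by (auto simp: y_def F_closed)
 obtain c where c: "c \<in> {..<Suc m} \<rightarrow> carrier K" "\<exists>j\<in>{..<Suc m}. c j \<noteq> \<zero>\<^sub>K" "B.lincomb {..<Suc m} c y \<in> W"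
  using B.quotient_dependence[OF W_ksubspace b, of "{..<Suc m}" y] yc by auto
 have cK: "c k \<in> carrier K" if "k < Suc m" for k using c(1) that by auto
 define L where "L = B.lincomb {..<Suc m} c y"
 have tL: "\<tau> i L 0 = (if i < n then c i else \<zero>\<^sub>K)" if i: "i < m" for i
 proof -
  have "\<tau> i L 0 = (\<Oplus>\<^sub>K j\<in>{..<Suc m}. \<tau> i (emb' (c j) ** y j) 0)" unfolding L_def using cK yc i by (intro tau_finsum) auto
  also have "... = (\<Oplus>\<^sub>K j\<in>{..<Suc m}. if i = j then (if i < n then c i else \<zero>\<^sub>K) else \<zero>\<^sub>K)"
  proof (intro R.finsum_cong' refl)
   fix j assume j: "j \<in> {..<Suc m}"
   have "\<tau> i (emb' (c j) ** y j) 0 = c j **\<^sub>K \<tau> i (y j) 0" using j cK yc i by (simp add: tau_scalar_mult)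
   moreover have "\<tau> i (y j) 0 = (if i = j \<and> i < n then \<one>\<^sub>K else \<zero>\<^sub>K)"
   proof -
    have u': "\<tau> i u 0 = \<zero>\<^sub>K" "\<tau> i w 0 = \<zero>\<^sub>K" using u i by (auto simp: F1_iff)
    show ?thesis
    proof (cases "j < n")
     case True
     thus ?thesis using idem(2)[of j i] i n by (auto simp: y_def)
    next
     case False
     thus ?thesis using u' by (auto simp: y_def)
    qed
   qed
   ultimately show "\<tau> i (emb' (c j) ** y j) 0 = (if i = j then (if i < n then c i else \<zero>\<^sub>K) else \<zero>\<^sub>K)" using cK j by auto
  qed (use cK i in auto)
  also have "... = (if i < n then c i else \<zero>\<^sub>K)" using cK i by (intro R.finsum_singleton) auto
  finally show ?thesis .
 qed
 have c0: "c i = \<zero>\<^sub>K" if "i < n" for i using W_tau_eq[OF c(3), of i n] tL[of i] tL[of n] that n by (simp add: L_def)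
 have "{..<Suc m} = insert n (insert m {..<n})" using n by auto
 hence "L = emb' (c n) ** y n \<oplus> (emb' (c m) ** y m \<oplus> B.lincomb {..<n} c y)"
  unfolding L_def using n cK yc by (simp add: B.S.finsum_insert Pi_iff)
 also have "B.lincomb {..<n} c y = (\<Oplus>i\<in>{..<n}. \<zero>)" using c0 yc by (intro B.S.finsum_cong') auto
 finally have "L = emb' (c n) ** u \<oplus> emb' (c m) ** w" using n cK u F_closed by (simp add: y_def)
 moreover have "c n \<noteq> \<zero>\<^sub>K \<or> c m \<noteq> \<zero>\<^sub>K"
 proof -
  obtain j where "j < Suc m" "c j \<noteq> \<zero>\<^sub>K" using c(2) by auto
  hence "j = n \<or> j = m" using c0[of j] n by (cases "j < n") auto
  thus ?thesis using \<open>c j \<noteq> \<zero>\<^sub>K \<close> by auto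
 qed
 ultimately show ?thesis using c(3) cK[of n] cK[of m] n unfolding L_def by auto
qed

text \<open>If \<open>F 1\<close> were contained in \<open>W\<close>, an element of \<open>B\<close>
  would be determined modulo \<open>W\<close> by its constant terms up to a common scalar. The
  \<open>m - 1\<close> idempotents would then span \<open>B\<close> modulo \<open>W\<close>, too few
  for dimension \<open>m\<close>.\<close>

lemma F1_not_subset_W: "\<exists>u\<in>F (Suc 0). u \<notin> W"
proof (rule ccontr)
 assume "\<not> (\<exists>u\<in>F (Suc 0). u \<notin> W)"
 hence F1W: "\<And>u. u \<in> F (Suc 0) ==> u \<in> W" by blast
 define n where "n = m - 1"
 have n: "Suc n = m" "n < m" using m_pos by (auto simp: n_def)
 obtain b where b: "b \<in> {..<m} \<rightarrow> carrier B" "spans_mod K B emb' W {..<m} b"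
  "\<forall>c\<in>{..<m} \<rightarrow> carrier K. B.lincomb {..<m} c b \<in> W --> (\<forall>i<m. c i = \<zero>\<^sub>K)" using delta_basis by blast
 have sp: "spans_mod K B emb' W {..<n} idem" unfolding spans_mod_def
 proof (intro conjI ballI)
  show "idem \<in> {..<n} \<rightarrow> carrier B" using idem n by auto
 next
  fix x assume x: "x \<in> carrier B"
  let ?t = "\<lambda>i. \<tau> i x 0"
  \<comment> \<open>The last branch has no idempotent in the family. Its constant term is matched by
    a scalar, which lies in \<open>W\<close>, and the idempotents correct the constant terms of the
    other branches.\<close>
  define l where "l = ?t n"
  have l: "l \<in> carrier K" using x n by (simp add: l_def)
  define S where "S = B.lincomb {..<n} (\<lambda>i. ?t i \<ominus>\<^sub>K l) idem"
  have S: "S \<in> carrier B" unfolding S_def using idem x l n by (intro B.lincomb_closed) auto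
  define y where "y = x \<ominus> S"
  have y: "y \<in> carrier B" using x S by (simp add: y_def)
  have tS: "\<tau> j S 0 = ?t j \<ominus>\<^sub>K l" if j: "j < m" for j
  proof -
   have "\<tau> j S 0 = (\<Oplus>\<^sub>K i\<in>{..<n}. \<tau> j (emb' (?t i \<ominus>\<^sub>K l) ** idem i) 0)"
    unfolding S_def using idem x l n j by (intro tau_finsum) auto
   also have "... = (\<Oplus>\<^sub>K i\<in>{..<n}. if j = i then ?t i \<ominus>\<^sub>K l else \<zero>\<^sub>K)"
   proof (intro R.finsum_cong' refl)
    fix i assume i: "i \<in> {..<n}"
    hence i: "i < m" using n by auto
    have tl: "?t i \<ominus>\<^sub>K l \<in> carrier K" using x l i by simp
    show "\<tau> j (emb' (?t i \<ominus>\<^sub>K l) ** idem i) 0 = (if j = i then ?t i \<ominus>\<^sub>K l else \<zero>\<^sub>K)"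
     using tau_scalar_mult[OF j tl idem(1)[OF i], of 0] idem(2)[OF i j] tl by auto
   qed (use x l n in auto)
   also have "... = ?t j \<ominus>\<^sub>K l"
   proof (cases "j < n")
    case True
    thus ?thesis using x l n by (intro R.finsum_singleton) auto
   next
    case False
    hence "j = n" using j n by simp
    have "(\<Oplus>\<^sub>K i\<in>{..<n}. if j = i then ?t i \<ominus>\<^sub>K l else \<zero>\<^sub>K) = (\<Oplus>\<^sub>K i\<in>{..<n}. \<zero>\<^sub>K)"
     using False by (intro R.finsum_cong') auto
    moreover have "?t j \<ominus>\<^sub>K l = \<zero>\<^sub>K" using l \<open>j = n\<close> R.r_right_minus_eq[of l l] by (simp add: l_def)
    ultimately show ?thesis by simp
   qed
   finally show ?thesis .
  qed
  have "y \<ominus> emb' l \<in> F (Suc 0)"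
  proof -
   have "\<tau> j x 0 \<ominus>\<^sub>K (\<tau> j x 0 \<ominus>\<^sub>K l) \<ominus>\<^sub>K l = \<zero>\<^sub>K" if "j < m" for j
    using tau_closed[OF that x, of 0] l by algebra
   thus ?thesis using x S y l tS by (simp add: F1_iff tau_diff y_def tau_scalar)
  qed
  hence "y \<ominus> emb' l \<oplus> emb' l \<in> W" using F1W W_scalar[OF l] W_add by blast
  also have "y \<ominus> emb' l \<oplus> emb' l = y" using y l by (simp add: a_minus_def B.S.a_assoc B.S.l_neg)
  finally have "x \<ominus> S \<in> W" by (simp add: y_def)
  thus "\<exists>c\<in>{..<n} \<rightarrow> carrier K. x \<ominus> B.lincomb {..<n} c idem \<in> W"
   using x l n unfolding S_def by (intro bexI[of _ "\<lambda>i. ?t i \<ominus>\<^sub>K l"]) auto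
 qed auto
 have "\<exists>c\<in>{..<m} \<rightarrow> carrier K. (\<exists>j\<in>{..<m}. c j \<noteq> \<zero>\<^sub>K) \<and> B.lincomb {..<m} c b \<in> W"
  by (rule B.quotient_dependence[OF W_ksubspace sp _ _ b(1)]) (simp_all add: n(2))
 then obtain c j where c: "c \<in> {..<m} \<rightarrow> carrier K" "B.lincomb {..<m} c b \<in> W" "j < m" "c j \<noteq> \<zero>\<^sub>K" by blast
 thus False using b(3) c by blast
qed

definition u0 where "u0 = (SOME u. u \<in> F (Suc 0) \<and> u \<notin> W)"

lemma u0: "u0 \<in> F (Suc 0)" "u0 \<notin> W" "u0 \<in> carrier B"
proof -
 have "\<exists>u. u \<in> F (Suc 0) \<and> u \<notin> W" using F1_not_subset_W by blast
 hence "u0 \<in> F (Suc 0) \<and> u0 \<notin> W" unfolding u0_def by (rule someI_ex)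
 thus "u0 \<in> F (Suc 0)" "u0 \<notin> W" "u0 \<in> carrier B" using F_closed by auto
qed

lemma F1_coordinate:
 assumes w: "w \<in> F (Suc 0)"
 shows "\<exists>x\<in>carrier K. w \<ominus> emb' x ** u0 \<in> W"
proof -
 obtain x y where xy: "x \<in> carrier K" "y \<in> carrier K" "x \<noteq> \<zero>\<^sub>K \<or> y \<noteq> \<zero>\<^sub>K"
  "emb' x ** u0 \<oplus> emb' y ** w \<in> W" using F1_pair_dependent[OF u0(1) w] by blast
 have wc: "w \<in> carrier B" using w F_closed by auto
 have y: "y \<noteq> \<zero>\<^sub>K"
 proof
  assume y: "y = \<zero>\<^sub>K"
  hence "emb' x ** u0 \<in> W" using xy wc u0 by simp
  thus False using W_smult_cancel[OF xy(1) _ u0(3)] xy y u0 by simp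
 qed
 define v where "v = inv\<^bsub>K\<^esub> y"
 have v: "v \<in> carrier K" "v **\<^sub>K y = \<one>\<^sub>K" using y xy K.field_Units by (auto simp: v_def)
 have c: "emb' v \<in> carrier B" "emb' x \<in> carrier B" "emb' y \<in> carrier B" using v xy by auto
 have vy: "emb' v ** emb' y = \<one>" using v xy B.hom_mult[of v y] by simp
 have "emb' v ** (emb' x ** u0 \<oplus> emb' y ** w) = (emb' v ** emb' y) ** w \<ominus> (\<ominus> (emb' v ** emb' x)) ** u0"
  using c u0(3) wc by algebra
 also have "... = w \<ominus> emb' (\<ominus>\<^sub>K (v **\<^sub>K x)) ** u0" using vy wc v xy by simp
 finally have "w \<ominus> emb' (\<ominus>\<^sub>K (v **\<^sub>K x)) ** u0 \<in> W" using W_smult[OF v(1) xy(4)] by simp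
 thus ?thesis using v xy by blast
qed

lemma scalar_u0_W: "x \<in> carrier K ==> emb' x ** u0 \<in> W ==> x = \<zero>\<^sub>K" using W_smult_cancel[OF _ _ u0(3)] u0(2) by blast

lemma F1_decompose:
 assumes "w \<in> F (Suc 0)"
 obtains x a where "x \<in> carrier K" "a \<in> nonunits A" "w = emb' x ** u0 \<oplus> \<psi> a"
proof -
 obtain x where x: "x \<in> carrier K" "w \<ominus> emb' x ** u0 \<in> W" using F1_coordinate[OF assms] by blast
 have "w \<ominus> emb' x ** u0 \<in> F (Suc 0)" using F_diff[OF assms F_smult[OF x(1) u0(1)]] .
 then obtain a where a: "a \<in> nonunits A" "w \<ominus> emb' x ** u0 = \<psi> a" using W_F1[OF x(2)] by blast
 have "w = \<psi> a \<oplus> emb' x ** u0" using B.S.diff_eq_imp_eq_add[OF a(2)] F_closed[OF assms] x u0 by simp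
 thus ?thesis using that x(1) a(1) u0(3) nonunits_closed[OF a(1)] by (simp add: B.S.a_comm)
qed

text \<open>Write \<open>\<psi> a ** u0\<close> as \<open>x u0\<close> modulo \<open>W\<close>. If
  \<open>x\<close> were nonzero, \<open>a - x\<close> would be a unit of \<open>A\<close> that
  multiplies \<open>u0\<close> into \<open>W\<close>; as its inverse preserves \<open>W\<close>,
  this would put \<open>u0\<close> itself in \<open>W\<close>.\<close>

lemma nonunit_mult_u0:
 assumes a: "a \<in> nonunits A"
 shows "\<psi> a ** u0 \<in> W"
proof -
 have ac: "a \<in> carrier A" using a nonunits_closed by auto
 have "\<psi> a ** u0 \<in> F (Suc 0)" using F_mult[OF psi_nonunit_in_F1[OF a] u0(3)] by simp
 then obtain x where x: "x \<in> carrier K" "\<psi> a ** u0 \<ominus> emb' x ** u0 \<in> W" using F1_coordinate by blast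
 have "x = \<zero>\<^sub>K"
 proof (rule ccontr)
  assume x0: "x \<noteq> \<zero>\<^sub>K"
  define d where "d = emb (\<ominus>\<^sub>K x) \<oplus>\<^sub>A a"
  have "d \<in> Units A" unfolding d_def using scalar_unit[of "\<ominus>\<^sub>K x"] x x0 a by (intro unit_add_nonunit) auto
  hence d: "d \<in> carrier A" "inv\<^bsub>A\<^esub> d \<in> carrier A" "inv\<^bsub>A\<^esub> d **\<^sub>A d = \<one>\<^sub>A" by auto
  have c: "emb' x \<in> carrier B" "\<psi> a \<in> carrier B" using x ac by auto
  have "\<psi> d = \<ominus> emb' x \<oplus> \<psi> a" using x ac by (simp add: d_def psi_scalar)
  hence "\<psi> d ** u0 = \<psi> a ** u0 \<ominus> emb' x ** u0" using c u0(3) by algebra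
  hence "\<psi> (inv\<^bsub>A\<^esub> d) ** (\<psi> d ** u0) \<in> W" using W_mult[of "\<psi> (inv\<^bsub>A\<^esub> d)"] x(2) d(2) by (simp add: W_def)
  also have "\<psi> (inv\<^bsub>A\<^esub> d) ** (\<psi> d ** u0) = \<psi> (inv\<^bsub>A\<^esub> d **\<^sub>A d) ** u0"
   using \<psi>.hom_mult[OF d(2,1)] d(1,2) u0(3) by (simp add: B.S.m_assoc)
  also have "... = u0" using d u0(3) by simp
  finally show False using u0 by simp
 qed
 thus ?thesis using x ac u0 by (simp add: a_minus_def)
qed

lemma nonunit_mult_F1:
 assumes a: "a \<in> nonunits A" and w: "w \<in> F (Suc 0)"
 shows "\<psi> a ** w \<in> W"
proof -
 have ac: "a \<in> carrier A" using a nonunits_closed by auto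
 obtain x b where x: "x \<in> carrier K" "b \<in> nonunits A" "w = emb' x ** u0 \<oplus> \<psi> b" using F1_decompose[OF w] by blast
 have bc: "b \<in> carrier A" using x nonunits_closed by auto
 have c: "emb' x \<in> carrier B" "\<psi> a \<in> carrier B" "\<psi> b \<in> carrier B" using x ac bc by auto
 have "\<psi> a ** w = emb' x ** (\<psi> a ** u0) \<oplus> \<psi> a ** \<psi> b" unfolding x(3) using c u0(3) by algebra
 moreover have "\<psi> a \<in> W" "\<psi> b \<in> W" using ac bc by (auto simp: W_def)
 ultimately show ?thesis using W_add W_smult[OF x(1) nonunit_mult_u0[OF a]] W_mult by simp
qed

text \<open>If \<open>u0 ** u0 = x u0 + \<psi> b\<close> with \<open>x\<close> nonzero, then
  \<open>u0 - x\<close> is a unit of \<open>B\<close> that multiplies \<open>u0\<close> to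
  \<open>\<psi> b\<close>. Its inverse is only known to lie in \<open>B\<close>; but it has the same
  constant term on every branch, so it is a scalar plus an element of \<open>F 1\<close>, and
  \<open>nonunit_mult_F1\<close> keeps the product in \<open>W\<close>.\<close>

lemma u0_square: "u0 ** u0 \<in> W"
proof -
 obtain x b where x: "x \<in> carrier K" "b \<in> nonunits A" "u0 ** u0 = emb' x ** u0 \<oplus> \<psi> b"
  using F1_decompose[OF F_mult[OF u0(1,3)]] by blast
 have bc: "b \<in> carrier A" using x nonunits_closed by auto
 have bW: "\<psi> b \<in> W" using bc by (auto simp: W_def)
 have "x = \<zero>\<^sub>K"
 proof (rule ccontr)
  assume x0: "x \<noteq> \<zero>\<^sub>K"
  define d where "d = u0 \<ominus> emb' x"
  have dc: "d \<in> carrier B" using u0 x by (simp add: d_def)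
  have td: "\<tau> i d 0 = \<ominus>\<^sub>K x" if "i < m" for i
  proof -
   have "\<tau> i u0 0 = \<zero>\<^sub>K" using u0(1) that by (auto simp: F1_iff)
   hence "\<tau> i d 0 = \<zero>\<^sub>K \<ominus>\<^sub>K x" using that u0(3) x(1) by (simp add: d_def tau_diff tau_scalar)
   thus ?thesis using x(1) by (simp add: a_minus_def)
  qed
  have "d \<in> Units B" using unitI[OF dc] td x x0 by simp
  hence d: "inv\<^bsub>B\<^esub> d \<in> carrier B" "inv\<^bsub>B\<^esub> d ** d = \<one>" by auto
  define v where "v = inv\<^bsub>B\<^esub> d"
  define y where "y = inv\<^bsub>K\<^esub> (\<ominus>\<^sub>K x)"
  have y: "y \<in> carrier K" "y **\<^sub>K (\<ominus>\<^sub>K x) = \<one>\<^sub>K" using x x0 K.field_Units by (auto simp: y_def)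
  have vc: "v \<in> carrier B" using d by (simp add: v_def)
  have tv: "\<tau> i v 0 = y" if i: "i < m" for i
  proof -
   have "\<tau> i (v ** d) 0 = \<one>\<^sub>K" using d i by (simp add: v_def tau_one)
   hence "\<tau> i v 0 **\<^sub>K (\<ominus>\<^sub>K x) = y **\<^sub>K (\<ominus>\<^sub>K x)" using y td i vc dc by (simp add: tau_mult_0)
   moreover have "\<ominus>\<^sub>K x \<noteq> \<zero>\<^sub>K" "\<ominus>\<^sub>K x \<in> carrier K" using x(1) x0 by auto
   ultimately show ?thesis using K.m_rcancel y(1) tau_closed[OF i vc] by blast
  qed
  define j where "j = v \<ominus> emb' y"
  have j: "j \<in> F (Suc 0)" using vc y tv by (simp add: j_def F1_iff tau_diff tau_scalar)
  have c: "emb' x \<in> carrier B" "emb' y \<in> carrier B" "\<psi> b \<in> carrier B" using x y bc by auto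
  have "u0 ** d = u0 ** u0 \<ominus> emb' x ** u0" unfolding d_def using c u0(3) by algebra
  also have "... = \<psi> b" unfolding x(3) using B.S.add_diff_cancel c u0(3) by simp
  finally have ud: "u0 ** d = \<psi> b" .
  have "u0 = v ** (u0 ** d)" using d u0(3) dc vc B.S.m_lcomm[OF vc u0(3) dc] by (simp add: v_def)
  also have "... = emb' y ** \<psi> b \<oplus> \<psi> b ** j" unfolding ud j_def using vc c by algebra
  also have "... \<in> W" using W_add[OF W_smult[OF y(1) bW] nonunit_mult_F1[OF x(2) j]] .
  finally show False using u0 by simp
 qed
 thus ?thesis using x bW W_sub[OF bW] u0(3) by simp
qed

lemma F1_mult_F1:
 assumes "v \<in> F (Suc 0)" "w \<in> F (Suc 0)"
 shows "v ** w \<in> W"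
proof -
 obtain x a where x: "x \<in> carrier K" "a \<in> nonunits A" "v = emb' x ** u0 \<oplus> \<psi> a" using F1_decompose[OF assms(1)] by blast
 obtain y b where y: "y \<in> carrier K" "b \<in> nonunits A" "w = emb' y ** u0 \<oplus> \<psi> b" using F1_decompose[OF assms(2)] by blast
 have ac: "a \<in> carrier A" "b \<in> carrier A" using x y nonunits_closed by auto
 have c: "emb' x \<in> carrier B" "emb' y \<in> carrier B" "\<psi> a \<in> carrier B" "\<psi> b \<in> carrier B" "w \<in> carrier B"
  using x y ac F_closed[OF assms(2)] by auto
 have "v ** w = emb' x ** (u0 ** w) \<oplus> \<psi> a ** w" unfolding x(3) using c u0(3) by algebra
 moreover have "u0 ** w = emb' y ** (u0 ** u0) \<oplus> \<psi> b ** u0" unfolding y(3) using c u0(3) by algebra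
 moreover have "u0 ** w \<in> W" using W_add[OF W_smult[OF y(1) u0_square] nonunit_mult_u0[OF y(2)]] calculation(2) by simp
 ultimately show ?thesis using W_add[OF W_smult[OF x(1)] nonunit_mult_F1[OF x(2) assms(2)]] by simp
qed

text \<open>An element of order two is \<open>pp\<close> times an element of \<open>F 1\<close>,
  hence a product of two elements of \<open>F 1\<close>. So membership in \<open>W\<close> depends
  on constant and linear terms alone.\<close>

lemma F2_subset_W: "b \<in> F 2 ==> b \<in> W"
proof -
 assume "b \<in> F 2"
 then obtain c where c: "c \<in> F (Suc 0)" "b = pp ** c" using F_Suc_divides[of b 1] by (auto simp: numeral_2_eq_2)
 moreover have "pp \<in> F (Suc 0)" using varpi by (simp add: F1_iff)
 ultimately show ?thesis using F1_mult_F1 by simp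
qed

lemma F_Suc_subset: "b \<in> F (Suc N) ==> b \<in> F N" using vanish_mono[of _ "Suc N" b N] by (auto simp: F_def)

definition lin where "lin = (SOME u. \<forall>i<m. u i \<in> F (Suc 0) \<and> (\<forall>j<m. \<tau> j (u i) (Suc 0) = (if j = i then \<one>\<^sub>K else \<zero>\<^sub>K)))"

lemma lin:
 assumes "i < m"
 shows "lin i \<in> F (Suc 0)" "j < m ==> \<tau> j (lin i) (Suc 0) = (if j = i then \<one>\<^sub>K else \<zero>\<^sub>K)"
proof -
 let ?P = "\<lambda>i b. b \<in> F (Suc 0) \<and> (\<forall>j<m. \<tau> j b (Suc 0) = (if j = i then \<one>\<^sub>K else \<zero>\<^sub>K))"
 have "\<exists>b. ?P i b" if i: "i < m" for i
 proof -
  obtain b where "b \<in> carrier B" "\<forall>j<m. \<forall>k<2. \<tau> j b k = (if j = i then if k = 1 then \<one>\<^sub>K else \<zero>\<^sub>K else \<zero>\<^sub>K)"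
   using approx_branch[OF i, of "\<lambda>k. if k = 1 then \<one>\<^sub>K else \<zero>\<^sub>K" 2] by fastforce
  thus ?thesis by (intro exI[of _ b]) (auto simp: F1_iff)
 qed
 hence "\<forall>i. \<exists>b. i < m --> ?P i b" by blast
 hence "\<exists>e. \<forall>i. i < m --> ?P i (e i)" by (rule choice)
 hence "\<forall>i<m. ?P i (lin i)" unfolding lin_def by (rule someI_ex)
 with assms show "lin i \<in> F (Suc 0)" "j < m ==> \<tau> j (lin i) (Suc 0) = (if j = i then \<one>\<^sub>K else \<zero>\<^sub>K)" by auto
qed

text \<open>The linear part of \<open>A\<close> is the hyperplane with these coefficients.\<close>

definition hyp where "hyp i = (SOME x. x \<in> carrier K \<and> lin i \<ominus> emb' x ** u0 \<in> W)"

lemma hyp: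
 assumes "i < m"
 shows "hyp i \<in> carrier K" "lin i \<ominus> emb' (hyp i) ** u0 \<in> W"
proof -
 have "\<exists>x. x \<in> carrier K \<and> lin i \<ominus> emb' x ** u0 \<in> W" using F1_coordinate[OF lin(1)[OF assms]] by blast
 hence "hyp i \<in> carrier K \<and> lin i \<ominus> emb' (hyp i) ** u0 \<in> W" unfolding hyp_def by (rule someI_ex)
 thus "hyp i \<in> carrier K" "lin i \<ominus> emb' (hyp i) ** u0 \<in> W" by auto
qed

text \<open>Modulo \<open>F 2\<close>, which lies in \<open>W\<close>, the element \<open>w\<close>
  is the combination of the \<open>lin i\<close> with its linear terms as coefficients. Each
  \<open>lin i\<close> is \<open>hyp i\<close> times \<open>u0\<close> modulo \<open>W\<close>, so
  \<open>w\<close> is the displayed sum times \<open>u0\<close>, and no nonzero multiple of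
  \<open>u0\<close> lies in \<open>W\<close>.\<close>

lemma F1_W_iff:
 assumes w: "w \<in> F (Suc 0)"
 shows "w \<in> W \<longleftrightarrow> (\<Oplus>\<^sub>K i\<in>{..<m}. hyp i **\<^sub>K \<tau> i w (Suc 0)) = \<zero>\<^sub>K"
proof -
 have wc: "w \<in> carrier B" using w F_closed by auto
 let ?t = "\<lambda>i. \<tau> i w (Suc 0)"
 have linc: "lin i \<in> carrier B" if "i < m" for i using lin(1)[OF that] F_closed by auto
 define L where "L = B.lincomb {..<m} ?t lin"
 have L: "L \<in> F (Suc 0)"
 proof -
  have "\<tau> j L 0 = \<zero>\<^sub>K" if j: "j < m" for j
  proof -
   have "\<tau> j L 0 = (\<Oplus>\<^sub>K i\<in>{..<m}. \<tau> j (emb' (?t i) ** lin i) 0)" unfolding L_def using linc wc j by (intro tau_finsum) auto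
   also have "... = (\<Oplus>\<^sub>K i\<in>{..<m}. \<zero>\<^sub>K)"
    using lin(1) linc wc j by (intro R.finsum_cong') (auto simp: tau_scalar_mult F1_iff)
   finally show ?thesis by simp
  qed
  moreover have "L \<in> carrier B" unfolding L_def using linc wc by (intro B.lincomb_closed) auto
  ultimately show ?thesis by (simp add: F1_iff)
 qed
 hence Lc: "L \<in> carrier B" using F_closed by auto
 have tL: "\<tau> j L (Suc 0) = ?t j" if j: "j < m" for j
 proof -
  have "\<tau> j L (Suc 0) = (\<Oplus>\<^sub>K i\<in>{..<m}. \<tau> j (emb' (?t i) ** lin i) (Suc 0))"
   unfolding L_def using linc wc j by (intro tau_finsum) auto
  also have "... = (\<Oplus>\<^sub>K i\<in>{..<m}. if j = i then ?t i else \<zero>\<^sub>K)"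
   using lin(2) linc wc j by (intro R.finsum_cong') (auto simp: tau_scalar_mult)
  also have "... = ?t j" using wc j by (intro R.finsum_singleton) auto
  finally show ?thesis .
 qed
 have "w \<ominus> L \<in> F 2" using w L tL wc Lc by (auto simp: F2_iff F1_iff tau_diff)
 hence wL: "w \<ominus> L \<in> W" by (rule F2_subset_W)
 define s where "s = (\<Oplus>\<^sub>K i\<in>{..<m}. hyp i **\<^sub>K ?t i)"
 have s: "s \<in> carrier K" unfolding s_def using hyp(1) wc by (intro R.finsum_closed) auto
 have hc: "emb' (hyp i) ** u0 \<in> carrier B" if "i < m" for i using hyp(1)[OF that] u0 by simp
 have "B.lincomb {..<m} ?t (\<lambda>i. lin i \<ominus> emb' (hyp i) ** u0) \<in> W"
  using hyp wc W_smult by (intro B.ksubspace_finsum[OF W_ksubspace]) auto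
 moreover have "L = B.lincomb {..<m} ?t (\<lambda>i. lin i \<ominus> emb' (hyp i) ** u0) \<oplus> emb' s ** u0"
 proof -
  have "L = (\<Oplus>i\<in>{..<m}. emb' (?t i) ** (lin i \<ominus> emb' (hyp i) ** u0) \<oplus> emb' (?t i) ** (emb' (hyp i) ** u0))" unfolding L_def
  proof (intro B.S.finsum_cong' refl)
   fix i assume "i \<in> {..<m}"
   hence i: "i < m" by simp
   have "emb' (?t i) \<in> carrier B" using wc i by simp
   thus "emb' (?t i) ** lin i = emb' (?t i) ** (lin i \<ominus> emb' (hyp i) ** u0) \<oplus> emb' (?t i) ** (emb' (hyp i) ** u0)"
    using linc[OF i] hc[OF i] by (rule B.S.distrib_diff_add)
  qed (use linc wc hc in auto)
  also have "... = B.lincomb {..<m} ?t (\<lambda>i. lin i \<ominus> emb' (hyp i) ** u0) \<oplus> B.lincomb {..<m} ?t (\<lambda>i. emb' (hyp i) ** u0)"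
   using linc wc hc by (intro B.S.finsum_addf) auto
  also have "B.lincomb {..<m} ?t (\<lambda>i. emb' (hyp i) ** u0) = (\<Oplus>i\<in>{..<m}. emb' (hyp i **\<^sub>K ?t i) ** u0)"
   using hyp(1) wc u0 by (intro B.S.finsum_cong') (auto simp: B.S.m_ac)
  also have "... = (\<Oplus>i\<in>{..<m}. emb' (hyp i **\<^sub>K ?t i)) ** u0" using hyp(1) wc u0 by (intro B.S.finsum_ldistr[symmetric]) auto
  also have "(\<Oplus>i\<in>{..<m}. emb' (hyp i **\<^sub>K ?t i)) = emb' s" unfolding s_def using hyp(1) wc by (subst B.hom_finsum) (auto simp: o_def)
  finally show ?thesis .
 qed
 ultimately obtain y where y: "y \<in> W" "L = y \<oplus> emb' s ** u0" by blast
 have yc: "y \<in> carrier B" using y W_sub by auto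
 have sc: "emb' s ** u0 \<in> carrier B" using s u0 by simp
 show ?thesis unfolding s_def[symmetric]
 proof
  assume wW: "w \<in> W"
  have "emb' s ** u0 = (w \<ominus> (w \<ominus> L)) \<ominus> (L \<ominus> emb' s ** u0)" using sc wc Lc by algebra
  also have "L \<ominus> emb' s ** u0 = y" unfolding y(2) using yc sc by algebra
  finally have "emb' s ** u0 \<in> W" using W_diff[OF W_diff[OF wW wL] y(1)] by simp
  thus "s = \<zero>\<^sub>K" using scalar_u0_W s by blast
 next
  assume "s = \<zero>\<^sub>K"
  hence "L \<in> W" using y u0 yc by simp
  hence "w \<ominus> L \<oplus> L \<in> W" using wL W_add by blast
  also have "w \<ominus> L \<oplus> L = w" using wc Lc by algebra
  finally show "w \<in> W" .
 qed
qed

text \<open>If \<open>hyp i = 0\<close>, the idempotent of the branch \<open>i\<close> is multiplied into \<open>A\<close> by the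
 maximal ideal, just as \<open>u0\<close> is; so the socle would be too large.\<close>

lemma hyp_nonzero:
 assumes i: "i < m"
 shows "hyp i \<noteq> \<zero>\<^sub>K"
proof
 assume h0: "hyp i = \<zero>\<^sub>K"
 note e = idem[OF i]
 have 1: "\<psi> a ** idem i \<in> \<psi> ` carrier A" if a: "a \<in> nonunits A" for a
 proof -
  have ac: "\<psi> a \<in> carrier B" using a nonunits_closed by auto
  have aF: "\<psi> a \<in> F (Suc 0)" using psi_nonunit_in_F1[OF a] .
  have F: "\<psi> a ** idem i \<in> F (Suc 0)" using F_mult[OF aF e(1)] .
  have "(\<Oplus>\<^sub>K j\<in>{..<m}. hyp j **\<^sub>K \<tau> j (\<psi> a ** idem i) (Suc 0)) = (\<Oplus>\<^sub>K j\<in>{..<m}. \<zero>\<^sub>K)"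
  proof (intro R.finsum_cong' refl)
   fix j assume "j \<in> {..<m}"
   hence j: "j < m" by simp
   have "\<tau> j (\<psi> a) 0 = \<zero>\<^sub>K" using aF j by (auto simp: F1_iff)
   thus "hyp j **\<^sub>K \<tau> j (\<psi> a ** idem i) (Suc 0) = \<zero>\<^sub>K"
    using e(2,3)[OF j] h0 j ac e(1) hyp(1)[OF j] by (cases "j = i") (auto simp: tau_mult_1)
  qed auto
  hence "\<psi> a ** idem i \<in> W" using F1_W_iff[OF F] by simp
  thus ?thesis by (simp add: W_def)
 qed
 have 2: "\<psi> a ** u0 \<in> \<psi> ` carrier A" if "a \<in> nonunits A" for a using nonunit_mult_u0[OF that] by (simp add: W_def)
 obtain x y z where xyz: "x \<in> carrier K" "y \<in> carrier K" "z \<in> carrier A" "x \<noteq> \<zero>\<^sub>K \<or> y \<noteq> \<zero>\<^sub>K"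
  "\<And>j k. j < m ==> \<tau> j (emb' x ** idem i \<oplus> emb' y ** u0 \<ominus> \<psi> z) k = \<zero>\<^sub>K"
  using socle[OF e(1) u0(3) 1 2] by auto
 define v where "v = emb' x ** idem i \<oplus> emb' y ** u0"
 have vc: "v \<in> carrier B" "\<psi> z \<in> carrier B" using xyz e(1) u0(3) by (auto simp: v_def)
 have "v \<ominus> \<psi> z \<in> F 2" using xyz(5) vc by (auto simp: F2_iff v_def)
 hence "v \<ominus> \<psi> z \<oplus> \<psi> z \<in> W" using F2_subset_W W_add xyz(3) by (auto simp: W_def)
 also have "v \<ominus> \<psi> z \<oplus> \<psi> z = v" using vc by algebra
 finally have vW: "v \<in> W" .
 have u00: "\<tau> j u0 0 = \<zero>\<^sub>K" if "j < m" for j using u0(1) that by (auto simp: F1_iff)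
 have tv: "\<tau> j v 0 = (if j = i then x else \<zero>\<^sub>K)" if j: "j < m" for j
  using j e(1) e(2)[OF j] u0(3) u00[OF j] xyz(1,2) by (simp add: v_def tau_add tau_scalar_mult)
 have u0W: "\<not> (x = \<zero>\<^sub>K)"
 proof
  assume "x = \<zero>\<^sub>K"
  hence "emb' y ** u0 \<in> W" "y \<noteq> \<zero>\<^sub>K" using vW xyz e(1) u0(3) by (auto simp: v_def)
  thus False using scalar_u0_W xyz(2) by blast
 qed
 show False
 \<comment> \<open>With a single branch the equality of constant terms is vacuous; there
   \<open>hyp i = 0\<close> makes the linear condition empty, which would put \<open>u0\<close> in
   \<open>W\<close>. With more branches \<open>v\<close> has constant term \<open>x\<close> on
   branch \<open>i\<close> and zero elsewhere, against \<open>v\<close> lying in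
   \<open>W\<close>.\<close>
 proof (cases "m = 1")
  case True
  hence "u0 \<in> W" using h0 i u0 by (subst F1_W_iff[OF u0(1)]) (simp add: R.finsum_insert Pi_iff lessThan_Suc)
  thus False using u0 by simp
 next
  case False
  then obtain j where "j < m" "j \<noteq> i" using i m_pos by (metis less_one linorder_neqE_nat nat_neq_iff)
  thus False using W_tau_eq[OF vW i, of j] tv i u0W by auto
 qed
qed

section \<open>Elements of the local ring with prescribed expansion, and powers of its maximal
  ideal\<close>

lemma A_hyperplane:
 assumes a: "a \<in> carrier A"
 shows "(\<Oplus>\<^sub>K i\<in>{..<m}. hyp i **\<^sub>K \<tau> i (\<psi> a) (Suc 0)) = \<zero>\<^sub>K"
proof -
 obtain x where x: "x \<in> carrier K" "a \<ominus>\<^sub>A emb x \<in> nonunits A" using residue[OF a] by blast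
 have eq: "\<psi> (a \<ominus>\<^sub>A emb x) = \<psi> a \<ominus> emb' x" using a x by (simp add: a_minus_def psi_scalar)
 have "\<psi> (a \<ominus>\<^sub>A emb x) \<in> F (Suc 0)" "\<psi> (a \<ominus>\<^sub>A emb x) \<in> W"
  using psi_nonunit_in_F1[OF x(2)] S.minus_closed[OF a hom_closed[OF x(1)]] unfolding W_def by blast+
 hence s: "(\<Oplus>\<^sub>K i\<in>{..<m}. hyp i **\<^sub>K \<tau> i (\<psi> (a \<ominus>\<^sub>A emb x)) (Suc 0)) = \<zero>\<^sub>K" using F1_W_iff by simp
 have z: "y \<ominus>\<^sub>K \<zero>\<^sub>K = y" if "y \<in> carrier K" for y using that by (simp add: a_minus_def)
 have "(\<Oplus>\<^sub>K i\<in>{..<m}. hyp i **\<^sub>K \<tau> i (\<psi> (a \<ominus>\<^sub>A emb x)) (Suc 0)) =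
   (\<Oplus>\<^sub>K i\<in>{..<m}. hyp i **\<^sub>K \<tau> i (\<psi> a) (Suc 0))"
  unfolding eq using a x hyp(1) z by (intro R.finsum_cong') (auto simp: tau_diff tau_scalar)
 with s show ?thesis by simp
qed

lemma A_approx:
 assumes f: "\<And>i k. f i k \<in> carrier K" and c: "\<And>i. i < m ==> f i 0 = f 0 0"
  and h: "(\<Oplus>\<^sub>K i\<in>{..<m}. hyp i **\<^sub>K f i (Suc 0)) = \<zero>\<^sub>K"
 shows "\<exists>a\<in>carrier A. \<forall>i<m. \<forall>k<N. \<tau> i (\<psi> a) k = f i k"
proof -
 \<comment> \<open>Two extra orders ensure that the constant and linear terms are prescribed for
   every \<open>N\<close>, even for 0 and 1.\<close>
 obtain b where b: "b \<in> carrier B" "\<And>i k. i < m ==> k < Suc (Suc N) ==> \<tau> i b k = f i k" using approx[of f "Suc (Suc N)", OF f] by blast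
 let ?b = "b \<ominus> emb' (f 0 0)"
 have t: "\<tau> i ?b k = (if k = 0 then \<zero>\<^sub>K else f i k)" if i: "i < m" and k: "k < Suc (Suc N)" for i k
 proof -
  have "\<tau> i ?b k = f i k \<ominus>\<^sub>K (if k = 0 then f 0 0 else \<zero>\<^sub>K)"
   using b(1) b(2)[OF i k] f i by (simp add: tau_diff tau_scalar)
  thus ?thesis using f c[OF i] R.r_right_minus_eq[of "f 0 0" "f 0 0"] by (simp add: a_minus_def)
 qed
 have F: "?b \<in> F (Suc 0)" using b(1) f t by (auto simp: F1_iff)
 have "(\<Oplus>\<^sub>K i\<in>{..<m}. hyp i **\<^sub>K \<tau> i ?b (Suc 0)) = (\<Oplus>\<^sub>K i\<in>{..<m}. hyp i **\<^sub>K f i (Suc 0))"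
  using t f hyp(1) by (intro R.finsum_cong') auto
 hence "?b \<in> W" using F1_W_iff[OF F] h by simp
 hence "?b \<oplus> emb' (f 0 0) \<in> W" using W_add W_scalar f by blast
 also have "?b \<oplus> emb' (f 0 0) = b" using b(1) f by (simp add: a_minus_def B.S.a_assoc B.S.l_neg)
 finally obtain a where "a \<in> carrier A" "b = \<psi> a" by (auto simp: W_def)
 thus ?thesis using b by (intro bexI[of _ a]) auto
qed

text \<open>The square of \<open>pp\<close> is a product of two elements of \<open>F 1\<close> and
  thus comes from the maximal ideal. Dividing by it costs two orders of vanishing and gains one
  factor of the ideal; the quotient still has order at least two and so comes from \<open>A\<close>
  again.\<close>

lemma high_order_in_ideal_power:
 assumes "a \<in> carrier A" "\<psi> a \<in> F (2 * n)"
 shows "a \<in> ideal_power A (nonunits A) n"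
proof (cases n)
 case 0
 thus ?thesis using assms by simp
next
 case (Suc k)
 have "a \<in> ideal_power A (nonunits A) (Suc k)" if "a \<in> carrier A" "\<psi> a \<in> F (2 * Suc k)" for a k using that
 proof (induction k arbitrary: a)
  case (0 a)
  hence "\<psi> a \<in> F (Suc 0)" using F_Suc_subset[of "\<psi> a" "Suc 0"] by (simp add: numeral_2_eq_2)
  hence "\<psi> a \<in> F (Suc 0)" "\<psi> a \<in> W" using 0 by (auto simp: W_def)
  then obtain a' where "a' \<in> nonunits A" "\<psi> a = \<psi> a'" using W_F1 by blast
  hence "a \<in> nonunits A" using psi_inj 0 nonunits_closed by (auto dest: inj_onD)
  hence "a **\<^sub>A \<one>\<^sub>A \<in> ideal_prod A (nonunits A) (carrier A)" by (intro ideal_prod.prod) auto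
  thus ?case using 0 by simp
 next
  case (Suc k a)
  have "\<psi> a \<in> F (Suc (Suc (2 * Suc k)))" using Suc.prems(2) by simp
  then obtain c1 where c1: "c1 \<in> F (Suc (2 * Suc k))" "\<psi> a = pp ** c1" using F_Suc_divides by blast
  then obtain c where c: "c \<in> F (2 * Suc k)" "c1 = pp ** c" using F_Suc_divides by blast
  have cc: "c \<in> carrier B" using c F_closed by auto
  have "c \<in> F 2" using c(1) vanish_mono[of _ "2 * Suc k" c 2] by (auto simp: F_def)
  then obtain z where z: "z \<in> carrier A" "c = \<psi> z" using F2_subset_W by (auto simp: W_def)
  have ppF: "pp \<in> F (Suc 0)" using varpi by (simp add: F1_iff)
  obtain y where y: "y \<in> nonunits A" "pp ** pp = \<psi> y" using W_F1[OF F1_mult_F1[OF ppF ppF] F_mult[OF ppF varpi(1)]] by blast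
  have yc: "y \<in> carrier A" using y nonunits_closed by auto
  have "\<psi> a = (pp ** pp) ** c" using c1 c cc varpi(1) by (simp add: B.S.m_assoc)
  also have "... = \<psi> (y **\<^sub>A z)" using yc z y by simp
  finally have "a = y **\<^sub>A z" using psi_inj Suc.prems(1) S.m_closed[OF yc z(1)] unfolding inj_on_def by blast
  moreover have "z \<in> ideal_power A (nonunits A) (Suc k)" using Suc.IH[of z] z c(1) by simp
  ultimately have "a \<in> ideal_prod A (nonunits A) (ideal_power A (nonunits A) (Suc k))" using y(1) by (auto intro: ideal_prod.prod)
  thus ?case by simp
 qed
 thus ?thesis using assms Suc by blast
qed

lemma ideal_power_high_order:
 assumes "a \<in> ideal_power A (nonunits A) n"
 shows "a \<in> carrier A \<and> \<psi> a \<in> F n" using assms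
proof (induction n arbitrary: a)
 case (Suc n)
 hence "a \<in> ideal_prod A (nonunits A) (ideal_power A (nonunits A) n)" by simp
 thus ?case
 proof (induction rule: ideal_prod.induct)
  case (prod i j)
  hence j: "j \<in> carrier A" "\<psi> j \<in> F n" using Suc.IH by auto
  have i: "i \<in> carrier A" "\<psi> i \<in> F (Suc 0)" using prod nonunits_closed psi_nonunit_in_F1 by auto
  have "vanish h (Suc 0 + n) (\<psi> i ** \<psi> j)" if "h < m" for h using i j that by (intro vanish_mult) (auto simp: F_def)
  thus ?case using i j by (auto simp: F_def)
 next
  case (sum s1 s2)
  thus ?case using F_add by auto
 qed
qed (auto simp: F_def vanish_def)

end

section \<open>Power series\<close>

lemma (in abelian_monoid) finsum_bij_eq:
 assumes "bij_betw h I J" "\<And>x. x \<in> I ==> f x = g (h x)" "g \<in> J \<rightarrow> carrier G"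
 shows "finsum G f I = finsum G g J"
proof -
 have h: "inj_on h I" "J = h ` I" using assms(1) by (auto simp: bij_betw_def)
 have "finsum G f I = finsum G (\<lambda>x. g (h x)) I" using assms h by (intro finsum_cong') (auto simp: Pi_iff)
 also have "... = finsum G g J" unfolding h(2) using assms(3) h by (intro finsum_reindex[symmetric]) auto
 finally show ?thesis .
qed

lemma (in abelian_monoid) finsum_Sigma:
 assumes "finite I" "\<And>x. x \<in> I ==> finite (J x)" "\<And>x y. x \<in> I ==> y \<in> J x ==> f x y \<in> carrier G"
 shows "(\<Oplus>x\<in>I. \<Oplus>y\<in>J x. f x y) = (\<Oplus>p\<in>Sigma I J. f (fst p) (snd p))" using assms
proof (induction I rule: finite_induct)
 case empty
 thus ?case by simp
next
 case (insert x I)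
 have S: "Sigma (insert x I) J = Pair x ` J x \<union> Sigma I J" "Pair x ` J x \<inter> Sigma I J = {}" using insert.hyps by auto
 have "(\<Oplus>p\<in>Sigma (insert x I) J. f (fst p) (snd p)) =
   (\<Oplus>p\<in>Pair x ` J x. f (fst p) (snd p)) \<oplus> (\<Oplus>p\<in>Sigma I J. f (fst p) (snd p))"
  unfolding S(1) using insert S(2) by (intro finsum_Un_disjoint) (auto simp: Pi_iff)
 also have "(\<Oplus>p\<in>Pair x ` J x. f (fst p) (snd p)) = (\<Oplus>y\<in>J x. f x y)"
  using insert by (subst finsum_reindex) (auto simp: Pi_iff inj_on_def)
 also have "(\<Oplus>p\<in>Sigma I J. f (fst p) (snd p)) = (\<Oplus>x\<in>I. \<Oplus>y\<in>J x. f x y)" using insert by auto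
 finally show ?case using insert by (simp add: finsum_insert Pi_iff)
qed

lemma (in abelian_monoid) finsum_single_support:
 assumes "finite I" "a \<in> I" "f a \<in> carrier G" "\<And>x. x \<in> I ==> x \<noteq> a ==> f x = \<zero>"
 shows "finsum G f I = f a"
proof -
 have cl: "f x \<in> carrier G" if "x \<in> I" for x using assms(3,4) that by (cases "x = a") auto
 have "finsum G f I = finsum G (\<lambda>x. if a = x then f x else \<zero>) I" using assms by (intro finsum_cong') auto
 also have "... = f a" using assms cl by (intro finsum_singleton) auto
 finally show ?thesis .
qed

locale power_series_ring = cring K for K :: "'k ring" (structure) +
 fixes V :: "nat set"
 assumes V_finite: "finite V"
begin

abbreviation "R \<equiv> power_series K V"

definition "below e = {a :: nat => nat. \<forall>i. a i \<le> e i}"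

lemma below_finite: "e \<in> exponents V ==> finite (below e)"
proof -
 assume e: "e \<in> exponents V"
 have "below e \<subseteq> (\<lambda>g i. if i \<in> V then g i else 0) ` (PiE V (\<lambda>i. {..e i}))"
 proof
  fix a assume a: "a \<in> below e"
  have "a = (\<lambda>i. if i \<in> V then restrict a V i else 0)"
  proof
   fix i show "a i = (if i \<in> V then restrict a V i else 0)" using a e by (auto simp: below_def exponents_def) (metis le_zero_eq)
  qed
  thus "a \<in> (\<lambda>g i. if i \<in> V then g i else 0) ` (PiE V (\<lambda>i. {..e i}))"
   using a by (intro image_eqI[of _ _ "restrict a V"]) (auto simp: below_def)
 qed
 thus ?thesis by (rule finite_subset) (intro finite_imageI finite_PiE V_finite, auto)
qed

lemma below_exponents: "e \<in> exponents V ==> a \<in> below e ==> a \<in> exponents V"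
 unfolding below_def exponents_def by (auto) (metis le_zero_eq)

lemma diff_exponents: "e \<in> exponents V ==> (\<lambda>i. e i - a i) \<in> exponents V" by (auto simp: exponents_def)

lemma ps_carrier: "f \<in> carrier R \<longleftrightarrow> (\<forall>e. f e \<in> carrier K) \<and> (\<forall>e. e \<notin> exponents V --> f e = \<zero>)"
 by (simp only: power_series_def partial_object.select_convs mem_Collect_eq)

lemma ps_closed [simp]: "f \<in> carrier R ==> f e \<in> carrier K" unfolding ps_carrier by blast

lemma ps_outside: "f \<in> carrier R ==> e \<notin> exponents V ==> f e = \<zero>" unfolding ps_carrier by blast

lemma ps_mult: "(f **\<^sub>R g) e = (if e \<in> exponents V then \<Oplus>a\<in>below e. f a ** g (\<lambda>i. e i - a i) else \<zero>)"
 by (simp only: power_series_def monoid.select_convs below_def)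

lemma ps_add: "(f \<oplus>\<^sub>R g) e = f e \<oplus> g e" by (simp only: power_series_def ring.select_convs)

lemma ps_zero: "\<zero>\<^sub>R e = \<zero>" by (simp only: power_series_def ring.select_convs)

lemma ps_one: "\<one>\<^sub>R e = (if e = (\<lambda>i. 0) then \<one> else \<zero>)" by (simp only: power_series_def monoid.select_convs)

lemma ps_carrierI: "(\<And>e. f e \<in> carrier K) ==> (\<And>e. e \<notin> exponents V ==> f e = \<zero>) ==> f \<in> carrier R"
 unfolding ps_carrier by blast

lemma ps_mult_closed: "f \<in> carrier R ==> g \<in> carrier R ==> f **\<^sub>R g \<in> carrier R"
 by (rule ps_carrierI) (auto simp: ps_mult intro!: finsum_closed)

lemma ps_comm:
 assumes "f \<in> carrier R" "g \<in> carrier R"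
 shows "f **\<^sub>R g = g **\<^sub>R f"
proof
 fix e
 show "(f **\<^sub>R g) e = (g **\<^sub>R f) e"
 proof (cases "e \<in> exponents V")
  case True
  have "bij_betw (\<lambda>a i. e i - a i) (below e) (below e)" by (rule bij_betwI[where g = "\<lambda>a i. e i - a i"]) (auto simp: below_def)
  hence "(\<Oplus>a\<in>below e. f a ** g (\<lambda>i. e i - a i)) = (\<Oplus>a\<in>below e. g a ** f (\<lambda>i. e i - a i))"
  proof (rule finsum_bij_eq)
   fix a assume "a \<in> below e"
   hence "(\<lambda>i. e i - (e i - a i)) = a" by (auto simp: below_def)
   thus "f a ** g (\<lambda>i. e i - a i) = g (\<lambda>i. e i - a i) ** f (\<lambda>i. e i - (e i - a i))" using assms by (simp add: m_comm)
  qed (use assms in auto)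
  thus ?thesis using True by (simp add: ps_mult)
 qed (simp add: ps_mult)
qed

text \<open>Both sides are sums over the ways of writing \<open>e\<close> as a sum of three exponent
  vectors. The left side indexes them by \<open>(a, b)\<close> with
  \<open>b \<le> a \<le> e\<close>, the right side by \<open>(b, c)\<close> with
  \<open>c \<le> e - b\<close>; the substitution is \<open>c = a - b\<close>.\<close>

lemma ps_assoc:
 assumes "f \<in> carrier R" "g \<in> carrier R" "h \<in> carrier R"
 shows "(f **\<^sub>R g) **\<^sub>R h = f **\<^sub>R (g **\<^sub>R h)"
proof
 fix e
 show "((f **\<^sub>R g) **\<^sub>R h) e = (f **\<^sub>R (g **\<^sub>R h)) e"
 proof (cases "e \<in> exponents V")
  case e: True
  have fin: "finite (below a)" if "a \<in> below e" for a using below_finite below_exponents[OF e that] by blast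
  have fin': "finite (below (\<lambda>i. e i - a i))" for a using below_finite diff_exponents[OF e] by blast
  let ?F = "\<lambda>a b. f b ** g (\<lambda>i. a i - b i) ** h (\<lambda>i. e i - a i)"
  let ?G = "\<lambda>b c. f b ** (g c ** h (\<lambda>i. e i - b i - c i))"
  have "((f **\<^sub>R g) **\<^sub>R h) e = (\<Oplus>a\<in>below e. (f **\<^sub>R g) a ** h (\<lambda>i. e i - a i))"
   using e by (simp add: ps_mult[of "f **\<^sub>R g"])
  also have "... = (\<Oplus>a\<in>below e. \<Oplus>b\<in>below a. ?F a b)" using assms e below_exponents fin
   by (intro finsum_cong') (auto simp: ps_mult finsum_ldistr intro!: finsum_closed)
  also have "... = (\<Oplus>p\<in>Sigma (below e) below. ?F (fst p) (snd p))" using assms e below_finite fin by (intro finsum_Sigma) auto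
  also have "... = (\<Oplus>p\<in>Sigma (below e) (\<lambda>b. below (\<lambda>i. e i - b i)). ?G (fst p) (snd p))"
  proof (rule finsum_bij_eq)
   show "bij_betw (\<lambda>p. (snd p, \<lambda>i. fst p i - snd p i)) (Sigma (below e) below) (Sigma (below e) (\<lambda>b. below (\<lambda>i. e i - b i)))"
   proof (rule bij_betwI[where g = "\<lambda>p. (\<lambda>i. fst p i + snd p i, fst p)"])
    show "(\<lambda>p. (snd p, \<lambda>i. fst p i - snd p i)) \<in> Sigma (below e) below \<rightarrow> Sigma (below e) (\<lambda>b. below (\<lambda>i. e i - b i))"
     by (auto simp: below_def diff_le_mono) (meson order_trans)
    show "(\<lambda>p. (\<lambda>i. fst p i + snd p i, fst p)) \<in> Sigma (below e) (\<lambda>b. below (\<lambda>i. e i - b i)) \<rightarrow> Sigma (below e) below"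
    proof
     fix p assume "p \<in> Sigma (below e) (\<lambda>b. below (\<lambda>i. e i - b i))"
     hence "fst p i \<le> e i" "snd p i \<le> e i - fst p i" for i by (auto simp: below_def)
     hence "fst p i + snd p i \<le> e i" for i by (metis add.commute le_diff_conv2)
     thus "(\<lambda>i. fst p i + snd p i, fst p) \<in> Sigma (below e) below" by (auto simp: below_def)
    qed
   qed (auto simp: below_def)
  next
   fix p assume "p \<in> Sigma (below e) below"
   hence p: "snd p i \<le> fst p i" "fst p i \<le> e i" for i by (auto simp: below_def)
   have "(\<lambda>i. e i - snd p i - (fst p i - snd p i)) = (\<lambda>i. e i - fst p i)"
   proof
    fix i show "e i - snd p i - (fst p i - snd p i) = e i - fst p i" using p[of i] by simp
   qed
   thus "?F (fst p) (snd p) = ?G (fst (snd p, \<lambda>i. fst p i - snd p i)) (snd (snd p, \<lambda>i. fst p i - snd p i))"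
    using assms by (simp add: m_assoc)
  qed (use assms in auto)
  also have "... = (\<Oplus>b\<in>below e. \<Oplus>c\<in>below (\<lambda>i. e i - b i). ?G b c)"
   using assms e below_finite fin' by (intro finsum_Sigma[symmetric]) auto
  also have "... = (\<Oplus>b\<in>below e. f b ** (g **\<^sub>R h) (\<lambda>i. e i - b i))" using assms e diff_exponents fin'
   by (intro finsum_cong') (auto simp: ps_mult finsum_rdistr intro!: finsum_closed)
  also have "... = (f **\<^sub>R (g **\<^sub>R h)) e" using e by (simp add: ps_mult[of f])
  finally show ?thesis .
 qed (simp add: ps_mult)
qed

definition mon :: "(nat => nat) => (nat => nat) => 'k" where
 "mon \<mu> = (\<lambda>e. if e = \<mu> then \<one> else \<zero>)"

lemma mon_closed [simp]: "\<mu> \<in> exponents V ==> mon \<mu> \<in> carrier R" by (rule ps_carrierI) (auto simp: mon_def)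

lemma mon_mult:
 assumes "\<mu> \<in> exponents V" "g \<in> carrier R"
 shows "(mon \<mu> **\<^sub>R g) e = (if \<mu> \<in> below e then g (\<lambda>i. e i - \<mu> i) else \<zero>)"
proof (cases "e \<in> exponents V")
 case True
 show ?thesis
 proof (cases "\<mu> \<in> below e")
  case \<mu>: True
  have "(\<Oplus>a\<in>below e. mon \<mu> a ** g (\<lambda>i. e i - a i)) = mon \<mu> \<mu> ** g (\<lambda>i. e i - \<mu> i)"
   using assms True \<mu> below_finite by (intro finsum_single_support) (auto simp: mon_def)
  thus ?thesis using True \<mu> assms by (simp add: ps_mult mon_def)
 next
  case False
  hence "(\<Oplus>a\<in>below e. mon \<mu> a ** g (\<lambda>i. e i - a i)) = (\<Oplus>a\<in>below e. \<zero>)"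
   using assms by (intro finsum_cong') (auto simp: mon_def)
  thus ?thesis using True False by (simp add: ps_mult)
 qed
next
 case False
 hence "(\<lambda>i. e i - \<mu> i) \<notin> exponents V" using assms(1) by (auto simp: exponents_def)
 thus ?thesis using False assms ps_outside by (simp add: ps_mult)
qed

lemma ps_cring: "cring R"
proof (rule cringI)
 show "abelian_group R"
 proof (rule abelian_groupI)
  fix f g assume fg: "f \<in> carrier R" "g \<in> carrier R"
  show "f \<oplus>\<^sub>R g \<in> carrier R" using fg ps_outside[OF fg(1)] ps_outside[OF fg(2)] by (intro ps_carrierI) (auto simp: ps_add)
  show "f \<oplus>\<^sub>R g = g \<oplus>\<^sub>R f" using fg by (intro ext) (simp add: ps_add a_comm)
  fix h assume "h \<in> carrier R"
  thus "f \<oplus>\<^sub>R g \<oplus>\<^sub>R h = f \<oplus>\<^sub>R (g \<oplus>\<^sub>R h)" using fg by (intro ext) (simp add: ps_add a_assoc)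
 next
  show "\<zero>\<^sub>R \<in> carrier R" by (rule ps_carrierI) (auto simp: ps_zero)
  fix f assume f: "f \<in> carrier R"
  show "\<zero>\<^sub>R \<oplus>\<^sub>R f = f" using f by (intro ext) (simp add: ps_add ps_zero)
  show "\<exists>g\<in>carrier R. g \<oplus>\<^sub>R f = \<zero>\<^sub>R"
   using f ps_outside[OF f] by (intro bexI[of _ "\<lambda>e. \<ominus> f e"] ps_carrierI ext)
    (auto simp: ps_add ps_zero l_neg)
 qed
 have one: "\<one>\<^sub>R = mon (\<lambda>i. 0)" by (auto simp: ps_one mon_def)
 show "comm_monoid R"
 proof (rule comm_monoidI)
  show "\<one>\<^sub>R \<in> carrier R" unfolding one by (rule mon_closed) (simp add: exponents_def)
  fix f assume "f \<in> carrier R"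
  thus "\<one>\<^sub>R **\<^sub>R f = f" unfolding one by (intro ext, subst mon_mult) (auto simp: exponents_def below_def)
 qed (auto intro: ps_mult_closed ps_assoc ps_comm)
 fix f g h assume fgh: "f \<in> carrier R" "g \<in> carrier R" "h \<in> carrier R"
 show "(f \<oplus>\<^sub>R g) **\<^sub>R h = f **\<^sub>R h \<oplus>\<^sub>R g **\<^sub>R h"
 proof
  fix e
  have "(\<Oplus>a\<in>below e. (f a \<oplus> g a) ** h (\<lambda>i. e i - a i)) =
    (\<Oplus>a\<in>below e. f a ** h (\<lambda>i. e i - a i) \<oplus> g a ** h (\<lambda>i. e i - a i))"
   using fgh by (intro finsum_cong') (auto simp: l_distr)
  also have "... = (\<Oplus>a\<in>below e. f a ** h (\<lambda>i. e i - a i)) \<oplus> (\<Oplus>a\<in>below e. g a ** h (\<lambda>i. e i - a i))"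
   using fgh by (intro finsum_addf) auto
  finally show "((f \<oplus>\<^sub>R g) **\<^sub>R h) e = (f **\<^sub>R h \<oplus>\<^sub>R g **\<^sub>R h) e" by (simp add: ps_mult ps_add)
 qed
qed

sublocale PS: cring R by (rule ps_cring)

lemma ps_minus: "f \<in> carrier R ==> (\<ominus>\<^sub>R f) e = \<ominus> f e"
proof -
 assume f: "f \<in> carrier R"
 hence "(\<ominus>\<^sub>R f \<oplus>\<^sub>R f) e = \<zero>" by (simp add: PS.l_neg ps_zero)
 hence "(\<ominus>\<^sub>R f) e \<oplus> f e = \<zero>" by (simp add: ps_add)
 thus ?thesis using f by (metis PS.a_inv_closed minus_equality ps_closed)
qed

lemma ps_diff: "f \<in> carrier R ==> g \<in> carrier R ==> (f \<ominus>\<^sub>R g) e = f e \<ominus> g e" by (simp add: a_minus_def ps_add ps_minus)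

lemma ps_finsum:
 assumes "finite I" "f \<in> I \<rightarrow> carrier R"
 shows "finsum R f I e = (\<Oplus>i\<in>I. f i e)" using assms
proof (induction I rule: finite_induct)
 case (insert i I)
 hence "f i \<in> carrier R" "f \<in> I \<rightarrow> carrier R" by auto
 thus ?case using insert by (simp add: PS.finsum_insert finsum_insert ps_add Pi_iff)
qed (simp add: ps_zero)

lemma mon_mon:
 assumes "\<mu> \<in> exponents V" "\<nu> \<in> exponents V"
 shows "mon \<mu> **\<^sub>R mon \<nu> = mon (\<lambda>i. \<mu> i + \<nu> i)"
proof
 fix e
 have "\<mu> \<in> below e \<and> (\<lambda>i. e i - \<mu> i) = \<nu> \<longleftrightarrow> e = (\<lambda>i. \<mu> i + \<nu> i)"
  by (auto simp: below_def fun_eq_iff) (metis le_add_diff_inverse)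
 thus "(mon \<mu> **\<^sub>R mon \<nu>) e = mon (\<lambda>i. \<mu> i + \<nu> i) e"
  unfolding mon_mult[OF assms(1) mon_closed[OF assms(2)]] by (auto simp: mon_def)
qed

lemma var_mon: "ps_var K i = mon (\<lambda>j. if j = i then 1 else 0)" by (simp add: ps_var_def mon_def)

lemma delta_exponents: "i \<in> V ==> (\<lambda>j. if j = i then n else 0) \<in> exponents V" by (auto simp: exponents_def)

lemma var_closed [simp]: "i \<in> V ==> ps_var K i \<in> carrier R" using delta_exponents[of i 1] by (simp add: var_mon)

lemma var_power: "i \<in> V ==> ps_var K i [^]\<^sub>R n = mon (\<lambda>j. if j = i then n else 0)"
proof (induction n)
 case 0
 thus ?case by (auto simp: ps_one mon_def fun_eq_iff)
next
 case (Suc n)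
 have "ps_var K i [^]\<^sub>R Suc n = mon (\<lambda>j. if j = i then n else 0) **\<^sub>R mon (\<lambda>j. if j = i then 1 else 0)"
  using Suc by (simp add: var_mon)
 also have "... = mon (\<lambda>j. (if j = i then n else 0) + (if j = i then 1 else 0))" using Suc.prems delta_exponents by (intro mon_mon) auto
 also have "(\<lambda>j. (if j = i then n else 0) + (if j = i then 1 else 0)) = (\<lambda>j. if j = i then Suc n else 0)" by auto
 finally show ?case .
qed

lemma divide_by_monomial:
 assumes \<mu>: "\<mu> \<in> exponents V" and f: "f \<in> carrier R" "\<And>e. \<mu> \<notin> below e ==> f e = \<zero>"
 shows "\<exists>g\<in>carrier R. f = mon \<mu> **\<^sub>R g"
proof
 let ?g = "\<lambda>e. f (\<lambda>i. e i + \<mu> i)"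
 show g: "?g \<in> carrier R"
 proof (rule ps_carrierI)
  fix e assume "e \<notin> exponents V"
  hence "(\<lambda>i. e i + \<mu> i) \<notin> exponents V" by (auto simp: exponents_def)
  thus "?g e = \<zero>" using f ps_outside by blast
 qed (use f in auto)
 show "f = mon \<mu> **\<^sub>R ?g"
 proof
  fix e
  show "f e = (mon \<mu> **\<^sub>R ?g) e" using f(2)[of e] by (subst mon_mult[OF \<mu> g]) (auto simp: below_def)
 qed
qed

text \<open>Division by \<open>x\<^sub>j\<^sup>c - x\<^sub>i\<^sup>s\<close> as a polynomial in \<open>x\<^sub>j\<close>.\<close>

lemma divide_by_binomial:
 assumes ij: "i \<in> V" "j \<in> V" "i \<noteq> j" and s: "s > 0" and f: "f \<in> carrier R"
 shows "\<exists>g\<in>carrier R. \<exists>r\<in>carrier R.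
  f = (ps_var K j [^]\<^sub>R (c::nat) \<ominus>\<^sub>R ps_var K i [^]\<^sub>R (s::nat)) **\<^sub>R g \<oplus>\<^sub>R r \<and>
  (\<forall>e. c \<le> e j --> r e = \<zero>) \<and>
  (\<forall>t. t \<noteq> i --> t \<noteq> j --> (\<forall>e. 0 < e t --> f e = \<zero>) --> (\<forall>e. 0 < e t --> r e = \<zero>))"
proof -
 \<comment> \<open>From the exponent \<open>sh e k\<close> one arrives at \<open>e\<close> by
   dividing by \<open>x_j^c\<close> once and then trading \<open>x_j^c\<close> for
   \<open>x_i^s\<close> another \<open>k\<close> times. These are the monomials of \<open>f\<close>
   that contribute to the quotient at \<open>e\<close>; since \<open>s > 0\<close>, there are
   finitely many.\<close>
 define sh where "sh e k = e(i := e i - s * k, j := e j + c + c * k)" for e :: "nat => nat" and k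
 define g where "g e = (if e \<in> exponents V then \<Oplus>k\<in>{..e i div s}. f (sh e k) else \<zero>)" for e
 have g: "g \<in> carrier R" by (rule ps_carrierI) (auto simp: g_def f intro!: finsum_closed)
 let ?y = "ps_var K j [^]\<^sub>R c" and ?x = "ps_var K i [^]\<^sub>R s"
 have xy: "?x \<in> carrier R" "?y \<in> carrier R" using ij by auto
 define r where "r = f \<ominus>\<^sub>R (?y \<ominus>\<^sub>R ?x) **\<^sub>R g"
 have r: "r \<in> carrier R" using f g xy by (simp add: r_def)
 have yx: "(?y \<ominus>\<^sub>R ?x) **\<^sub>R g = ?y **\<^sub>R g \<ominus>\<^sub>R ?x **\<^sub>R g" using xy g by algebra
 have yg: "(?y **\<^sub>R g) e = (if c \<le> e j then g (e(j := e j - c)) else \<zero>)" for e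
 proof -
  have "(\<lambda>t. e t - (if t = j then c else 0)) = e(j := e j - c)" by auto
  thus ?thesis using ij g delta_exponents[of j c] by (simp add: var_power mon_mult below_def)
 qed
 have xg: "(?x **\<^sub>R g) e = (if s \<le> e i then g (e(i := e i - s)) else \<zero>)" for e
 proof -
  have "(\<lambda>t. e t - (if t = i then s else 0)) = e(i := e i - s)" by auto
  thus ?thesis using ij g delta_exponents[of i s] by (simp add: var_power mon_mult below_def)
 qed
 have re: "r e = f e \<ominus> ((?y **\<^sub>R g) e \<ominus> (?x **\<^sub>R g) e)" for e unfolding r_def yx using f g xy by (simp add: ps_diff)
 have "r e = \<zero>" if e: "c \<le> e j" for e
 proof (cases "e \<in> exponents V")
  case True
  define d where "d = e(j := e j - c)"
  have dV: "d \<in> exponents V" using True by (auto simp: exponents_def d_def)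
  have d0: "sh d 0 = e" using ij e by (auto simp: sh_def d_def)
  show ?thesis
  proof (cases "s \<le> e i")
   case si: True
   define h where "h = e(i := e i - s)"
   have hV: "h \<in> exponents V" using True by (auto simp: exponents_def h_def)
   have q: "d i div s = Suc (h i div s)" using si s ij by (simp add: d_def h_def le_div_geq)
   have shs: "sh d (Suc k) = sh h k" if "k \<le> h i div s" for k using ij e by (auto simp: sh_def d_def h_def fun_eq_iff)
   \<comment> \<open>Splitting off the term \<open>k = 0\<close> makes the sums telescope:
     \<open>g d = g h + f e\<close>.\<close>
   have "g d = (\<Oplus>k\<in>{..h i div s}. f (sh d (Suc k))) \<oplus> f (sh d 0)"
    unfolding g_def q using dV f finsum_Suc2[of "\<lambda>k. f (sh d k)" "h i div s"] by (simp del: finsum_Suc)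
   also have "(\<Oplus>k\<in>{..h i div s}. f (sh d (Suc k))) = g h" using hV f shs by (simp add: g_def) (intro finsum_cong', auto)
   finally have "g d = g h \<oplus> f e" using d0 by simp
   hence "r e = f e \<ominus> ((g h \<oplus> f e) \<ominus> g h)" unfolding re yg xg using e si by (simp add: d_def h_def)
   moreover have "f e \<in> carrier K" "g h \<in> carrier K" using f g by auto
   ultimately show ?thesis using add_diff_cancel[of "g h" "f e"] r_right_minus_eq by simp
  next
   case False
   hence "d i div s = 0" using ij by (simp add: d_def)
   hence "g d = f e" using dV f d0 by (simp add: g_def)
   hence "r e = f e \<ominus> (f e \<ominus> \<zero>)" unfolding re yg xg using e False by (simp add: d_def)
   thus ?thesis using f r_right_minus_eq by (simp add: a_minus_def r_neg)
  qed
 qed (use r ps_outside in blast)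
 moreover have "r e = \<zero>" if t: "t \<noteq> i" "t \<noteq> j" "\<forall>e. 0 < e t --> f e = \<zero>" "0 < e t" for t e
 proof -
  have g0: "g e = \<zero>" if "0 < e t" for e
  proof -
   have "sh e k t = e t" for k using t by (simp add: sh_def)
   hence "f (sh e k) = \<zero>" for k using t(3) that by simp
   thus ?thesis by (simp add: g_def)
  qed
  have "(?y **\<^sub>R g) e = \<zero>" "(?x **\<^sub>R g) e = \<zero>" unfolding yg xg using g0 t by auto
  thus ?thesis unfolding re using t by (simp add: a_minus_def)
 qed
 moreover have "f = (?y \<ominus>\<^sub>R ?x) **\<^sub>R g \<oplus>\<^sub>R r"
 proof -
  have "(?y \<ominus>\<^sub>R ?x) **\<^sub>R g \<in> carrier R" using xy g by simp
  thus ?thesis unfolding r_def using f by algebra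
 qed
 ultimately show ?thesis using g r by blast
qed

end

section \<open>The branches of the elliptic fold point\<close>

definition wdeg :: "nat set => (nat => nat) => (nat => nat) => nat" where
 "wdeg S w e = (\<Sum>i\<in>S. w i * e i)"

definition wset :: "nat set => (nat => nat) => nat => (nat => nat) set" where
 "wset S w d = {e \<in> exponents S. wdeg S w e = d}"

text \<open>The coefficients of the series obtained by substituting \<open>x\<^sub>i \<mapsto> t^(w i)\<close> for \<open>i \<in> S\<close> and
 \<open>x\<^sub>i \<mapsto> 0\<close> for the other variables.\<close>

definition subst_series :: "('k, 'b) ring_scheme => nat set => (nat => nat) => ((nat => nat) => 'k) => nat => 'k" where
 "subst_series K S w f d = finsum K f (wset S w d)"

locale substitution = power_series_ring +
 fixes S :: "nat set" and w :: "nat => nat"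
 assumes S_sub: "S \<subseteq> V" and w_pos: "i \<in> S ==> 0 < w i"
begin

lemma S_finite: "finite S" using S_sub V_finite finite_subset by blast

lemma wset_exponents: "e \<in> wset S w d ==> e \<in> exponents V" using S_sub by (auto simp: wset_def exponents_def)

text \<open>Positive weights bound every exponent by \<open>d\<close>. This is what makes each
  coefficient of the substituted series a finite sum.\<close>

lemma wset_finite: "finite (wset S w d)"
proof -
 let ?c = "\<lambda>i. if i \<in> S then d else 0"
 have "wset S w d \<subseteq> below ?c"
 proof
  fix e assume e: "e \<in> wset S w d"
  have "e i \<le> d" if i: "i \<in> S" for i
  proof -
   have "e i \<le> w i * e i" using w_pos[OF i] by simp
   also have "... \<le> wdeg S w e" unfolding wdeg_def by (rule member_le_sum) (use i S_finite in auto)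
   finally show ?thesis using e by (simp add: wset_def)
  qed
  thus "e \<in> below ?c" using e by (auto simp: below_def wset_def exponents_def)
 qed
 moreover have "?c \<in> exponents V" using S_sub by (auto simp: exponents_def)
 ultimately show ?thesis using below_finite finite_subset by blast
qed

lemma wdeg_add: "wdeg S w (\<lambda>i. a i + b i) = wdeg S w a + wdeg S w b" by (simp add: wdeg_def sum.distrib algebra_simps)

lemma subst_closed [simp]: "f \<in> carrier R ==> subst_series K S w f d \<in> carrier K" by (auto simp: subst_series_def intro!: finsum_closed)

lemma subst_add:
 "f \<in> carrier R ==> g \<in> carrier R ==> subst_series K S w (f \<oplus>\<^sub>R g) d = subst_series K S w f d \<oplus> subst_series K S w g d"
proof -
 assume fg: "f \<in> carrier R" "g \<in> carrier R"
 have "subst_series K S w (f \<oplus>\<^sub>R g) d = finsum K (\<lambda>e. f e \<oplus> g e) (wset S w d)"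
  unfolding subst_series_def using fg by (intro finsum_cong') (auto simp: ps_add)
 also have "... = subst_series K S w f d \<oplus> subst_series K S w g d" unfolding subst_series_def using fg by (intro finsum_addf) auto
 finally show ?thesis .
qed

lemma subst_zero: "subst_series K S w \<zero>\<^sub>R d = \<zero>"
proof -
 have "subst_series K S w \<zero>\<^sub>R d = finsum K (\<lambda>_. \<zero>) (wset S w d)"
  unfolding subst_series_def by (intro finsum_cong') (auto simp: ps_zero)
 thus ?thesis by simp
qed

lemma subst_minus:
 assumes "f \<in> carrier R"
 shows "subst_series K S w (\<ominus>\<^sub>R f) d = \<ominus> subst_series K S w f d"
proof -
 have "subst_series K S w (\<ominus>\<^sub>R f) d \<oplus> subst_series K S w f d = subst_series K S w (\<ominus>\<^sub>R f \<oplus>\<^sub>R f) d"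
  using assms by (simp add: subst_add)
 also have "... = \<zero>" using assms by (simp add: PS.l_neg subst_zero)
 finally show ?thesis using assms by (simp add: minus_equality)
qed

lemma subst_diff:
 "f \<in> carrier R ==> g \<in> carrier R ==> subst_series K S w (f \<ominus>\<^sub>R g) d = subst_series K S w f d \<ominus> subst_series K S w g d"
 by (simp add: a_minus_def subst_add subst_minus)

text \<open>Weighted degree is additive. Splitting an exponent of weight \<open>d\<close> into two
  summands is the same as choosing a weight \<open>k\<close>, a summand of weight \<open>k\<close>
  and a summand of weight \<open>d - k\<close>; the triples \<open>(k, a, b)\<close> in the
  reindexing record this.\<close>

lemma subst_mult:
 assumes f: "f \<in> carrier R" and g: "g \<in> carrier R"
 shows "subst_series K S w (f **\<^sub>R g) d =
  (\<Oplus>k\<in>{..d}. subst_series K S w f k ** subst_series K S w g (d - k))"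
proof -
 let ?F = "\<lambda>p. f (snd p) ** g (\<lambda>i. fst p i - snd p i)"
 let ?G = "\<lambda>p. f (fst (snd p)) ** g (snd (snd p))"
 let ?T = "Sigma {..d} (\<lambda>k. wset S w k \<times> wset S w (d - k))"
 have bf: "finite (below e)" if "e \<in> wset S w d" for e using below_finite wset_exponents that by blast
 have "subst_series K S w (f **\<^sub>R g) d = (\<Oplus>e\<in>wset S w d. \<Oplus>a\<in>below e. f a ** g (\<lambda>i. e i - a i))"
  unfolding subst_series_def using wset_exponents f g by (intro finsum_cong') (auto simp: ps_mult intro!: finsum_closed)
 also have "... = (\<Oplus>p\<in>Sigma (wset S w d) below. ?F p)" using f g bf wset_finite by (intro finsum_Sigma) auto
 also have "... = (\<Oplus>p\<in>?T. ?G p)"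
 proof (rule finsum_bij_eq)
  show "bij_betw (\<lambda>p. (wdeg S w (snd p), snd p, \<lambda>i. fst p i - snd p i)) (Sigma (wset S w d) below) ?T"
  proof (rule bij_betwI[where g = "\<lambda>q. (\<lambda>i. fst (snd q) i + snd (snd q) i, fst (snd q))"])
   show "(\<lambda>p. (wdeg S w (snd p), snd p, \<lambda>i. fst p i - snd p i)) \<in> Sigma (wset S w d) below \<rightarrow> ?T"
   proof
    fix p assume p: "p \<in> Sigma (wset S w d) below"
    hence le: "snd p i \<le> fst p i" for i by (auto simp: below_def)
    have "(\<lambda>i. snd p i + (fst p i - snd p i)) = fst p" using le by auto
    hence d: "wdeg S w (snd p) + wdeg S w (\<lambda>i. fst p i - snd p i) = d"
     using p wdeg_add[of "snd p" "\<lambda>i. fst p i - snd p i"] by (auto simp: wset_def)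
    have e: "fst p i = 0" if "i \<notin> S" for i using p that by (auto simp: wset_def exponents_def)
    have "snd p \<in> exponents S" "(\<lambda>i. fst p i - snd p i) \<in> exponents S" using e le by (auto simp: exponents_def) (metis le_zero_eq)
    thus "(wdeg S w (snd p), snd p, \<lambda>i. fst p i - snd p i) \<in> ?T" using d by (auto simp: wset_def)
   qed
   show "(\<lambda>q. (\<lambda>i. fst (snd q) i + snd (snd q) i, fst (snd q))) \<in> ?T \<rightarrow> Sigma (wset S w d) below"
    by (auto simp: wset_def wdeg_add exponents_def below_def)
  next
   fix p assume "p \<in> Sigma (wset S w d) below"
   thus "(\<lambda>q. (\<lambda>i. fst (snd q) i + snd (snd q) i, fst (snd q))) (wdeg S w (snd p), snd p, \<lambda>i. fst p i - snd p i) = p"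
    by (auto simp: below_def)
  next
   fix q assume "q \<in> ?T"
   thus "(\<lambda>p. (wdeg S w (snd p), snd p, \<lambda>i. fst p i - snd p i)) ((\<lambda>i. fst (snd q) i + snd (snd q) i, fst (snd q))) = q"
    by (auto simp: wset_def)
  qed
 qed (use f g in auto)
 also have "... = (\<Oplus>k\<in>{..d}. \<Oplus>q\<in>wset S w k \<times> wset S w (d - k). f (fst q) ** g (snd q))"
  using f g wset_finite by (intro finsum_Sigma[symmetric]) auto
 also have "... = (\<Oplus>k\<in>{..d}. subst_series K S w f k ** subst_series K S w g (d - k))"
 proof (intro finsum_cong' refl)
  fix k assume "k \<in> {..d}"
  have "(\<Oplus>q\<in>wset S w k \<times> wset S w (d - k). f (fst q) ** g (snd q)) =
    (\<Oplus>a\<in>wset S w k. \<Oplus>b\<in>wset S w (d - k). f a ** g b)" using f g wset_finite by (intro finsum_Sigma[symmetric]) auto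
  also have "... = (\<Oplus>a\<in>wset S w k. f a ** subst_series K S w g (d - k))"
   unfolding subst_series_def using f g wset_finite by (intro finsum_cong') (auto simp: finsum_rdistr)
  also have "... = subst_series K S w f k ** subst_series K S w g (d - k)"
   using f g wset_finite subst_closed[OF g, of "d - k"] unfolding subst_series_def[of K S w f] by (intro finsum_ldistr[symmetric]) auto
  finally show "(\<Oplus>q\<in>wset S w k \<times> wset S w (d - k). f (fst q) ** g (snd q)) =
    subst_series K S w f k ** subst_series K S w g (d - k)" .
 qed (use f g in auto)
 finally show ?thesis .
qed

lemma subst_mult_zero:
 assumes "f \<in> carrier R" "g \<in> carrier R" "(\<forall>d. subst_series K S w f d = \<zero>) \<or> (\<forall>d. subst_series K S w g d = \<zero>)"
 shows "subst_series K S w (f **\<^sub>R g) d = \<zero>"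
proof -
 have "(\<Oplus>k\<in>{..d}. subst_series K S w f k ** subst_series K S w g (d - k)) = (\<Oplus>k\<in>{..d}. \<zero>)"
  using assms by (intro finsum_cong') auto
 thus ?thesis using assms by (simp add: subst_mult)
qed

lemma subst_mon: "subst_series K S w (mon \<mu>) d = (if \<mu> \<in> wset S w d then \<one> else \<zero>)"
proof (cases "\<mu> \<in> wset S w d")
 case True
 hence "finsum K (mon \<mu>) (wset S w d) = mon \<mu> \<mu>" using wset_finite by (intro finsum_single_support) (auto simp: mon_def)
 thus ?thesis using True by (simp add: subst_series_def mon_def)
next
 case False
 hence "finsum K (mon \<mu>) (wset S w d) = finsum K (\<lambda>_. \<zero>) (wset S w d)" by (intro finsum_cong') (auto simp: mon_def)
 thus ?thesis using False by (simp add: subst_series_def)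
qed

lemma subst_mon_mult:
 assumes \<mu>: "\<mu> \<in> wset S w c" and f: "f \<in> carrier R"
 shows "subst_series K S w (mon \<mu> **\<^sub>R f) (c + d) = subst_series K S w f d"
proof -
 have \<mu>V: "\<mu> \<in> exponents V" using wset_exponents[OF \<mu>] .
 have s: "subst_series K S w (mon \<mu>) k = (if k = c then \<one> else \<zero>)" for k using \<mu> by (auto simp: subst_mon wset_def)
 have "subst_series K S w (mon \<mu> **\<^sub>R f) (c + d) =
   (\<Oplus>k\<in>{..c + d}. (if k = c then \<one> else \<zero>) ** subst_series K S w f (c + d - k))" using \<mu>V f by (simp add: subst_mult s)
 also have "... = (if c = c then \<one> else \<zero>) ** subst_series K S w f (c + d - c)" using f by (intro finsum_single_support) auto
 finally show ?thesis using f by simp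
qed

lemma subst_single:
 assumes "f \<in> carrier R" "e \<in> wset S w d" "\<And>e'. e' \<in> wset S w d ==> e' \<noteq> e ==> f e' = \<zero>"
 shows "subst_series K S w f d = f e" unfolding subst_series_def using assms wset_finite by (intro finsum_single_support) auto

end

text \<open>The variables that do not vanish on branch \<open>i\<close>. For \<open>m = 2\<close>
  branch 0 is the parabola and branch 1 the axis. For \<open>m \<ge> 3\<close> branch
  \<open>i < m - 1\<close> is the axis of the variable with number \<open>i + 1\<close>, and the
  last branch is the diagonal.\<close>

definition bvars :: "nat => nat => nat set" where
 "bvars m i = (if m = 1 \<or> m = 2 \<and> i = 0 then {1, 2} else if m = 2 then {1}
   else if i = m - 1 then {1..m - 1} else {Suc i})"

definition weight :: "nat => nat => nat" where
 "weight m = (if m = 1 then (\<lambda>j. if j = 1 then 2 else 3) else if m = 2 then (\<lambda>j. j) else (\<lambda>_. 1))"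

text \<open>Branch \<open>i\<close> of the elliptic \<open>m\<close>-fold point: \<open>(t\<^sup>2, t\<^sup>3)\<close> for \<open>m = 1\<close>, \<open>(t, t\<^sup>2)\<close> and
 \<open>(t, 0)\<close> for \<open>m = 2\<close>, otherwise the coordinate axes and the diagonal.\<close>

definition parametrize :: "('k, 'b) ring_scheme => nat => ((nat => nat) => 'k) => nat => nat => 'k" where
 "parametrize K m f i = subst_series K (bvars m i) (weight m) f"

section \<open>The elliptic ideal and the vanishing of its generators on the branches\<close>

locale elliptic_ring = cring K for K :: "'k ring" (structure) +
 fixes m :: nat
 assumes m_pos: "0 < m"
begin

sublocale power_series_ring K "elliptic_vars m" by unfold_locales (simp add: elliptic_vars_def)

abbreviation "V \<equiv> elliptic_vars m"
abbreviation "\<Psi> \<equiv> parametrize K m"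
abbreviation "I \<equiv> elliptic_ideal K m"
abbreviation "x \<equiv> ps_var K"

lemma branch: "i < m ==> substitution K V (bvars m i) (weight m)"
 by unfold_locales (auto simp: bvars_def weight_def elliptic_vars_def split: if_splits)

lemma \<Psi>_closed [simp]: "i < m ==> f \<in> carrier R ==> \<Psi> f i d \<in> carrier K"
 unfolding parametrize_def using substitution.subst_closed[OF branch] .

lemma \<Psi>_add: "i < m ==> f \<in> carrier R ==> g \<in> carrier R ==> \<Psi> (f \<oplus>\<^sub>R g) i d = \<Psi> f i d \<oplus> \<Psi> g i d"
 unfolding parametrize_def using substitution.subst_add[OF branch] .

lemma \<Psi>_minus: "i < m ==> f \<in> carrier R ==> \<Psi> (\<ominus>\<^sub>R f) i d = \<ominus> \<Psi> f i d"
 unfolding parametrize_def using substitution.subst_minus[OF branch] .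

lemma \<Psi>_diff: "i < m ==> f \<in> carrier R ==> g \<in> carrier R ==> \<Psi> (f \<ominus>\<^sub>R g) i d = \<Psi> f i d \<ominus> \<Psi> g i d"
 unfolding parametrize_def using substitution.subst_diff[OF branch] .

lemma \<Psi>_mult: "i < m ==> f \<in> carrier R ==> g \<in> carrier R ==>
  \<Psi> (f **\<^sub>R g) i d = (\<Oplus>k\<in>{..d}. \<Psi> f i k ** \<Psi> g i (d - k))"
 unfolding parametrize_def using substitution.subst_mult[OF branch] .

lemma \<Psi>_mult_zero: "i < m ==> f \<in> carrier R ==> g \<in> carrier R ==>
  (\<forall>d. \<Psi> f i d = \<zero>) \<or> (\<forall>d. \<Psi> g i d = \<zero>) ==> \<Psi> (f **\<^sub>R g) i d = \<zero>"
 unfolding parametrize_def using substitution.subst_mult_zero[OF branch] .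

lemma \<Psi>_mon: "i < m ==> \<Psi> (mon \<mu>) i d = (if \<mu> \<in> wset (bvars m i) (weight m) d then \<one> else \<zero>)"
 unfolding parametrize_def using substitution.subst_mon[OF branch] .

lemma \<Psi>_mon_mult: "i < m ==> \<mu> \<in> wset (bvars m i) (weight m) c ==> f \<in> carrier R ==>
  \<Psi> (mon \<mu> **\<^sub>R f) i (c + d) = \<Psi> f i d" unfolding parametrize_def using substitution.subst_mon_mult[OF branch] .

lemma \<Psi>_single: "i < m ==> f \<in> carrier R ==> e \<in> wset (bvars m i) (weight m) d ==>
  (\<And>e'. e' \<in> wset (bvars m i) (weight m) d ==> e' \<noteq> e ==> f e' = \<zero>) ==> \<Psi> f i d = f e"
 unfolding parametrize_def using substitution.subst_single[OF branch] .

lemma \<Psi>_zero: "i < m ==> \<Psi> \<zero>\<^sub>R i d = \<zero>" unfolding parametrize_def using substitution.subst_zero[OF branch] .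

lemma bvars_finite: "i < m ==> finite (bvars m i)" using substitution.S_finite[OF branch] .

lemma delta_wset:
 assumes "i < m"
 shows "(\<lambda>j. if j = k then n else 0) \<in> wset (bvars m i) (weight m) d \<longleftrightarrow>
  (k \<in> bvars m i \<and> weight m k * n = d) \<or> (k \<notin> bvars m i \<and> n = 0 \<and> d = 0)"
proof (cases "k \<in> bvars m i")
 case True
 have "(\<Sum>j\<in>bvars m i. weight m j * (if j = k then n else 0)) =
   (\<Sum>j\<in>bvars m i. if j = k then weight m k * n else 0)" by (intro sum.cong) auto
 also have "... = weight m k * n" using True bvars_finite[OF assms] by simp
 finally show ?thesis using True by (auto simp: wset_def wdeg_def exponents_def)
next
 case False
 have "(\<Sum>j\<in>bvars m i. weight m j * (if j = k then n else 0)) = 0" using False by (intro sum.neutral) auto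
 thus ?thesis using False by (auto simp: wset_def wdeg_def exponents_def)
qed

lemma \<Psi>_var_power: "i < m ==> k \<in> V ==>
  \<Psi> (x k [^]\<^sub>R (n::nat)) i d = (if (k \<in> bvars m i \<and> weight m k * n = d) \<or> (k \<notin> bvars m i \<and> n = 0 \<and> d = 0) then \<one> else \<zero>)"
 by (simp add: var_power \<Psi>_mon delta_wset)

lemma \<Psi>_var: "i < m ==> k \<in> V ==> \<Psi> (x k) i d = (if k \<in> bvars m i \<and> weight m k = d then \<one> else \<zero>)"
 using \<Psi>_var_power[of i k 1 d] by auto

definition "ker = {f \<in> carrier R. \<forall>i<m. \<forall>d. \<Psi> f i d = \<zero>}"

lemma ker_ideal: "ideal ker R"
proof (rule idealI)
 show "ring R" by (rule PS.ring_axioms)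
 show "subgroup ker (add_monoid R)"
 proof (rule PS.add.subgroupI)
  show "ker \<subseteq> carrier R" by (auto simp: ker_def)
  show "ker \<noteq> {}" using \<Psi>_zero by (auto simp: ker_def)
  show "\<ominus>\<^sub>R a \<in> ker" if "a \<in> ker" for a using that by (auto simp: ker_def \<Psi>_minus)
  show "a \<oplus>\<^sub>R b \<in> ker" if "a \<in> ker" "b \<in> ker" for a b using that by (auto simp: ker_def \<Psi>_add)
 qed
 fix a b assume "a \<in> ker" "b \<in> carrier R"
 thus "b **\<^sub>R a \<in> ker" "a **\<^sub>R b \<in> ker" by (auto simp: ker_def \<Psi>_mult_zero)
qed

definition "gens =
 (if m = 1 then {(x 2 [^]\<^sub>R (2::nat)) \<ominus>\<^sub>R (x 1 [^]\<^sub>R (3::nat))}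
  else if m = 2 then {x 2 **\<^sub>R (x 2 \<ominus>\<^sub>R (x 1 [^]\<^sub>R (2::nat)))}
  else if m = 3 then {x 1 **\<^sub>R x 2 **\<^sub>R (x 2 \<ominus>\<^sub>R x 1)}
  else {x h **\<^sub>R (x i \<ominus>\<^sub>R x j) | h i j. h \<in> V \<and> i \<in> V \<and> j \<in> V \<and> h \<noteq> i \<and> h \<noteq> j \<and> i \<noteq> j})"

lemma I_gens: "I = Idl\<^bsub>R\<^esub> gens" by (simp add: elliptic_ideal_def gens_def Let_def)

lemma gens_1: "m = 1 ==> gens = {(x 2 [^]\<^sub>R (2::nat)) \<ominus>\<^sub>R (x 1 [^]\<^sub>R (3::nat))}"
 and gens_2: "m = 2 ==> gens = {x 2 **\<^sub>R (x 2 \<ominus>\<^sub>R (x 1 [^]\<^sub>R (2::nat)))}"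
 and gens_3: "m = 3 ==> gens = {x 1 **\<^sub>R x 2 **\<^sub>R (x 2 \<ominus>\<^sub>R x 1)}"
 and gens_4: "m \<ge> 4 ==> gens = {x h **\<^sub>R (x i \<ominus>\<^sub>R x j) | h i j. h \<in> V \<and> i \<in> V \<and> j \<in> V \<and> h \<noteq> i \<and> h \<noteq> j \<and> i \<noteq> j}"
 unfolding gens_def by simp_all

lemma V_12: "m \<le> 3 ==> V = {1, 2}" by (simp add: elliptic_vars_def)

lemma m_cases: obtains "m = 1" | "m = 2" | "m = 3" | "m \<ge> 4" using m_pos by linarith

lemma gens_closed: "gens \<subseteq> carrier R"
proof (cases rule: m_cases)
 case 1
 have "1 \<in> V" "2 \<in> V" using 1 V_12 by auto
 thus ?thesis unfolding gens_1[OF 1] by simp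
next
 case 2
 have "1 \<in> V" "2 \<in> V" using 2 V_12 by auto
 thus ?thesis unfolding gens_2[OF 2] by simp
next
 case 3
 have "1 \<in> V" "2 \<in> V" using 3 V_12 by auto
 thus ?thesis unfolding gens_3[OF 3] by simp
next
 case 4
 thus ?thesis unfolding gens_4[OF 4] by auto
qed

lemma I_ideal: "ideal I R" unfolding I_gens using gens_closed by (rule PS.genideal_ideal)

lemma gens_I: "g \<in> gens ==> g \<in> I" unfolding I_gens using PS.genideal_self[OF gens_closed] by blast

lemma ker_diffI:
 assumes "f \<in> carrier R" "g \<in> carrier R" "\<And>i d. i < m ==> \<Psi> f i d = \<Psi> g i d"
 shows "f \<ominus>\<^sub>R g \<in> ker" using assms r_right_minus_eq by (auto simp: ker_def \<Psi>_diff)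

lemma \<Psi>_diff_zero:
 assumes "f \<in> carrier R" "g \<in> carrier R" "i < m" "\<And>d. \<Psi> f i d = \<Psi> g i d"
 shows "\<forall>d. \<Psi> (f \<ominus>\<^sub>R g) i d = \<zero>" using assms r_right_minus_eq by (auto simp: \<Psi>_diff)

lemma gens_ker: "gens \<subseteq> ker"
proof (cases rule: m_cases)
 case 1
 have V: "1 \<in> V" "2 \<in> V" using 1 V_12 by auto
 have b: "bvars m i = {1, 2}" "weight m 1 = 2" "weight m 2 = 3" for i using 1 by (simp_all add: bvars_def weight_def)
 show ?thesis unfolding gens_1[OF 1] insert_subset
 proof (intro conjI ker_diffI)
  fix i d assume i: "i < m"
  show "\<Psi> (x 2 [^]\<^sub>R (2::nat)) i d = \<Psi> (x 1 [^]\<^sub>R (3::nat)) i d"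
   unfolding \<Psi>_var_power[OF i V(1)] \<Psi>_var_power[OF i V(2)] b by simp
 qed (use V in auto)
next
 case 2
 have V: "1 \<in> V" "2 \<in> V" using 2 V_12 by auto
 have b: "bvars m 0 = {1, 2}" "bvars m 1 = {1}" "weight m 1 = 1" "weight m 2 = 2" using 2 by (simp_all add: bvars_def weight_def)
 have "\<Psi> (x 2 **\<^sub>R (x 2 \<ominus>\<^sub>R (x 1 [^]\<^sub>R (2::nat)))) i d = \<zero>" if i: "i < m" for i d
 proof (cases "i = 0")
  case True
  have i0: "0 < m" by (rule m_pos)
  have "\<forall>d. \<Psi> (x 2 \<ominus>\<^sub>R (x 1 [^]\<^sub>R (2::nat))) 0 d = \<zero>"
   using V m_pos by (intro \<Psi>_diff_zero) (auto simp: \<Psi>_var[OF i0 V(2)] \<Psi>_var_power[OF i0 V(1)] b simp del: One_nat_def)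
  thus ?thesis using V i True by (intro \<Psi>_mult_zero) auto
 next
  case False
  hence "i = 1" using i 2 by simp
  hence "\<forall>d. \<Psi> (x 2) i d = \<zero>" using \<Psi>_var[OF i V(2)] b(2) by simp
  thus ?thesis using V i by (intro \<Psi>_mult_zero) auto
 qed
 thus ?thesis using V unfolding gens_2[OF 2] by (simp add: ker_def)
next
 case 3
 have V: "1 \<in> V" "2 \<in> V" using 3 V_12 by auto
 have b: "bvars m 2 = {1, 2}" "weight m 1 = 1" "weight m 2 = 1"
  "bvars m 0 = {1}" "bvars m 1 = {2}" using 3 by (auto simp: bvars_def weight_def)
 have "\<Psi> (x 1 **\<^sub>R x 2 **\<^sub>R (x 2 \<ominus>\<^sub>R x 1)) i d = \<zero>" if i: "i < m" for i d
 proof (cases "i = 2")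
  case True
  have "\<forall>d. \<Psi> (x 2 \<ominus>\<^sub>R x 1) i d = \<zero>"
  proof (intro \<Psi>_diff_zero i)
   fix d
   have "bvars m i = {1, 2}" using b(1) True by simp
   thus "\<Psi> (x 2) i d = \<Psi> (x 1) i d" unfolding \<Psi>_var[OF i V(1)] \<Psi>_var[OF i V(2)] b(2,3) by simp
  qed (use V in auto)
  thus ?thesis using V i by (intro \<Psi>_mult_zero) auto
 next
  case False
  hence "i = 0 \<or> i = 1" using i 3 by auto
  hence "(\<forall>d. \<Psi> (x 1) i d = \<zero>) \<or> (\<forall>d. \<Psi> (x 2) i d = \<zero>)"
   using \<Psi>_var[OF i V(1)] \<Psi>_var[OF i V(2)] b(4,5) by auto
  hence "\<forall>d. \<Psi> (x 1 **\<^sub>R x 2) i d = \<zero>" using V i by (intro allI \<Psi>_mult_zero) auto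
  thus ?thesis using V i by (intro \<Psi>_mult_zero) auto
 qed
 thus ?thesis using V unfolding gens_3[OF 3] by (simp add: ker_def)
next
 case 4
 have w: "weight m k = 1" for k using 4 by (simp add: weight_def)
 have "\<Psi> (x h **\<^sub>R (x i \<ominus>\<^sub>R x j)) b d = \<zero>"
  if V: "h \<in> V" "i \<in> V" "j \<in> V" "h \<noteq> i" "h \<noteq> j" and b: "b < m" for h i j b d
 proof (cases "b = m - 1")
  case True
  have "i \<in> bvars m b" "j \<in> bvars m b" using True V 4 by (auto simp: bvars_def elliptic_vars_def)
  hence "\<forall>d. \<Psi> (x i \<ominus>\<^sub>R x j) b d = \<zero>" using V b w by (intro \<Psi>_diff_zero) (auto simp: \<Psi>_var)
  thus ?thesis using V b by (intro \<Psi>_mult_zero) auto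
 next
  case False
  hence bv: "bvars m b = {Suc b}" using 4 by (auto simp: bvars_def)
  show ?thesis
  proof (cases "h = Suc b")
   case True
   hence "\<forall>d. \<Psi> (x i \<ominus>\<^sub>R x j) b d = \<zero>" using V b bv by (intro \<Psi>_diff_zero) (auto simp: \<Psi>_var)
   thus ?thesis using V b by (intro \<Psi>_mult_zero) auto
  next
   case False
   hence "\<forall>d. \<Psi> (x h) b d = \<zero>" using V b bv by (auto simp: \<Psi>_var)
   thus ?thesis using V b by (intro \<Psi>_mult_zero) auto
  qed
 qed
 thus ?thesis unfolding gens_4[OF 4] by (auto simp: ker_def)
qed

lemma I_subset_ker: "I \<subseteq> ker" unfolding I_gens using PS.genideal_minimal[OF ker_ideal gens_ker] .

section \<open>The kernel for at most three branches\<close>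

lemma two_exponents:
 assumes "e \<in> exponents {1, 2}" "e' \<in> exponents {1, 2}" "e 1 = e' 1" "e 2 = e' 2"
 shows "e = e'"
proof
 fix i show "e i = e' i" using assms by (cases "i = 1 \<or> i = 2") (auto simp: exponents_def)
qed

lemma divide_12:
 assumes "1 \<in> V" "2 \<in> V" "f \<in> carrier R" "s > 0"
 shows "\<exists>g\<in>carrier R. \<exists>r\<in>carrier R. f = (x 2 [^]\<^sub>R (c::nat) \<ominus>\<^sub>R x 1 [^]\<^sub>R (s::nat)) **\<^sub>R g \<oplus>\<^sub>R r \<and>
  (\<forall>e. c \<le> e 2 --> r e = \<zero>)"
proof -
 have "1 \<noteq> (2::nat)" by simp
 from divide_by_binomial[OF assms(1,2) this assms(4,3), of c] show ?thesis by blast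
qed

lemma two_exponents_support: "e \<in> exponents {1, 2} ==> j \<noteq> 1 ==> 0 < e j ==> j = 2" unfolding exponents_def by fastforce

lemma ker_remainder:
 assumes "f \<in> ker" "a \<in> ker" "r \<in> carrier R" "f = a \<oplus>\<^sub>R r" "i < m"
 shows "\<Psi> r i d = \<zero>"
proof -
 have "\<Psi> f i d = \<Psi> a i d \<oplus> \<Psi> r i d" unfolding assms(4) using assms by (intro \<Psi>_add) (auto simp: ker_def)
 moreover have "\<Psi> f i d = \<zero>" "\<Psi> a i d = \<zero>" using assms by (auto simp: ker_def)
 ultimately show ?thesis using assms(3,5) by simp
qed

text \<open>Division by \<open>x_2^2 - x_1^3\<close> leaves a remainder of degree below 2 in
  \<open>x_2\<close>. The weights \<open>2 a + 3 b\<close> with \<open>b < 2\<close> are pairwise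
  distinct, so the coefficients of the remainder reappear separately along \<open>(t^2, t^3)\<close>
  and must all vanish.\<close>

lemma ker_1:
 assumes m: "m = 1" and f: "f \<in> ker"
 shows "f \<in> I"
proof -
 have V: "V = {1, 2}" using m V_12 by auto
 have b: "bvars m 0 = {1, 2}" "weight m 1 = 2" "weight m 2 = 3" using m by (simp_all add: bvars_def weight_def)
 have fc: "f \<in> carrier R" using f by (simp add: ker_def)
 define y where "y = (x 2 [^]\<^sub>R (2::nat)) \<ominus>\<^sub>R (x 1 [^]\<^sub>R (3::nat))"
 have yI: "y \<in> I" using gens_I gens_1[OF m] by (simp add: y_def)
 have V': "1 \<in> V" "2 \<in> V" using V by auto
 hence yc: "y \<in> carrier R" by (simp add: y_def)
 obtain g r where gr: "g \<in> carrier R" "r \<in> carrier R" "f = y **\<^sub>R g \<oplus>\<^sub>R r" "\<And>e. 2 \<le> e 2 ==> r e = \<zero>"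
  using divide_12[OF V' fc, of 3 2] unfolding y_def by auto
 have ygI: "y **\<^sub>R g \<in> I" using yI gr(1) I_ideal by (simp add: ideal.I_r_closed)
 have ygk: "y **\<^sub>R g \<in> ker" using ygI I_subset_ker by blast
 have rk: "\<Psi> r 0 d = \<zero>" for d using ker_remainder[OF f ygk gr(2,3) m_pos] .
 have "r = \<zero>\<^sub>R"
 proof
  fix e
  have "r e = \<zero>"
  proof (cases "e \<in> exponents V \<and> e 2 < 2")
   case True
   have wd: "e' \<in> wset (bvars m 0) (weight m) d \<longleftrightarrow> e' \<in> exponents V \<and> 2 * e' 1 + 3 * e' 2 = d" for e' d
    using b V by (simp add: wset_def wdeg_def)
   have "r e = \<Psi> r 0 (2 * e 1 + 3 * e 2)"
   proof (rule \<Psi>_single[symmetric, OF m_pos gr(2)])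
    show "e \<in> wset (bvars m 0) (weight m) (2 * e 1 + 3 * e 2)" using True wd by simp
    fix e' assume e': "e' \<in> wset (bvars m 0) (weight m) (2 * e 1 + 3 * e 2)" "e' \<noteq> e"
    show "r e' = \<zero>"
    proof (rule ccontr)
     assume "r e' \<noteq> \<zero>"
     hence "e' 2 < 2" using gr(4)[of e'] by (cases "e' 2 < 2") auto
     moreover have "2 * e' 1 + 3 * e' 2 = 2 * e 1 + 3 * e 2" using e' wd by simp
     moreover have "a = c \<and> b = d" if "b < 2" "d < 2" "2 * a + 3 * b = 2 * c + 3 * d" for a b c d :: nat using that by presburger
     ultimately have "e' 1 = e 1" "e' 2 = e 2" using True by blast+
     hence "e' = e" using two_exponents[of e' e] e' wd True V by simp
     thus False using e' by simp
    qed
   qed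
   thus ?thesis using rk by simp
  next
   case False
   thus ?thesis using gr(4)[of e] ps_outside[OF gr(2)] by (cases "e \<in> exponents V") auto
  qed
  thus "r e = \<zero>\<^sub>R e" by (simp add: ps_zero)
 qed
 thus ?thesis using ygI gr yc by simp
qed

text \<open>On a branch where \<open>x 1\<close> becomes the parameter itself, a series in
  \<open>x 1\<close> alone is its own expansion.\<close>

lemma one_variable_zero:
 assumes i: "i < m" "1 \<in> bvars m i" "weight m 1 = 1"
  and r: "r \<in> carrier R" "\<And>e j. j \<noteq> 1 ==> 0 < e j ==> r e = \<zero>" "\<And>d. \<Psi> r i d = \<zero>"
 shows "r = \<zero>\<^sub>R"
proof
 fix e
 have "r e = \<zero>"
 proof (cases "\<exists>j. j \<noteq> 1 \<and> 0 < e j")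
  case False
  hence e: "e = (\<lambda>j. if j = 1 then e 1 else 0)" by (intro ext) auto
  have "\<Psi> r i (e 1) = r (\<lambda>j. if j = 1 then e 1 else 0)"
  proof (rule \<Psi>_single[OF i(1) r(1)])
   show "(\<lambda>j. if j = 1 then e 1 else 0) \<in> wset (bvars m i) (weight m) (e 1)" using i by (simp add: delta_wset)
   fix e' assume e': "e' \<in> wset (bvars m i) (weight m) (e 1)" "e' \<noteq> (\<lambda>j. if j = 1 then e 1 else 0)"
   show "r e' = \<zero>"
   proof (rule ccontr)
    assume "r e' \<noteq> \<zero>"
    hence "\<And>j. j \<noteq> 1 ==> e' j = 0" using r(2)[of _ e'] by blast
    hence e1: "e' = (\<lambda>j. if j = 1 then e' 1 else 0)" by (intro ext) auto
    hence "(\<lambda>j. if j = 1 then e' 1 else 0) \<in> wset (bvars m i) (weight m) (e 1)" using e' by simp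
    hence eq: "e' 1 = e 1" using i by (simp add: delta_wset)
    have "e' = (\<lambda>j. if j = 1 then e 1 else 0)" using e1 unfolding eq .
    thus False using e'(2) by contradiction
   qed
  qed
  thus ?thesis using r(3) e by simp
 qed (use r(2) in blast)
 thus "r e = \<zero>\<^sub>R e" by (simp add: ps_zero)
qed

lemma pure_coefficient:
 assumes f: "f \<in> ker" and i: "i < m" "bvars m i = {k}" "weight m k = 1"
 shows "f (\<lambda>j. if j = k then d else 0) = \<zero>"
proof -
 have "\<Psi> f i d = f (\<lambda>j. if j = k then d else 0)"
 proof (rule \<Psi>_single[OF i(1)])
  show "f \<in> carrier R" using f by (simp add: ker_def)
  show "(\<lambda>j. if j = k then d else 0) \<in> wset (bvars m i) (weight m) d" unfolding delta_wset[OF i(1)] using i(2,3) by simp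
  fix e' assume e': "e' \<in> wset (bvars m i) (weight m) d" "e' \<noteq> (\<lambda>j. if j = k then d else 0)"
  hence "e' = (\<lambda>j. if j = k then d else 0)" using i by (auto simp: wset_def wdeg_def exponents_def)
  thus "f e' = \<zero>" using e' by simp
 qed
 thus ?thesis using f i by (simp add: ker_def)
qed

text \<open>Vanishing on the axis \<open>(t, 0)\<close> makes \<open>f\<close> divisible by
  \<open>x_2\<close>. Dividing the cofactor by \<open>x_2 - x_1^2\<close> leaves a series in
  \<open>x_1\<close> alone. Along \<open>(t, t^2)\<close> the factor \<open>x_2\<close> becomes a
  shift by two degrees, so this series vanishes as well.\<close>

lemma ker_2:
 assumes m: "m = 2" and f: "f \<in> ker"
 shows "f \<in> I"
proof -
 have V: "V = {1, 2}" using m V_12 by auto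
 hence V': "1 \<in> V" "2 \<in> V" by auto
 have b: "bvars m 0 = {1, 2}" "weight m 1 = 1" "weight m 2 = 2" "bvars m 1 = {1}" using m by (simp_all add: bvars_def weight_def)
 have m1: "1 < m" using m by simp
 have fc: "f \<in> carrier R" using f by (simp add: ker_def)
 let ?\<mu> = "\<lambda>j. if j = 2 then 1 else 0 :: nat"
 have \<mu>: "?\<mu> \<in> exponents V" using delta_exponents[OF V'(2)] .
 obtain f' where f': "f' \<in> carrier R" "f = mon ?\<mu> **\<^sub>R f'"
 proof (rule bexE[OF divide_by_monomial[OF \<mu> fc]])
  fix e assume e: "?\<mu> \<notin> below e"
  hence "e 2 = 0" by (auto simp: below_def split: if_splits)
  show "f e = \<zero>"
  proof (cases "e \<in> exponents V")
   case True
   hence "e = (\<lambda>j. if j = 1 then e 1 else 0)" using V \<open>e 2 = 0\<close> by (intro two_exponents) (auto simp: exponents_def)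
   thus ?thesis using pure_coefficient[OF f m1 b(4,2), of "e 1"] by simp
  qed (use ps_outside[OF fc] in blast)
 qed
 define y where "y = x 2 \<ominus>\<^sub>R (x 1 [^]\<^sub>R (2::nat))"
 have yI: "x 2 **\<^sub>R y \<in> I" using gens_I gens_2[OF m] by (simp add: y_def)
 have yc: "y \<in> carrier R" "x 2 \<in> carrier R" using V' by (auto simp: y_def)
 obtain g r where gr: "g \<in> carrier R" "r \<in> carrier R" "f' = y **\<^sub>R g \<oplus>\<^sub>R r" "\<And>e. 1 \<le> e 2 ==> r e = \<zero>"
 proof -
  have y1: "y = x 2 [^]\<^sub>R (1::nat) \<ominus>\<^sub>R x 1 [^]\<^sub>R (2::nat)" using V' by (simp add: y_def)
  show ?thesis using divide_12[OF V' f'(1) pos2, of 1] that unfolding y1 by blast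
 qed
 have fx: "f = (x 2 **\<^sub>R y) **\<^sub>R g \<oplus>\<^sub>R x 2 **\<^sub>R r"
  unfolding f'(2) gr(3) var_mon[symmetric] using gr(1,2) yc by (simp add: PS.r_distr PS.m_assoc)
 have ygI: "(x 2 **\<^sub>R y) **\<^sub>R g \<in> I" using yI gr(1) I_ideal by (simp add: ideal.I_r_closed)
 have "r = \<zero>\<^sub>R"
 proof (rule one_variable_zero[OF m_pos])
  show "1 \<in> bvars m 0" "weight m 1 = 1" using b by auto
  show "r e = \<zero>" if "j \<noteq> 1" "0 < e j" for e j
  proof (cases "e \<in> exponents V")
   case True
   have "j = 2" using two_exponents_support[OF True[unfolded V] that] .
   hence "1 \<le> e 2" using that(2) by simp
   thus ?thesis by (rule gr(4))
  qed (use ps_outside[OF gr(2)] in blast)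
  fix d
  have "\<Psi> (x 2 **\<^sub>R r) 0 (2 + d) = \<zero>" using ygI I_subset_ker gr(2) yc by (intro ker_remainder[OF f _ _ fx m_pos]) auto
  moreover have "?\<mu> \<in> wset (bvars m 0) (weight m) 2" unfolding delta_wset[OF m_pos] using b by simp
  ultimately show "\<Psi> r 0 d = \<zero>" using \<Psi>_mon_mult[OF m_pos _ gr(2), of ?\<mu> 2 d] by (simp add: var_mon)
 qed (rule gr(2))
 thus ?thesis using fx ygI yc gr by simp
qed

text \<open>Vanishing on both axes removes the pure powers and makes \<open>f\<close> divisible by
  \<open>x_1 x_2\<close>. Division of the cofactor by \<open>x_2 - x_1\<close> leaves a series in
  \<open>x_1\<close>, which the diagonal detects after a shift by two degrees.\<close>

lemma ker_3:
 assumes m: "m = 3" and f: "f \<in> ker"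
 shows "f \<in> I"
proof -
 have V: "V = {1, 2}" using m V_12 by auto
 hence V': "1 \<in> V" "2 \<in> V" by auto
 have b: "bvars m 2 = {1, 2}" "weight m 1 = 1" "weight m 2 = 1" "bvars m 0 = {1}" "bvars m 1 = {2}" using m by (auto simp: bvars_def weight_def)
 have m1: "1 < m" "2 < m" using m by auto
 have fc: "f \<in> carrier R" using f by (simp add: ker_def)
 let ?\<mu> = "\<lambda>j. if j = 1 \<or> j = 2 then 1 else 0 :: nat"
 have \<mu>: "?\<mu> \<in> exponents V" using V by (auto simp: exponents_def)
 obtain f' where f': "f' \<in> carrier R" "f = mon ?\<mu> **\<^sub>R f'"
 proof (rule bexE[OF divide_by_monomial[OF \<mu> fc]])
  fix e assume e: "?\<mu> \<notin> below e"
  hence e12: "e 1 = 0 \<or> e 2 = 0" by (auto simp: below_def split: if_splits)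
  show "f e = \<zero>"
  proof (cases "e \<in> exponents V")
   case True
   from e12 show ?thesis
   proof
    assume "e 2 = 0"
    hence "e = (\<lambda>j. if j = 1 then e 1 else 0)" using V True by (intro two_exponents) (auto simp: exponents_def)
    thus ?thesis using pure_coefficient[OF f m_pos b(4,2), of "e 1"] by simp
   next
    assume "e 1 = 0"
    hence "e = (\<lambda>j. if j = 2 then e 2 else 0)" using V True by (intro two_exponents) (auto simp: exponents_def)
    thus ?thesis using pure_coefficient[OF f m1(1) b(5,3), of "e 2"] by simp
   qed
  qed (use ps_outside[OF fc] in blast)
 qed
 have xy: "mon ?\<mu> = x 1 **\<^sub>R x 2"
 proof -
  have "x 1 **\<^sub>R x 2 = mon (\<lambda>j::nat. (if j = 1 then 1 else 0) + (if j = 2 then 1 else 0))"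
   unfolding var_mon using delta_exponents[OF V'(1), of 1] delta_exponents[OF V'(2), of 1] by (intro mon_mon) auto
  also have "(\<lambda>j::nat. (if j = 1 then 1 else 0) + (if j = 2 then 1 else 0)) = ?\<mu>" by (intro ext) auto
  finally show ?thesis by simp
 qed
 define y where "y = x 2 \<ominus>\<^sub>R x 1"
 let ?z = "x 1 **\<^sub>R x 2"
 have yI: "?z **\<^sub>R y \<in> I" using gens_I gens_3[OF m] by (simp add: y_def)
 have yc: "y \<in> carrier R" "?z \<in> carrier R" using V' by (auto simp: y_def)
 obtain g r where gr: "g \<in> carrier R" "r \<in> carrier R" "f' = y **\<^sub>R g \<oplus>\<^sub>R r" "\<And>e. 1 \<le> e 2 ==> r e = \<zero>"
 proof -
  have y1: "y = x 2 [^]\<^sub>R (1::nat) \<ominus>\<^sub>R x 1 [^]\<^sub>R (1::nat)" using V' by (simp add: y_def)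
  show ?thesis using divide_12[OF V' f'(1) zero_less_one, of 1] that unfolding y1 by blast
 qed
 have fx: "f = (?z **\<^sub>R y) **\<^sub>R g \<oplus>\<^sub>R ?z **\<^sub>R r"
  unfolding f'(2) xy gr(3) using gr(1,2) yc by (simp add: PS.r_distr PS.m_assoc)
 have ygI: "(?z **\<^sub>R y) **\<^sub>R g \<in> I" using yI gr(1) I_ideal by (simp add: ideal.I_r_closed)
 have "r = \<zero>\<^sub>R"
 proof (rule one_variable_zero[OF m1(2)])
  show "1 \<in> bvars m 2" "weight m 1 = 1" using b by auto
  show "r e = \<zero>" if "j \<noteq> 1" "0 < e j" for e j
  proof (cases "e \<in> exponents V")
   case True
   have "j = 2" using two_exponents_support[OF True[unfolded V] that] .
   hence "1 \<le> e 2" using that(2) by simp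
   thus ?thesis by (rule gr(4))
  qed (use ps_outside[OF gr(2)] in blast)
  fix d
  have "\<Psi> (?z **\<^sub>R r) 2 (2 + d) = \<zero>" using ygI I_subset_ker gr(2) yc by (intro ker_remainder[OF f _ _ fx m1(2)]) auto
  moreover have "?\<mu> \<in> wset (bvars m 2) (weight m) 2" using b by (auto simp: wset_def wdeg_def exponents_def)
  ultimately show "\<Psi> r 2 d = \<zero>" using \<Psi>_mon_mult[OF m1(2) _ gr(2), of ?\<mu> 2 d] unfolding xy by simp
 qed (rule gr(2))
 thus ?thesis using fx ygI yc gr by simp
qed

end

section \<open>The kernel of the parametrization\<close>

lemma (in ideal) sum_closed: "a \<in> I ==> b \<in> I ==> a \<oplus> b \<in> I" by (rule additive_subgroup.a_closed[OF additive_subgroup_axioms])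

lemma (in ideal) minus_closed': "a \<in> I ==> \<ominus> a \<in> I" by (rule additive_subgroup.a_inv_closed[OF additive_subgroup_axioms])

lemma (in ideal) zero_mem: "\<zero> \<in> I" by (rule additive_subgroup.zero_closed[OF additive_subgroup_axioms])

lemma (in ideal) congruence_finsum:
 assumes "cring R" "finite P" "\<And>p. p \<in> P ==> a p \<in> carrier R" "\<And>p. p \<in> P ==> g p \<in> carrier R"
  "\<And>p. p \<in> P ==> a p \<ominus> z ** g p \<in> I" "z \<in> carrier R"
 shows "finsum R a P \<ominus> z ** finsum R g P \<in> I" using assms(2-5)
proof (induction P rule: finite_induct)
 case empty
 thus ?case using assms(6) by (simp add: a_minus_def zero_mem)
next
 case (insert p P)
 interpret cring R by fact
 have c: "a p \<in> carrier R" "g p \<in> carrier R" "finsum R a P \<in> carrier R" "finsum R g P \<in> carrier R" using insert by auto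
 have "finsum R a (insert p P) \<ominus> z ** finsum R g (insert p P) =
   (a p \<oplus> finsum R a P) \<ominus> z ** (g p \<oplus> finsum R g P)" using insert c by (simp add: finsum_insert Pi_iff)
 also have "... = (a p \<ominus> z ** g p) \<oplus> (finsum R a P \<ominus> z ** finsum R g P)" using c assms(6) by algebra
 also have "... \<in> I" using insert by (intro sum_closed) auto
 finally show ?case .
qed

lemma (in ideal) congruence_trans:
 assumes "a \<ominus> b \<in> I" "b \<ominus> c \<in> I" "a \<in> carrier R" "b \<in> carrier R" "c \<in> carrier R"
 shows "a \<ominus> c \<in> I"
proof -
 have "a \<ominus> c = (a \<ominus> b) \<oplus> (b \<ominus> c)"
  using assms(3-5) by (simp add: a_minus_def a_assoc[symmetric]) (simp add: a_assoc l_neg)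
 thus ?thesis using sum_closed[OF assms(1,2)] by simp
qed

lemma exponents_mono: "S \<subseteq> T ==> exponents S \<subseteq> exponents T" unfolding exponents_def by blast

context elliptic_ring
begin

text \<open>The generators allow one index of a mixed product to be exchanged as long as it stays
  distinct from the other. Passing through a product that contains \<open>x 1\<close>, every mixed
  product becomes congruent to \<open>x 1 ** x 2\<close>.\<close>

lemma elliptic_quadrics:
 assumes m: "m \<ge> 4" and hi: "h \<in> V" "i \<in> V" "h \<noteq> i"
 shows "x h **\<^sub>R x i \<ominus>\<^sub>R x 1 **\<^sub>R x 2 \<in> I"
proof -
 interpret I: ideal I R by (rule I_ideal)
 have V12: "1 \<in> V" "2 \<in> V" using m by (auto simp: elliptic_vars_def)
 have step: "x h **\<^sub>R x i \<ominus>\<^sub>R x h **\<^sub>R x j \<in> I" if "h \<in> V" "i \<in> V" "j \<in> V" "h \<noteq> i" "h \<noteq> j" for h i j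
 proof (cases "i = j")
  case True
  thus ?thesis using that I.zero_mem by (simp add: a_minus_def PS.r_neg)
 next
  case False
  have "x h **\<^sub>R (x i \<ominus>\<^sub>R x j) \<in> I" using gens_I that False unfolding gens_4[OF m] by blast
  moreover have "x h **\<^sub>R (x i \<ominus>\<^sub>R x j) = x h **\<^sub>R x i \<ominus>\<^sub>R x h **\<^sub>R x j"
   using var_closed[OF that(1)] var_closed[OF that(2)] var_closed[OF that(3)] by (simp add: a_minus_def PS.r_distr PS.r_minus)
  ultimately show ?thesis by simp
 qed
 have one: "x 1 **\<^sub>R x k \<ominus>\<^sub>R x 1 **\<^sub>R x 2 \<in> I" if "k \<in> V" "k \<noteq> 1" for k using step[of 1 k 2] that V12 by simp
 show ?thesis
 proof (cases "h = 1")
  case True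
  thus ?thesis using one[of i] hi by simp
 next
  case h1: False
  show ?thesis
  proof (cases "i = 1")
   case True
   thus ?thesis using one[OF hi(1) h1] PS.m_comm[of "x h" "x 1"] hi V12 by simp
  next
   case False
   have "x h **\<^sub>R x i \<ominus>\<^sub>R x 1 **\<^sub>R x h \<in> I" using step[of h i 1] hi V12 h1 False PS.m_comm[of "x h" "x 1"] by simp
   thus ?thesis by (rule I.congruence_trans[OF _ one[OF hi(1) h1]]) (use hi V12 in auto)
  qed
 qed
qed

text \<open>For \<open>i \<noteq> 2\<close> this is \<open>x 1\<close> times the congruence of
  \<open>x 2 ** x i\<close> with \<open>x 1 ** x 2\<close>. For \<open>i = 2\<close> a third
  variable mediates: both \<open>x_1 x_2^2\<close> and \<open>x_1^2 x_2\<close> are congruent to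
  \<open>x_1 x_2 x_3\<close>, which is where \<open>m \<ge> 4\<close> enters.\<close>

lemma elliptic_cubics:
 assumes m: "m \<ge> 4" and i: "i \<in> V"
 shows "x 1 **\<^sub>R x 2 **\<^sub>R (x i \<ominus>\<^sub>R x 1) \<in> I"
proof -
 interpret I: ideal I R by (rule I_ideal)
 have V12: "1 \<in> V" "2 \<in> V" "3 \<in> V" using m by (auto simp: elliptic_vars_def)
 have c: "x 1 \<in> carrier R" "x 2 \<in> carrier R" "x 3 \<in> carrier R" "x i \<in> carrier R" using V12 i by auto
 have q: "x 2 **\<^sub>R x k \<ominus>\<^sub>R x 1 **\<^sub>R x 2 \<in> I" if "k \<in> V" "k \<noteq> 2" for k
  using elliptic_quadrics[OF m V12(2) that(1)] that by simp
 have mul: "x 1 **\<^sub>R x 2 **\<^sub>R (x k \<ominus>\<^sub>R x 1) \<in> I" if "k \<in> V" "k \<noteq> 2" for k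
 proof -
  have kc: "x k \<in> carrier R" using that by simp
  have "x 1 **\<^sub>R x 2 **\<^sub>R (x k \<ominus>\<^sub>R x 1) = x 1 **\<^sub>R (x 2 **\<^sub>R x k \<ominus>\<^sub>R x 1 **\<^sub>R x 2)"
   using c(1,2) kc by algebra
  thus ?thesis using I.I_l_closed[OF q[OF that] c(1)] by simp
 qed
 show ?thesis
 proof (cases "i = 2")
  case False
  thus ?thesis using mul i by blast
 next
  case True
  have "x 1 **\<^sub>R x 2 **\<^sub>R (x 2 \<ominus>\<^sub>R x 1) =
    \<ominus>\<^sub>R (x 2 **\<^sub>R (x 1 **\<^sub>R x 3 \<ominus>\<^sub>R x 1 **\<^sub>R x 2)) \<oplus>\<^sub>R x 1 **\<^sub>R (x 2 **\<^sub>R x 3 \<ominus>\<^sub>R x 1 **\<^sub>R x 2)"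
   using c(1-3) by algebra
  also have "... \<in> I"
  proof (intro I.sum_closed I.minus_closed' I.I_l_closed c(1,2))
   show "x 1 **\<^sub>R x 3 \<ominus>\<^sub>R x 1 **\<^sub>R x 2 \<in> I" using elliptic_quadrics[OF m V12(1,3)] by simp
   show "x 2 **\<^sub>R x 3 \<ominus>\<^sub>R x 1 **\<^sub>R x 2 \<in> I" using q[OF V12(3)] by simp
  qed
  finally show ?thesis by (simp add: True)
 qed
qed

text \<open>In front of the factor \<open>x 1 ** x 2\<close> each variable may be replaced by
  \<open>x 1\<close>, according to the cubics. Replacing \<open>x t\<close> means taking the
  remainder of the division by \<open>x t - x 1\<close>; the last clause of
  \<open>divide_by_binomial\<close> guarantees that variables eliminated earlier do not come
  back.\<close>

lemma eliminate_variables: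
 assumes m: "m \<ge> 4" and T: "finite T" "T \<subseteq> V - {1}" and G: "G \<in> carrier R"
 shows "\<exists>G'\<in>carrier R. x 1 **\<^sub>R x 2 **\<^sub>R G \<ominus>\<^sub>R x 1 **\<^sub>R x 2 **\<^sub>R G' \<in> I \<and>
  (\<forall>t\<in>T. \<forall>e. 0 < e t --> G' e = \<zero>)" using T
proof (induction T rule: finite_induct)
 case empty
 interpret I: ideal I R by (rule I_ideal)
 have "1 \<in> V" "2 \<in> V" using m by (auto simp: elliptic_vars_def)
 hence "x 1 **\<^sub>R x 2 \<in> carrier R" by simp
 thus ?case using G I.zero_mem by (intro bexI[of _ G]) (auto simp: a_minus_def PS.r_neg)
next
 case (insert t T)
 interpret I: ideal I R by (rule I_ideal)
 have V: "1 \<in> V" "2 \<in> V" "t \<in> V" "1 \<noteq> t" using m insert.prems by (auto simp: elliptic_vars_def)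
 have c: "x 1 \<in> carrier R" "x 2 \<in> carrier R" "x t \<in> carrier R" using V by auto
 define z where "z = x 1 **\<^sub>R x 2"
 have z: "z \<in> carrier R" using c by (simp add: z_def)
 obtain G1 where G1: "G1 \<in> carrier R" "z **\<^sub>R G \<ominus>\<^sub>R z **\<^sub>R G1 \<in> I" "\<And>s e. s \<in> T ==> 0 < e s ==> G1 e = \<zero>"
  using insert unfolding z_def by auto
 obtain g r where gr: "g \<in> carrier R" "r \<in> carrier R"
  "G1 = (x t [^]\<^sub>R (1::nat) \<ominus>\<^sub>R x 1 [^]\<^sub>R (1::nat)) **\<^sub>R g \<oplus>\<^sub>R r"
  "\<forall>e. 1 \<le> e t --> r e = \<zero>"
  "\<forall>s. s \<noteq> 1 --> s \<noteq> t --> (\<forall>e. 0 < e s --> G1 e = \<zero>) --> (\<forall>e. 0 < e s --> r e = \<zero>)"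
  using divide_by_binomial[OF V(1,3,4) zero_less_one G1(1), of 1] by blast
 have y: "x t [^]\<^sub>R (1::nat) \<ominus>\<^sub>R x 1 [^]\<^sub>R (1::nat) = x t \<ominus>\<^sub>R x 1" using c by simp
 define y where "y = x t \<ominus>\<^sub>R x 1"
 have yc: "y \<in> carrier R" using c by (simp add: y_def)
 have G1eq: "G1 = y **\<^sub>R g \<oplus>\<^sub>R r" using gr(3) unfolding y y_def .
 have "(z **\<^sub>R y) **\<^sub>R g \<in> I" using elliptic_cubics[OF m V(3)] gr(1) unfolding z_def y_def by (rule I.I_r_closed)
 moreover have "z **\<^sub>R G1 \<ominus>\<^sub>R z **\<^sub>R r = (z **\<^sub>R y) **\<^sub>R g" unfolding G1eq using z yc gr(1,2) by algebra
 ultimately have "z **\<^sub>R G1 \<ominus>\<^sub>R z **\<^sub>R r \<in> I" by simp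
 hence 1: "z **\<^sub>R G \<ominus>\<^sub>R z **\<^sub>R r \<in> I" by (rule I.congruence_trans[OF G1(2)]) (use z G G1 gr in auto)
 have 2: "\<forall>s\<in>insert t T. \<forall>e. 0 < e s --> r e = \<zero>"
 proof (intro ballI allI impI)
  fix s and e :: "nat => nat" assume s: "s \<in> insert t T" "0 < e s"
  show "r e = \<zero>"
  proof (cases "s = t")
   case True
   hence "1 \<le> e t" using s(2) by simp
   thus ?thesis using gr(4) by blast
  next
   case False
   hence "s \<in> T" using s by auto
   hence "s \<noteq> 1" using insert.prems by auto
   thus ?thesis using gr(5) False G1(3)[OF \<open>s \<in> T\<close>] s(2) by blast
  qed
 qed
 show ?case using 1 2 gr(2) unfolding z_def by blast
qed

definition "mixed e \<longleftrightarrow> (\<exists>h\<in>V. \<exists>i\<in>V. h \<noteq> i \<and> 0 < e h \<and> 0 < (e i :: nat))"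

lemma pure_exponent:
 assumes "e \<in> exponents V" "\<not> mixed e" "V \<noteq> {}"
 shows "\<exists>k\<in>V. \<exists>d. e = (\<lambda>j. if j = k then d else 0)"
proof (cases "\<exists>k\<in>V. 0 < e k")
 case True
 then obtain k where k: "k \<in> V" "0 < e k" by blast
 have "e j = 0" if "j \<noteq> k" for j
 proof (cases "j \<in> V")
  case True
  show ?thesis
  proof (rule ccontr)
   assume "e j \<noteq> 0"
   hence "mixed e" unfolding mixed_def using k True that by blast
   thus False using assms(2) by contradiction
  qed
 next
  case False
  thus ?thesis using assms(1) by (simp add: exponents_def)
 qed
 hence "e = (\<lambda>j. if j = k then e k else 0)" by (intro ext) auto
 thus ?thesis using k by blast
next
 case False
 obtain k where k: "k \<in> V" using assms(3) by blast
 have "e j = 0" for j using False assms(1) by (cases "j \<in> V") (auto simp: exponents_def)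
 hence "e = (\<lambda>j. if j = k then 0 else 0)" by auto
 thus ?thesis using k by blast
qed

text \<open>Each mixed monomial is assigned to one pair of distinct variables dividing it
  (\<open>pick\<close>). As there are finitely many pairs, \<open>f\<close> is a finite sum of
  products of a quadric and a series, and each quadric may be replaced by \<open>x 1 ** x 2\<close>
  modulo the ideal.\<close>

lemma mixed_part:
 assumes m: "m \<ge> 4" and f: "f \<in> carrier R" "\<And>e. e \<in> exponents V ==> \<not> mixed e ==> f e = \<zero>"
 shows "\<exists>G\<in>carrier R. f \<ominus>\<^sub>R x 1 **\<^sub>R x 2 **\<^sub>R G \<in> I"
proof -
 interpret I: ideal I R by (rule I_ideal)
 have V: "1 \<in> V" "2 \<in> V" using m by (auto simp: elliptic_vars_def)
 define P where "P = {p \<in> V \<times> V. fst p \<noteq> snd p}"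
 have P: "finite P" using V_finite by (auto simp: P_def)
 define pick where "pick e = (SOME p. p \<in> P \<and> 0 < e (fst p) \<and> 0 < (e (snd p) :: nat))" for e
 have pick: "pick e \<in> P" "0 < e (fst (pick e))" "0 < e (snd (pick e))" if "mixed e" for e
 proof -
  have "\<exists>p. p \<in> P \<and> 0 < e (fst p) \<and> 0 < e (snd p)" using that by (auto simp: mixed_def P_def)
  hence "pick e \<in> P \<and> 0 < e (fst (pick e)) \<and> 0 < e (snd (pick e))" unfolding pick_def by (rule someI_ex)
  thus "pick e \<in> P" "0 < e (fst (pick e))" "0 < e (snd (pick e))" by auto
 qed
 define a where "a p e = (if mixed e \<and> pick e = p then f e else \<zero>)" for p e
 have ac: "a p \<in> carrier R" for p using f ps_outside[OF f(1)] by (intro ps_carrierI) (auto simp: a_def)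
 have "\<exists>g. g \<in> carrier R \<and> a p = (x (fst p) **\<^sub>R x (snd p)) **\<^sub>R g" if p: "p \<in> P" for p
 proof -
  let ?\<mu> = "\<lambda>j. (if j = fst p then 1 else 0) + (if j = snd p then 1 else 0 :: nat)"
  have pV: "fst p \<in> V" "snd p \<in> V" "fst p \<noteq> snd p" using p by (auto simp: P_def)
  have xy: "x (fst p) **\<^sub>R x (snd p) = mon ?\<mu>"
   unfolding var_mon using delta_exponents[OF pV(1), of 1] delta_exponents[OF pV(2), of 1] by (intro mon_mon) auto
  have \<mu>: "?\<mu> \<in> exponents V" using pV by (auto simp: exponents_def)
  have "a p e = \<zero>" if e: "?\<mu> \<notin> below e" for e
  proof (rule ccontr)
   assume "a p e \<noteq> \<zero>"
   hence "mixed e" "pick e = p" by (auto simp: a_def split: if_splits)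
   hence "0 < e (fst p)" "0 < e (snd p)" using pick by auto
   hence "?\<mu> \<in> below e" using pV by (auto simp: below_def)
   thus False using e by contradiction
  qed
  thus ?thesis using divide_by_monomial[OF \<mu> ac[of p]] unfolding xy by blast
 qed
 hence "\<forall>p\<in>P. \<exists>g. g \<in> carrier R \<and> a p = (x (fst p) **\<^sub>R x (snd p)) **\<^sub>R g" by blast
 from bchoice[OF this] obtain g where
  g: "\<forall>p\<in>P. g p \<in> carrier R \<and> a p = (x (fst p) **\<^sub>R x (snd p)) **\<^sub>R g p" by blast
 define z where "z = x 1 **\<^sub>R x 2"
 have z: "z \<in> carrier R" using V by (simp add: z_def)
 have "a p \<ominus>\<^sub>R z **\<^sub>R g p \<in> I" if p: "p \<in> P" for p
 proof -
  have pV: "fst p \<in> V" "snd p \<in> V" "fst p \<noteq> snd p" using p by (auto simp: P_def)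
  define y where "y = x (fst p) **\<^sub>R x (snd p)"
  have yc: "y \<in> carrier R" using pV by (simp add: y_def)
  have "(y \<ominus>\<^sub>R z) **\<^sub>R g p \<in> I" unfolding y_def z_def using elliptic_quadrics[OF m pV] g p by (intro I.I_r_closed) auto
  moreover have "(y \<ominus>\<^sub>R z) **\<^sub>R g p = y **\<^sub>R g p \<ominus>\<^sub>R z **\<^sub>R g p"
   using yc z g p by (simp add: a_minus_def PS.l_distr PS.l_minus)
  ultimately show ?thesis using g p by (simp add: y_def)
 qed
 hence "finsum R a P \<ominus>\<^sub>R z **\<^sub>R finsum R g P \<in> I" by (intro I.congruence_finsum[OF ps_cring P ac _ _ z]) (use g in auto)
 moreover have "f = finsum R a P"
 proof
  fix e
  have "finsum R a P e = (\<Oplus>p\<in>P. a p e)" using P ac by (intro ps_finsum) auto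
  also have "... = f e"
  proof (cases "mixed e")
   case True
   hence "(\<Oplus>p\<in>P. a p e) = a (pick e) e" using P pick(1) f(1) by (intro finsum_single_support) (auto simp: a_def)
   thus ?thesis using True by (simp add: a_def)
  next
   case False
   hence "f e = \<zero>" using f ps_outside[OF f(1)] by blast
   moreover have "(\<Oplus>p\<in>P. a p e) = (\<Oplus>p\<in>P. \<zero>)" using False by (intro finsum_cong') (auto simp: a_def)
   ultimately show ?thesis by simp
  qed
  finally show "f e = finsum R a P e" ..
 qed
 ultimately show ?thesis unfolding z_def using g by (intro bexI[of _ "finsum R g P"]) auto
qed

text \<open>The axes force the pure powers in \<open>f\<close> to vanish. Modulo the ideal, the
  mixed rest is \<open>x 1 ** x 2\<close> times a series \<open>H\<close> in \<open>x 1\<close>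
  alone, and the diagonal, on which \<open>x 1 ** x 2\<close> is a shift by two degrees, forces
  \<open>H = 0\<close>.\<close>

lemma ker_4:
 assumes m: "m \<ge> 4" and f: "f \<in> ker"
 shows "f \<in> I"
proof -
 have fc: "f \<in> carrier R" using f by (simp add: ker_def)
 interpret I: ideal I R by (rule I_ideal)
 interpret ker: ideal ker R by (rule ker_ideal)
 have V: "V = {1..m - 1}" "1 \<in> V" "2 \<in> V" using m by (auto simp: elliptic_vars_def)
 have w: "weight m k = 1" for k using m by (simp add: weight_def)
 have pure: "f e = \<zero>" if e: "e \<in> exponents V" "\<not> mixed e" for e
 proof -
  obtain k d where k: "k \<in> V" "e = (\<lambda>j. if j = k then d else 0)" using pure_exponent[OF e] V by blast
  hence "k - 1 < m" "bvars m (k - 1) = {k}" using m V by (auto simp: bvars_def)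
  thus ?thesis using pure_coefficient[OF f _ _ w] k(2) by blast
 qed
 define z where "z = x 1 **\<^sub>R x 2"
 have z: "z \<in> carrier R" using V(2,3) by (simp add: z_def)
 obtain G where G: "G \<in> carrier R" "f \<ominus>\<^sub>R z **\<^sub>R G \<in> I" using mixed_part[OF m fc pure] unfolding z_def by blast
 obtain H where H: "H \<in> carrier R" "z **\<^sub>R G \<ominus>\<^sub>R z **\<^sub>R H \<in> I" "\<And>t e. t \<in> V - {1} ==> 0 < e t ==> H e = \<zero>"
  using eliminate_variables[OF m _ subset_refl G(1)] V_finite unfolding z_def by blast
 have fH: "f \<ominus>\<^sub>R z **\<^sub>R H \<in> I" by (rule I.congruence_trans[OF G(2) H(2)]) (use fc z G H in auto)
 let ?b = "m - 1"
 have b: "?b < m" "bvars m ?b = V" using m V by (auto simp: bvars_def)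
 let ?\<mu> = "\<lambda>j::nat. (if j = 1 then 1 else 0) + (if j = 2 then 1 else 0 :: nat)"
 have z\<mu>: "z = mon ?\<mu>" unfolding z_def var_mon using delta_exponents[OF V(2), of 1] delta_exponents[OF V(3), of 1] by (intro mon_mon) auto
 have \<mu>: "?\<mu> \<in> wset (bvars m ?b) (weight m) 2"
 proof -
  have "(\<Sum>i\<in>V. ?\<mu> i) = (\<Sum>i\<in>V. if i = 1 then 1 else 0) + (\<Sum>i\<in>V. if i = 2 then 1 else 0)" by (rule sum.distrib)
  also have "... = 2" using V V_finite by simp
  finally have "(\<Sum>i\<in>V. ?\<mu> i) = 2" .
  thus ?thesis using V(2,3) unfolding b(2) wset_def wdeg_def w by (auto simp: exponents_def)
 qed
 have zH: "z **\<^sub>R H \<in> ker"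
 proof -
  have "f \<ominus>\<^sub>R z **\<^sub>R H \<in> ker" using fH I_subset_ker by blast
  hence "f \<ominus>\<^sub>R (f \<ominus>\<^sub>R z **\<^sub>R H) \<in> ker"
   using ker.sum_closed[OF f ker.minus_closed'] unfolding a_minus_def[of R f] by blast
  moreover have "f \<ominus>\<^sub>R (f \<ominus>\<^sub>R z **\<^sub>R H) = z **\<^sub>R H" using fc z H(1) by algebra
  ultimately show ?thesis by simp
 qed
 have "H = \<zero>\<^sub>R"
 proof (rule one_variable_zero[OF b(1) _ w H(1)])
  show "1 \<in> bvars m ?b" using b V by simp
  show "H e = \<zero>" if "j \<noteq> 1" "0 < e j" for e j
  proof (cases "j \<in> V")
   case True
   thus ?thesis using H(3)[of j e] that by simp
  next
   case False
   hence "e \<notin> exponents V" using that by (auto simp: exponents_def)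
   thus ?thesis by (rule ps_outside[OF H(1)])
  qed
  fix d
  have "\<Psi> (z **\<^sub>R H) ?b (2 + d) = \<zero>" using zH b(1) unfolding ker_def by blast
  thus "\<Psi> H ?b d = \<zero>" using \<Psi>_mon_mult[OF b(1) \<mu> H(1), of d] unfolding z\<mu> by simp
 qed
 thus ?thesis using fH fc z by (simp add: a_minus_def)
qed

lemma ker_eq: "ker = I"
proof
 show "ker \<subseteq> I"
 proof
  fix f assume "f \<in> ker"
  thus "f \<in> I" using ker_1 ker_2 ker_3 ker_4 by (cases rule: m_cases) blast+
 qed
qed (rule I_subset_ker)

text \<open>The image of the parametrization.\<close>

definition "gluing F \<longleftrightarrow> (\<forall>i<m. \<forall>d. F i d \<in> carrier K) \<and> (\<forall>i<m. F i 0 = F 0 (0::nat)) \<and>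
  F (m - 1) 1 = (\<Oplus>i\<in>{..<m - 1}. F i 1)"

lemma gluing_closed: "gluing F ==> i < m ==> F i d \<in> carrier K"
 and gluing_0: "gluing F ==> i < m ==> F i 0 = F 0 0"
 and gluing_1: "gluing F ==> F (m - 1) 1 = (\<Oplus>i\<in>{..<m - 1}. F i 1)" unfolding gluing_def by blast+

section \<open>Gluing conditions on the branches and series that realize them\<close>

lemma wset_0: "i < m ==> wset (bvars m i) (weight m) 0 = {\<lambda>_. 0}"
proof -
 assume i: "i < m"
 interpret s: substitution K V "bvars m i" "weight m" by (rule branch[OF i])
 show ?thesis
 proof
  show "{\<lambda>_. 0} \<subseteq> wset (bvars m i) (weight m) 0" by (simp add: wset_def wdeg_def exponents_def)
  show "wset (bvars m i) (weight m) 0 \<subseteq> {\<lambda>_. 0}"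
  proof
   fix e assume e: "e \<in> wset (bvars m i) (weight m) 0"
   have "e j = 0" for j
   proof (cases "j \<in> bvars m i")
    case True
    hence "weight m j * e j = 0" using e s.S_finite by (auto simp: wset_def wdeg_def)
    thus ?thesis using s.w_pos[OF True] by simp
   next
    case False
    thus ?thesis using e by (auto simp: wset_def exponents_def)
   qed
   thus "e \<in> {\<lambda>_. 0}" by auto
  qed
 qed
qed

lemma \<Psi>_0: "i < m ==> f \<in> carrier R ==> \<Psi> f i 0 = f (\<lambda>_. 0)" by (simp add: parametrize_def subst_series_def wset_0)

lemma wset_single:
 assumes "i < m" "bvars m i = {k}" "weight m k = 1"
 shows "wset (bvars m i) (weight m) d = {\<lambda>j. if j = k then d else 0}"
proof -
 have "e \<in> wset {k} (weight m) d \<longleftrightarrow> e = (\<lambda>j. if j = k then d else 0)" for e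
 proof
  assume "e \<in> wset {k} (weight m) d"
  hence "\<And>j. j \<noteq> k ==> e j = 0" "e k = d" using assms(3) by (auto simp: wset_def wdeg_def exponents_def)
  thus "e = (\<lambda>j. if j = k then d else 0)" by (intro ext) simp
 qed (use assms(3) in "simp add: wset_def wdeg_def exponents_def")
 thus ?thesis unfolding assms(2) by blast
qed

lemma \<Psi>_branch_single:
 assumes "i < m" "bvars m i = {k}" "weight m k = 1" "f \<in> carrier R"
 shows "\<Psi> f i d = f (\<lambda>j. if j = k then d else 0)"
 unfolding parametrize_def subst_series_def wset_single[OF assms(1-3)] using assms(4) by simp

text \<open>On the diagonal the coefficient of degree \<open>d\<close> is the sum over all monomials
  of degree \<open>d\<close>, of which only the pure powers contribute here. Positivity of
  \<open>d\<close> makes the powers of different variables different monomials.\<close>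

lemma \<Psi>_diagonal:
 assumes m: "m \<ge> 3" and f: "f \<in> carrier R" and d: "0 < d"
  and z: "\<And>e. e \<in> wset V (weight m) d ==> mixed e ==> f e = \<zero>"
 shows "\<Psi> f (m - 1) d = (\<Oplus>i\<in>{..<m - 1}. f (\<lambda>j. if j = Suc i then d else 0))"
proof -
 have V: "V = {1..m - 1}" using m by (auto simp: elliptic_vars_def)
 have i: "m - 1 < m" using m by simp
 have bv: "bvars m (m - 1) = V" using m V by (auto simp: bvars_def)
 have w: "weight m k = 1" for k using m by (simp add: weight_def)
 interpret s: substitution K V V "weight m" using branch[OF i] unfolding bv .
 let ?\<delta> = "\<lambda>i j. if j = Suc i then d else 0"
 let ?D = "?\<delta> ` {..<m - 1}"
 have inj: "inj_on ?\<delta> {..<m - 1}"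
 proof (rule inj_onI)
  fix a b assume "?\<delta> a = ?\<delta> b"
  hence "?\<delta> a (Suc a) = ?\<delta> b (Suc a)" by (rule fun_cong)
  thus "a = b" using d by (auto split: if_splits)
 qed
 have sub: "?D \<subseteq> wset V (weight m) d"
 proof
  fix e assume "e \<in> ?D"
  then obtain k where k: "k < m - 1" "e = ?\<delta> k" by blast
  hence "Suc k \<in> V" using V by auto
  thus "e \<in> wset V (weight m) d" using delta_wset[OF i, of "Suc k" d d] k(2) unfolding bv w by simp
 qed
 have "\<Psi> f (m - 1) d = finsum K f (wset V (weight m) d)" unfolding parametrize_def subst_series_def bv ..
 also have "... = finsum K f ?D"
 proof (intro add.finprod_mono_neutral_cong_right s.wset_finite sub ballI refl)
  fix e assume e: "e \<in> wset V (weight m) d - ?D"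
  show "f e = \<zero>"
  proof (cases "mixed e")
   case False
   have "V \<noteq> {}" "e \<in> exponents V" using V m e by (auto simp: wset_def)
   then obtain k n where k: "k \<in> V" "e = (\<lambda>j. if j = k then n else 0)" using pure_exponent[of e] False by blast
   hence nd: "n = d" using e delta_wset[OF i, of k n d] unfolding bv w by simp
   have k': "k = Suc (k - 1)" "k - 1 < m - 1" using k V by auto
   have "e = ?\<delta> (k - 1)" using k(2) unfolding nd k'(1)[symmetric] .
   hence "e \<in> ?D" using k'(2) by (intro image_eqI[of _ _ "k - 1"]) auto
   thus ?thesis using e by simp
  qed (use e z in auto)
 qed (use f in auto)
 also have "... = (\<Oplus>i\<in>{..<m - 1}. f (?\<delta> i))" using f inj by (intro finsum_reindex) auto
 finally show ?thesis .
qed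

lemma branch_axis:
 assumes "m \<ge> 3" "i < m - 1"
 shows "i < m" "bvars m i = {Suc i}" "weight m (Suc i) = 1" using assms by (auto simp: bvars_def weight_def)

lemma wdeg_12: "wdeg {1, 2} w e = w 1 * e 1 + w 2 * e 2" by (simp add: wdeg_def)

text \<open>The linear condition has a different cause in each case. For \<open>m = 1\<close> the
  number 1 is not of the form \<open>2 a + 3 b\<close>. For \<open>m = 2\<close> the two branches
  share the tangent of \<open>x_1\<close>. For \<open>m \<ge> 3\<close> no mixed monomial has degree
  1, so the linear term on the diagonal is the sum of those on the axes.\<close>

lemma \<Psi>_gluing:
 assumes f: "f \<in> carrier R"
 shows "gluing (\<Psi> f)" unfolding gluing_def
proof (intro conjI allI impI)
 show "\<Psi> f i d \<in> carrier K" if "i < m" for i d using that f by simp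
 show "\<Psi> f i 0 = \<Psi> f 0 0" if "i < m" for i using that f m_pos by (simp add: \<Psi>_0)
 consider "m = 1" | "m = 2" | "m \<ge> 3" using m_pos by linarith
 thus "\<Psi> f (m - 1) 1 = (\<Oplus>i\<in>{..<m - 1}. \<Psi> f i 1)"
 proof cases
  case 1
  hence b: "bvars m 0 = {1, 2}" "weight m 1 = 2" "weight m 2 = 3" by (simp_all add: bvars_def weight_def)
  have "wset (bvars m 0) (weight m) 1 = {}" unfolding b wset_def wdeg_12 by (auto, presburger)
  hence "\<Psi> f 0 1 = \<zero>" by (simp add: parametrize_def subst_series_def)
  moreover have "m - 1 = 0" using 1 by simp
  ultimately show ?thesis by simp
 next
  case 2
  hence b: "bvars m 0 = {1, 2}" "bvars m 1 = {1}" "weight m 1 = 1" "weight m 2 = 2" by (simp_all add: bvars_def weight_def)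
  have m1: "1 < m" "m - 1 = 1" using 2 by auto
  let ?\<delta> = "\<lambda>j::nat. if j = 1 then 1 else 0 :: nat"
  have "\<Psi> f 0 1 = f ?\<delta>"
  proof (rule \<Psi>_single[OF m_pos f])
   show "?\<delta> \<in> wset (bvars m 0) (weight m) 1" unfolding delta_wset[OF m_pos] using b by simp
   fix e assume e: "e \<in> wset (bvars m 0) (weight m) 1" "e \<noteq> ?\<delta>"
   hence e': "e \<in> exponents {1, 2}" "e 1 + 2 * e 2 = 1" unfolding b wset_def wdeg_12 by auto
   hence "e 1 = 1" "e 2 = 0" by presburger+
   hence "e = ?\<delta>" using e'(1) by (intro two_exponents) (auto simp: exponents_def)
   thus "f e = \<zero>" using e(2) by contradiction
  qed
  moreover have "\<Psi> f 1 1 = f ?\<delta>" by (rule \<Psi>_branch_single[OF m1(1) b(2,3) f])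
  ultimately show ?thesis using f m1 m_pos unfolding m1(2) by (simp add: lessThan_Suc)
 next
  case 3
  have w: "weight m k = 1" for k using 3 by (simp add: weight_def)
  have "\<Psi> f (m - 1) 1 = (\<Oplus>i\<in>{..<m - 1}. f (\<lambda>j. if j = Suc i then 1 else 0))"
  proof (rule \<Psi>_diagonal[OF 3 f])
   fix e assume e: "e \<in> wset V (weight m) 1" "mixed e"
   then obtain h i where hi: "h \<in> V" "i \<in> V" "h \<noteq> i" "0 < e h" "0 < e i" by (auto simp: mixed_def)
   have "e h + e i \<le> (\<Sum>k\<in>V. e k)" using sum_mono2[of V "{h, i}" e] V_finite hi by simp
   also have "... = 1" using e(1) by (simp add: wset_def wdeg_def w)
   finally show "f e = \<zero>" using hi by simp
  qed simp
  also have "... = (\<Oplus>i\<in>{..<m - 1}. \<Psi> f i 1)"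
  proof (intro finsum_cong' refl)
   fix i assume "i \<in> {..<m - 1}"
   hence i: "i < m - 1" by simp
   show "f (\<lambda>j. if j = Suc i then 1 else 0) = \<Psi> f i 1" by (rule \<Psi>_branch_single[OF branch_axis[OF 3 i] f, symmetric])
  qed (use f in auto)
  finally show ?thesis .
 qed
qed

lemma \<Psi>_surj_1:
 assumes m: "m = 1" and F: "gluing F"
 shows "\<exists>f\<in>carrier R. \<forall>i<m. \<forall>d. \<Psi> f i d = F i d"
proof -
 have b: "bvars m 0 = {1, 2}" "weight m 1 = 2" "weight m 2 = 3" using m by (simp_all add: bvars_def weight_def)
 have V: "V = {1, 2}" using m V_12 by auto
 have Fc: "F 0 d \<in> carrier K" for d using gluing_closed[OF F m_pos] .
 have F1: "F 0 1 = \<zero>"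
 proof -
  have "m - 1 = 0" using m by simp
  moreover have "F (m - 1) 1 = (\<Oplus>i\<in>{..<m - 1}. F i 1)" using gluing_1[OF F] .
  ultimately show ?thesis by simp
 qed
 \<comment> \<open>Every weight other than 1 equals \<open>2 a + 3 b\<close> with exactly one choice
   of \<open>b < 2\<close>: even weights come from \<open>x_1^a\<close>, odd ones from
   \<open>x_1^a x_2\<close>. These monomials carry the prescribed coefficients.\<close>
 define f where "f e = (if e \<notin> exponents V then \<zero> else if e 2 = 0 then F 0 (2 * e 1) else if e 2 = 1 then F 0 (2 * e 1 + 3) else \<zero>)" for e :: "nat => nat"
 have f: "f \<in> carrier R" using Fc by (intro ps_carrierI) (auto simp: f_def)
 have wd: "e \<in> wset (bvars m 0) (weight m) d \<longleftrightarrow> e \<in> exponents V \<and> 2 * e 1 + 3 * e 2 = d" for e d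
  unfolding b V wset_def wdeg_12 by simp
 have "\<Psi> f 0 d = F 0 d" for d
 proof (cases "d = 1")
  case True
  have "wset (bvars m 0) (weight m) 1 = {}" unfolding b wset_def wdeg_12 by (auto, presburger)
  thus ?thesis using F1 True by (simp add: parametrize_def subst_series_def)
 next
  case False
  define e where "e = (\<lambda>j::nat. if j = 1 then (if even d then d div 2 else (d - 3) div 2) else if j = 2 then (if even d then 0 else 1) else 0)"
  have eV: "e \<in> exponents V" unfolding V by (auto simp: e_def exponents_def)
  have e12: "e 1 = (if even d then d div 2 else (d - 3) div 2)" "e 2 = (if even d then 0 else 1)" by (auto simp: e_def)
  have ed: "2 * e 1 + 3 * e 2 = d" unfolding e12 using False by (cases "even d") (auto, presburger)
  have "\<Psi> f 0 d = f e"
  proof (rule \<Psi>_single[OF m_pos f])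
   show "e \<in> wset (bvars m 0) (weight m) d" using eV ed wd by blast
   fix e' assume e': "e' \<in> wset (bvars m 0) (weight m) d" "e' \<noteq> e"
   hence e'V: "e' \<in> exponents V" "2 * e' 1 + 3 * e' 2 = d" using wd by auto
   show "f e' = \<zero>"
   proof (rule ccontr)
    assume "f e' \<noteq> \<zero>"
    hence "e' 2 < 2" by (auto simp: f_def split: if_splits)
    moreover have "a = c \<and> b = d" if "b < 2" "d < 2" "2 * a + 3 * b = 2 * c + 3 * d" for a b c d :: nat using that by presburger
    moreover have "e 2 < 2" by (simp add: e12)
    ultimately have "e' 1 = e 1" "e' 2 = e 2" using ed e'V(2) by metis+
    hence "e' = e" using two_exponents[of e' e] e'V(1) eV unfolding V by blast
    thus False using e' by simp
   qed
  qed
  also have "f e = F 0 d"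
  proof (cases "even d")
   case True
   hence "e 2 = 0" "2 * e 1 = d" unfolding e12 by auto
   thus ?thesis using eV by (simp add: f_def)
  next
   case False
   hence "e 2 = 1" "2 * e 1 + 3 = d" using ed e12 by auto
   thus ?thesis using eV by (simp add: f_def)
  qed
  finally show ?thesis .
 qed
 moreover have "i = 0" if "i < m" for i using that m by simp
 ultimately show ?thesis using f by blast
qed

text \<open>A series \<open>f\<close> in \<open>x_1\<close> realizes the data of the axis. The
  series \<open>g\<close>, a multiple of \<open>x_2\<close>, corrects the parabola without being
  seen on the axis. Because \<open>x_2\<close> becomes \<open>t^2\<close>, the correction starts in
  degree 2, and the gluing conditions settle degrees 0 and 1.\<close>

lemma \<Psi>_surj_2:
 assumes m: "m = 2" and F: "gluing F"
 shows "\<exists>f\<in>carrier R. \<forall>i<m. \<forall>d. \<Psi> f i d = F i d"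
proof -
 have b: "bvars m 0 = {1, 2}" "bvars m 1 = {1}" "weight m 1 = 1" "weight m 2 = 2" using m by (simp_all add: bvars_def weight_def)
 have m1: "1 < m" using m by simp
 have V: "V = {1, 2}" using m V_12 by auto
 have Fc: "F i d \<in> carrier K" if "i < m" for i d using gluing_closed[OF F that] .
 have F01: "F 0 d = F 1 d" if "d < 2" for d
 proof (cases "d = 0")
  case True
  thus ?thesis using gluing_0[OF F m1] by simp
 next
  case False
  hence "d = 1" using that by simp
  have "m - 1 = 1" using m by simp
  moreover have "F (m - 1) 1 = (\<Oplus>i\<in>{..<m - 1}. F i 1)" using gluing_1[OF F] .
  ultimately show ?thesis using \<open>d = 1\<close> Fc[OF m_pos, of 1] by (simp add: lessThan_Suc)
 qed
 define f where "f e = (if e \<in> exponents V \<and> e 2 = 0 then F 1 (e 1) else \<zero>)" for e :: "nat => nat"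
 define g where "g e = (if e \<in> exponents V \<and> e 2 = 1 then F 0 (e 1 + 2) \<ominus> F 1 (e 1 + 2) else \<zero>)" for e :: "nat => nat"
 have fg: "f \<in> carrier R" "g \<in> carrier R" using Fc m_pos m1 by (auto intro!: ps_carrierI simp: f_def g_def)
 have wd: "e \<in> wset (bvars m 0) (weight m) d \<longleftrightarrow> e \<in> exponents V \<and> e 1 + 2 * e 2 = d" for e d
  unfolding b V wset_def wdeg_12 by simp
 have f1: "\<Psi> f 1 d = F 1 d" "\<Psi> g 1 d = \<zero>" for d
  unfolding \<Psi>_branch_single[OF m1 b(2,3) fg(1)] \<Psi>_branch_single[OF m1 b(2,3) fg(2)]
  using delta_exponents[of 1 d] V by (auto simp: f_def g_def)
 have f0: "\<Psi> f 0 d = F 1 d" for d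
 proof -
  let ?e = "\<lambda>j::nat. if j = 1 then d else 0"
  have eV: "?e \<in> exponents V" using V by (intro delta_exponents) auto
  have "\<Psi> f 0 d = f ?e"
  proof (rule \<Psi>_single[OF m_pos fg(1)])
   show "?e \<in> wset (bvars m 0) (weight m) d" using eV wd by simp
   fix e' assume e': "e' \<in> wset (bvars m 0) (weight m) d" "e' \<noteq> ?e"
   hence e'V: "e' \<in> exponents V" "e' 1 + 2 * e' 2 = d" using wd by auto
   show "f e' = \<zero>"
   proof (rule ccontr)
    assume "f e' \<noteq> \<zero>"
    hence "e' 2 = 0" by (auto simp: f_def split: if_splits)
    hence "e' = ?e" using e'V eV unfolding V by (intro two_exponents) auto
    thus False using e'(2) by contradiction
   qed
  qed
  also have "... = F 1 d" using eV by (simp add: f_def)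
  finally show ?thesis .
 qed
 have g0: "\<Psi> g 0 d = F 0 d \<ominus> F 1 d" for d
 proof (cases "d < 2")
  case True
  have "\<Psi> g 0 d = finsum K (\<lambda>_. \<zero>) (wset (bvars m 0) (weight m) d)" unfolding parametrize_def subst_series_def
  proof (intro finsum_cong' refl)
   fix e assume "e \<in> wset (bvars m 0) (weight m) d"
   hence "e 1 + 2 * e 2 = d" using wd by blast
   thus "g e = \<zero>" using True by (auto simp: g_def)
  qed auto
  thus ?thesis using F01[OF True] Fc[OF m1, of d] by (simp add: a_minus_def r_neg del: One_nat_def)
 next
  case False
  define e where "e = (\<lambda>j::nat. if j = 1 then d - 2 else if j = 2 then 1 else 0)"
  have eV: "e \<in> exponents V" unfolding V by (auto simp: e_def exponents_def)
  have e12: "e 1 = d - 2" "e 2 = 1" by (auto simp: e_def)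
  have "\<Psi> g 0 d = g e"
  proof (rule \<Psi>_single[OF m_pos fg(2)])
   show "e \<in> wset (bvars m 0) (weight m) d" using eV wd e12 False by simp
   fix e' assume e': "e' \<in> wset (bvars m 0) (weight m) d" "e' \<noteq> e"
   hence e'V: "e' \<in> exponents V" "e' 1 + 2 * e' 2 = d" using wd by auto
   show "g e' = \<zero>"
   proof (rule ccontr)
    assume "g e' \<noteq> \<zero>"
    hence "e' 2 = 1" by (auto simp: g_def split: if_splits)
    moreover from this have "e' 1 = d - 2" using e'V by simp
    ultimately have "e' = e" using e'V eV e12 unfolding V by (intro two_exponents) auto
    thus False using e'(2) by contradiction
   qed
  qed
  moreover have "e 1 + 2 = d" using False e12 by simp
  ultimately show ?thesis using eV e12(2) by (simp add: g_def)
 qed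
 have "\<Psi> (f \<oplus>\<^sub>R g) i d = F i d" if i: "i < m" for i d
 proof (cases "i = 0")
  case True
  have "F 1 d \<oplus> (F 0 d \<ominus> F 1 d) = F 0 d" using Fc[OF m_pos, of d] Fc[OF m1, of d] by algebra
  thus ?thesis unfolding True \<Psi>_add[OF m_pos fg] f0 g0 .
 next
  case False
  hence "i = 1" using i m by simp
  thus ?thesis using \<Psi>_add[OF m1 fg] f1 Fc[OF m1] by simp
 qed
 thus ?thesis using fg by (intro bexI[of _ "f \<oplus>\<^sub>R g"]) auto
qed

text \<open>The pure powers in \<open>f\<close> realize the data of the axes. The monomials
  \<open>x_1^(d-1) x_2\<close> with \<open>d \<ge> 2\<close> in \<open>g\<close> vanish on all axes
  and correct the diagonal; degrees 0 and 1 there are settled by the gluing conditions.\<close>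

lemma \<Psi>_surj_3:
 assumes m: "m \<ge> 3" and F: "gluing F"
 shows "\<exists>f\<in>carrier R. \<forall>i<m. \<forall>d. \<Psi> f i d = F i d"
proof -
 let ?n = "m - 1"
 have V: "V = {1..?n}" using m by (auto simp: elliptic_vars_def)
 have n: "?n < m" using m by simp
 have bv: "bvars m ?n = V" using m V by (auto simp: bvars_def)
 have w: "weight m k = 1" for k using m by (simp add: weight_def)
 have Fc: "F i d \<in> carrier K" if "i < m" for i d using gluing_closed[OF F that] .
 \<comment> \<open>For a nontrivial pure power, \<open>THE k. 0 < e k\<close> is its variable, and
   subtracting 1 turns the number of the variable into that of the branch. The zero exponent has no
   such variable and takes the common constant term.\<close>
 define f where "f e = (if e \<notin> exponents V \<or> mixed e then \<zero> else if e = (\<lambda>_. 0) then F 0 0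
   else F ((THE k. 0 < e k) - 1) (e (THE k. 0 < e k)))" for e :: "nat => nat"
 have f\<delta>: "f (\<lambda>j. if j = Suc i then d else 0) = F i d" if i: "i < ?n" for i d
 proof -
  let ?e = "\<lambda>j. if j = Suc i then d else 0"
  have eV: "?e \<in> exponents V" using V i by (intro delta_exponents) auto
  have nm: "\<not> mixed ?e" by (auto simp: mixed_def split: if_splits)
  show ?thesis
  proof (cases "d = 0")
   case True
   hence "?e = (\<lambda>_. 0)" by auto
   hence "f ?e = F 0 0" using eV nm unfolding f_def by simp
   also have "F 0 0 = F i 0" using gluing_0[OF F, of i] i by simp
   finally show ?thesis unfolding True .
  next
   case False
   have k: "(THE k. 0 < ?e k) = Suc i" using False by (intro the_equality) (auto split: if_splits)
   have nz: "?e \<noteq> (\<lambda>_. 0)"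
   proof
    assume "?e = (\<lambda>_. 0)"
    hence "?e (Suc i) = 0" by (rule fun_cong)
    thus False using False by simp
   qed
   have "f ?e = F ((THE k. 0 < ?e k) - 1) (?e (THE k. 0 < ?e k))" using eV nm nz unfolding f_def by simp
   thus ?thesis unfolding k by simp
  qed
 qed
 have fR: "f \<in> carrier R"
 proof (rule ps_carrierI)
  fix e
  show "f e \<in> carrier K"
  proof (cases "e \<notin> exponents V \<or> mixed e")
   case True
   thus ?thesis by (auto simp: f_def)
  next
   case False
   moreover have "V \<noteq> {}" using V m by auto
   ultimately obtain k d where k: "k \<in> V" "e = (\<lambda>j. if j = k then d else 0)" using pure_exponent[of e] by blast
   hence k': "k = Suc (k - 1)" "k - 1 < ?n" using V by auto
   have "f e = F (k - 1) d" using f\<delta>[OF k'(2), of d] k'(1) k(2) by simp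
   thus ?thesis using Fc k'(2) by simp
  qed
 qed (simp add: f_def)
 define c where "c d = F ?n d \<ominus> (\<Oplus>i\<in>{..<?n}. F i d)" for d
 have sc: "(\<Oplus>i\<in>{..<?n}. F i d) \<in> carrier K" for d using Fc by (intro finsum_closed) auto
 have cc: "c d \<in> carrier K" for d using Fc[OF n] sc by (simp add: c_def)
 define g where "g e = (if e \<in> exponents {1, 2} \<and> e 2 = 1 \<and> 1 \<le> e 1 then c (e 1 + 1) else \<zero>)" for e :: "nat => nat"
 have V12: "{1, 2} \<subseteq> V" using V m by auto
 have gR: "g \<in> carrier R"
 proof (rule ps_carrierI)
  fix e assume "e \<notin> exponents V"
  hence "e \<notin> exponents {1, 2}" using exponents_mono[OF V12] by blast
  thus "g e = \<zero>" by (simp add: g_def)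
 qed (simp add: g_def cc)
 have faxis: "\<Psi> f i d = F i d" if i: "i < ?n" for i d unfolding \<Psi>_branch_single[OF branch_axis[OF m i] fR] by (rule f\<delta>[OF i])
 have gaxis: "\<Psi> g i d = \<zero>" if i: "i < ?n" for i d unfolding \<Psi>_branch_single[OF branch_axis[OF m i] gR] by (auto simp: g_def)
 have wd: "wdeg V (weight m) e = (\<Sum>k\<in>V. e k)" for e by (simp add: wdeg_def w)
 have g12: "wdeg V (weight m) e = e 1 + e 2" if "e \<in> exponents {1, 2}" for e
 proof -
  have "(\<Sum>k\<in>V. e k) = (\<Sum>k\<in>{1, 2}. e k)" using V12 V_finite that by (intro sum.mono_neutral_right) (auto simp: exponents_def)
  thus ?thesis unfolding wd by simp
 qed
 have fdiag: "\<Psi> f ?n d = (\<Oplus>i\<in>{..<?n}. F i d)" if "0 < d" for d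
 proof -
  have "\<Psi> f ?n d = (\<Oplus>i\<in>{..<?n}. f (\<lambda>j. if j = Suc i then d else 0))" by (rule \<Psi>_diagonal[OF m fR that]) (simp add: f_def)
  also have "... = (\<Oplus>i\<in>{..<?n}. F i d)" using f\<delta> Fc by (intro finsum_cong') auto
  finally show ?thesis .
 qed
 have gdiag: "\<Psi> g ?n d = (if 2 \<le> d then c d else \<zero>)" for d
 proof (cases "2 \<le> d")
  case False
  have "\<Psi> g ?n d = finsum K (\<lambda>_. \<zero>) (wset V (weight m) d)" unfolding parametrize_def subst_series_def bv
  proof (intro finsum_cong' refl)
   fix e assume e: "e \<in> wset V (weight m) d"
   show "g e = \<zero>"
   proof (rule ccontr)
    assume "g e \<noteq> \<zero>"
    hence "e \<in> exponents {1, 2}" "e 2 = 1" "1 \<le> e 1" by (auto simp: g_def split: if_splits)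
    hence "2 \<le> wdeg V (weight m) e" using g12 by simp
    thus False using e False by (simp add: wset_def)
   qed
  qed auto
  thus ?thesis using False by simp
 next
  case True
  define e where "e = (\<lambda>j::nat. if j = 1 then d - 1 else if j = 2 then 1 else 0)"
  have e: "e \<in> exponents {1, 2}" "e 1 = d - 1" "e 2 = 1" by (auto simp: e_def exponents_def)
  have "\<Psi> g ?n d = g e"
  proof (rule \<Psi>_single[OF n gR])
   have "e \<in> exponents V" using exponents_mono[OF V12] e(1) by blast
   thus "e \<in> wset (bvars m ?n) (weight m) d" unfolding bv wset_def using g12[OF e(1)] e True by simp
   fix e' assume e': "e' \<in> wset (bvars m ?n) (weight m) d" "e' \<noteq> e"
   show "g e' = \<zero>"
   proof (rule ccontr)
    assume "g e' \<noteq> \<zero>"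
    hence *: "e' \<in> exponents {1, 2}" "e' 2 = 1" by (auto simp: g_def split: if_splits)
    hence "e' 1 + 1 = d" using g12[OF *(1)] e'(1) unfolding bv by (simp add: wset_def)
    hence "e' = e" using * e by (intro two_exponents) auto
    thus False using e'(2) by contradiction
   qed
  qed
  moreover have "e 1 + 1 = d" "1 \<le> e 1" using e True by auto
  ultimately show ?thesis using e True by (simp add: g_def)
 qed
 have "\<Psi> (f \<oplus>\<^sub>R g) i d = F i d" if i: "i < m" for i d
 proof (cases "i = ?n")
  case False
  hence i': "i < ?n" using i by simp
  thus ?thesis using \<Psi>_add[OF i fR gR] faxis gaxis Fc[OF i] by simp
 next
  case True
  have "\<Psi> (f \<oplus>\<^sub>R g) ?n d = F ?n d"
  proof (cases "d = 0")
   case True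
   have "f (\<lambda>_. 0) = F 0 0" by (auto simp: f_def mixed_def exponents_def)
   moreover have "g (\<lambda>_. 0) = \<zero>" by (simp add: g_def)
   moreover have "F ?n 0 = F 0 0" using gluing_0[OF F n] .
   ultimately show ?thesis using True \<Psi>_0[OF n, of "f \<oplus>\<^sub>R g"] fR gR Fc[OF m_pos] by (simp add: ps_add)
  next
   case False
   show ?thesis
   proof (cases "d = 1")
    case True
    have "F ?n 1 = (\<Oplus>i\<in>{..<?n}. F i 1)" using gluing_1[OF F] .
    thus ?thesis unfolding \<Psi>_add[OF n fR gR] fdiag[OF \<open>d \<noteq> 0\<close>[unfolded neq0_conv]] gdiag using True sc by simp
   next
    case d1: False
    have "(\<Oplus>i\<in>{..<?n}. F i d) \<oplus> c d = F ?n d" unfolding c_def using Fc[OF n, of d] sc[of d] by (simp add: a_minus_def a_lcomm r_neg)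
    thus ?thesis unfolding \<Psi>_add[OF n fR gR] fdiag[OF \<open>d \<noteq> 0\<close>[unfolded neq0_conv]] gdiag using False d1 by simp
   qed
  qed
  thus ?thesis using True by simp
 qed
 thus ?thesis using fR gR by (intro bexI[of _ "f \<oplus>\<^sub>R g"]) auto
qed

lemma \<Psi>_surj:
 assumes "gluing F"
 shows "\<exists>f\<in>carrier R. \<forall>i<m. \<forall>d. \<Psi> f i d = F i d"
proof -
 consider "m = 1" | "m = 2" | "m \<ge> 3" using m_pos by linarith
 thus ?thesis using \<Psi>_surj_1 \<Psi>_surj_2 \<Psi>_surj_3 assms by cases blast+
qed

lemma \<Psi>_const:
 assumes "c \<in> carrier K" "i < m"
 shows "ps_const K c \<in> carrier R" "\<Psi> (ps_const K c) i d = (if d = 0 then c else \<zero>)"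
proof -
 show c: "ps_const K c \<in> carrier R" using assms(1) by (intro ps_carrierI) (auto simp: ps_const_def exponents_def)
 show "\<Psi> (ps_const K c) i d = (if d = 0 then c else \<zero>)"
 proof (cases "d = 0")
  case True
  thus ?thesis using \<Psi>_0[OF assms(2) c] by (simp add: ps_const_def)
 next
  case False
  have "\<Psi> (ps_const K c) i d = finsum K (\<lambda>_. \<zero>) (wset (bvars m i) (weight m) d)" unfolding parametrize_def subst_series_def
  proof (intro finsum_cong' refl)
   fix e assume "e \<in> wset (bvars m i) (weight m) d"
   hence "e \<noteq> (\<lambda>_. 0)" using False by (auto simp: wset_def wdeg_def)
   thus "ps_const K c e = \<zero>" by (simp add: ps_const_def)
  qed auto
  thus ?thesis using False by simp
 qed
qed

lemma \<Psi>_one: "i < m ==> \<Psi> \<one>\<^sub>R i d = (if d = 0 then \<one> else \<zero>)"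
proof -
 have "\<one>\<^sub>R = ps_const K \<one>" by (auto simp: ps_one ps_const_def)
 thus "i < m ==> \<Psi> \<one>\<^sub>R i d = (if d = 0 then \<one> else \<zero>)" using \<Psi>_const(2)[of \<one>] by simp
qed

end

section \<open>The completion\<close>

lemma (in ideal) coset_mem_iff: "x \<in> carrier R ==> y \<in> carrier R ==> y \<in> I +> x \<longleftrightarrow> y \<ominus> x \<in> I"
 using a_rcos_module_minus[OF local.ring_axioms] by blast

lemma (in ideal) coset_eq_iff:
 assumes "x \<in> carrier R" "y \<in> carrier R"
 shows "I +> x = I +> y \<longleftrightarrow> x \<ominus> y \<in> I"
proof
 assume "I +> x = I +> y"
 hence "x \<in> I +> y" using a_rcos_self[OF assms(1)] by simp
 thus "x \<ominus> y \<in> I" using coset_mem_iff assms by simp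
next
 assume "x \<ominus> y \<in> I"
 hence "x \<in> I +> y" using coset_mem_iff assms by simp
 thus "I +> x = I +> y" using a_repr_independence'[of x y] assms by simp
qed

lemma (in ideal) quotient_repr:
 assumes "\<xi> \<in> carrier (R Quot I)"
 obtains a where "a \<in> carrier R" "\<xi> = I +> a" using assms that by (auto simp: FactRing_simps A_RCOSETS_def')

lemma (in ideal) quotient_ops:
 assumes "x \<in> carrier R" "y \<in> carrier R"
 shows "I +> x \<in> carrier (R Quot I)" "(I +> x) **\<^bsub>R Quot I\<^esub> (I +> y) = I +> (x ** y)"
  "(I +> x) \<oplus>\<^bsub>R Quot I\<^esub> (I +> y) = I +> (x \<oplus> y)" "\<one>\<^bsub>R Quot I\<^esub> = I +> \<one>"
 using assms a_rcosetsI[OF a_subset] by (auto simp: FactRing_simps rcoset_mult_add a_rcos_sum)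

lemma (in local_algebra) nonunits_ideal: "ideal (nonunits A) A"
proof (rule idealI)
 show "ring A" by (rule S.ring_axioms)
 show "subgroup (nonunits A) (add_monoid A)" by (rule S.add.subgroupI) (use nonunits_closed nonunits_zero nonunits_minus nonunits_add in auto)
qed (use nonunits_mult in auto)

lemma (in local_algebra) ideal_power_ideal: "ideal (ideal_power A (nonunits A) n) A"
 by (induction n) (auto intro: S.oneideal S.ideal_prod_is_ideal nonunits_ideal)

lemma (in local_algebra) ideal_power_Suc_subset:
 "ideal_power A (nonunits A) (Suc n) \<subseteq> ideal_power A (nonunits A) n" using S.ideal_prod_inter[OF nonunits_ideal ideal_power_ideal] by simp

context curve_singularity
begin

interpretation E: elliptic_ring K m by unfold_locales (rule m_pos)

abbreviation "Mp n \<equiv> ideal_power A (nonunits A) n"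

text \<open>Rescaling the branch parameters normalizes the coefficients of the hyperplane to
 \<open>(1, ..., 1, -1)\<close>.\<close>

definition scale where "scale i = (if i = m - 1 then \<ominus>\<^sub>K hyp i else hyp i)"
definition \<theta> where "\<theta> i a k = scale i [^]\<^sub>K k **\<^sub>K \<tau> i (\<psi> a) k" for i a and k :: nat

lemma scale: "i < m ==> scale i \<in> carrier K" "i < m ==> scale i \<noteq> \<zero>\<^sub>K" using hyp(1) hyp_nonzero by (auto simp: scale_def)

lemma theta_closed [simp]: "i < m ==> a \<in> carrier A ==> \<theta> i a k \<in> carrier K" using scale by (simp add: \<theta>_def)

lemma theta_add: "i < m ==> a \<in> carrier A ==> b \<in> carrier A ==> \<theta> i (a \<oplus>\<^sub>A b) k = \<theta> i a k \<oplus>\<^sub>K \<theta> i b k"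
 using scale by (simp add: \<theta>_def tau_add R.r_distr)

lemma theta_mult:
 assumes i: "i < m" and ab: "a \<in> carrier A" "b \<in> carrier A"
 shows "\<theta> i (a **\<^sub>A b) k = (\<Oplus>\<^sub>K j\<in>{..k}. \<theta> i a j **\<^sub>K \<theta> i b (k - j))"
proof -
 have "\<theta> i (a **\<^sub>A b) k = (\<Oplus>\<^sub>K j\<in>{..k}. scale i [^]\<^sub>K k **\<^sub>K (\<tau> i (\<psi> a) j **\<^sub>K \<tau> i (\<psi> b) (k - j)))"
  using assms scale(1)[OF i] by (simp add: \<theta>_def tau_mult R.finsum_rdistr)
 also have "... = (\<Oplus>\<^sub>K j\<in>{..k}. \<theta> i a j **\<^sub>K \<theta> i b (k - j))"
 proof (intro R.finsum_cong' refl)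
  fix j assume j: "j \<in> {..k}"
  have "scale i [^]\<^sub>K k = scale i [^]\<^sub>K j **\<^sub>K scale i [^]\<^sub>K (k - j)" using j scale(1)[OF i] by (simp add: R.nat_pow_mult)
  thus "scale i [^]\<^sub>K k **\<^sub>K (\<tau> i (\<psi> a) j **\<^sub>K \<tau> i (\<psi> b) (k - j)) = \<theta> i a j **\<^sub>K \<theta> i b (k - j)"
   using assms scale(1)[OF i] by (simp add: \<theta>_def R.m_ac)
 qed (use assms in auto)
 finally show ?thesis .
qed

lemma theta_scalar: "i < m ==> c \<in> carrier K ==> \<theta> i (emb c) k = (if k = 0 then c else \<zero>\<^sub>K)"
 using scale by (simp add: \<theta>_def psi_scalar[symmetric] tau_scalar)

lemma theta_eq_iff:
 assumes "i < m" "x \<in> carrier K" "y \<in> carrier K"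
 shows "scale i [^]\<^sub>K (k::nat) **\<^sub>K x = scale i [^]\<^sub>K k **\<^sub>K y \<longleftrightarrow> x = y"
proof -
 have "scale i [^]\<^sub>K k \<noteq> \<zero>\<^sub>K" using scale[OF assms(1)] by (induction k) (auto simp: K.integral_iff)
 thus ?thesis using assms scale(1)[OF assms(1)] K.m_lcancel by simp
qed

lemma theta_agree_iff:
 assumes "a \<in> carrier A" "b \<in> carrier A"
 shows "(\<forall>i<m. \<forall>k<N. \<theta> i a k = \<theta> i b k) \<longleftrightarrow> \<psi> (a \<ominus>\<^sub>A b) \<in> F N"
proof -
 have "\<psi> (a \<ominus>\<^sub>A b) = \<psi> a \<ominus> \<psi> b" using assms by (simp add: a_minus_def)
 thus ?thesis using assms by (auto simp: F_def vanish_def tau_diff \<theta>_def theta_eq_iff)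
qed

text \<open>The scale factor of the last branch carries a minus sign, so the hyperplane equation
  states that the rescaled linear term of the last branch is the sum of those of the others, exactly
  as for the elliptic fold point.\<close>

lemma theta_gluing:
 assumes a: "a \<in> carrier A"
 shows "E.gluing (\<lambda>i. \<theta> i a)" unfolding E.gluing_def
proof (intro conjI allI impI)
 show "\<theta> i a d \<in> carrier K" if "i < m" for i d using that a by simp
 show "\<theta> i a 0 = \<theta> 0 a 0" if "i < m" for i using tau_psi_eq[OF a that m_pos] a that m_pos scale by (simp add: \<theta>_def)
 define n where "n = m - 1"
 have n: "n < m" "{..<m} = insert n {..<n}" using m_pos by (auto simp: n_def)
 have im: "i < m" if "i < n" for i using that n by simp
 define S where "S = (\<Oplus>\<^sub>K i\<in>{..<n}. hyp i **\<^sub>K \<tau> i (\<psi> a) (Suc 0))"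
 have S: "S \<in> carrier K" unfolding S_def using hyp(1) a im by (intro R.finsum_closed) auto
 have "(\<Oplus>\<^sub>K i\<in>{..<m}. hyp i **\<^sub>K \<tau> i (\<psi> a) (Suc 0)) = hyp n **\<^sub>K \<tau> n (\<psi> a) (Suc 0) \<oplus>\<^sub>K S"
  unfolding n(2) S_def using hyp(1) a im n(1) by (subst R.finsum_insert) auto
 hence 0: "hyp n **\<^sub>K \<tau> n (\<psi> a) (Suc 0) \<oplus>\<^sub>K S = \<zero>\<^sub>K" using A_hyperplane[OF a] by simp
 have "\<theta> n a 1 = \<ominus>\<^sub>K (hyp n **\<^sub>K \<tau> n (\<psi> a) (Suc 0))"
  using hyp(1)[OF n(1)] a n(1) by (simp add: \<theta>_def scale_def n_def R.l_minus)
 also have "... = S" using 0 S hyp(1)[OF n(1)] a n(1) R.minus_equality[of S "hyp n **\<^sub>K \<tau> n (\<psi> a) (Suc 0)"] by (simp add: R.a_comm)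
 also have "S = (\<Oplus>\<^sub>K i\<in>{..<n}. \<theta> i a 1)"
  unfolding S_def using a im hyp(1) by (intro R.finsum_cong') (auto simp: \<theta>_def scale_def n_def)
 finally show "\<theta> (m - 1) a 1 = (\<Oplus>\<^sub>K i\<in>{..<m - 1}. \<theta> i a 1)" by (simp add: n_def)
qed

lemma theta_approx:
 assumes G: "E.gluing G"
 shows "\<exists>a\<in>carrier A. \<forall>i<m. \<forall>k<N. \<theta> i a k = G i k"
proof -
 define f where "f i k = (if i < m then inv\<^bsub>K\<^esub> (scale i [^]\<^sub>K k) **\<^sub>K G i k else \<zero>\<^sub>K)" for i and k :: nat
 have nz: "scale i [^]\<^sub>K k \<in> Units K" if "i < m" for i and k :: nat using scale[OF that] K.field_Units by (intro R.Units_pow_closed) auto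
 have Gc: "G i k \<in> carrier K" if "i < m" for i k using E.gluing_closed[OF G that] .
 have fc: "f i k \<in> carrier K" for i k using nz Gc by (simp add: f_def)
 have fG: "scale i [^]\<^sub>K k **\<^sub>K f i k = G i k" if "i < m" for i k
  using R.m_assoc[of "scale i [^]\<^sub>K k" "inv\<^bsub>K\<^esub> (scale i [^]\<^sub>K k)" "G i k"] R.Units_r_inv[OF nz[OF that, of k]]
   R.Units_inv_closed[OF nz[OF that, of k]] R.Units_closed[OF nz[OF that, of k]] Gc[OF that, of k] that by (simp add: f_def)
 have f0: "f i 0 = f 0 0" if "i < m" for i using E.gluing_0[OF G that] that m_pos Gc[OF that, of 0] by (simp add: f_def)
 define n where "n = m - 1"
 have n: "n < m" "{..<m} = insert n {..<n}" using m_pos by (auto simp: n_def)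
 have im: "i < m" if "i < n" for i using that n by simp
 have hf: "hyp i **\<^sub>K f i (Suc 0) = (if i = n then \<ominus>\<^sub>K G i 1 else G i 1)" if i: "i < m" for i
 proof -
  have "scale i **\<^sub>K f i (Suc 0) = G i 1" using fG[OF i, of 1] scale(1)[OF i] by simp
  moreover have "hyp i = (if i = n then \<ominus>\<^sub>K scale i else scale i)" using hyp(1)[OF i] by (auto simp: scale_def n_def)
  ultimately show ?thesis using scale(1)[OF i] fc i by (auto simp: R.l_minus)
 qed
 have Sc: "(\<Oplus>\<^sub>K i\<in>{..<n}. G i 1) \<in> carrier K" using Gc im by (intro R.finsum_closed) auto
 have "(\<Oplus>\<^sub>K i\<in>{..<m}. hyp i **\<^sub>K f i (Suc 0)) = hyp n **\<^sub>K f n (Suc 0) \<oplus>\<^sub>K (\<Oplus>\<^sub>K i\<in>{..<n}. hyp i **\<^sub>K f i (Suc 0))"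
  unfolding n(2) using hyp(1) fc im n(1) by (subst R.finsum_insert) auto
 also have "(\<Oplus>\<^sub>K i\<in>{..<n}. hyp i **\<^sub>K f i (Suc 0)) = (\<Oplus>\<^sub>K i\<in>{..<n}. G i 1)"
  using hf Gc im by (intro R.finsum_cong') auto
 also have "... = G n 1" using E.gluing_1[OF G] by (simp add: n_def)
 also have "hyp n **\<^sub>K f n (Suc 0) \<oplus>\<^sub>K G n 1 = \<zero>\<^sub>K" using hf[OF n(1)] Gc[OF n(1)] by (simp add: R.l_neg)
 finally obtain a where a: "a \<in> carrier A" "\<forall>i<m. \<forall>k<N. \<tau> i (\<psi> a) k = f i k" using A_approx[of f N, OF fc f0] by blast
 hence "\<forall>i<m. \<forall>k<N. \<theta> i a k = G i k" using fG by (simp add: \<theta>_def)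
 thus ?thesis using a by blast
qed

section \<open>Elements of the completion and their coefficients\<close>

definition "Ac = completion A (nonunits A)"

lemma Ac_coset:
 assumes "\<xi> \<in> carrier Ac"
 obtains a where "a \<in> carrier A" "\<xi> n = Mp n +>\<^sub>A a"
proof -
 interpret I: ideal "Mp n" A by (rule ideal_power_ideal)
 have "\<xi> n \<in> carrier (A Quot Mp n)" using assms by (simp add: Ac_def completion_def)
 thus ?thesis using that I.quotient_repr by blast
qed

lemma Ac_mem: "\<xi> \<in> carrier Ac ==> a \<in> \<xi> n ==> a \<in> carrier A \<and> \<xi> n = Mp n +>\<^sub>A a"
proof -
 assume \<xi>: "\<xi> \<in> carrier Ac" and a: "a \<in> \<xi> n"
 interpret I: ideal "Mp n" A by (rule ideal_power_ideal)
 obtain b where b: "b \<in> carrier A" "\<xi> n = Mp n +>\<^sub>A b" using Ac_coset[OF \<xi>] by blast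
 have ac: "a \<in> carrier A" using a b I.a_elemrcos_carrier by blast
 thus ?thesis using a b I.a_repr_independence' by blast
qed

lemma Ac_nonempty: "\<xi> \<in> carrier Ac ==> \<exists>a. a \<in> \<xi> n"
proof -
 assume \<xi>: "\<xi> \<in> carrier Ac"
 interpret I: ideal "Mp n" A by (rule ideal_power_ideal)
 obtain b where "b \<in> carrier A" "\<xi> n = Mp n +>\<^sub>A b" using Ac_coset[OF \<xi>] by blast
 thus ?thesis using I.a_rcos_self by blast
qed

lemma Ac_decreasing: "\<xi> \<in> carrier Ac ==> k \<le> n ==> \<xi> n \<subseteq> \<xi> k"
proof (induction n)
 case (Suc n)
 have "\<xi> (Suc n) \<subseteq> \<xi> n" using Suc.prems(1) by (simp add: Ac_def completion_def)
 thus ?case using Suc by (cases "k = Suc n") auto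
qed simp

lemma Ac_same_level:
 assumes "\<xi> \<in> carrier Ac" "a \<in> \<xi> n" "b \<in> \<xi> n" "i < m" "k < n"
 shows "\<theta> i a k = \<theta> i b k"
proof -
 interpret I: ideal "Mp n" A by (rule ideal_power_ideal)
 have ab: "a \<in> carrier A" "b \<in> carrier A" "\<xi> n = Mp n +>\<^sub>A b" using Ac_mem assms by blast+
 hence "a \<ominus>\<^sub>A b \<in> Mp n" using assms(2) I.coset_mem_iff by simp
 hence "\<psi> (a \<ominus>\<^sub>A b) \<in> F n" using ideal_power_high_order by blast
 thus ?thesis using theta_agree_iff[OF ab(1,2), of n] assms by blast
qed

text \<open>The coefficient of degree \<open>k\<close> is read off at level \<open>k + 1\<close>.
  Elements of that power of the maximal ideal vanish to order \<open>k + 1\<close> on every branch,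
  so the choice of representative does not matter.\<close>

definition \<Theta> where "\<Theta> \<xi> i k = \<theta> i (SOME a. a \<in> \<xi> (Suc k)) k" for \<xi> :: "nat => 'a set"

lemma Theta_eq:
 assumes \<xi>: "\<xi> \<in> carrier Ac" and a: "a \<in> \<xi> n" and i: "i < m" and k: "k < n"
 shows "\<Theta> \<xi> i k = \<theta> i a k"
proof -
 have "(SOME a. a \<in> \<xi> (Suc k)) \<in> \<xi> (Suc k)" using Ac_nonempty[OF \<xi>] by (rule someI_ex)
 moreover have "a \<in> \<xi> (Suc k)" using Ac_decreasing[OF \<xi>, of "Suc k" n] a k by auto
 ultimately show ?thesis unfolding \<Theta>_def using Ac_same_level[OF \<xi>] i by blast
qed

lemma Theta_gluing: "\<xi> \<in> carrier Ac ==> E.gluing (\<Theta> \<xi>)"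
proof -
 assume \<xi>: "\<xi> \<in> carrier Ac"
 have "\<exists>a\<in>carrier A. \<forall>i<m. \<forall>k<n. \<Theta> \<xi> i k = \<theta> i a k" for n
  using Ac_nonempty[OF \<xi>, of n] Ac_mem[OF \<xi>] Theta_eq[OF \<xi>] by blast
 note * = this
 obtain a where a: "a \<in> carrier A" "\<And>i k. i < m ==> k < 2 ==> \<Theta> \<xi> i k = \<theta> i a k" using *[of 2] by blast
 note g = theta_gluing[OF a(1)]
 show ?thesis unfolding E.gluing_def
 proof (intro conjI allI impI)
  fix i d assume i: "i < m"
  obtain b where "b \<in> carrier A" "\<forall>i<m. \<forall>k<Suc d. \<Theta> \<xi> i k = \<theta> i b k" using *[of "Suc d"] by blast
  thus "\<Theta> \<xi> i d \<in> carrier K" using i by simp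
 next
  fix i assume i: "i < m"
  show "\<Theta> \<xi> i 0 = \<Theta> \<xi> 0 0" using E.gluing_0[OF g i] a(2)[OF i, of 0] a(2)[OF m_pos, of 0] by simp
 next
  have "(\<Oplus>\<^sub>K i\<in>{..<m - 1}. \<Theta> \<xi> i 1) = (\<Oplus>\<^sub>K i\<in>{..<m - 1}. \<theta> i a 1)"
   using a by (intro R.finsum_cong') auto
  thus "\<Theta> \<xi> (m - 1) 1 = (\<Oplus>\<^sub>K i\<in>{..<m - 1}. \<Theta> \<xi> i 1)" using E.gluing_1[OF g] a(2)[of "m - 1" 1] m_pos by simp
 qed
qed

lemma Ac_ops:
 assumes \<xi>: "\<xi> \<in> carrier Ac" "\<zeta> \<in> carrier Ac" and a: "a \<in> \<xi> n" "b \<in> \<zeta> n"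
 shows "a **\<^sub>A b \<in> (\<xi> **\<^sub>Ac \<zeta>) n" "a \<oplus>\<^sub>A b \<in> (\<xi> \<oplus>\<^sub>Ac \<zeta>) n"
proof -
 interpret I: ideal "Mp n" A by (rule ideal_power_ideal)
 have ab: "a \<in> carrier A" "\<xi> n = Mp n +>\<^sub>A a" "b \<in> carrier A" "\<zeta> n = Mp n +>\<^sub>A b" using Ac_mem \<xi> a by blast+
 have "(\<xi> **\<^sub>Ac \<zeta>) n = Mp n +>\<^sub>A (a **\<^sub>A b)" "(\<xi> \<oplus>\<^sub>Ac \<zeta>) n = Mp n +>\<^sub>A (a \<oplus>\<^sub>A b)"
  using I.quotient_ops ab by (auto simp: Ac_def completion_def)
 thus "a **\<^sub>A b \<in> (\<xi> **\<^sub>Ac \<zeta>) n" "a \<oplus>\<^sub>A b \<in> (\<xi> \<oplus>\<^sub>Ac \<zeta>) n"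
  using I.a_rcos_self ab by auto
qed

lemma Ac_ops_closed:
 assumes \<xi>: "\<xi> \<in> carrier Ac" "\<zeta> \<in> carrier Ac"
 shows "\<xi> **\<^sub>Ac \<zeta> \<in> carrier Ac" "\<xi> \<oplus>\<^sub>Ac \<zeta> \<in> carrier Ac"
proof -
 have 1: "(\<xi> **\<^sub>Ac \<zeta>) n \<in> carrier (A Quot Mp n) \<and> (\<xi> \<oplus>\<^sub>Ac \<zeta>) n \<in> carrier (A Quot Mp n)
   \<and> (\<xi> **\<^sub>Ac \<zeta>) (Suc n) \<subseteq> (\<xi> **\<^sub>Ac \<zeta>) n \<and> (\<xi> \<oplus>\<^sub>Ac \<zeta>) (Suc n) \<subseteq> (\<xi> \<oplus>\<^sub>Ac \<zeta>) n" for n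
 proof -
  interpret I: ideal "Mp n" A by (rule ideal_power_ideal)
  interpret J: ideal "Mp (Suc n)" A by (rule ideal_power_ideal)
  obtain a b where ab: "a \<in> \<xi> (Suc n)" "b \<in> \<zeta> (Suc n)" using Ac_nonempty \<xi> by blast
  have abS: "a \<in> carrier A" "\<xi> (Suc n) = Mp (Suc n) +>\<^sub>A a" "b \<in> carrier A" "\<zeta> (Suc n) = Mp (Suc n) +>\<^sub>A b"
   using Ac_mem \<xi> ab by blast+
  have "a \<in> \<xi> n" "b \<in> \<zeta> n" using ab Ac_decreasing \<xi> by (meson le_SucI le_refl subsetD)+
  hence abn: "\<xi> n = Mp n +>\<^sub>A a" "\<zeta> n = Mp n +>\<^sub>A b" using Ac_mem \<xi> by blast+
  have "Mp (Suc n) +>\<^sub>A c \<subseteq> Mp n +>\<^sub>A c" for c using ideal_power_Suc_subset[of n] by (auto simp: a_r_coset_def')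
  thus ?thesis using I.quotient_ops[OF abS(1,3)] J.quotient_ops[OF abS(1,3)] abS abn
   I.quotient_ops(1)[of "a **\<^sub>A b" "a"] I.quotient_ops(1)[of "a \<oplus>\<^sub>A b" "a"] by (simp add: Ac_def completion_def)
 qed
 thus "\<xi> **\<^sub>Ac \<zeta> \<in> carrier Ac" "\<xi> \<oplus>\<^sub>Ac \<zeta> \<in> carrier Ac" by (auto simp: Ac_def completion_def)
qed

lemma Theta_add:
 assumes \<xi>: "\<xi> \<in> carrier Ac" "\<zeta> \<in> carrier Ac" and i: "i < m"
 shows "\<Theta> (\<xi> \<oplus>\<^sub>Ac \<zeta>) i k = \<Theta> \<xi> i k \<oplus>\<^sub>K \<Theta> \<zeta> i k"
proof -
 obtain a b where ab: "a \<in> \<xi> (Suc k)" "b \<in> \<zeta> (Suc k)" using Ac_nonempty \<xi> by blast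
 hence "a \<in> carrier A" "b \<in> carrier A" using Ac_mem \<xi> by blast+
 thus ?thesis using Theta_eq[OF Ac_ops_closed(2)[OF \<xi>] Ac_ops(2)[OF \<xi> ab] i] Theta_eq[OF \<xi>(1) ab(1) i] Theta_eq[OF \<xi>(2) ab(2) i] i
  by (simp add: theta_add)
qed

lemma Theta_mult:
 assumes \<xi>: "\<xi> \<in> carrier Ac" "\<zeta> \<in> carrier Ac" and i: "i < m"
 shows "\<Theta> (\<xi> **\<^sub>Ac \<zeta>) i k = (\<Oplus>\<^sub>K j\<in>{..k}. \<Theta> \<xi> i j **\<^sub>K \<Theta> \<zeta> i (k - j))"
proof -
 obtain a b where ab: "a \<in> \<xi> (Suc k)" "b \<in> \<zeta> (Suc k)" using Ac_nonempty \<xi> by blast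
 hence c: "a \<in> carrier A" "b \<in> carrier A" using Ac_mem \<xi> by blast+
 have "\<Theta> (\<xi> **\<^sub>Ac \<zeta>) i k = (\<Oplus>\<^sub>K j\<in>{..k}. \<theta> i a j **\<^sub>K \<theta> i b (k - j))"
  using Theta_eq[OF Ac_ops_closed(1)[OF \<xi>] Ac_ops(1)[OF \<xi> ab] i] i c by (simp add: theta_mult)
 also have "... = (\<Oplus>\<^sub>K j\<in>{..k}. \<Theta> \<xi> i j **\<^sub>K \<Theta> \<zeta> i (k - j))"
 proof (intro R.finsum_cong' refl)
  fix j assume "j \<in> {..k}"
  hence "j < Suc k" "k - j < Suc k" by auto
  thus "\<theta> i a j **\<^sub>K \<theta> i b (k - j) = \<Theta> \<xi> i j **\<^sub>K \<Theta> \<zeta> i (k - j)"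
   using Theta_eq[OF \<xi>(1) ab(1) i] Theta_eq[OF \<xi>(2) ab(2) i] by simp
 qed (use E.gluing_closed[OF Theta_gluing[OF \<xi>(1)] i] E.gluing_closed[OF Theta_gluing[OF \<xi>(2)] i] in auto)
 finally show ?thesis .
qed

definition const where "const c = (\<lambda>n. Mp n +>\<^sub>A emb c)"

lemma const_mem: "c \<in> carrier K ==> emb c \<in> const c n"
proof -
 assume c: "c \<in> carrier K"
 interpret I: ideal "Mp n" A by (rule ideal_power_ideal)
 show ?thesis unfolding const_def using c by (intro I.a_rcos_self) simp
qed

lemma const_closed: "c \<in> carrier K ==> const c \<in> carrier Ac"
proof -
 assume c: "c \<in> carrier K"
 have "const c n \<in> carrier (A Quot Mp n) \<and> const c (Suc n) \<subseteq> const c n" for n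
 proof -
  interpret I: ideal "Mp n" A by (rule ideal_power_ideal)
  show ?thesis unfolding const_def using I.quotient_ops(1)[of "emb c" "emb c"] c ideal_power_Suc_subset[of n] by (auto simp: a_r_coset_def')
 qed
 thus ?thesis by (auto simp: Ac_def completion_def)
qed

lemma Theta_const: "c \<in> carrier K ==> i < m ==> \<Theta> (const c) i k = (if k = 0 then c else \<zero>\<^sub>K)"
 using Theta_eq[OF const_closed const_mem, of c i k "Suc k"] by (simp add: theta_scalar)

lemma Ac_one: "\<one>\<^sub>Ac = const \<one>\<^sub>K"
proof
 fix n
 interpret I: ideal "Mp n" A by (rule ideal_power_ideal)
 show "\<one>\<^sub>Ac n = const \<one>\<^sub>K n"
  using I.quotient_ops(4)[OF S.one_closed S.one_closed] by (simp add: Ac_def completion_def const_def)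
qed

text \<open>To compare level \<open>n\<close>, representatives are taken at level
  \<open>2 n\<close>: their difference has order at least \<open>2 n\<close> on all branches and
  thus lies in the \<open>n\<close>-th power of the maximal ideal.\<close>

lemma Theta_inj:
 assumes \<xi>: "\<xi> \<in> carrier Ac" "\<zeta> \<in> carrier Ac" and eq: "\<And>i k. i < m ==> \<Theta> \<xi> i k = \<Theta> \<zeta> i k"
 shows "\<xi> = \<zeta>"
proof
 fix n
 interpret I: ideal "Mp n" A by (rule ideal_power_ideal)
 obtain a b where ab: "a \<in> \<xi> (2 * n)" "b \<in> \<zeta> (2 * n)" using Ac_nonempty \<xi> by blast
 have c: "a \<in> carrier A" "b \<in> carrier A" using Ac_mem \<xi> ab by blast+
 have "\<theta> i a k = \<theta> i b k" if "i < m" "k < 2 * n" for i k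
  using Theta_eq[OF \<xi>(1) ab(1) that] Theta_eq[OF \<xi>(2) ab(2) that] eq[OF that(1)] by simp
 hence "\<psi> (a \<ominus>\<^sub>A b) \<in> F (2 * n)" using theta_agree_iff[OF c] by blast
 hence "a \<ominus>\<^sub>A b \<in> Mp n" using high_order_in_ideal_power c by simp
 hence "Mp n +>\<^sub>A a = Mp n +>\<^sub>A b" using I.coset_eq_iff c by simp
 moreover have "a \<in> \<xi> n" "b \<in> \<zeta> n" using ab Ac_decreasing[OF \<xi>(1), of n "2 * n"] Ac_decreasing[OF \<xi>(2), of n "2 * n"] by auto
 hence "\<xi> n = Mp n +>\<^sub>A a" "\<zeta> n = Mp n +>\<^sub>A b" using Ac_mem \<xi> by blast+
 ultimately show "\<xi> n = \<zeta> n" by simp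
qed

text \<open>The approximation \<open>a n\<close> has the right coefficients up to order
  \<open>2 n\<close>. Successive approximations then differ by elements of the \<open>n\<close>-th
  power, which is the compatibility required in the inverse limit.\<close>

lemma Theta_surj:
 assumes G: "E.gluing G"
 shows "\<exists>\<xi>\<in>carrier Ac. \<forall>i<m. \<forall>k. \<Theta> \<xi> i k = G i k"
proof -
 have "\<forall>n. \<exists>a. a \<in> carrier A \<and> (\<forall>i<m. \<forall>k<2 * n. \<theta> i a k = G i k)" using theta_approx[OF G] by blast
 from choice[OF this] obtain a where a: "\<And>n. a n \<in> carrier A" "\<And>n i k. i < m ==> k < 2 * n ==> \<theta> i (a n) k = G i k" by blast
 define \<xi> where "\<xi> n = Mp n +>\<^sub>A a n" for n
 have mem: "a n \<in> \<xi> n" for n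
 proof -
  interpret I: ideal "Mp n" A by (rule ideal_power_ideal)
  show ?thesis unfolding \<xi>_def using a(1) by (rule I.a_rcos_self)
 qed
 have "\<xi> n \<in> carrier (A Quot Mp n) \<and> \<xi> (Suc n) \<subseteq> \<xi> n" for n
 proof -
  interpret I: ideal "Mp n" A by (rule ideal_power_ideal)
  have "\<forall>i<m. \<forall>k<2 * n. \<theta> i (a (Suc n)) k = \<theta> i (a n) k" using a(2) by simp
  hence "\<psi> (a (Suc n) \<ominus>\<^sub>A a n) \<in> F (2 * n)" using theta_agree_iff a(1) by blast
  hence "a (Suc n) \<ominus>\<^sub>A a n \<in> Mp n" using high_order_in_ideal_power a(1) by simp
  hence "Mp n +>\<^sub>A a (Suc n) = \<xi> n" unfolding \<xi>_def using I.coset_eq_iff a(1) by simp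
  moreover have "\<xi> (Suc n) \<subseteq> Mp n +>\<^sub>A a (Suc n)"
   unfolding \<xi>_def using ideal_power_Suc_subset[of n] by (auto simp: a_r_coset_def')
  ultimately show ?thesis using I.quotient_ops(1)[OF a(1) a(1)] by (simp add: \<xi>_def)
 qed
 hence \<xi>: "\<xi> \<in> carrier Ac" by (auto simp: Ac_def completion_def)
 have "\<Theta> \<xi> i k = G i k" if "i < m" for i k using Theta_eq[OF \<xi> mem[of "Suc k"] that, of k] a(2)[OF that, of k "Suc k"] by simp
 thus ?thesis using \<xi> by blast
qed

theorem completion_elliptic:
 "\<exists>\<phi>\<in>ring_iso (completion A (nonunits A)) (power_series K (elliptic_vars m) Quot elliptic_ideal K m).
   \<forall>c\<in>carrier K. \<phi> (\<lambda>n. ideal_power A (nonunits A) n +>\<^sub>A emb c) =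
    elliptic_ideal K m +>\<^bsub>power_series K (elliptic_vars m)\<^esub> ps_const K c"
proof -
 let ?R = "power_series K (elliptic_vars m)" and ?I = "elliptic_ideal K m"
 interpret I: ideal ?I ?R by (rule E.I_ideal)
 \<comment> \<open>The fibre of the parametrization over the coefficients of \<open>\<xi>\<close>.
   As the kernel of the parametrization is the elliptic ideal, this fibre is a coset, so an element
   of the quotient ring arises without choosing a lift.\<close>
 define \<phi> where "\<phi> \<xi> = {f \<in> carrier ?R. \<forall>i<m. \<forall>k. parametrize K m f i k = \<Theta> \<xi> i k}" for \<xi>
 have \<phi>_coset: "\<phi> \<xi> = ?I +>\<^sub>?R f" if f: "f \<in> carrier ?R" "\<And>i k. i < m ==> parametrize K m f i k = \<Theta> \<xi> i k" for \<xi> f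
 proof -
  have "g \<in> \<phi> \<xi> \<longleftrightarrow> g \<in> ?I +>\<^sub>?R f" if g: "g \<in> carrier ?R" for g
  proof -
   have "g \<in> ?I +>\<^sub>?R f \<longleftrightarrow> g \<ominus>\<^sub>?R f \<in> E.ker" using I.coset_mem_iff f(1) g E.ker_eq by simp
   also have "... \<longleftrightarrow> g \<in> \<phi> \<xi>"
    using f g E.gluing_closed[OF E.\<Psi>_gluing[OF f(1)]] E.gluing_closed[OF E.\<Psi>_gluing[OF g]]
    by (simp add: E.ker_def E.\<Psi>_diff \<phi>_def R.r_right_minus_eq cong: conj_cong)
   finally show ?thesis by simp
  qed
  moreover have "\<phi> \<xi> \<subseteq> carrier ?R" by (auto simp: \<phi>_def)
  moreover have "?I +>\<^sub>?R f \<subseteq> carrier ?R" using I.a_elemrcos_carrier[OF f(1)] by blast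
  ultimately show ?thesis by blast
 qed
 have lift: "\<exists>f\<in>carrier ?R. \<forall>i<m. \<forall>k. parametrize K m f i k = \<Theta> \<xi> i k" if "\<xi> \<in> carrier Ac" for \<xi>
  using E.\<Psi>_surj[OF Theta_gluing[OF that]] .
 have "\<phi> \<in> ring_iso Ac (?R Quot ?I)" unfolding ring_iso_def mem_Collect_eq
 proof (intro conjI ring_hom_memI)
  fix \<xi> \<zeta> assume xz: "\<xi> \<in> carrier Ac" "\<zeta> \<in> carrier Ac"
  obtain f where f: "f \<in> carrier ?R" "\<And>i k. i < m ==> parametrize K m f i k = \<Theta> \<xi> i k" using lift[OF xz(1)] by blast
  obtain g where g: "g \<in> carrier ?R" "\<And>i k. i < m ==> parametrize K m g i k = \<Theta> \<zeta> i k" using lift[OF xz(2)] by blast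
  have fg: "\<phi> \<xi> = ?I +>\<^sub>?R f" "\<phi> \<zeta> = ?I +>\<^sub>?R g" using \<phi>_coset[OF f] \<phi>_coset[OF g] by auto
  have "\<phi> (\<xi> **\<^sub>Ac \<zeta>) = ?I +>\<^sub>?R (f **\<^sub>?R g)"
   using f g xz by (intro \<phi>_coset) (auto simp: E.\<Psi>_mult Theta_mult)
  thus "\<phi> (\<xi> **\<^sub>Ac \<zeta>) = \<phi> \<xi> **\<^bsub>?R Quot ?I\<^esub> \<phi> \<zeta>" unfolding fg using I.quotient_ops(2)[OF f(1) g(1)] by simp
  have "\<phi> (\<xi> \<oplus>\<^sub>Ac \<zeta>) = ?I +>\<^sub>?R (f \<oplus>\<^sub>?R g)"
   using f g xz by (intro \<phi>_coset) (auto simp: E.\<Psi>_add Theta_add)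
  thus "\<phi> (\<xi> \<oplus>\<^sub>Ac \<zeta>) = \<phi> \<xi> \<oplus>\<^bsub>?R Quot ?I\<^esub> \<phi> \<zeta>" unfolding fg using I.quotient_ops(3)[OF f(1) g(1)] by simp
 next
  fix \<xi> assume \<xi>: "\<xi> \<in> carrier Ac"
  obtain f where f: "f \<in> carrier ?R" "\<And>i k. i < m ==> parametrize K m f i k = \<Theta> \<xi> i k" using lift[OF \<xi>] by blast
  show "\<phi> \<xi> \<in> carrier (?R Quot ?I)" using \<phi>_coset[OF f] I.quotient_ops(1)[OF f(1) f(1)] by simp
 next
  have "\<phi> \<one>\<^sub>Ac = ?I +>\<^sub>?R \<one>\<^sub>?R" by (intro \<phi>_coset) (auto simp: E.\<Psi>_one Ac_one Theta_const)
  thus "\<phi> \<one>\<^sub>Ac = \<one>\<^bsub>?R Quot ?I\<^esub>" using I.quotient_ops(4)[OF E.PS.one_closed E.PS.one_closed] by simp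
 next
  show "bij_betw \<phi> (carrier Ac) (carrier (?R Quot ?I))"
  proof (rule bij_betw_imageI)
   show "inj_on \<phi> (carrier Ac)"
   proof (rule inj_onI)
    fix \<xi> \<zeta> assume xz: "\<xi> \<in> carrier Ac" "\<zeta> \<in> carrier Ac" "\<phi> \<xi> = \<phi> \<zeta>"
    obtain f where f: "f \<in> carrier ?R" "\<forall>i<m. \<forall>k. parametrize K m f i k = \<Theta> \<xi> i k" using lift[OF xz(1)] by blast
    hence "f \<in> \<phi> \<xi>" by (simp add: \<phi>_def)
    hence "f \<in> \<phi> \<zeta>" using xz by simp
    hence "\<forall>i<m. \<forall>k. parametrize K m f i k = \<Theta> \<zeta> i k" by (simp add: \<phi>_def)
    thus "\<xi> = \<zeta>" using f xz by (intro Theta_inj) auto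
   qed
   show "\<phi> ` carrier Ac = carrier (?R Quot ?I)"
   proof
    show "\<phi> ` carrier Ac \<subseteq> carrier (?R Quot ?I)"
    proof
     fix Z assume "Z \<in> \<phi> ` carrier Ac"
     then obtain \<xi> where \<xi>: "\<xi> \<in> carrier Ac" "Z = \<phi> \<xi>" by blast
     obtain f where f: "f \<in> carrier ?R" "\<And>i k. i < m ==> parametrize K m f i k = \<Theta> \<xi> i k" using lift[OF \<xi>(1)] by blast
     show "Z \<in> carrier (?R Quot ?I)" using \<phi>_coset[OF f] \<xi>(2) I.quotient_ops(1)[OF f(1) f(1)] by simp
    qed
    show "carrier (?R Quot ?I) \<subseteq> \<phi> ` carrier Ac"
    proof
     fix Z assume "Z \<in> carrier (?R Quot ?I)"
     then obtain f where f: "f \<in> carrier ?R" "Z = ?I +>\<^sub>?R f" using I.quotient_repr by blast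
     obtain \<xi> where \<xi>: "\<xi> \<in> carrier Ac" "\<forall>i<m. \<forall>k. \<Theta> \<xi> i k = parametrize K m f i k"
      using Theta_surj[OF E.\<Psi>_gluing[OF f(1)]] by blast
     have "\<phi> \<xi> = Z" unfolding f(2) using f(1) \<xi>(2) by (intro \<phi>_coset) auto
     thus "Z \<in> \<phi> ` carrier Ac" using \<xi>(1) by blast
    qed
   qed
  qed
 qed
 moreover have "\<phi> (const c) = ?I +>\<^sub>?R ps_const K c" if "c \<in> carrier K" for c
  using that m_pos E.\<Psi>_const by (intro \<phi>_coset) (auto simp: Theta_const)
 ultimately show ?thesis unfolding Ac_def const_def by blast
qed

end

section \<open>Localizations\<close>

lemma (in cring) ideal_Union_chain:
 assumes "\<C> \<noteq> {}" "\<And>I. I \<in> \<C> ==> ideal I R" "\<And>I J. I \<in> \<C> ==> J \<in> \<C> ==> I \<subseteq> J \<or> J \<subseteq> I"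
 shows "ideal (\<Union>\<C>) R"
proof (rule idealI)
 show "subgroup (\<Union>\<C>) (add_monoid R)"
 proof (rule add.subgroupI)
  show "\<Union>\<C> \<subseteq> carrier R" using ideal.Icarr[OF assms(2)] by blast
  obtain I where "I \<in> \<C>" using assms(1) by blast
  thus "\<Union>\<C> \<noteq> {}" using additive_subgroup.zero_closed[OF ideal.axioms(1)[OF assms(2)]] by blast
 next
  fix a assume "a \<in> \<Union>\<C>"
  thus "\<ominus> a \<in> \<Union>\<C>" using additive_subgroup.a_inv_closed[OF ideal.axioms(1)[OF assms(2)]] by blast
 next
  fix a b assume "a \<in> \<Union>\<C>" "b \<in> \<Union>\<C>"
  then obtain I J where IJ: "I \<in> \<C>" "a \<in> I" "J \<in> \<C>" "b \<in> J" by blast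
  then obtain I where "I \<in> \<C>" "a \<in> I" "b \<in> I" using assms(3)[OF IJ(1,3)] by auto
  thus "a \<oplus> b \<in> \<Union>\<C>" using additive_subgroup.a_closed[OF ideal.axioms(1)[OF assms(2)]] by blast
 qed
next
 fix a x assume "a \<in> \<Union>\<C>" "x \<in> carrier R"
 thus "x ** a \<in> \<Union>\<C>" "a ** x \<in> \<Union>\<C>" using ideal.I_l_closed[OF assms(2)] ideal.I_r_closed[OF assms(2)] by blast+
qed (rule ring_axioms)

lemma (in cring) nonunit_in_maximalideal:
 assumes a: "a \<in> carrier R" "a \<notin> Units R"
 shows "\<exists>M. maximalideal M R \<and> a \<in> M"
proof -
 let ?P = "{I. ideal I R \<and> a \<in> I \<and> \<one> \<notin> I}"
 have "\<one> \<notin> PIdl a" using a unfolding cgenideal_def Units_def by (auto simp: m_comm)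
 hence "PIdl a \<in> ?P" using a cgenideal_ideal cgenideal_self by blast
 hence "?P \<noteq> {}" by auto
 moreover have "\<Union>\<C> \<in> ?P" if \<C>: "\<C> \<noteq> {}" "subset.chain ?P \<C>" for \<C>
 proof -
  have sub: "\<C> \<subseteq> ?P" and chain: "\<And>I J. I \<in> \<C> ==> J \<in> \<C> ==> I \<subseteq> J \<or> J \<subseteq> I"
   using \<C>(2) by (auto simp: subset_chain_def)
  hence "ideal (\<Union>\<C>) R" using \<C>(1) by (intro ideal_Union_chain) auto
  thus ?thesis using sub \<C>(1) by auto
 qed
 ultimately have "\<exists>M\<in>?P. \<forall>J\<in>?P. M \<subseteq> J --> J = M" by (rule subset_Zorn_nonempty)
 then obtain M where M: "M \<in> ?P" "\<And>J. J \<in> ?P ==> M \<subseteq> J ==> J = M" by auto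
 have "maximalideal M R"
 proof (rule maximalidealI)
  show "ideal M R" using M(1) by blast
  show "carrier R \<noteq> M" using M(1) by blast
  fix J assume J: "ideal J R" "M \<subseteq> J" "J \<subseteq> carrier R"
  show "J = M \<or> J = carrier R" using M J ideal.one_imp_carrier[OF J(1)] by blast
 qed
 thus ?thesis using M(1) by blast
qed

text \<open>Multiplication of a polynomial by the monic linear polynomial with root
  \<open>l\<close>, on coefficient lists. Keeping track of \<open>hd\<close> shows that the product
  has the same leading coefficient, so a nonzero polynomial stays nonzero.\<close>

lemma (in cring) eval_times_linear:
 assumes L: "subring L R" and l: "l \<in> L" and x: "x \<in> carrier R" and p: "p \<noteq> []" "set p \<subseteq> L"
 shows "\<exists>q. q \<noteq> [] \<and> set q \<subseteq> L \<and> hd q = hd p \<and> eval q x = eval p x ** (x \<ominus> l)"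
proof -
 note Lc = subringE(1)[OF L] and Lo = subringE(5,6,7)[OF L]
 have "\<exists>q d. q \<noteq> [] \<and> set (q @ [d]) \<subseteq> L \<and> hd q = hd p \<and> eval (q @ [d]) x = eval p x ** (x \<ominus> l)"
  using p
 proof (induction p rule: rev_nonempty_induct)
  case (single c)
  have "eval ([c] @ [\<ominus> (c ** l)]) x = eval [c] x ** (x \<ominus> l)" using single Lc l x by (simp add: subset_iff) algebra
  thus ?case using single Lo l by (intro exI[of _ "[c]"] exI[of _ "\<ominus> (c ** l)"]) auto
 next
  case (snoc c ps)
  then obtain q d where q: "q \<noteq> []" "set (q @ [d]) \<subseteq> L" "hd q = hd ps"
   "eval (q @ [d]) x = eval ps x ** (x \<ominus> l)" by auto
  have c: "c \<in> carrier R" "l \<in> carrier R" "d \<in> carrier R" "set q \<subseteq> carrier R" "set ps \<subseteq> carrier R"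
   using snoc.prems q Lc l by auto
  hence e: "eval q x \<in> carrier R" "eval ps x \<in> carrier R" using x eval_in_carrier by auto
  have 1: "eval q x ** x \<oplus> d = eval ps x ** (x \<ominus> l)" using q(4) c x by (simp add: eval_snoc)
  have "eval ((q @ [d \<oplus> c]) @ [\<ominus> (c ** l)]) x = (eval q x ** x \<oplus> (d \<oplus> c)) ** x \<oplus> \<ominus> (c ** l)"
   using c x e by (subst eval_snoc) (auto simp: eval_snoc)
  also have "... = (eval q x ** x \<oplus> d) ** x \<oplus> c ** (x \<ominus> l)" using c(1-3) x e by algebra
  also have "... = (eval ps x ** (x \<ominus> l)) ** x \<oplus> c ** (x \<ominus> l)" unfolding 1 ..
  also have "... = (eval ps x ** x \<oplus> c) ** (x \<ominus> l)" using c(1-3) x e by algebra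
  also have "... = eval (ps @ [c]) x ** (x \<ominus> l)" using c x by (simp add: eval_snoc)
  finally show ?case using q snoc.prems Lo l snoc.hyps by (intro exI[of _ "q @ [d \<oplus> c]"] exI[of _ "\<ominus> (c ** l)"]) auto
 qed
 then obtain q d where "q \<noteq> []" "set (q @ [d]) \<subseteq> L" "hd q = hd p" "eval (q @ [d]) x = eval p x ** (x \<ominus> l)" by blast
 thus ?thesis by (intro exI[of _ "q @ [d]"]) auto
qed

lemma (in ring) simple_extension_eval:
 assumes "L \<subseteq> carrier R" "x \<in> carrier R" "r \<in> simple_extension L x"
 shows "\<exists>p. polynomial L p \<and> eval p x = r" using assms(3)
proof induction
 case zero
 thus ?case by (auto simp: polynomial_def intro!: exI[of _ "[]"])
next
 case (lin r k)
 then obtain p where p: "polynomial L p" "eval p x = r" by blast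
 hence rc: "r \<in> carrier R" using assms by (auto simp: polynomial_def intro!: eval_in_carrier)
 show ?case
 proof (cases "p = [] \<and> k = \<zero>")
  case True
  thus ?thesis using p assms by (intro exI[of _ "[]"]) (auto simp: polynomial_def)
 next
  case False
  have "eval (p @ [k]) x = r ** x \<oplus> k" using p lin.hyps assms by (subst eval_snoc) (auto simp: polynomial_def)
  moreover have "polynomial L (p @ [k])" using False p lin.hyps by (cases p) (auto simp: polynomial_def)
  ultimately show ?thesis by blast
 qed
qed

text \<open>If \<open>r\<close> is the value at \<open>x\<close> of a nonzero polynomial over
  \<open>L\<close>, then \<open>(x - l) r\<close> is the value of another nonzero polynomial, which
  cannot vanish as \<open>x\<close> is transcendental.\<close>

lemma (in cring) transcendental_linear_nonzerodivisor:
 assumes L: "subring L R" and l: "l \<in> L" and x: "x \<in> carrier R" and t: "transcendental L x"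
  and r: "r \<in> simple_extension L x" and 0: "(x \<ominus> l) ** r = \<zero>"
 shows "r = \<zero>"
proof -
 obtain p where p: "polynomial L p" "eval p x = r" using simple_extension_eval[OF subringE(1)[OF L] x r] by blast
 have rc: "r \<in> carrier R" "l \<in> carrier R" using p x l subringE(1)[OF L] by (auto simp: polynomial_def intro!: eval_in_carrier)
 show ?thesis
 proof (cases "p = []")
  case False
  then obtain q where q: "q \<noteq> []" "set q \<subseteq> L" "hd q = hd p" "eval q x = r ** (x \<ominus> l)"
   using eval_times_linear[OF L l x False] p by (auto simp: polynomial_def)
  hence "eval q x = eval [] x" using 0 x rc by (simp add: m_comm)
  moreover have "q \<in> carrier (univ_poly R L)" "[] \<in> carrier (univ_poly R L)" using q p False by (auto simp: univ_poly_def polynomial_def)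
  ultimately show ?thesis using t q(1) unfolding transcendental_def inj_on_def by blast
 qed (use p in auto)
qed

context kalgebra
begin

text \<open>Module generators of \<open>A\<close> over \<open>C\<close>, multiplied by elements that
  span \<open>C\<close> modulo \<open>t\<close>, span \<open>A\<close> modulo \<open>t\<close>;
  hence the product index set.\<close>

lemma spans_mod_finite_over:
 fixes J :: "'j set"
 assumes t: "t \<in> carrier A" and fin: "finite_over A C" and C: "C \<subseteq> carrier A" and J: "finite J" "b \<in> J \<rightarrow> carrier A"
  and span: "\<And>c. c \<in> C ==> \<exists>d\<in>J \<rightarrow> carrier K. c \<ominus> lincomb J d b \<in> multiples A t"
 shows "\<exists>(I :: ('x \<times> 'j) set) b'. spans_mod K A emb (multiples A t) I b'"
proof -
 obtain S where S: "finite S" "S \<subseteq> carrier A"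
  "\<And>x. x \<in> carrier A ==> \<exists>c\<in>S \<rightarrow> C. x = (\<Oplus>s\<in>S. c s ** s)" using fin unfolding finite_over_def by blast
 note W = ksubspace_multiples[OF t]
 define b' where "b' = (\<lambda>(s, j). b j ** s)"
 have b': "b' \<in> S \<times> J \<rightarrow> carrier A" using S J by (auto simp: b'_def)
 have "\<exists>d\<in>S \<times> J \<rightarrow> carrier K. x \<ominus> lincomb (S \<times> J) d b' \<in> multiples A t" if x: "x \<in> carrier A" for x
 proof -
  obtain c where c: "c \<in> S \<rightarrow> C" "x = (\<Oplus>s\<in>S. c s ** s)" using S(3)[OF x] by blast
  have "\<forall>s\<in>S. \<exists>d. d \<in> J \<rightarrow> carrier K \<and> c s \<ominus> lincomb J d b \<in> multiples A t" using span c by blast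
  from bchoice[OF this] obtain d where d: "\<And>s. s \<in> S ==> d s \<in> J \<rightarrow> carrier K"
   "\<And>s. s \<in> S ==> c s \<ominus> lincomb J (d s) b \<in> multiples A t" by blast
  have cl: "c s \<in> carrier A" "s \<in> carrier A" "lincomb J (d s) b \<in> carrier A" if "s \<in> S" for s using c C S d J that by auto
  have "lincomb (S \<times> J) (\<lambda>(s, j). d s j) b' = (\<Oplus>s\<in>S. \<Oplus>j\<in>J. emb (d s j) ** (b j ** s))"
   using S.finsum_Sigma[of S "\<lambda>_. J" "\<lambda>s j. emb (d s j) ** (b j ** s)"] S J d cl by (simp add: b'_def case_prod_unfold Pi_iff)
  also have "... = (\<Oplus>s\<in>S. lincomb J (d s) b ** s)"
  proof (intro S.finsum_cong' refl)
   fix s assume s: "s \<in> S"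
   show "(\<Oplus>j\<in>J. emb (d s j) ** (b j ** s)) = lincomb J (d s) b ** s"
    using d[OF s] J cl[OF s] by (subst S.finsum_ldistr) (auto simp: Pi_iff S.m_assoc intro!: S.finsum_cong')
  qed (use cl in auto)
  finally have e: "lincomb (S \<times> J) (\<lambda>(s, j). d s j) b' = (\<Oplus>s\<in>S. lincomb J (d s) b ** s)" .
  have "x = (\<Oplus>s\<in>S. (c s \<ominus> lincomb J (d s) b) ** s \<oplus> lincomb J (d s) b ** s)" unfolding c(2)
  proof (intro S.finsum_cong' refl)
   fix s assume s: "s \<in> S"
   show "c s ** s = (c s \<ominus> lincomb J (d s) b) ** s \<oplus> lincomb J (d s) b ** s"
    using cl[OF s] S.distrib_diff_add[of s "c s" "lincomb J (d s) b"] by (simp add: S.m_comm)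
  qed (use cl in auto)
  also have "... = (\<Oplus>s\<in>S. (c s \<ominus> lincomb J (d s) b) ** s) \<oplus> (\<Oplus>s\<in>S. lincomb J (d s) b ** s)"
   using cl by (intro S.finsum_addf) auto
  finally have "x \<ominus> lincomb (S \<times> J) (\<lambda>(s, j). d s j) b' = (\<Oplus>s\<in>S. (c s \<ominus> lincomb J (d s) b) ** s)"
   unfolding e using cl by (simp add: a_minus_def S.a_assoc S.r_neg S.finsum_closed Pi_iff)
  moreover have "... \<in> multiples A t" using ksubspace_finsum[OF W S(1)] multiples_mult(1)[OF t d(2)] cl by simp
  moreover have "(\<lambda>(s, j). d s j) \<in> S \<times> J \<rightarrow> carrier K" using d by auto
  ultimately show ?thesis by (intro bexI[of _ "\<lambda>(s, j). d s j"]) auto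
 qed
 hence "spans_mod K A emb (multiples A t) (S \<times> J) b'" unfolding spans_mod_def using S(1) J(1) b' by simp
 thus ?thesis by blast
qed

end

text \<open>A characterization of rings of fractions up to isomorphism: denominators become units,
  every element is a fraction, and an element dies only if a denominator kills it. In this form it
  can be checked on stalks, which are given as classes of sections.\<close>

locale localization = ring_hom_cring A L g for A (structure) and L (structure) and g +
 fixes T
 assumes denom_closed: "s \<in> T ==> s \<in> carrier A"
  and denom_one: "\<one> \<in> T"
  and denom_mult: "s \<in> T ==> s' \<in> T ==> s ** s' \<in> T"
  and denom_unit: "s \<in> T ==> g s \<in> Units L"
  and fraction: "z \<in> carrier L ==> \<exists>a\<in>carrier A. \<exists>s\<in>T. z **\<^sub>L g s = g a"
  and kernel: "a \<in> carrier A ==> g a = \<zero>\<^sub>L ==> \<exists>s\<in>T. s ** a = \<zero>"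
begin

lemma equal:
 assumes "a \<in> carrier A" "b \<in> carrier A" "g a = g b"
 shows "\<exists>s\<in>T. s ** a = s ** b"
proof -
 have "g (a \<ominus> b) = \<zero>\<^sub>L" using assms S.r_neg[of "g b"] by (simp add: a_minus_def)
 then obtain s where s: "s \<in> T" "s ** (a \<ominus> b) = \<zero>" using kernel assms by blast
 note sc = denom_closed[OF s(1)]
 have "s ** a = s ** (a \<ominus> b) \<oplus> s ** b" by (rule R.distrib_diff_add[OF sc assms(1,2)])
 hence "s ** a = s ** b" unfolding s(2) using sc assms(2) by simp
 thus ?thesis using s(1) by blast
qed

lemma denom_cancel:
 assumes "s \<in> T" "x \<in> carrier L" "y \<in> carrier L" "x **\<^sub>L g s = y **\<^sub>L g s"
 shows "x = y" using S.Units_l_cancel[OF denom_unit[OF assms(1)] assms(2,3)] assms(4)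
  S.m_comm[OF assms(2) S.Units_closed[OF denom_unit[OF assms(1)]]]
  S.m_comm[OF assms(3) S.Units_closed[OF denom_unit[OF assms(1)]]] by simp

end

locale prime_localization = localization A L g "carrier A - P" + P: primeideal P A
 for A (structure) and L (structure) and g and P
begin

lemma unit_iff: "a \<in> carrier A ==> g a \<in> Units L \<longleftrightarrow> a \<notin> P"
proof
 assume a: "a \<in> carrier A" and u: "g a \<in> Units L"
 obtain b s where bs: "b \<in> carrier A" "s \<in> carrier A - P" "inv\<^bsub>L\<^esub> (g a) **\<^sub>L g s = g b" using fraction u by blast
 have "g (a ** b) = g a **\<^sub>L (inv\<^bsub>L\<^esub> (g a) **\<^sub>L g s)" using a bs by simp
 also have "... = g s" using u bs(2) a by (simp add: S.m_assoc[symmetric] S.Units_r_inv del: S.m_assoc)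
 finally obtain v where v: "v \<in> carrier A - P" "v ** (a ** b) = v ** s" using equal[of "a ** b" s] a bs by auto
 show "a \<notin> P"
 proof
  assume "a \<in> P"
  hence "v ** (a ** b) \<in> P" using P.I_l_closed[OF P.I_r_closed[of a b]] v(1) bs(1) by blast
  thus False using v bs denom_mult[OF v(1) bs(2)] by simp
 qed
qed (use denom_unit in simp)

lemma unit_fraction_iff:
 assumes "z \<in> carrier L" "a \<in> carrier A" "s \<in> carrier A - P" "z **\<^sub>L g s = g a"
 shows "z \<in> Units L \<longleftrightarrow> a \<notin> P"
proof -
 have "z \<in> Units L \<longleftrightarrow> z **\<^sub>L g s \<in> Units L"
  using denom_unit[OF assms(3)] assms(1) S.Units_m_closed S.unit_factor[of z "g s"] by blast
 thus ?thesis using unit_iff assms by simp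
qed

lemma zero_nonunit: "\<zero>\<^sub>L \<notin> Units L" using unit_iff[of "\<zero>"] P.zero_closed by simp

lemma nonunits_add:
 assumes "x \<in> nonunits L" "y \<in> nonunits L"
 shows "x \<oplus>\<^sub>L y \<in> nonunits L"
proof -
 have c: "x \<in> carrier L" "y \<in> carrier L" using assms by (auto simp: nonunits_def)
 obtain a s where a: "a \<in> carrier A" "s \<in> carrier A - P" "x **\<^sub>L g s = g a" using fraction[OF c(1)] by blast
 obtain b r where b: "b \<in> carrier A" "r \<in> carrier A - P" "y **\<^sub>L g r = g b" using fraction[OF c(2)] by blast
 have ab: "a \<in> P" "b \<in> P" using unit_fraction_iff a b c assms by (auto simp: nonunits_def)
 have gc: "g s \<in> carrier L" "g r \<in> carrier L" using a b by auto
 have "(x \<oplus>\<^sub>L y) **\<^sub>L g (s ** r) = (x \<oplus>\<^sub>L y) **\<^sub>L (g s **\<^sub>L g r)" using a b by simp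
 also have "... = (x **\<^sub>L g s) **\<^sub>L g r \<oplus>\<^sub>L (y **\<^sub>L g r) **\<^sub>L g s" using c gc by algebra
 also have "... = g (a ** r \<oplus> b ** s)" using a b by simp
 finally have "x \<oplus>\<^sub>L y \<notin> Units L"
  using unit_fraction_iff[of "x \<oplus>\<^sub>L y" "a ** r \<oplus> b ** s" "s ** r"] denom_mult[OF a(2) b(2)] c a b ab
   P.I_r_closed P.a_closed by simp
 thus ?thesis using c by (simp add: nonunits_def)
qed

lemma local_algebra:
 assumes "kalgebra K A emb"
 shows "local_algebra K L (g \<circ> emb)"
proof -
 interpret K: kalgebra K A emb by fact
 show ?thesis by unfold_locales (use zero_nonunit nonunits_add in "auto intro!: ring_hom_memI")
qed

text \<open>Zero constant terms of the polynomial can be divided out because \<open>s\<close>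
  becomes a unit. Once the constant term \<open>c\<close> is nonzero and \<open>y\<close> is the
  value of the tail, \<open>c + s y\<close> being zero modulo \<open>t\<close> makes
  \<open>- y/c\<close> an inverse of \<open>s\<close> modulo \<open>t\<close>, and this inverse lies
  in \<open>A\<close>.\<close>

lemma inverse_mod:
 assumes "kalgebra K A emb" and t: "t \<in> carrier A" and s: "s \<in> carrier A - P"
  and cs: "set cs \<subseteq> carrier K" "\<not> set cs \<subseteq> {\<zero>\<^sub>K}" "g (horner A emb cs s) \<in> multiples L (g t)"
 shows "\<exists>e\<in>carrier A. \<one>\<^sub>L \<ominus>\<^sub>L g (s ** e) \<in> multiples L (g t)"
proof -
 interpret K: kalgebra K A emb by fact
 interpret L: local_algebra K L "g \<circ> emb" by (rule local_algebra) fact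
 have tc: "g t \<in> carrier L" and su: "g s \<in> Units L" and sc: "s \<in> carrier A" using t s denom_unit by auto
 show ?thesis using cs
 proof (induction cs)
  case (Cons c cs)
  define y where "y = horner A emb cs s"
  have y: "y \<in> carrier A" using Cons.prems sc by (simp add: y_def)
  have c: "c \<in> carrier K" using Cons.prems by simp
  obtain x where x: "x \<in> carrier L" "g (emb c) \<oplus>\<^sub>L g s **\<^sub>L g y = g t **\<^sub>L x"
   using Cons.prems(3) y c sc by (auto simp: multiples_def y_def[symmetric])
  show ?case
  proof (cases "c = \<zero>\<^sub>K")
   case True
   hence "g s **\<^sub>L g y \<in> multiples L (g t)" using x y sc by (auto simp: multiples_def)
   moreover have "inv\<^bsub>L\<^esub> g s **\<^sub>L (g s **\<^sub>L g y) = g y"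
    using S.m_assoc[of "inv\<^bsub>L\<^esub> g s" "g s" "g y"] S.Units_l_inv[OF su] su y sc by simp
   ultimately have "g y \<in> multiples L (g t)" using L.multiples_mult(2)[OF tc _ S.Units_inv_closed[OF su]] by metis
   thus ?thesis using Cons True by (auto simp: y_def)
  next
   case False
   hence cu: "c \<in> Units K" using c K.K.field_Units by simp
   define d where "d = inv\<^bsub>K\<^esub> c"
   have d: "d \<in> carrier K" "d **\<^sub>K c = \<one>\<^sub>K" using cu by (auto simp: d_def)
   define e where "e = \<ominus> (emb d ** y)"
   have e: "e \<in> carrier A" using d y by (simp add: e_def)
   have 1: "g (emb d) **\<^sub>L g (emb c) = \<one>\<^sub>L" using d c L.hom_mult[of d c] by simp
   have cl: "g (emb d) \<in> carrier L" "g (emb c) \<in> carrier L" "g s \<in> carrier L" "g y \<in> carrier L" using d c sc y by auto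
   have "\<one>\<^sub>L \<ominus>\<^sub>L g (s ** e) = g (emb d) **\<^sub>L g (emb c) \<ominus>\<^sub>L g s **\<^sub>L (\<ominus>\<^sub>L (g (emb d) **\<^sub>L g y))"
    using d y sc by (simp add: 1 e_def)
   also have "... = g (emb d) **\<^sub>L (g (emb c) \<oplus>\<^sub>L g s **\<^sub>L g y)" using cl by algebra
   also have "... = g t **\<^sub>L (g (emb d) **\<^sub>L x)" using x(1) cl tc by (simp add: x(2) S.m_lcomm)
   finally show ?thesis using e cl x(1) by (auto simp: multiples_def)
  qed
 qed simp
qed

text \<open>Modulo \<open>t\<close> each denominator is already invertible by an element of
  \<open>A\<close>. A fraction \<open>a/s\<close> is thus congruent to the image of some
  \<open>a e\<close>, and the family that spans \<open>A\<close> modulo \<open>t\<close> also spans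
  the localization.\<close>

lemma spans_mod_localization:
 assumes A: "kalgebra K A emb" and t: "t \<in> P" and b: "spans_mod K A emb (multiples A t) I b"
 shows "spans_mod K L (g \<circ> emb) (multiples L (g t)) I (g \<circ> b)"
proof -
 interpret K: kalgebra K A emb by fact
 interpret L: local_algebra K L "g \<circ> emb" by (rule local_algebra) fact
 have tA: "t \<in> carrier A" and tc: "g t \<in> carrier L" using t by auto
 note WA = K.ksubspace_multiples[OF tA] and WL = L.ksubspace_multiples[OF tc]
 have I: "finite I" "b \<in> I \<rightarrow> carrier A" using b by (auto simp: spans_mod_def)
 have hom: "g x \<in> multiples L (g t)" if "x \<in> multiples A t" for x using that tA by (auto simp: multiples_def)
 have "\<exists>c\<in>I \<rightarrow> carrier K. z \<ominus>\<^sub>L L.lincomb I c (g \<circ> b) \<in> multiples L (g t)" if z: "z \<in> carrier L" for z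
 proof -
  obtain a s where a: "a \<in> carrier A" "s \<in> carrier A - P" "z **\<^sub>L g s = g a" using fraction[OF z] by blast
  have sc: "s \<in> carrier A" using a by simp
  obtain cs where cs: "set cs \<subseteq> carrier K" "\<not> set cs \<subseteq> {\<zero>\<^sub>K}" "horner A emb cs s ** \<one> \<in> multiples A t"
   using K.algebraic_mod[OF WA b sc] by blast
  hence "g (horner A emb cs s) \<in> multiples L (g t)" using hom sc by simp
  then obtain e where e: "e \<in> carrier A" "\<one>\<^sub>L \<ominus>\<^sub>L g (s ** e) \<in> multiples L (g t)"
   using inverse_mod[OF A tA a(2) cs(1,2)] by blast
  obtain c where c: "c \<in> I \<rightarrow> carrier K" "(a ** e) \<ominus> K.lincomb I c b \<in> multiples A t"
   using b a(1) e(1) unfolding spans_mod_def by blast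
  have lc: "K.lincomb I c b \<in> carrier A" using c I by simp
  define d w v where "d = z **\<^sub>L (\<one>\<^sub>L \<ominus>\<^sub>L g (s ** e))" and "w = g (K.lincomb I c b)" and "v = g (a ** e)"
  have dc: "d \<in> carrier L" "w \<in> carrier L" "v \<in> carrier L" using z sc e lc a by (auto simp: d_def w_def v_def)
  have "v = z **\<^sub>L g (s ** e)" using a(1,3) e(1) sc z by (simp add: v_def S.m_assoc[symmetric])
  hence zd: "z = d \<oplus>\<^sub>L v" using S.distrib_diff_add[of z "\<one>\<^sub>L" "g (s ** e)"] z sc e(1) by (simp add: d_def)
  have "L.lincomb I c (g \<circ> b) = w" using c I unfolding w_def by (subst hom_finsum) (auto simp: Pi_iff intro!: S.finsum_cong')
  hence "z \<ominus>\<^sub>L L.lincomb I c (g \<circ> b) = (d \<oplus>\<^sub>L v) \<ominus>\<^sub>L w" by (simp add: zd)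
  also have "... = d \<oplus>\<^sub>L (v \<ominus>\<^sub>L w)" using dc by algebra
  also have "v \<ominus>\<^sub>L w = g ((a ** e) \<ominus> K.lincomb I c b)" using lc a e by (simp add: a_minus_def v_def w_def)
  also have "d \<oplus>\<^sub>L ... \<in> multiples L (g t)"
   using WL L.multiples_mult(2)[OF tc e(2) z] hom[OF c(2)] unfolding ksubspace_def d_def by blast
  finally show ?thesis using c(1) by blast
 qed
 moreover have "g \<circ> b \<in> I \<rightarrow> carrier L" using I by (auto simp: Pi_iff)
 ultimately show ?thesis unfolding spans_mod_def using I(1) by simp
qed

end

section \<open>Charts of the normalization\<close>

lemma (in cring) inverse_mod_maximalideal:
 assumes "maximalideal M R" "a \<in> carrier R" "a \<notin> M"
 shows "\<exists>b\<in>carrier R. a ** b \<ominus> \<one> \<in> M"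
proof -
 interpret M: maximalideal M R by fact
 interpret F: field "R Quot M" by (rule M.quotient_is_field) (rule cring_axioms)
 have z: "\<zero>\<^bsub>R Quot M\<^esub> = M +> \<zero>" by (simp add: FactRing_def M.a_subset)
 have "M +> a \<noteq> M +> \<zero>" using M.coset_eq_iff[of a \<zero>] assms(2,3) by (simp add: a_minus_def)
 hence "M +> a \<in> Units (R Quot M)" using F.field_Units M.quotient_ops(1)[OF assms(2,2)] z by simp
 then obtain y where "y \<in> carrier (R Quot M)" "(M +> a) **\<^bsub>R Quot M\<^esub> y = \<one>\<^bsub>R Quot M\<^esub>"
  using F.Units_r_inv_ex by blast
 then obtain b where b: "b \<in> carrier R" "(M +> a) **\<^bsub>R Quot M\<^esub> (M +> b) = M +> \<one>"
  using M.quotient_repr M.quotient_ops(4)[OF assms(2,2)] by metis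
 hence "M +> (a ** b) = M +> \<one>" using M.quotient_ops(2)[OF assms(2) b(1)] by simp
 thus ?thesis using M.coset_eq_iff[of "a ** b" \<one>] b(1) assms(2) by blast
qed

text \<open>An affine neighbourhood of the point in algebraic terms: \<open>A\<close> and
  \<open>B\<close> are the coordinate rings of the neighbourhood and of its preimage,
  \<open>L\<close> is the local ring at the prime \<open>P\<close>, \<open>N\<close> is
  \<open>B\<close> with the elements of \<open>A\<close> outside \<open>P\<close> inverted, and the
  \<open>D i\<close> are the local rings of the branches at the primes \<open>Q i\<close>. That the
  normalization is an isomorphism away from the point appears as \<open>clear_denominator\<close>
  and \<open>h_kernel\<close>; \<open>dense\<close> excludes components contracted to the
  point.\<close>

locale normalization_chart =
 A: kalgebra K A emb + h: ring_hom_cring A B h + L: prime_localization A L g P +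
 N: localization B N f "h ` (carrier A - P)" + psi: ring_hom_cring L N \<psi>
 for K :: "'k ring" and A :: "('a, 'aa) ring_scheme" (structure) and emb and B :: "('b, 'bb) ring_scheme" and h
  and L :: "('l, 'll) ring_scheme" and g P and N :: "('n, 'nn) ring_scheme" and f \<psi> +
 fixes m :: nat and D :: "nat => ('d, 'dd) ring_scheme" and Q e \<eta> t
 assumes alg_closed: "algebraically_closed K"
  and psi_g: "a \<in> carrier A ==> \<psi> (g a) = f (h a)"
  and branch: "i < m ==> prime_localization B (D i) (e i) (Q i)"
  and eta: "i < m ==> \<eta> i \<in> ring_hom N (D i)" "i < m ==> b \<in> carrier B ==> \<eta> i (f b) = e i b"
  and lying_over: "primeideal J B ==> {a \<in> carrier A. h a \<in> J} = P ==> \<exists>i<m. J = Q i"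
  and contraction: "i < m ==> {a \<in> carrier A. h a \<in> Q i} = P"
  and Q_inj: "inj_on Q {..<m}"
  and clear_denominator: "x \<in> P ==> b \<in> carrier B ==> \<exists>a\<in>carrier A. \<exists>n::nat. h x [^]\<^sub>B n **\<^sub>B b = h a"
  and h_kernel: "x \<in> P ==> a \<in> carrier A ==> h a = \<zero>\<^sub>B ==> \<exists>n::nat. x [^] n ** a = \<zero>"
  and dense: "i < m ==> s \<in> carrier B ==> s \<notin> Q i ==>
   \<exists>J. primeideal J B \<and> s \<notin> J \<and> {a \<in> carrier A. h a \<in> J} \<noteq> P"
  and finite_B: "finite_over B (h ` carrier A)"
  and normal: "i < m ==> integrally_closed_domain (D i)"
  and delta: "quotient_has_dim K (f \<circ> (h \<circ> emb)) N (\<psi> ` carrier L) m"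
  and t: "t \<in> carrier A" "A.S.transcendental (emb ` carrier K) t"
  and finite_A: "finite_over A (A.S.simple_extension (emb ` carrier K) t)"
  and gorenstein: "free_of_rank_one A (dualizing_module A (A.S.simple_extension (emb ` carrier K) t))"
  and reduced: "a \<in> carrier A ==> a [^] (n::nat) = \<zero> ==> a = \<zero>"
  and singular: "\<not> regular_local_ring L"
begin

abbreviation "embL \<equiv> g \<circ> emb"
abbreviation "embN \<equiv> f \<circ> (h \<circ> emb)"
abbreviation "embD i \<equiv> e i \<circ> (h \<circ> emb)"

sublocale LK: local_algebra K L embL by (rule L.local_algebra) unfold_locales

lemma kalgebra_B: "kalgebra K B (h \<circ> emb)" by unfold_locales (auto intro!: ring_hom_memI)

sublocale NK: kalgebra K N embN by unfold_locales (auto intro!: ring_hom_memI)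

lemma P_closed: "a \<in> P ==> a \<in> carrier A" by (rule L.P.Icarr)

lemma nonunit_g_iff: "a \<in> carrier A ==> g a \<in> nonunits L \<longleftrightarrow> a \<in> P" using L.unit_iff by (auto simp: nonunits_def)

lemma psi_scalar: "c \<in> carrier K ==> embN c = \<psi> (embL c)" by (simp add: psi_g)

lemma ksubspace_psi: "ksubspace K N embN (\<psi> ` carrier L)" unfolding ksubspace_def
proof (intro conjI ballI)
 show "\<zero>\<^sub>N \<in> \<psi> ` carrier L" by (rule image_eqI[of _ _ "\<zero>\<^sub>L"]) auto
next
 fix x y assume "x \<in> \<psi> ` carrier L" "y \<in> \<psi> ` carrier L"
 then obtain a b where ab: "a \<in> carrier L" "b \<in> carrier L" "x = \<psi> a" "y = \<psi> b" by blast
 thus "x \<oplus>\<^sub>N y \<in> \<psi> ` carrier L" by (intro image_eqI[of _ _ "a \<oplus>\<^sub>L b"]) auto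
next
 fix c x assume c: "c \<in> carrier K" and "x \<in> \<psi> ` carrier L"
 then obtain a where a: "a \<in> carrier L" "x = \<psi> a" by blast
 thus "embN c **\<^sub>N x \<in> \<psi> ` carrier L" unfolding psi_scalar[OF c] a(2) using c by (intro image_eqI[of _ _ "embL c **\<^sub>L a"]) auto
qed auto

lemma spans_N: "\<exists>b. spans_mod K N embN (\<psi> ` carrier L) {..<m} b"
proof -
 obtain b where b: "b \<in> {..<m} \<rightarrow> carrier N" and ex: "\<forall>x\<in>carrier N.
   \<exists>!c. c \<in> {..<m} \<rightarrow>\<^sub>E carrier K \<and> x \<ominus>\<^sub>N NK.lincomb {..<m} c b \<in> \<psi> ` carrier L"
  using delta unfolding quotient_has_dim_def by (elim bexE) (rule that)
 have "\<exists>c\<in>{..<m} \<rightarrow> carrier K. x \<ominus>\<^sub>N NK.lincomb {..<m} c b \<in> \<psi> ` carrier L" if x: "x \<in> carrier N" for x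
 proof -
  obtain c where c: "c \<in> {..<m} \<rightarrow>\<^sub>E carrier K" "x \<ominus>\<^sub>N NK.lincomb {..<m} c b \<in> \<psi> ` carrier L"
   using ex1_implies_ex[OF bspec[OF ex x]] by (elim exE conjE) (rule that)
  hence "c \<in> {..<m} \<rightarrow> carrier K" by (simp add: PiE_def)
  with c(2) show ?thesis by (rule bexI)
 qed
 hence "spans_mod K N embN (\<psi> ` carrier L) {..<m} b" unfolding spans_mod_def using b by simp
 thus ?thesis by blast
qed

text \<open>An inverse \<open>\<beta>\<close> of \<open>\<psi> \<alpha>\<close> modulo \<open>M\<close> satisfies a polynomial relation modulo the image of \<open>\<psi>\<close>; multiplying it
 by a power of \<open>\<alpha>\<close> turns it into a unit of \<open>L\<close> that lies in \<open>M\<close>.\<close>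

lemma nonunits_in_maximalideal:
 assumes M: "maximalideal M N" and \<alpha>: "\<alpha> \<in> nonunits L"
 shows "\<psi> \<alpha> \<in> M"
proof (rule ccontr)
 assume n: "\<psi> \<alpha> \<notin> M"
 interpret M: maximalideal M N by fact
 have \<alpha>c: "\<alpha> \<in> carrier L" using \<alpha> by (simp add: nonunits_def)
 define a where "a = \<psi> \<alpha>"
 have ac: "a \<in> carrier N" using \<alpha>c by (simp add: a_def)
 obtain \<beta> where \<beta>: "\<beta> \<in> carrier N" "a **\<^sub>N \<beta> \<ominus>\<^sub>N \<one>\<^sub>N \<in> M"
  using N.S.inverse_mod_maximalideal[OF M ac] n by (auto simp: a_def)
 obtain b where b: "spans_mod K N embN (\<psi> ` carrier L) {..<m} b" using spans_N by blast
 let ?H = "\<lambda>cs. horner N embN cs \<beta>"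
 \<comment> \<open>Modulo \<open>M\<close> the product of \<open>\<psi> \<alpha>\<close> and
   \<open>\<beta>\<close> is 1. A sufficient power of \<open>\<alpha>\<close> therefore turns
   \<open>?H cs ** \<beta>\<close> into a polynomial in \<open>\<alpha>\<close> with the
   coefficients reversed, whose constant term is the last nonzero entry of \<open>cs\<close>; this
   is the unit \<open>v\<close>.\<close>
 have key: "\<exists>k::nat. \<exists>v\<in>Units L. \<psi> (\<alpha> [^]\<^sub>L Suc k) **\<^sub>N (?H cs **\<^sub>N \<beta>) \<ominus>\<^sub>N \<psi> v \<in> M"
  if "set cs \<subseteq> carrier K" "\<not> set cs \<subseteq> {\<zero>\<^sub>K}" for cs using that
 proof (induction cs)
  case (Cons c cs)
  have c: "c \<in> carrier K" and H: "?H cs \<in> carrier N" using Cons.prems \<beta>(1) by auto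
  define w where "w = \<psi> (embL c)"
  have w: "w \<in> carrier N" using c by (simp add: w_def)
  have Hc: "?H (c # cs) = w \<oplus>\<^sub>N \<beta> **\<^sub>N ?H cs" using psi_scalar[OF c] by (simp add: w_def)
  show ?case
  proof (cases "set cs \<subseteq> {\<zero>\<^sub>K}")
   case True
   hence "c \<noteq> \<zero>\<^sub>K" using Cons.prems by auto
   hence u: "embL c \<in> Units L" using LK.scalar_unit c by blast
   have "?H cs = \<zero>\<^sub>N" using NK.horner_zero True \<beta>(1) by blast
   hence "?H (c # cs) = w" using w \<beta>(1) unfolding Hc by simp
   hence "\<psi> (\<alpha> [^]\<^sub>L Suc 0) **\<^sub>N (?H (c # cs) **\<^sub>N \<beta>) \<ominus>\<^sub>N w = a **\<^sub>N (w **\<^sub>N \<beta>) \<ominus>\<^sub>N w"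
    using \<alpha>c by (simp add: a_def)
   also have "... = (a **\<^sub>N \<beta> \<ominus>\<^sub>N \<one>\<^sub>N) **\<^sub>N w" using ac \<beta>(1) w by algebra
   also have "... \<in> M" using M.I_r_closed \<beta>(2) w by blast
   finally show ?thesis using u unfolding w_def by blast
  next
   case False
   then obtain k v where kv: "v \<in> Units L" "\<psi> (\<alpha> [^]\<^sub>L Suc k) **\<^sub>N (?H cs **\<^sub>N \<beta>) \<ominus>\<^sub>N \<psi> v \<in> M"
    using Cons by (meson set_subset_Cons subset_trans)
   define q where "q = \<alpha> [^]\<^sub>L Suc k"
   have "q \<in> nonunits L" unfolding q_def using \<alpha> \<alpha>c by (simp add: LK.nonunits_mult)
   hence u: "v \<oplus>\<^sub>L embL c **\<^sub>L q \<in> Units L" using LK.unit_add_nonunit[OF kv(1)] LK.nonunits_mult(2) c by simp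
   have qc: "q \<in> carrier L" "v \<in> carrier L" using \<alpha>c kv by (auto simp: q_def)
   have cl: "\<psi> q \<in> carrier N" "\<psi> v \<in> carrier N" using qc by auto
   have "\<psi> (\<alpha> [^]\<^sub>L Suc (Suc k)) = \<psi> q **\<^sub>N a" using qc \<alpha>c by (simp add: q_def a_def)
   moreover have "\<psi> (v \<oplus>\<^sub>L embL c **\<^sub>L q) = \<psi> v \<oplus>\<^sub>N w **\<^sub>N \<psi> q" using qc c by (simp add: w_def)
   moreover have "(\<psi> q **\<^sub>N a) **\<^sub>N ((w \<oplus>\<^sub>N \<beta> **\<^sub>N ?H cs) **\<^sub>N \<beta>) \<ominus>\<^sub>N (\<psi> v \<oplus>\<^sub>N w **\<^sub>N \<psi> q)
     = (a **\<^sub>N \<beta> \<ominus>\<^sub>N \<one>\<^sub>N) **\<^sub>N (w **\<^sub>N \<psi> q \<oplus>\<^sub>N \<psi> q **\<^sub>N (?H cs **\<^sub>N \<beta>)) \<oplus>\<^sub>N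
      (\<psi> q **\<^sub>N (?H cs **\<^sub>N \<beta>) \<ominus>\<^sub>N \<psi> v)" using cl H w ac \<beta>(1) by algebra
   moreover have "... \<in> M" using M.a_closed M.I_r_closed[OF \<beta>(2)] kv(2) cl w H \<beta>(1) unfolding q_def by simp
   ultimately show ?thesis using u unfolding Hc by metis
  qed
 qed simp
 obtain cs where cs: "set cs \<subseteq> carrier K" "\<not> set cs \<subseteq> {\<zero>\<^sub>K}" "?H cs **\<^sub>N \<beta> \<in> \<psi> ` carrier L"
  using NK.algebraic_mod[OF ksubspace_psi b \<beta>(1,1)] by blast
 obtain k v z where z: "z \<in> carrier L" "?H cs **\<^sub>N \<beta> = \<psi> z" and
  kv: "v \<in> Units L" "\<psi> (\<alpha> [^]\<^sub>L Suc k) **\<^sub>N (?H cs **\<^sub>N \<beta>) \<ominus>\<^sub>N \<psi> v \<in> M" using key[OF cs(1,2)] cs(3) by blast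
 define u where "u = \<ominus>\<^sub>L v \<oplus>\<^sub>L \<alpha> [^]\<^sub>L Suc k **\<^sub>L z"
 have q: "\<alpha> [^]\<^sub>L Suc k **\<^sub>L z \<in> nonunits L" using \<alpha> \<alpha>c z LK.nonunits_mult by simp
 have "\<ominus>\<^sub>L v \<in> Units L"
  using L.S.Units_m_closed[OF L.S.Units_minus_one_closed kv(1)] L.S.l_minus[OF L.S.one_closed L.S.Units_closed[OF kv(1)]] L.S.Units_closed[OF kv(1)] by simp
 hence u: "u \<in> Units L" unfolding u_def by (rule LK.unit_add_nonunit[OF _ q])
 have "\<psi> u = \<psi> (\<alpha> [^]\<^sub>L Suc k) **\<^sub>N \<psi> z \<ominus>\<^sub>N \<psi> v"
  using \<alpha>c z L.S.Units_closed[OF kv(1)] by (simp add: u_def a_minus_def N.S.a_comm)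
 hence "\<psi> u \<in> M" using kv(2) z by simp
 moreover have "\<psi> (inv\<^bsub>L\<^esub> u) **\<^sub>N \<psi> u = \<one>\<^sub>N"
  using psi.hom_mult[of "inv\<^bsub>L\<^esub> u" u] L.S.Units_l_inv[OF u] L.S.Units_closed[OF u] L.S.Units_inv_closed[OF u] by simp
 ultimately have "\<one>\<^sub>N \<in> M" using M.I_l_closed[of "\<psi> u" "\<psi> (inv\<^bsub>L\<^esub> u)"] u by simp
 thus False using M.one_imp_carrier M.I_notcarr by simp
qed

text \<open>A maximal ideal of \<open>N\<close> containing \<open>f b\<close> pulls back to a prime
  of \<open>B\<close>. By \<open>nonunits_in_maximalideal\<close> that prime lies over
  \<open>P\<close>, and such primes are the branches.\<close>

lemma nonunit_in_branch:
 assumes b: "b \<in> carrier B" "f b \<notin> Units N"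
 shows "\<exists>i<m. b \<in> Q i"
proof -
 obtain M where M: "maximalideal M N" "f b \<in> M" using N.S.nonunit_in_maximalideal[of "f b"] b by auto
 interpret M: primeideal M N using N.S.maximalideal_prime[OF M(1)] .
 have "primeideal {b \<in> carrier B. f b \<in> M} B"
 proof (rule primeidealI)
  show "ideal {b \<in> carrier B. f b \<in> M} B" by (rule N.ring.ideal_vimage) (rule M.ideal_axioms)
  show "carrier B \<noteq> {b \<in> carrier B. f b \<in> M}"
  proof
   assume "carrier B = {b \<in> carrier B. f b \<in> M}"
   hence "f \<one>\<^sub>B \<in> M" using h.S.one_closed by blast
   thus False using M.one_imp_carrier M.I_notcarr by simp
  qed
  show "a \<in> {b \<in> carrier B. f b \<in> M} \<or> b \<in> {b \<in> carrier B. f b \<in> M}"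
   if "a \<in> carrier B" "b \<in> carrier B" "a **\<^sub>B b \<in> {b \<in> carrier B. f b \<in> M}" for a b
   using that M.I_prime[of "f a" "f b"] by simp
 qed (rule h.S.cring_axioms)
 moreover have "{a \<in> carrier A. h a \<in> {b \<in> carrier B. f b \<in> M}} = P"
 proof (intro equalityI subsetI)
  fix a assume "a \<in> {a \<in> carrier A. h a \<in> {b \<in> carrier B. f b \<in> M}}"
  hence a: "a \<in> carrier A" "f (h a) \<in> M" by auto
  show "a \<in> P"
  proof (rule ccontr)
   assume "a \<notin> P"
   hence u: "f (h a) \<in> Units N" using N.denom_unit a by blast
   have "inv\<^bsub>N\<^esub> (f (h a)) **\<^sub>N f (h a) \<in> M" using M.I_l_closed[OF a(2)] u by blast
   hence "\<one>\<^sub>N \<in> M" using u by (simp add: N.S.Units_l_inv)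
   thus False using M.one_imp_carrier M.I_notcarr by simp
  qed
 next
  fix a assume "a \<in> P"
  hence "a \<in> carrier A" "g a \<in> nonunits L" using nonunit_g_iff P_closed by auto
  thus "a \<in> {a \<in> carrier A. h a \<in> {b \<in> carrier B. f b \<in> M}}" using nonunits_in_maximalideal[OF M(1)] psi_g by fastforce
 qed
 ultimately obtain i where "i < m" "{b \<in> carrier B. f b \<in> M} = Q i" using lying_over by blast
 thus ?thesis using b M(2) by blast
qed

end

section \<open>The generator of the dualizing module\<close>

context normalization_chart
begin

text \<open>Without branches \<open>N\<close> would be the zero ring, so some \<open>s\<close>
  outside \<open>P\<close> would vanish in \<open>B\<close>. Then every \<open>x\<close> in
  \<open>P\<close> has a power killing \<open>s\<close>, and reducedness gives
  \<open>x s = 0\<close>. Hence the maximal ideal of \<open>L\<close> is zero, and \<open>L\<close>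
  is regular of dimension zero, against the singularity.\<close>

lemma m_pos: "m > 0"
proof (rule ccontr)
 assume "\<not> m > 0"
 hence "f \<zero>\<^sub>B \<in> Units N" using nonunit_in_branch[of "\<zero>\<^sub>B"] by auto
 hence "\<zero>\<^sub>N \<in> Units N" by simp
 hence "\<one>\<^sub>N = \<zero>\<^sub>N" using N.S.Units_l_inv N.S.Units_inv_closed N.S.r_null by metis
 then obtain s where s: "s \<in> carrier A" "s \<notin> P" "h s = \<zero>\<^sub>B" using N.kernel[of "\<one>\<^sub>B"] by auto
 have zero: "g x = \<zero>\<^sub>L" if x: "x \<in> P" for x
 proof -
  have xc: "x \<in> carrier A" using x P_closed by blast
  obtain n where n: "x [^] (n::nat) ** s = \<zero>" using h_kernel[OF x s(1,3)] by blast
  \<comment> \<open>The factor \<open>x^n s = 0\<close> is exposed in a power of \<open>x s\<close>,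
    so that reducedness applies to \<open>x s\<close> itself.\<close>
  have "(x ** s) [^] Suc n = (x [^] n ** s) ** (s [^] n ** x)" using xc s(1) by (simp add: A.S.nat_pow_distrib A.S.m_ac)
  hence "x ** s = \<zero>" using reduced[of "x ** s" "Suc n"] n xc s(1) by simp
  hence "g x **\<^sub>L g s = \<zero>\<^sub>L" unfolding L.hom_mult[OF xc s(1), symmetric] by simp
  also have "... = \<zero>\<^sub>L **\<^sub>L g s" using s(1) by (simp del: L.hom_mult)
  finally have "g x **\<^sub>L g s = \<zero>\<^sub>L **\<^sub>L g s" .
  thus ?thesis using L.denom_cancel[of s "g x" "\<zero>\<^sub>L"] s xc by simp
 qed
 have nu: "nonunits L = {\<zero>\<^sub>L}"
 proof
  show "nonunits L \<subseteq> {\<zero>\<^sub>L}"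
  proof
   fix z assume z: "z \<in> nonunits L"
   hence zc: "z \<in> carrier L" by (simp add: nonunits_def)
   obtain a r where a: "a \<in> carrier A" "r \<in> carrier A - P" "z **\<^sub>L g r = g a" using L.fraction[OF zc] by blast
   have "a \<in> P" using L.unit_fraction_iff[OF zc a] z by (simp add: nonunits_def)
   hence "z **\<^sub>L g r = \<zero>\<^sub>L **\<^sub>L g r" using zero a by simp
   thus "z \<in> {\<zero>\<^sub>L}" using L.denom_cancel[OF a(2) zc] by simp
  qed
 qed (use LK.nonunits_zero in simp)
 have P0: "J = {\<zero>\<^sub>L}" if "primeideal J L" for J
 proof -
  interpret J: primeideal J L by fact
  have "J \<subseteq> nonunits L"
  proof
   fix x assume x: "x \<in> J"
   show "x \<in> nonunits L"
   proof (rule ccontr)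
    assume "x \<notin> nonunits L"
    hence u: "x \<in> Units L" using x J.Icarr by (simp add: nonunits_def)
    have "inv\<^bsub>L\<^esub> x **\<^sub>L x \<in> J" using J.I_l_closed[OF x L.S.Units_inv_closed[OF u]] .
    thus False using L.S.Units_l_inv[OF u] J.one_imp_carrier J.I_notcarr by simp
   qed
  qed
  thus ?thesis using nu J.zero_closed by blast
 qed
 have "n = 0" if "\<forall>i\<le>n. primeideal (J i) L" "\<forall>i<n. J i \<subset> J (Suc i)" for n and J :: "nat => 'l set"
 proof (rule ccontr)
  assume "n \<noteq> 0"
  hence "J 0 \<subset> J (Suc 0)" "J 0 = {\<zero>\<^sub>L}" "J (Suc 0) = {\<zero>\<^sub>L}" using that P0 by auto
  thus False by simp
 qed
 hence "krull_dim L \<le> 0" unfolding krull_dim_def by (intro Sup_least) (auto simp: zero_enat_def)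
 hence "krull_dim L = enat (card ({} :: 'l set))" by (simp flip: zero_enat_def)
 moreover have "Idl\<^bsub>L\<^esub> {} = nonunits L"
 proof
  show "Idl\<^bsub>L\<^esub> {} \<subseteq> nonunits L" using L.S.genideal_minimal[OF LK.nonunits_ideal] by simp
  show "nonunits L \<subseteq> Idl\<^bsub>L\<^esub> {}"
   using additive_subgroup.zero_closed[OF ideal.axioms(1)[OF L.S.genideal_ideal[of "{}"]]] nu by simp
 qed
 ultimately show False using singular unfolding regular_local_ring_def by (metis empty_subsetI finite.emptyI)
qed

text \<open>Since \<open>m > 0\<close>, the image of \<open>L\<close> is not all of
  \<open>N\<close>: otherwise every choice of coordinates would represent zero, contrary to their
  uniqueness. An element of \<open>N\<close> outside the image is what
  \<open>residue_exists_extension\<close> needs.\<close>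

lemma residue_L:
 assumes "a \<in> carrier L"
 shows "\<exists>c\<in>carrier K. a \<ominus>\<^sub>L embL c \<in> nonunits L"
proof -
 have "\<psi> ` carrier L \<noteq> carrier N"
 proof
  assume all: "\<psi> ` carrier L = carrier N"
  obtain b where b: "b \<in> {..<m} \<rightarrow> carrier N" and ex: "\<forall>x\<in>carrier N.
    \<exists>!c. c \<in> {..<m} \<rightarrow>\<^sub>E carrier K \<and> x \<ominus>\<^sub>N NK.lincomb {..<m} c b \<in> \<psi> ` carrier L"
   using delta unfolding quotient_has_dim_def by (elim bexE) (rule that)
  have in_all: "\<zero>\<^sub>N \<ominus>\<^sub>N NK.lincomb {..<m} c b \<in> \<psi> ` carrier L" if "c \<in> {..<m} \<rightarrow>\<^sub>E carrier K" for c
   using that b NK.lincomb_closed[of c "{..<m}" b] unfolding all by (simp add: PiE_def)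
  have "(\<lambda>i\<in>{..<m}. \<zero>\<^sub>K) = (\<lambda>i\<in>{..<m}. \<one>\<^sub>K)" using ex1_implies_ex[OF bspec[OF ex N.S.zero_closed]]
    the1_equality[OF bspec[OF ex N.S.zero_closed], of "\<lambda>i\<in>{..<m}. \<zero>\<^sub>K"]
    the1_equality[OF bspec[OF ex N.S.zero_closed], of "\<lambda>i\<in>{..<m}. \<one>\<^sub>K"]
    in_all[of "\<lambda>i\<in>{..<m}. \<zero>\<^sub>K"] in_all[of "\<lambda>i\<in>{..<m}. \<one>\<^sub>K"] by simp
  from fun_cong[OF this, of 0] show False using m_pos by simp
 qed
 then obtain n where "n \<in> carrier N" "n \<notin> \<psi> ` carrier L" by auto
 moreover obtain b where "spans_mod K N embN (\<psi> ` carrier L) {..<m} b" using spans_N by blast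
 ultimately show ?thesis using LK.residue_exists_extension[OF alg_closed NK.kalgebra_axioms psi.homh psi_scalar _ _ _ assms] by blast
qed

lemma residue_A: "a \<in> carrier A ==> \<exists>c\<in>carrier K. a \<ominus> emb c \<in> P"
proof -
 assume a: "a \<in> carrier A"
 obtain c where c: "c \<in> carrier K" "g a \<ominus>\<^sub>L embL c \<in> nonunits L" using residue_L[of "g a"] a by auto
 have "g (a \<ominus> emb c) \<in> nonunits L" using c a by (simp add: a_minus_def)
 thus ?thesis using nonunit_g_iff[of "a \<ominus> emb c"] a c(1) by auto
qed

lemma scalar_in_P: "c \<in> carrier K ==> emb c \<in> P ==> c = \<zero>\<^sub>K" using LK.scalar_nonunit nonunit_g_iff[of "emb c"] by simp

lemma scalar_in_prime:
 assumes "primeideal J B" "c \<in> carrier K" "h (emb c) \<in> J"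
 shows "c = \<zero>\<^sub>K"
proof (rule ccontr)
 interpret J: primeideal J B by fact
 interpret BK: kalgebra K B "h \<circ> emb" by (rule kalgebra_B)
 assume "c \<noteq> \<zero>\<^sub>K"
 hence u: "h (emb c) \<in> Units B" using BK.scalar_unit assms(2) by simp
 hence "\<one>\<^sub>B \<in> J" using J.I_l_closed[OF assms(3) h.S.Units_inv_closed[OF u]] h.S.Units_l_inv[OF u] by simp
 thus False using J.one_imp_carrier J.I_notcarr by simp
qed

text \<open>The ideal \<open>P\<close> is maximal with residue field \<open>K\<close>, so a prime
  \<open>J\<close> that does not lie over \<open>P\<close> cannot contain all of it. An element of
  \<open>P\<close> outside \<open>J\<close> serves later as a denominator.\<close>

lemma exists_denominator:
 assumes i: "i < m" and s: "s \<in> carrier B" "s \<notin> Q i"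
 shows "\<exists>x\<in>P. \<exists>J. primeideal J B \<and> s \<notin> J \<and> h x \<notin> J"
proof -
 obtain J where J: "primeideal J B" "s \<notin> J" "{a \<in> carrier A. h a \<in> J} \<noteq> P" using dense[OF i s] by blast
 interpret J: primeideal J B by fact
 have "\<not> P \<subseteq> {a \<in> carrier A. h a \<in> J}"
 proof
  assume sub: "P \<subseteq> {a \<in> carrier A. h a \<in> J}"
  have "a \<in> P" if a: "a \<in> carrier A" "h a \<in> J" for a
  proof -
   obtain c where c: "c \<in> carrier K" "a \<ominus> emb c \<in> P" using residue_A[OF a(1)] by blast
   hence "h (a \<ominus> emb c) \<in> J" using sub by blast
   hence "h a \<ominus>\<^sub>B (h a \<ominus>\<^sub>B h (emb c)) \<in> J" using a c(1) J.minus_closed' by (simp add: a_minus_def)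
   moreover have "h a \<ominus>\<^sub>B (h a \<ominus>\<^sub>B h (emb c)) = h (emb c)"
    using h.hom_closed[OF a(1)] h.hom_closed[OF A.hom_closed[OF c(1)]] by algebra
   ultimately have "c = \<zero>\<^sub>K" using scalar_in_prime[OF J(1) c(1)] by simp
   thus ?thesis using c(2) a(1) by (simp add: a_minus_def)
  qed
  thus False using sub J(3) by blast
 qed
 thus ?thesis using J P_closed by blast
qed

text \<open>The value of the parameter \<open>t\<close> at the point. The translate
  \<open>u = t - r\<close> vanishes there and replaces \<open>t\<close> in all that follows.\<close>

definition r where "r = (SOME r. r \<in> carrier K \<and> t \<ominus> emb r \<in> P)"
definition u where "u = t \<ominus> emb r"

lemma r: "r \<in> carrier K" and u_in_P: "u \<in> P"
 using someI_ex[of "\<lambda>r. r \<in> carrier K \<and> t \<ominus> emb r \<in> P"] residue_A[OF t(1)] by (auto simp: r_def u_def)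

lemma u_closed [simp]: "u \<in> carrier A" using u_in_P P_closed by blast

abbreviation "P0 \<equiv> A.S.simple_extension (emb ` carrier K) t"

section \<open>The polynomial subring \<open>P0\<close> and the generating functional
  \<open>E\<close>\<close>

lemma scalars_subring: "subring (emb ` carrier K) A" using A.ring.img_is_subring[OF A.R.carrier_is_subring] .

lemma P0_closed: "x \<in> P0 ==> x \<in> carrier A"
proof -
 have "emb ` carrier K \<subseteq> carrier A" by auto
 from A.S.simple_extension_in_carrier[OF this t(1)] show "x \<in> P0 ==> x \<in> carrier A" by (rule subsetD)
qed

lemma P0_scalar: "c \<in> carrier K ==> emb c \<in> P0"
proof -
 assume c: "c \<in> carrier K"
 have "\<zero> ** t \<oplus> emb c \<in> P0" by (intro A.S.simple_extension.lin A.S.simple_extension.zero imageI c)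
 thus ?thesis using t(1) c by simp
qed

lemma P0_u: "u \<in> P0"
proof -
 have "emb \<one>\<^sub>K ** t \<oplus> emb (\<ominus>\<^sub>K r) \<in> P0" by (intro A.S.simple_extension.lin P0_scalar imageI) (use r in auto)
 thus ?thesis using t(1) r by (simp add: u_def a_minus_def)
qed

lemma P0_decompose:
 assumes "x \<in> P0"
 shows "\<exists>c\<in>carrier K. \<exists>y\<in>P0. x = emb c \<oplus> u ** y" using assms
proof induction
 case zero
 show ?case by (rule bexI[of _ "\<zero>\<^sub>K"], rule bexI[of _ "\<zero>"]) auto
next
 case (lin k d')
 then obtain c y where cy: "c \<in> carrier K" "y \<in> P0" "k = emb c \<oplus> u ** y" by blast
 obtain d where d: "d \<in> carrier K" "d' = emb d" using lin by blast
 have "y ** t \<oplus> emb c \<in> P0" using A.S.simple_extension.lin[OF cy(2)] cy(1) by blast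
 moreover have "k ** t \<oplus> d' = emb (r **\<^sub>K c \<oplus>\<^sub>K d) \<oplus> u ** (y ** t \<oplus> emb c)"
 proof -
  have cl: "emb c \<in> carrier A" "emb d \<in> carrier A" "emb r \<in> carrier A" "y \<in> carrier A" using cy d r P0_closed by auto
  have "(emb c \<oplus> (t \<ominus> emb r) ** y) ** t \<oplus> emb d =
    (emb r ** emb c \<oplus> emb d) \<oplus> (t \<ominus> emb r) ** (y ** t \<oplus> emb c)" using cl t(1) by algebra
  thus ?thesis using cy(1) d r unfolding cy(3) d(2) u_def by simp
 qed
 ultimately show ?case using cy(1) d(1) r by blast
qed

lemma P0_u_cancel:
 assumes "x \<in> P0" "u ** x = \<zero>"
 shows "x = \<zero>" using A.S.transcendental_linear_nonzerodivisor[OF scalars_subring _ t assms(1)] assms(2) r unfolding u_def by blast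

definition E where "E = (SOME E. E \<in> carrier (dualizing_module A P0) \<and>
 bij_betw (\<lambda>a. a \<odot>\<^bsub>dualizing_module A P0\<^esub> E) (carrier A) (carrier (dualizing_module A P0)))"

lemma E_generator: "E \<in> carrier (dualizing_module A P0)"
 "bij_betw (\<lambda>a. a \<odot>\<^bsub>dualizing_module A P0\<^esub> E) (carrier A) (carrier (dualizing_module A P0))"
 using gorenstein someI_ex[of "\<lambda>E. E \<in> carrier (dualizing_module A P0) \<and>
  bij_betw (\<lambda>a. a \<odot>\<^bsub>dualizing_module A P0\<^esub> E) (carrier A) (carrier (dualizing_module A P0))"]
 unfolding free_of_rank_one_def E_def by blast+

lemma E_smult: "a \<odot>\<^bsub>dualizing_module A P0\<^esub> E = (\<lambda>x\<in>carrier A. E (a ** x))" by (simp add: dualizing_module_def)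

lemma E_in_P0: "x \<in> carrier A ==> E x \<in> P0"
 and E_add: "x \<in> carrier A ==> y \<in> carrier A ==> E (x \<oplus> y) = E x \<oplus> E y"
 and E_mult: "s \<in> P0 ==> x \<in> carrier A ==> E (s ** x) = s ** E x" using E_generator(1) by (auto simp: dualizing_module_def)

lemma E_faithful:
 assumes "x \<in> carrier A" "y \<in> carrier A" "\<And>z. z \<in> carrier A ==> E (x ** z) = E (y ** z)"
 shows "x = y"
proof -
 have "x \<odot>\<^bsub>dualizing_module A P0\<^esub> E = y \<odot>\<^bsub>dualizing_module A P0\<^esub> E" unfolding E_smult using assms(3) by (intro restrict_ext) simp
 thus ?thesis using inj_onD[OF bij_betw_imp_inj_on[OF E_generator(2)]] assms(1,2) by simp
qed

lemma E_represents:
 assumes \<phi>: "\<And>x. x \<in> carrier A ==> \<phi> x \<in> P0"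
  "\<And>x y. x \<in> carrier A ==> y \<in> carrier A ==> \<phi> (x \<oplus> y) = \<phi> x \<oplus> \<phi> y"
  "\<And>s x. s \<in> P0 ==> x \<in> carrier A ==> \<phi> (s ** x) = s ** \<phi> x"
 shows "\<exists>a\<in>carrier A. \<forall>x\<in>carrier A. \<phi> x = E (a ** x)"
proof -
 have "restrict \<phi> (carrier A) \<in> carrier (dualizing_module A P0)" using \<phi> P0_closed by (simp add: dualizing_module_def)
 then obtain a where a: "a \<in> carrier A" "restrict \<phi> (carrier A) = a \<odot>\<^bsub>dualizing_module A P0\<^esub> E"
  using bij_betw_imp_surj_on[OF E_generator(2)] by (metis (no_types, lifting) imageE)
 have "\<phi> x = E (a ** x)" if "x \<in> carrier A" for x using fun_cong[OF a(2), of x] that unfolding E_smult by simp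
 thus ?thesis using a(1) by blast
qed

text \<open>If \<open>u x = 0\<close>, then all values \<open>E (x z)\<close> are annihilated by
  \<open>u\<close>. They lie in \<open>P0\<close>, where \<open>u\<close> is not a zero divisor, so
  they vanish, and an element on which the functional vanishes identically is zero.\<close>

lemma u_cancel_zero:
 assumes x: "x \<in> carrier A" "u ** x = \<zero>"
 shows "x = \<zero>"
proof -
 have E0: "E \<zero> = \<zero>" using E_mult[of "\<zero>" "\<zero>"] P0_closed[OF E_in_P0[of "\<zero>"]] by simp
 have "E (x ** z) = E (\<zero> ** z)" if z: "z \<in> carrier A" for z
 proof -
  have "u ** E (x ** z) = E ((u ** x) ** z)" using E_mult[OF P0_u, of "x ** z"] x(1) z by (simp add: A.S.m_assoc)
  hence "u ** E (x ** z) = \<zero>" using x(2) z E0 by simp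
  thus ?thesis using P0_u_cancel[OF E_in_P0] x(1) z E0 by simp
 qed
 thus ?thesis using E_faithful[OF x(1) A.S.zero_closed] by blast
qed

lemma u_cancel:
 assumes "x \<in> carrier A" "y \<in> carrier A" "u ** x = u ** y"
 shows "x = y"
proof -
 have "u ** (x \<ominus> y) = u ** x \<ominus> u ** y" using assms(1,2) u_closed by algebra
 also have "... = \<zero>" unfolding assms(3) using assms(2) by (simp add: a_minus_def A.S.r_neg)
 finally have "x \<ominus> y = \<zero>" using u_cancel_zero assms(1,2) by simp
 thus ?thesis using assms(1,2) A.S.r_right_minus_eq by blast
qed

lemma u_pow_cancel:
 assumes "x \<in> carrier A" "u [^] (n::nat) ** x = \<zero>"
 shows "x = \<zero>" using assms
proof (induction n arbitrary: x)
 case (Suc n)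
 hence "u ** x = \<zero>" by (simp add: A.S.m_assoc)
 thus ?case using u_cancel_zero Suc.prems by blast
qed simp

text \<open>The quotient \<open>\<phi>\<close> of \<open>E (x \<cdot> _)\<close> by \<open>u\<close> is again a functional, hence equal to \<open>E (z \<cdot> _)\<close> for some \<open>z\<close>, and
 then \<open>x = u z\<close>.\<close>

lemma functional_quotient:
 assumes x: "x \<in> carrier A" "E x \<in> multiples A u" "\<And>p. p \<in> P ==> p ** x \<in> multiples A u"
 shows "x \<in> multiples A u"
proof -
 have u: "u \<in> carrier A" by simp
 have ex: "\<exists>y. y \<in> P0 \<and> E (a ** x) = u ** y" if a: "a \<in> carrier A" for a
 proof -
  obtain c where c: "c \<in> carrier K" "a \<ominus> emb c \<in> P" using residue_A[OF a] by blast
  obtain z where z: "z \<in> carrier A" "(a \<ominus> emb c) ** x = u ** z" using x(3)[OF c(2)] by (auto simp: multiples_def)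
  obtain w where w: "w \<in> carrier A" "E x = u ** w" using x(2) by (auto simp: multiples_def)
  have cl: "emb c \<in> carrier A" "E z \<in> carrier A" using c E_in_P0[OF z(1)] P0_closed by auto
  have "a ** x = (a \<ominus> emb c) ** x \<oplus> emb c ** x" using a cl x(1) by algebra
  also have "E ... = E (u ** z) \<oplus> E (emb c ** x)" unfolding z(2) using z(1) cl x(1) by (intro E_add) auto
  also have "... = u ** (E z \<oplus> emb c ** w)"
   using E_mult[OF P0_u z(1)] E_mult[OF P0_scalar[OF c(1)] x(1)] w cl z(1) by (simp add: A.S.r_distr A.S.m_lcomm)
  finally have e: "E (a ** x) = u ** (E z \<oplus> emb c ** w)" .
  \<comment> \<open>The quotient by \<open>u\<close> has to lie in \<open>P0\<close> and not just in
    \<open>A\<close>. So \<open>E (a ** x)\<close> is expanded in \<open>P0\<close>; its constant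
    term \<open>d\<close> lies in \<open>P\<close> and is therefore zero.\<close>
  obtain d y where d: "d \<in> carrier K" "y \<in> P0" "E (a ** x) = emb d \<oplus> u ** y" using P0_decompose[OF E_in_P0] a x(1) by blast
  have "E (a ** x) \<ominus> u ** y \<in> P" unfolding e a_minus_def
   by (intro L.P.a_closed L.P.a_inv_closed L.P.I_r_closed[OF u_in_P]) (use cl w(1) P0_closed[OF d(2)] in auto)
  moreover have "E (a ** x) \<ominus> u ** y = emb d" unfolding d(3) using P0_closed[OF d(2)] u A.hom_closed[OF d(1)] by algebra
  ultimately have "d = \<zero>\<^sub>K" using scalar_in_P[OF d(1)] by simp
  thus ?thesis using d P0_closed[OF d(2)] by auto
 qed
 hence "\<exists>\<phi>. \<forall>a\<in>carrier A. \<phi> a \<in> P0 \<and> E (a ** x) = u ** \<phi> a" by (intro bchoice) blast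
 then obtain \<phi> where \<phi>: "\<And>a. a \<in> carrier A ==> \<phi> a \<in> P0"
  "\<And>a. a \<in> carrier A ==> E (a ** x) = u ** \<phi> a" by auto
 have \<phi>c: "\<phi> a \<in> carrier A" if "a \<in> carrier A" for a using \<phi>(1)[OF that] P0_closed by blast
 have "\<exists>z\<in>carrier A. \<forall>a\<in>carrier A. \<phi> a = E (z ** a)"
 proof (rule E_represents)
  fix a b assume ab: "a \<in> carrier A" "b \<in> carrier A"
  have "u ** \<phi> (a \<oplus> b) = u ** (\<phi> a \<oplus> \<phi> b)"
   using \<phi>(2)[of "a \<oplus> b"] \<phi>(2)[of a] \<phi>(2)[of b] E_add[of "a ** x" "b ** x"] ab x(1) \<phi>c
   by (simp add: A.S.l_distr A.S.r_distr)
  from u_cancel[OF \<phi>c[OF A.S.a_closed[OF ab]] A.S.a_closed[OF \<phi>c[OF ab(1)] \<phi>c[OF ab(2)]] this]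
  show "\<phi> (a \<oplus> b) = \<phi> a \<oplus> \<phi> b" .
 next
  fix s a assume sa: "s \<in> P0" "a \<in> carrier A"
  have sc: "s \<in> carrier A" using sa P0_closed by blast
  have "u ** \<phi> (s ** a) = u ** (s ** \<phi> a)" using \<phi>(2)[of "s ** a"] \<phi>(2)[of a] E_mult[of s "a ** x"] sa sc x(1) \<phi>c
   by (simp add: A.S.m_assoc A.S.m_lcomm)
  from u_cancel[OF \<phi>c[OF A.S.m_closed[OF sc sa(2)]] A.S.m_closed[OF sc \<phi>c[OF sa(2)]] this]
  show "\<phi> (s ** a) = s ** \<phi> a" .
 qed (rule \<phi>(1))
 then obtain z where z: "z \<in> carrier A" "\<And>a. a \<in> carrier A ==> \<phi> a = E (z ** a)" by blast
 have "x = u ** z"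
 proof (rule E_faithful)
   fix a assume a: "a \<in> carrier A"
   have "E (x ** a) = u ** E (z ** a)" using \<phi>(2)[OF a] z(2)[OF a] a x(1) by (simp add: A.S.m_comm)
   also have "... = E ((u ** z) ** a)" using E_mult[OF P0_u, of "z ** a"] z(1) a by (simp add: A.S.m_assoc)
   finally show "E (x ** a) = E ((u ** z) ** a)" .
 qed (use x z in auto)
 thus ?thesis using z(1) by (auto simp: multiples_def)
qed

text \<open>Modulo \<open>u\<close> the functional \<open>E\<close> takes values in
  \<open>K\<close>. Two elements thus have a nontrivial combination on which this value is zero, and
  \<open>functional_quotient\<close> makes that combination a multiple of \<open>u\<close>.\<close>

lemma socle_A:
 assumes x: "x \<in> carrier A" "\<And>p. p \<in> P ==> p ** x \<in> multiples A u"
  and y: "y \<in> carrier A" "\<And>p. p \<in> P ==> p ** y \<in> multiples A u"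
 shows "\<exists>c\<in>carrier K. \<exists>d\<in>carrier K. (c \<noteq> \<zero>\<^sub>K \<or> d \<noteq> \<zero>\<^sub>K) \<and> emb c ** x \<oplus> emb d ** y \<in> multiples A u"
proof -
 obtain a x' where a: "a \<in> carrier K" "x' \<in> P0" "E x = emb a \<oplus> u ** x'" using P0_decompose[OF E_in_P0[OF x(1)]] by blast
 obtain b y' where b: "b \<in> carrier K" "y' \<in> P0" "E y = emb b \<oplus> u ** y'" using P0_decompose[OF E_in_P0[OF y(1)]] by blast
 \<comment> \<open>A nontrivial solution of \<open>c a + d b = 0\<close>: the pair
   \<open>(1, 0)\<close> if \<open>a\<close> is zero, and \<open>(b, -a)\<close> otherwise.\<close>
 obtain c d where cd: "c \<in> carrier K" "d \<in> carrier K" "c \<noteq> \<zero>\<^sub>K \<or> d \<noteq> \<zero>\<^sub>K" "c **\<^sub>K a \<oplus>\<^sub>K d **\<^sub>K b = \<zero>\<^sub>K"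
 proof (cases "a = \<zero>\<^sub>K")
  case True
  show ?thesis by (rule that[of "\<one>\<^sub>K" "\<zero>\<^sub>K"]) (use True a b in auto)
 next
  case False
  show ?thesis
   by (rule that[of "b" "\<ominus>\<^sub>K a"]) (use False a b A.R.add.inv_eq_1_iff in "auto simp: A.R.l_minus A.R.r_minus A.R.r_neg A.R.m_comm")
 qed
 have cl: "emb a \<in> carrier A" "emb b \<in> carrier A" "emb c \<in> carrier A" "emb d \<in> carrier A" "x' \<in> carrier A" "y' \<in> carrier A"
  using a b cd P0_closed by auto
 define w where "w = emb c ** x \<oplus> emb d ** y"
 have w: "w \<in> carrier A" using cl x y by (simp add: w_def)
 have "E w = emb c ** E x \<oplus> emb d ** E y"
  unfolding w_def using x(1) y(1) cl E_add[of "emb c ** x" "emb d ** y"] E_mult[OF P0_scalar] cd(1,2) by simp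
 also have "... = (emb c ** emb a \<oplus> emb d ** emb b) \<oplus> u ** (emb c ** x' \<oplus> emb d ** y')"
  unfolding a(3) b(3) using cl u_closed by algebra
 also have "emb c ** emb a \<oplus> emb d ** emb b = emb (c **\<^sub>K a \<oplus>\<^sub>K d **\<^sub>K b)" using a b cd(1,2) by simp
 finally have "E w \<in> multiples A u" using cl unfolding cd(4) multiples_def by simp
 moreover have "p ** w \<in> multiples A u" if p: "p \<in> P" for p
 proof -
  have pc: "p \<in> carrier A" using p P_closed by blast
  have "p ** w = emb c ** (p ** x) \<oplus> emb d ** (p ** y)" unfolding w_def using pc cl x(1) y(1) by algebra
  thus ?thesis using A.ksubspace_multiples[OF u_closed] x(2)[OF p] y(2)[OF p] cd(1,2) unfolding ksubspace_def by simp
 qed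
 ultimately have "w \<in> multiples A u" using functional_quotient w by blast
 thus ?thesis using cd unfolding w_def by blast
qed

end

section \<open>Passing between the chart and the local rings\<close>

context normalization_chart
begin

text \<open>\<open>A\<close> is finite over \<open>P0\<close>, and \<open>P0\<close> modulo
  \<open>u\<close> is spanned by 1. This is the source of all finite spanning families for
  \<open>A\<close>, \<open>B\<close> and the local rings of the branches.\<close>

lemma spans_A: "\<exists>(I :: ('a \<times> nat) set) b. spans_mod K A emb (multiples A u) I b"
proof (rule A.spans_mod_finite_over[OF u_closed finite_A, of "{0}" "\<lambda>_. \<one>"])
 fix x assume x: "x \<in> P0"
 obtain c y where cy: "c \<in> carrier K" "y \<in> P0" "x = emb c \<oplus> u ** y" using P0_decompose[OF x] by blast
 have y: "y \<in> carrier A" using cy P0_closed by blast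
 have "x \<ominus> A.lincomb {0::nat} (\<lambda>_. c) (\<lambda>_. \<one>) = (emb c \<oplus> u ** y) \<ominus> emb c" unfolding cy(3) using cy(1) by simp
 also have "... = u ** y" using A.hom_closed[OF cy(1)] y u_closed by algebra
 finally show "\<exists>d\<in>{0::nat} \<rightarrow> carrier K. x \<ominus> A.lincomb {0::nat} d (\<lambda>_. \<one>) \<in> multiples A u"
  using cy(1) y by (intro bexI[of _ "\<lambda>_. c"]) (auto simp: multiples_def)
qed (use P0_closed in auto)

lemma spans_B: "\<exists>(I :: ('b \<times> ('a \<times> nat)) set) b. spans_mod K B (h \<circ> emb) (multiples B (h u)) I b"
proof -
 interpret BK: kalgebra K B "h \<circ> emb" by (rule kalgebra_B)
 obtain I :: "('a \<times> nat) set" and b where b: "spans_mod K A emb (multiples A u) I b" using spans_A by blast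
 have I: "finite I" "b \<in> I \<rightarrow> carrier A" using b by (auto simp: spans_mod_def)
 show ?thesis
 proof (rule BK.spans_mod_finite_over[OF _ finite_B, of _ I "h \<circ> b"])
  fix y assume "y \<in> h ` carrier A"
  then obtain a where a: "a \<in> carrier A" "y = h a" by blast
  then obtain c where c: "c \<in> I \<rightarrow> carrier K" "a \<ominus> A.lincomb I c b \<in> multiples A u"
   using b unfolding spans_mod_def by blast
  obtain z where z: "z \<in> carrier A" "a \<ominus> A.lincomb I c b = u ** z" using c(2) by (auto simp: multiples_def)
  have lc: "A.lincomb I c b \<in> carrier A" using c I by simp
  have "BK.lincomb I c (h \<circ> b) = h (A.lincomb I c b)" using c I by (subst h.hom_finsum) (auto simp: Pi_iff intro!: h.S.finsum_cong')
  hence "y \<ominus>\<^sub>B BK.lincomb I c (h \<circ> b) = h (a \<ominus> A.lincomb I c b)" using a lc by (simp add: a_minus_def)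
  also have "... \<in> multiples B (h u)" using z by (auto simp: multiples_def)
  finally show "\<exists>d\<in>I \<rightarrow> carrier K. y \<ominus>\<^sub>B BK.lincomb I d (h \<circ> b) \<in> multiples B (h u)" using c(1) by blast
 qed (use I in "auto simp: Pi_iff")
qed

lemma u_in_Q: "i < m ==> h u \<in> Q i" using contraction u_in_P by blast

lemma D_local: "i < m ==> local_algebra K (D i) (embD i)" using prime_localization.local_algebra[OF branch kalgebra_B] .

lemma spans_D:
 assumes i: "i < m"
 shows "\<exists>(I :: ('b \<times> ('a \<times> nat)) set) b. spans_mod K (D i) (embD i) (multiples (D i) (e i (h u))) I b"
 using prime_localization.spans_mod_localization[OF branch[OF i] kalgebra_B u_in_Q[OF i]] spans_B by blast

lemma ksubspace_P: "ksubspace K A emb P" unfolding ksubspace_def using L.P.a_subset L.P.zero_closed L.P.a_closed L.P.I_l_closed by auto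

text \<open>Subtracting residues from a family that spans \<open>A\<close> modulo \<open>u\<close>
  yields elements of \<open>P\<close>. An element of \<open>P\<close> is a combination of them plus
  a scalar, and that scalar lies in \<open>P\<close>, hence is zero.\<close>

lemma P_generators:
 "\<exists>(I :: ('a \<times> nat) set) q. finite I \<and> q \<in> I \<rightarrow> P \<and> (\<forall>p\<in>P. \<exists>c\<in>I \<rightarrow> carrier K. p \<ominus> A.lincomb I c q \<in> multiples A u)"
proof -
 obtain I :: "('a \<times> nat) set" and b where b: "spans_mod K A emb (multiples A u) I b" using spans_A by blast
 have I: "finite I" "b \<in> I \<rightarrow> carrier A" using b by (auto simp: spans_mod_def)
 have "\<forall>i\<in>I. \<exists>d. d \<in> carrier K \<and> b i \<ominus> emb d \<in> P" using residue_A I by blast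
 from bchoice[OF this] obtain d where d: "\<And>i. i \<in> I ==> d i \<in> carrier K" "\<And>i. i \<in> I ==> b i \<ominus> emb (d i) \<in> P" by blast
 define q where "q i = b i \<ominus> emb (d i)" for i
 have q: "q \<in> I \<rightarrow> P" "q \<in> I \<rightarrow> carrier A" using d P_closed by (auto simp: q_def)
 have "\<exists>c\<in>I \<rightarrow> carrier K. p \<ominus> A.lincomb I c q \<in> multiples A u" if p: "p \<in> P" for p
 proof -
  have pc: "p \<in> carrier A" using p P_closed by blast
  obtain c where c: "c \<in> I \<rightarrow> carrier K" "p \<ominus> A.lincomb I c b \<in> multiples A u" using b pc unfolding spans_mod_def by blast
  obtain z where z: "z \<in> carrier A" "p \<ominus> A.lincomb I c b = u ** z" using c(2) by (auto simp: multiples_def)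
  define k where "k = (\<Oplus>\<^sub>K i\<in>I. c i **\<^sub>K d i)"
  have k: "k \<in> carrier K" unfolding k_def using c d by (intro A.R.finsum_closed) auto
  have cl: "A.lincomb I c b \<in> carrier A" "A.lincomb I c q \<in> carrier A" "emb k \<in> carrier A" using c I q k by auto
  have "A.lincomb I c b = (\<Oplus>i\<in>I. emb (c i) ** q i \<oplus> emb (c i **\<^sub>K d i))"
  proof (intro A.S.finsum_cong' refl)
   fix i assume i: "i \<in> I"
   have "c i \<in> carrier K" "b i \<in> carrier A" using c I i by auto
   thus "emb (c i) ** b i = emb (c i) ** q i \<oplus> emb (c i **\<^sub>K d i)"
    using A.S.distrib_diff_add[of "emb (c i)" "b i" "emb (d i)"] d(1)[OF i] by (simp add: q_def)
  qed (use c d q in "auto simp: Pi_iff")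
  also have "... = A.lincomb I c q \<oplus> (\<Oplus>i\<in>I. emb (c i **\<^sub>K d i))" using c d q by (intro A.S.finsum_addf) (auto simp: Pi_iff)
  also have "(\<Oplus>i\<in>I. emb (c i **\<^sub>K d i)) = emb k"
   unfolding k_def using c d by (subst A.hom_finsum) (auto simp: comp_def Pi_iff intro!: A.S.finsum_cong')
  finally have lb: "A.lincomb I c b = A.lincomb I c q \<oplus> emb k" .
  have "A.lincomb I c q \<in> P" using c(1) q(1) L.P.I_l_closed by (intro A.ksubspace_finsum[OF ksubspace_P I(1)]) (auto simp: Pi_iff)
  moreover have "emb k = p \<ominus> u ** z \<ominus> A.lincomb I c q"
  proof -
   have "y = p \<ominus> (p \<ominus> (x \<oplus> y)) \<ominus> x" if "x \<in> carrier A" "y \<in> carrier A" for x y using that pc by algebra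
   from this[OF cl(2,3)] show ?thesis unfolding z(2)[symmetric] lb .
  qed
  ultimately have "emb k \<in> P"  using p L.P.I_r_closed[OF u_in_P z(1)] L.P.a_closed L.P.a_inv_closed by (simp add: a_minus_def)
  hence "k = \<zero>\<^sub>K" using scalar_in_P k by simp
  thus ?thesis using c lb cl by auto
 qed
 thus ?thesis using I(1) q(1) by (intro exI[of _ I] exI[of _ q]) simp
qed

text \<open>Every single \<open>p\<close> in \<open>P\<close> admits a denominator \<open>v\<close>
  that makes \<open>p ** (v ** a)\<close> a multiple of \<open>u\<close> in \<open>A\<close>. Modulo
  \<open>u\<close> the ideal \<open>P\<close> is spanned by finitely many elements, so the product
  of their denominators serves all of \<open>P\<close>.\<close>

lemma globalize:
 assumes x: "x \<in> carrier L" "\<And>a. a \<in> nonunits L ==> a **\<^sub>L x \<in> multiples L (g u)"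
 shows "\<exists>s\<in>carrier A - P. \<exists>y\<in>carrier A. x **\<^sub>L g s = g y \<and> (\<forall>p\<in>P. p ** y \<in> multiples A u)"
proof -
 note W = A.ksubspace_multiples[OF u_closed]
 obtain a s where a: "a \<in> carrier A" "s \<in> carrier A - P" "x **\<^sub>L g s = g a" using L.fraction[OF x(1)] by blast
 have each: "\<exists>v\<in>carrier A - P. p ** (v ** a) \<in> multiples A u" if p: "p \<in> P" for p
 proof -
  have pc: "p \<in> carrier A" "g p \<in> nonunits L" using p P_closed nonunit_g_iff by auto
  obtain z where z: "z \<in> carrier L" "g p **\<^sub>L x = g u **\<^sub>L z" using x(2)[OF pc(2)] by (auto simp: multiples_def)
  obtain b v where b: "b \<in> carrier A" "v \<in> carrier A - P" "z **\<^sub>L g v = g b" using L.fraction[OF z(1)] by blast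
  have cl: "g p \<in> carrier L" "g u \<in> carrier L" "g s \<in> carrier L" "g v \<in> carrier L" using pc a b by auto
  have "g (p ** (v ** a)) = g p **\<^sub>L (g v **\<^sub>L (x **\<^sub>L g s))" using a b pc by simp
  also have "... = (g p **\<^sub>L x) **\<^sub>L (g v **\<^sub>L g s)" using cl x(1) by algebra
  also have "... = g u **\<^sub>L ((z **\<^sub>L g v) **\<^sub>L g s)" unfolding z(2) using cl z(1) by algebra
  also have "... = g (u ** (b ** s))" using a b by simp
  finally obtain v' where v': "v' \<in> carrier A - P" "v' ** (p ** (v ** a)) = v' ** (u ** (b ** s))"
   using L.equal[of "p ** (v ** a)" "u ** (b ** s)"] a b pc by auto
  have "p ** ((v' ** v) ** a) = u ** (v' ** (b ** s))" using v' a b pc by (simp add: A.S.m_ac)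
  hence "p ** ((v' ** v) ** a) \<in> multiples A u" using v' a b by (auto simp: multiples_def)
  thus ?thesis using L.denom_mult[OF v'(1) b(2)] by blast
 qed
 obtain I :: "('a \<times> nat) set" and q where I: "finite I" "q \<in> I \<rightarrow> P"
  and gen: "\<And>p. p \<in> P ==> \<exists>c\<in>I \<rightarrow> carrier K. p \<ominus> A.lincomb I c q \<in> multiples A u" using P_generators by blast
 have qc: "q \<in> I \<rightarrow> carrier A" using I(2) P_closed by (auto simp: Pi_iff)
 have "\<exists>v\<in>carrier A - P. \<forall>i\<in>I. q i ** (v ** a) \<in> multiples A u" using I
 proof (induction I rule: finite_induct)
  case empty
  thus ?case using L.denom_one by blast
 next
  case (insert i I)
  then obtain v where v: "v \<in> carrier A - P" "\<forall>i\<in>I. q i ** (v ** a) \<in> multiples A u" by auto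
  have qi: "q i \<in> P" using insert.prems by simp
  obtain v' where v': "v' \<in> carrier A - P" "q i ** (v' ** a) \<in> multiples A u" using each[OF qi] by blast
  have "q j ** ((v ** v') ** a) \<in> multiples A u" if j: "j \<in> insert i I" for j
  proof -
   have qj: "q j \<in> carrier A" using insert.prems j by (intro P_closed) auto
   have e: "q j ** ((v ** v') ** a) = v' ** (q j ** (v ** a))"
    "q j ** ((v ** v') ** a) = v ** (q j ** (v' ** a))" using qj v(1) v'(1) a(1) by (simp_all add: A.S.m_ac)
   show ?thesis
   proof (cases "j = i")
    case True
    thus ?thesis unfolding e(2) using A.multiples_mult(2)[OF u_closed v'(2), of v] v(1) by simp
   next
    case False
    thus ?thesis unfolding e(1) using A.multiples_mult(2)[OF u_closed, of _ v'] v(2) v'(1) j by simp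
   qed
  qed
  thus ?case using L.denom_mult[OF v(1) v'(1)] by blast
 qed
 then obtain v where v: "v \<in> carrier A - P" "\<And>i. i \<in> I ==> q i ** (v ** a) \<in> multiples A u" by blast
 define y where "y = v ** a"
 have y: "y \<in> carrier A" using v a by (simp add: y_def)
 have "x **\<^sub>L g (s ** v) = g y"
 proof -
  have "x **\<^sub>L (g s **\<^sub>L g v) = g v **\<^sub>L (x **\<^sub>L g s)"
   using L.S.m_assoc[of x "g s" "g v"] L.S.m_comm[of "x **\<^sub>L g s" "g v"] x(1) a(2) v(1) by simp
  thus ?thesis using a v by (simp add: y_def)
 qed
 moreover have "p ** y \<in> multiples A u" if p: "p \<in> P" for p
 proof -
  have pc: "p \<in> carrier A" using p P_closed by blast
  obtain c where c: "c \<in> I \<rightarrow> carrier K" "p \<ominus> A.lincomb I c q \<in> multiples A u" using gen[OF p] by blast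
  have lc: "A.lincomb I c q \<in> carrier A" using c qc by simp
  have "A.lincomb I c q ** y = (\<Oplus>i\<in>I. emb (c i) ** (q i ** y))"
   using c qc y I by (subst A.S.finsum_ldistr) (auto simp: Pi_iff A.S.m_assoc intro!: A.S.finsum_cong')
  also have "... \<in> multiples A u" using c v(2) A.ksubspace_finsum[OF W I(1), of "\<lambda>i. emb (c i) ** (q i ** y)"] W
   unfolding ksubspace_def y_def[symmetric] by (auto simp: Pi_iff)
  finally have "(p \<ominus> A.lincomb I c q) ** y \<oplus> A.lincomb I c q ** y \<in> multiples A u"
   using A.multiples_mult(1)[OF u_closed c(2) y] W unfolding ksubspace_def by blast
  moreover have "(p \<ominus> A.lincomb I c q) ** y \<oplus> A.lincomb I c q ** y = p ** y"
   using A.S.distrib_diff_add[OF y pc lc] pc lc y by (simp add: A.S.m_comm)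
  ultimately show ?thesis by simp
 qed
 ultimately show ?thesis using L.denom_mult[OF a(2) v(1)] y by blast
qed

text \<open>A numerator that dies in \<open>N\<close> dies in \<open>B\<close> after multiplication
  by some denominator \<open>v\<close>, hence in \<open>A\<close> after multiplication by a power of
  \<open>u\<close> as well. As \<open>u\<close> is not a zero divisor, \<open>v\<close> alone kills
  it, and \<open>v\<close> becomes a unit in \<open>L\<close>.\<close>

lemma psi_zero:
 assumes x: "x \<in> carrier L" "\<psi> x = \<zero>\<^sub>N"
 shows "x = \<zero>\<^sub>L"
proof -
 obtain a s where a: "a \<in> carrier A" "s \<in> carrier A - P" "x **\<^sub>L g s = g a" using L.fraction[OF x(1)] by blast
 have "f (h a) = \<psi> x **\<^sub>N \<psi> (g s)" unfolding psi_g[OF a(1), symmetric] a(3)[symmetric] using x(1) a(2) by simp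
 hence "f (h a) = \<zero>\<^sub>N" using x(2) a(2) by simp
 then obtain v where v: "v \<in> carrier A - P" "h (v ** a) = \<zero>\<^sub>B" using N.kernel[of "h a"] a(1) by auto
 obtain n where "u [^] (n::nat) ** (v ** a) = \<zero>" using h_kernel[OF u_in_P _ v(2)] v a by auto
 hence "v ** a = \<zero>" using u_pow_cancel[of "v ** a" n] v a by simp
 hence "g v **\<^sub>L g a = \<zero>\<^sub>L" using L.hom_mult[of v a] v a by simp
 hence "g a **\<^sub>L g v = \<zero>\<^sub>L **\<^sub>L g v" using v a by (simp add: L.S.m_comm)
 hence "g a = \<zero>\<^sub>L" using L.denom_cancel[OF v(1)] a by simp
 hence "x **\<^sub>L g s = \<zero>\<^sub>L **\<^sub>L g s" using a by simp
 thus ?thesis using L.denom_cancel[OF a(2) x(1)] by simp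
qed

lemma psi_inj: "inj_on \<psi> (carrier L)"
proof (rule inj_onI)
 fix x y assume xy: "x \<in> carrier L" "y \<in> carrier L" "\<psi> x = \<psi> y"
 have "\<psi> (x \<ominus>\<^sub>L y) = \<zero>\<^sub>N" using xy by (simp add: a_minus_def N.S.r_neg)
 hence "x \<ominus>\<^sub>L y = \<zero>\<^sub>L" using psi_zero xy by simp
 thus "x = y" using xy L.S.r_right_minus_eq by blast
qed

text \<open>If \<open>u\<close> vanished on branch \<open>i\<close>, some \<open>s\<close> outside
  \<open>Q i\<close> would satisfy \<open>s u = 0\<close>. Density supplies a prime \<open>J\<close>
  without \<open>s\<close> and an \<open>x\<close> in \<open>P\<close> outside \<open>J\<close>; a
  power of \<open>x\<close> times \<open>s\<close> comes from an element \<open>a\<close> of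
  \<open>A\<close>. Then \<open>a u\<close> is killed by a power of \<open>u\<close>, so
  \<open>a = 0\<close>, and a product of elements outside \<open>J\<close> would be zero.\<close>

lemma u_nonzero_D:
 assumes i: "i < m"
 shows "e i (h u) \<noteq> \<zero>\<^bsub>D i\<^esub>"
proof
 assume 0: "e i (h u) = \<zero>\<^bsub>D i\<^esub>"
 interpret D: prime_localization B "D i" "e i" "Q i" by (rule branch[OF i])
 obtain s where s: "s \<in> carrier B" "s \<notin> Q i" "s **\<^sub>B h u = \<zero>\<^sub>B" using D.kernel[OF _ 0] by auto
 obtain x J where J: "x \<in> P" "primeideal J B" "s \<notin> J" "h x \<notin> J" using exists_denominator[OF i s(1,2)] by blast
 interpret J: primeideal J B by fact
 obtain a n where a: "a \<in> carrier A" "h x [^]\<^sub>B (n::nat) **\<^sub>B s = h a" using clear_denominator[OF J(1) s(1)] by blast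
 have xc: "h x \<in> carrier B" using J(1) P_closed by simp
 have "h (a ** u) = h x [^]\<^sub>B n **\<^sub>B (s **\<^sub>B h u)" using a(1) s(1) xc by (simp add: a(2)[symmetric] h.S.m_assoc)
 hence "h (a ** u) = \<zero>\<^sub>B" using s(3) xc by simp
 then obtain k where "u [^] (k::nat) ** (a ** u) = \<zero>" using h_kernel[OF u_in_P A.S.m_closed[OF a(1) u_closed]] by blast
 hence "a ** u = \<zero>" using u_pow_cancel[of "a ** u" k] a(1) by simp
 hence "a = \<zero>" using u_cancel_zero a(1) by (simp add: A.S.m_comm)
 hence in0: "h x [^]\<^sub>B n **\<^sub>B s \<in> J" using a(2) J.zero_closed by simp
 have "h x [^]\<^sub>B k \<notin> J" for k :: nat
 proof (induction k)
  case 0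
  thus ?case using J.one_imp_carrier J.I_notcarr by auto
 next
  case (Suc k)
  thus ?case using J.I_prime[of "h x [^]\<^sub>B k" "h x"] J(4) xc by auto
 qed
 thus False using J.I_prime[OF _ s(1) in0] J(3) xc by simp
qed

end

section \<open>Uniformizers and Taylor coefficients on the branches\<close>

context normalization_chart
begin

lemma residue_D:
 assumes i: "i < m" and a: "a \<in> carrier (D i)"
 shows "\<exists>c\<in>carrier K. a \<ominus>\<^bsub>D i\<^esub> (embD i) c \<in> nonunits (D i)"
proof -
 interpret D: prime_localization B "D i" "e i" "Q i" by (rule branch[OF i])
 interpret DL: local_algebra K "D i" "embD i" by (rule D_local[OF i])
 have u: "e i (h u) \<in> carrier (D i)" "e i (h u) \<in> nonunits (D i)" using D.unit_iff[of "h u"] u_in_Q[OF i] by (auto simp: nonunits_def)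
 have "multiples (D i) (e i (h u)) \<subseteq> nonunits (D i)" using DL.nonunits_mult(1)[OF u(2)] by (auto simp: multiples_def)
 thus ?thesis using DL.residue_exists[OF alg_closed DL.ksubspace_multiples[OF u(1)] _ _ a] spans_D[OF i] by blast
qed

text \<open>Multiplying a uniformizer by a denominator makes it the image of an element of \<open>B\<close>.\<close>

lemma uniformizer_exists:
 assumes i: "i < m"
 shows "\<exists>w\<in>Q i. e i w \<noteq> \<zero>\<^bsub>D i\<^esub> \<and> (\<forall>d\<in>nonunits (D i). \<exists>x\<in>carrier (D i). d = e i w **\<^bsub>D i\<^esub> x)"
proof -
 interpret D: prime_localization B "D i" "e i" "Q i" by (rule branch[OF i])
 interpret DL: local_algebra K "D i" "embD i" by (rule D_local[OF i])
 have u: "e i (h u) \<in> nonunits (D i)" using D.unit_iff[of "h u"] u_in_Q[OF i] by (auto simp: nonunits_def)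
 obtain I :: "('b \<times> ('a \<times> nat)) set" and b where
  b: "spans_mod K (D i) (embD i) (multiples (D i) (e i (h u))) I b" using spans_D[OF i] by blast
 obtain p where p: "p \<in> nonunits (D i)" "p \<noteq> \<zero>\<^bsub>D i\<^esub>" "\<And>d. d \<in> nonunits (D i) ==> \<exists>x\<in>carrier (D i). d = p **\<^bsub>D i\<^esub> x"
  using DL.maximal_ideal_principal[OF normal[OF i] u u_nonzero_D[OF i] b residue_D[OF i]] by blast
 have pc: "p \<in> carrier (D i)" using p(1) by (simp add: nonunits_def)
 obtain w s where w: "w \<in> carrier B" "s \<in> carrier B - Q i" "p **\<^bsub>D i\<^esub> e i s = e i w" using D.fraction[OF pc] by blast
 have su: "e i s \<in> Units (D i)" using D.denom_unit[OF w(2)] .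
 have sc: "e i s \<in> carrier (D i)" "inv\<^bsub>D i\<^esub> e i s \<in> carrier (D i)" using su D.S.Units_closed D.S.Units_inv_closed by blast+
 have ps: "p = e i w **\<^bsub>D i\<^esub> inv\<^bsub>D i\<^esub> e i s" using D.S.m_assoc[OF pc sc] D.S.Units_r_inv[OF su] pc w(3) by simp
 have "w \<in> Q i" using D.unit_fraction_iff[OF pc w] p(1) by (simp add: nonunits_def)
 moreover have "e i w \<noteq> \<zero>\<^bsub>D i\<^esub>" using ps p(2) sc by auto
 moreover have "\<exists>x\<in>carrier (D i). d = e i w **\<^bsub>D i\<^esub> x" if d: "d \<in> nonunits (D i)" for d
 proof -
  obtain x where x: "x \<in> carrier (D i)" "d = p **\<^bsub>D i\<^esub> x" using p(3)[OF d] by blast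
  have "d = e i w **\<^bsub>D i\<^esub> (inv\<^bsub>D i\<^esub> e i s **\<^bsub>D i\<^esub> x)"
   unfolding x(2) ps using D.hom_closed[OF w(1)] sc(2) x(1) by (rule D.S.m_assoc)
  thus ?thesis using sc(2) x(1) by blast
 qed
 ultimately show ?thesis by blast
qed

definition \<omega> where "\<omega> i = (SOME w. w \<in> Q i \<and> e i w \<noteq> \<zero>\<^bsub>D i\<^esub> \<and>
 (\<forall>d\<in>nonunits (D i). \<exists>x\<in>carrier (D i). d = e i w **\<^bsub>D i\<^esub> x))"

lemma omega:
 assumes i: "i < m"
 shows "\<omega> i \<in> Q i" "e i (\<omega> i) \<noteq> \<zero>\<^bsub>D i\<^esub>" "d \<in> nonunits (D i) ==> \<exists>x\<in>carrier (D i). d = e i (\<omega> i) **\<^bsub>D i\<^esub> x" "\<omega> i \<in> carrier B"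
proof -
 have ex: "\<exists>w. w \<in> Q i \<and> e i w \<noteq> \<zero>\<^bsub>D i\<^esub> \<and> (\<forall>d\<in>nonunits (D i). \<exists>x\<in>carrier (D i). d = e i w **\<^bsub>D i\<^esub> x)"
  using uniformizer_exists[OF i] by blast
 interpret D: prime_localization B "D i" "e i" "Q i" by (rule branch[OF i])
 from someI_ex[OF ex] show 1: "\<omega> i \<in> Q i" "e i (\<omega> i) \<noteq> \<zero>\<^bsub>D i\<^esub>"
  "d \<in> nonunits (D i) ==> \<exists>x\<in>carrier (D i). d = e i (\<omega> i) **\<^bsub>D i\<^esub> x" unfolding \<omega>_def by blast+
 thus "\<omega> i \<in> carrier B" by (simp add: D.P.Icarr)
qed

lemma uniformized: "i < m ==> uniformized_algebra K (D i) (embD i) (e i (\<omega> i))"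
proof -
 assume i: "i < m"
 interpret D: prime_localization B "D i" "e i" "Q i" by (rule branch[OF i])
 interpret DL: local_algebra K "D i" "embD i" by (rule D_local[OF i])
 interpret domain "D i" using normal[OF i] by (simp add: integrally_closed_domain_def)
 have "e i (\<omega> i) \<in> nonunits (D i)" using D.unit_iff[of "\<omega> i"] omega[OF i] by (auto simp: nonunits_def)
 thus ?thesis by unfold_locales (use omega[OF i] residue_D[OF i] in auto)
qed

definition \<tau> where "\<tau> i b = uniformized_algebra.taylor K (D i) (embD i) (e i (\<omega> i)) (\<eta> i b)"

lemma eta_hom: "i < m ==> ring_hom_cring N (D i) (\<eta> i)"
proof -
 assume i: "i < m"
 interpret D: prime_localization B "D i" "e i" "Q i" by (rule branch[OF i])
 show ?thesis using eta(1)[OF i] by unfold_locales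
qed

text \<open>A denominator \<open>h s\<close> lies outside \<open>Q i\<close>, because
  \<open>Q i\<close> contracts to \<open>P\<close>; it is a unit on the branch, and the constant
  term vanishes exactly when the numerator does.\<close>

lemma tau_0_iff:
 assumes i: "i < m" and b: "b \<in> carrier N" "b' \<in> carrier B" "s \<in> carrier A - P" "b **\<^sub>N f (h s) = f b'"
 shows "\<tau> i b 0 = \<zero>\<^sub>K \<longleftrightarrow> b' \<in> Q i"
proof -
 interpret D: prime_localization B "D i" "e i" "Q i" by (rule branch[OF i])
 interpret U: uniformized_algebra K "D i" "embD i" "e i (\<omega> i)" by (rule uniformized[OF i])
 interpret H: ring_hom_cring N "D i" "\<eta> i" by (rule eta_hom[OF i])
 have hs: "h s \<in> carrier B - Q i" using b(3) contraction[OF i] by auto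
 have "\<eta> i b **\<^bsub>D i\<^esub> \<eta> i (f (h s)) = \<eta> i (f b')" using b hs by (simp flip: H.hom_mult)
 hence "\<eta> i b **\<^bsub>D i\<^esub> e i (h s) = e i b'" using eta(2)[OF i] hs b(2) by simp
 hence "\<eta> i b \<in> Units (D i) \<longleftrightarrow> b' \<notin> Q i" using D.unit_fraction_iff[OF _ b(2) hs] b(1) by simp
 thus ?thesis using U.taylor_0_iff[of "\<eta> i b"] b(1) by (auto simp: \<tau>_def nonunits_def)
qed

lemma tau_f_0_iff: "i < m ==> b \<in> carrier B ==> \<tau> i (f b) 0 = \<zero>\<^sub>K \<longleftrightarrow> b \<in> Q i"
 by (rule tau_0_iff[OF _ _ _ L.denom_one]) auto

lemma N_fraction: "b \<in> carrier N ==> \<exists>b'\<in>carrier B. \<exists>s\<in>carrier A - P. b **\<^sub>N f (h s) = f b'"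
 using N.fraction by blast

text \<open>The division by the uniformizer takes place in the local ring \<open>D i\<close>. Its
  denominators are cleared in \<open>B\<close>, where the identity holds up to one more factor
  outside \<open>Q i\<close>; the product of all these factors is the \<open>s\<close> of the
  conclusion.\<close>

lemma tau_local_divides:
 assumes i: "i < m" and b: "b \<in> carrier N" "\<tau> i b 0 = \<zero>\<^sub>K"
 shows "\<exists>s\<in>carrier N. \<exists>c\<in>carrier N. \<tau> i s 0 \<noteq> \<zero>\<^sub>K \<and> s **\<^sub>N b = f (\<omega> i) **\<^sub>N c"
proof -
 interpret D: prime_localization B "D i" "e i" "Q i" by (rule branch[OF i])
 obtain b' s where b': "b' \<in> carrier B" "s \<in> carrier A - P" "b **\<^sub>N f (h s) = f b'" using N_fraction[OF b(1)] by blast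
 have "b' \<in> Q i" using tau_0_iff[OF i b(1) b'] b(2) by simp
 hence "e i b' \<in> nonunits (D i)" using D.unit_iff[OF b'(1)] b'(1) by (simp add: nonunits_def)
 then obtain x where x: "x \<in> carrier (D i)" "e i b' = e i (\<omega> i) **\<^bsub>D i\<^esub> x" using omega(3)[OF i] by blast
 obtain c v where c: "c \<in> carrier B" "v \<in> carrier B - Q i" "x **\<^bsub>D i\<^esub> e i v = e i c" using D.fraction[OF x(1)] by blast
 note w = omega(4)[OF i]
 have "e i (b' **\<^sub>B v) = (e i (\<omega> i) **\<^bsub>D i\<^esub> x) **\<^bsub>D i\<^esub> e i v" using b' c(2) x(2) by simp
 also have "... = e i (\<omega> i **\<^sub>B c)" using x(1) c w by (simp add: D.S.m_assoc)
 finally obtain v' where v': "v' \<in> carrier B - Q i" "v' **\<^sub>B (b' **\<^sub>B v) = v' **\<^sub>B (\<omega> i **\<^sub>B c)"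
  using D.equal[of "b' **\<^sub>B v" "\<omega> i **\<^sub>B c"] b' c w by auto
 have vv: "v' **\<^sub>B v \<in> carrier B - Q i" using D.denom_mult[OF v'(1) c(2)] .
 have cl: "f v' \<in> carrier N" "f v \<in> carrier N" "f (h s) \<in> carrier N" "f b' \<in> carrier N" "f (\<omega> i) \<in> carrier N" "f c \<in> carrier N"
  using v' c b' w by auto
 have eq: "f v' **\<^sub>N (f b' **\<^sub>N f v) = f v' **\<^sub>N (f (\<omega> i) **\<^sub>N f c)"
  using arg_cong[OF v'(2), of f] v'(1) b'(1) c(1,2) w by simp
 have "(f v' **\<^sub>N f v) **\<^sub>N f (h s) **\<^sub>N b = f v' **\<^sub>N ((b **\<^sub>N f (h s)) **\<^sub>N f v)" using cl b(1) by algebra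
 also have "... = f v' **\<^sub>N (f (\<omega> i) **\<^sub>N f c)" unfolding b'(3) eq ..
 also have "... = f (\<omega> i) **\<^sub>N (f v' **\<^sub>N f c)" using cl by algebra
 finally have "f ((v' **\<^sub>B v) **\<^sub>B h s) **\<^sub>N b = f (\<omega> i) **\<^sub>N f (v' **\<^sub>B c)" using v'(1) c b'(2) by simp
 moreover have "h s \<in> carrier B - Q i" using b'(2) contraction[OF i] by auto
 hence "(v' **\<^sub>B v) **\<^sub>B h s \<in> carrier B - Q i" using D.denom_mult[OF vv] by blast
 hence "\<tau> i (f ((v' **\<^sub>B v) **\<^sub>B h s)) 0 \<noteq> \<zero>\<^sub>K" using tau_f_0_iff[OF i] by blast
 ultimately show ?thesis using v'(1) c(1,2) b'(2) by (intro bexI[of _ "f ((v' **\<^sub>B v) **\<^sub>B h s)"] bexI[of _ "f (v' **\<^sub>B c)"]) auto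
qed

text \<open>Distinct branches are incomparable: if \<open>Q j\<close> were contained in
  \<open>Q i\<close>, an element of \<open>Q i\<close> would differ from an element of
  \<open>Q j\<close> by a scalar lying in \<open>Q i\<close>, which is zero, and the two ideals
  would coincide.\<close>

lemma tau_distinct:
 assumes i: "i < m" and j: "j < m" and ij: "i \<noteq> j"
 shows "\<exists>b\<in>carrier N. \<tau> i b 0 \<noteq> \<zero>\<^sub>K \<and> \<tau> j b 0 = \<zero>\<^sub>K"
proof -
 interpret D: prime_localization B "D i" "e i" "Q i" by (rule branch[OF i])
 interpret E: prime_localization B "D j" "e j" "Q j" by (rule branch[OF j])
 have "\<not> Q j \<subseteq> Q i"
 proof
  assume sub: "Q j \<subseteq> Q i"
  have "b \<in> Q j" if b: "b \<in> Q i" for b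
  proof -
   have bc: "b \<in> carrier B" using b D.P.Icarr by blast
   obtain c where c: "c \<in> carrier K" "e j b \<ominus>\<^bsub>D j\<^esub> e j (h (emb c)) \<in> nonunits (D j)"
    using residue_D[OF j, of "e j b"] bc by auto
   have hc: "h (emb c) \<in> carrier B" using c by simp
   have "e j (b \<ominus>\<^sub>B h (emb c)) \<in> nonunits (D j)" using c bc by (simp add: a_minus_def)
   hence bj: "b \<ominus>\<^sub>B h (emb c) \<in> Q j" using E.unit_iff[of "b \<ominus>\<^sub>B h (emb c)"] bc hc by (auto simp: nonunits_def)
   hence "b \<oplus>\<^sub>B \<ominus>\<^sub>B (b \<ominus>\<^sub>B h (emb c)) \<in> Q i" using b sub D.P.a_closed D.P.a_inv_closed by blast
   moreover have "b \<oplus>\<^sub>B \<ominus>\<^sub>B (b \<ominus>\<^sub>B h (emb c)) = h (emb c)" using bc hc by algebra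
   ultimately have "c = \<zero>\<^sub>K" using scalar_in_prime[OF D.P.primeideal_axioms c(1)] by simp
   thus ?thesis using bj bc by (simp add: a_minus_def)
  qed
  hence "Q i = Q j" using sub by blast
  thus False using Q_inj i j ij by (auto simp: inj_on_def)
 qed
 then obtain b where b: "b \<in> Q j" "b \<notin> Q i" by blast
 hence "b \<in> carrier B" using E.P.Icarr by blast
 thus ?thesis using b tau_f_0_iff[OF i, of b] tau_f_0_iff[OF j, of b] N.hom_closed by blast
qed

lemma tau_unitI:
 assumes b: "b \<in> carrier N" "\<And>i. i < m ==> \<tau> i b 0 \<noteq> \<zero>\<^sub>K"
 shows "b \<in> Units N"
proof -
 obtain b' s where b': "b' \<in> carrier B" "s \<in> carrier A - P" "b **\<^sub>N f (h s) = f b'" using N_fraction[OF b(1)] by blast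
 have "f b' \<in> Units N" using nonunit_in_branch[OF b'(1)] tau_0_iff[OF _ b(1) b'] b(2) by blast
 moreover have "h s \<in> carrier B" using b'(2) by simp
 ultimately show ?thesis using N.S.unit_factor[of b "f (h s)"] b(1) b'(3) by simp
qed

text \<open>The element \<open>w\<close> becomes an element \<open>x\<close> of \<open>L\<close>
  after multiplication by \<open>u\<close>, and the maximal ideal annihilates \<open>x\<close>
  modulo \<open>u\<close>. Its representative \<open>y\<close> in the chart is \<open>s x\<close>
  for a denominator \<open>s\<close>. As \<open>s\<close> has nonzero residue \<open>c\<close> and
  the maximal ideal kills \<open>x\<close> modulo \<open>u\<close>, the elements \<open>y\<close>
  and \<open>c x\<close> agree modulo \<open>u\<close>.\<close>

lemma socle_element_globalize:
 assumes w: "w \<in> carrier N" "\<And>a. a \<in> nonunits L ==> \<psi> a **\<^sub>N w \<in> \<psi> ` carrier L"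
 shows "\<exists>x\<in>carrier L. \<exists>c\<in>carrier K. \<exists>y\<in>carrier A. \<psi> (g u) **\<^sub>N w = \<psi> x \<and> c \<noteq> \<zero>\<^sub>K \<and>
  g y \<ominus>\<^sub>L embL c **\<^sub>L x \<in> multiples L (g u) \<and> (\<forall>p\<in>P. p ** y \<in> multiples A u)"
proof -
 have u: "g u \<in> nonunits L" "g u \<in> carrier L" using nonunit_g_iff u_in_P by auto
 obtain x where x: "x \<in> carrier L" "\<psi> (g u) **\<^sub>N w = \<psi> x" using w(2)[OF u(1)] by blast
 have ann: "a **\<^sub>L x \<in> multiples L (g u)" if a: "a \<in> nonunits L" for a
 proof -
  have ac: "a \<in> carrier L" using a by (simp add: nonunits_def)
  obtain z where z: "z \<in> carrier L" "\<psi> a **\<^sub>N w = \<psi> z" using w(2)[OF a] by blast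
  have "\<psi> (a **\<^sub>L x) = \<psi> a **\<^sub>N (\<psi> (g u) **\<^sub>N w)" using ac x by simp
  also have "... = \<psi> (g u) **\<^sub>N (\<psi> a **\<^sub>N w)" using ac u(2) w(1) by (intro N.S.m_lcomm) auto
  also have "... = \<psi> (g u **\<^sub>L z)" unfolding z(2) using z(1) u(2) by simp
  finally have "a **\<^sub>L x = g u **\<^sub>L z" using inj_onD[OF psi_inj] ac x(1) z(1) u(2) by simp
  thus ?thesis using z(1) by (auto simp: multiples_def)
 qed
 obtain s y where y: "s \<in> carrier A - P" "y \<in> carrier A" "x **\<^sub>L g s = g y" "\<forall>p\<in>P. p ** y \<in> multiples A u"
  using globalize[OF x(1) ann] by blast
 have sc: "s \<in> carrier A" "s \<notin> P" using y by auto
 obtain c where c: "c \<in> carrier K" "s \<ominus> emb c \<in> P" using residue_A[OF sc(1)] by blast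
 have "c \<noteq> \<zero>\<^sub>K" using c sc by (auto simp: a_minus_def)
 moreover have "g y \<ominus>\<^sub>L embL c **\<^sub>L x \<in> multiples L (g u)"
 proof -
  have gc: "g (emb c) \<in> carrier L" "g s \<in> carrier L" using c sc by auto
  have "g (s \<ominus> emb c) \<in> nonunits L" using nonunit_g_iff[of "s \<ominus> emb c"] c sc(1) by auto
  hence "g (s \<ominus> emb c) **\<^sub>L x \<in> multiples L (g u)" by (rule ann)
  moreover have "g (s \<ominus> emb c) = g s \<ominus>\<^sub>L g (emb c)" using sc(1) c(1) by (simp add: a_minus_def)
  moreover have "(g s \<ominus>\<^sub>L g (emb c)) **\<^sub>L x = x **\<^sub>L g s \<ominus>\<^sub>L g (emb c) **\<^sub>L x" using gc x(1) by algebra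
  ultimately show ?thesis using y(3) by simp
 qed
 ultimately show ?thesis using x y c(1) by blast
qed

text \<open>The socle relation in the chart is divided by \<open>u\<close> and carried back, the
  residues \<open>c\<close> and \<open>d\<close> of the denominators entering as factors of the
  coefficients. The resulting combination differs from an element of \<open>L\<close> by some
  \<open>q\<close> with \<open>u q = 0\<close>. Since \<open>u\<close> is nonzero in each of the
  domains \<open>D i\<close>, the image of \<open>q\<close> there is zero.\<close>

lemma tau_socle:
 assumes v: "v \<in> carrier N" "\<And>a. a \<in> nonunits L ==> \<psi> a **\<^sub>N v \<in> \<psi> ` carrier L"
  and w: "w \<in> carrier N" "\<And>a. a \<in> nonunits L ==> \<psi> a **\<^sub>N w \<in> \<psi> ` carrier L"
 shows "\<exists>x\<in>carrier K. \<exists>y\<in>carrier K. \<exists>z\<in>carrier L. (x \<noteq> \<zero>\<^sub>K \<or> y \<noteq> \<zero>\<^sub>K) \<and>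
  (\<forall>i<m. \<forall>k. \<tau> i (embN x **\<^sub>N v \<oplus>\<^sub>N embN y **\<^sub>N w \<ominus>\<^sub>N \<psi> z) k = \<zero>\<^sub>K)"
proof -
 obtain x c a where x: "x \<in> carrier L" "\<psi> (g u) **\<^sub>N v = \<psi> x" and c: "c \<in> carrier K" "c \<noteq> \<zero>\<^sub>K" and a: "a \<in> carrier A"
  "g a \<ominus>\<^sub>L embL c **\<^sub>L x \<in> multiples L (g u)" "\<forall>p\<in>P. p ** a \<in> multiples A u"
  using socle_element_globalize[OF v] by blast
 obtain y d b where y: "y \<in> carrier L" "\<psi> (g u) **\<^sub>N w = \<psi> y" and d: "d \<in> carrier K" "d \<noteq> \<zero>\<^sub>K" and b: "b \<in> carrier A"
  "g b \<ominus>\<^sub>L embL d **\<^sub>L y \<in> multiples L (g u)" "\<forall>p\<in>P. p ** b \<in> multiples A u"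
  using socle_element_globalize[OF w] by blast
 obtain \<alpha> \<beta> where ab: "\<alpha> \<in> carrier K" "\<beta> \<in> carrier K" "\<alpha> \<noteq> \<zero>\<^sub>K \<or> \<beta> \<noteq> \<zero>\<^sub>K" "emb \<alpha> ** a \<oplus> emb \<beta> ** b \<in> multiples A u"
  using socle_A[OF a(1) _ b(1)] a(3) b(3) by blast
 have gu: "g u \<in> carrier L" by simp
 obtain z1 where z1: "z1 \<in> carrier L" "g a \<ominus>\<^sub>L g (emb c) **\<^sub>L x = g u **\<^sub>L z1" using a(2) by (auto simp: multiples_def)
 obtain z2 where z2: "z2 \<in> carrier L" "g b \<ominus>\<^sub>L g (emb d) **\<^sub>L y = g u **\<^sub>L z2" using b(2) by (auto simp: multiples_def)
 obtain z3 where z3: "z3 \<in> carrier A" "emb \<alpha> ** a \<oplus> emb \<beta> ** b = u ** z3" using ab(4) by (auto simp: multiples_def)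
 have cl: "g (emb \<alpha>) \<in> carrier L" "g (emb \<beta>) \<in> carrier L" "g (emb c) \<in> carrier L" "g (emb d) \<in> carrier L" "g a \<in> carrier L" "g b \<in> carrier L" "g z3 \<in> carrier L"
  using ab c d a b z3 by auto
 have z3': "g (emb \<alpha>) **\<^sub>L g a \<oplus>\<^sub>L g (emb \<beta>) **\<^sub>L g b = g u **\<^sub>L g z3"
  using arg_cong[OF z3(2), of g] z3(1) ab(1,2) a(1) b(1) by simp
 define z where "z = g z3 \<ominus>\<^sub>L g (emb \<alpha>) **\<^sub>L z1 \<ominus>\<^sub>L g (emb \<beta>) **\<^sub>L z2"
 have z: "z \<in> carrier L" using cl z1 z2 by (simp add: z_def)
 have "g u **\<^sub>L z = g u **\<^sub>L g z3 \<ominus>\<^sub>L g (emb \<alpha>) **\<^sub>L (g u **\<^sub>L z1) \<ominus>\<^sub>L g (emb \<beta>) **\<^sub>L (g u **\<^sub>L z2)"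
  unfolding z_def using cl gu z1(1) z2(1) by algebra
 also have "... = (g (emb \<alpha>) **\<^sub>L g (emb c)) **\<^sub>L x \<oplus>\<^sub>L (g (emb \<beta>) **\<^sub>L g (emb d)) **\<^sub>L y"
  unfolding z3'[symmetric] z1(2)[symmetric] z2(2)[symmetric] using cl x(1) y(1) by algebra
 finally have uz: "(g (emb \<alpha>) **\<^sub>L g (emb c)) **\<^sub>L x \<oplus>\<^sub>L (g (emb \<beta>) **\<^sub>L g (emb d)) **\<^sub>L y = g u **\<^sub>L z" by simp
 let ?x = "\<alpha> **\<^sub>K c" and ?y = "\<beta> **\<^sub>K d"
 have xy: "?x \<in> carrier K" "?y \<in> carrier K" "?x \<noteq> \<zero>\<^sub>K \<or> ?y \<noteq> \<zero>\<^sub>K" using ab c d A.K.integral by auto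
 define q where "q = embN ?x **\<^sub>N v \<oplus>\<^sub>N embN ?y **\<^sub>N w \<ominus>\<^sub>N \<psi> z"
 have sc: "embN ?x = \<psi> (g (emb \<alpha>) **\<^sub>L g (emb c))" "embN ?y = \<psi> (g (emb \<beta>) **\<^sub>L g (emb d))"
  using psi_scalar[OF xy(1)] psi_scalar[OF xy(2)] ab c d by simp_all
 define sx sy where "sx = \<psi> (g (emb \<alpha>) **\<^sub>L g (emb c))" and "sy = \<psi> (g (emb \<beta>) **\<^sub>L g (emb d))"
 have scl: "sx \<in> carrier N" "sy \<in> carrier N" "\<psi> (g u) \<in> carrier N" "\<psi> z \<in> carrier N" using cl z unfolding sx_def sy_def by auto
 have q: "q \<in> carrier N" unfolding q_def sc sx_def[symmetric] sy_def[symmetric] using scl v(1) w(1) by simp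
 have "\<psi> (g u) **\<^sub>N q = sx **\<^sub>N (\<psi> (g u) **\<^sub>N v) \<oplus>\<^sub>N sy **\<^sub>N (\<psi> (g u) **\<^sub>N w) \<ominus>\<^sub>N \<psi> (g u) **\<^sub>N \<psi> z"
  unfolding q_def sc sx_def[symmetric] sy_def[symmetric] using scl v(1) w(1) by algebra
 also have "... = \<psi> ((g (emb \<alpha>) **\<^sub>L g (emb c)) **\<^sub>L x \<oplus>\<^sub>L (g (emb \<beta>) **\<^sub>L g (emb d)) **\<^sub>L y) \<ominus>\<^sub>N \<psi> (g u **\<^sub>L z)"
  unfolding x(2) y(2) sx_def sy_def using cl x(1) y(1) z gu by simp
 also have "... = \<zero>\<^sub>N" unfolding uz using scl z gu by (simp add: a_minus_def N.S.r_neg)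
 finally have 0: "\<psi> (g u) **\<^sub>N q = \<zero>\<^sub>N" .
 have "\<tau> i q k = \<zero>\<^sub>K" if i: "i < m" for i k
 proof -
  interpret U: uniformized_algebra K "D i" "embD i" "e i (\<omega> i)" by (rule uniformized[OF i])
  interpret H: ring_hom_cring N "D i" "\<eta> i" by (rule eta_hom[OF i])
  interpret D: prime_localization B "D i" "e i" "Q i" by (rule branch[OF i])
  have "e i (h u) **\<^bsub>D i\<^esub> \<eta> i q = \<zero>\<^bsub>D i\<^esub>"
   using arg_cong[OF 0, of "\<eta> i"] q scl eta(2)[OF i, of "h u"] psi_g[OF u_closed] by simp
  hence "\<eta> i q = \<zero>\<^bsub>D i\<^esub>"
   using U.integral[OF _ D.hom_closed[OF h.hom_closed[OF u_closed]] H.hom_closed[OF q]] u_nonzero_D[OF i] by blast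
  moreover have "U.taylor \<zero>\<^bsub>D i\<^esub> k = \<zero>\<^sub>K"
   using U.taylor_scalar_mult[of "\<zero>\<^bsub>D i\<^esub>" "\<zero>\<^sub>K" k] by simp
  ultimately show ?thesis by (simp add: \<tau>_def)
 qed
 thus ?thesis using xy z unfolding q_def by blast
qed

theorem elliptic:
 "\<exists>\<phi>\<in>ring_iso (completion L (nonunits L)) (power_series K (elliptic_vars m) Quot elliptic_ideal K m).
   \<forall>c\<in>carrier K. \<phi> (\<lambda>n. ideal_power L (nonunits L) n +>\<^sub>L embL c) =
    elliptic_ideal K m +>\<^bsub>power_series K (elliptic_vars m)\<^esub> ps_const K c"
proof -
 interpret curve_singularity K L embL N embN \<psi> m \<tau> "\<lambda>i. f (\<omega> i)"
 proof unfold_locales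
  fix i b assume i: "i < m" and b: "b \<in> carrier N"
  interpret U: uniformized_algebra K "D i" "embD i" "e i (\<omega> i)" by (rule uniformized[OF i])
  interpret H: ring_hom_cring N "D i" "\<eta> i" by (rule eta_hom[OF i])
  have sc: "\<eta> i (embN x) = (embD i) x" if "x \<in> carrier K" for x using eta(2)[OF i] that by simp
  have w: "\<eta> i (f (\<omega> i)) = e i (\<omega> i)" "f (\<omega> i) \<in> carrier N" using eta(2)[OF i] omega(4)[OF i] by auto
  show "\<tau> i b k \<in> carrier K" for k using b by (simp add: \<tau>_def)
  show "\<tau> i (b \<oplus>\<^sub>N c) k = \<tau> i b k \<oplus>\<^sub>K \<tau> i c k" if "c \<in> carrier N" for c k
   using b that by (simp add: \<tau>_def U.taylor_add)
  show "\<tau> i (b **\<^sub>N c) k = (\<Oplus>\<^sub>K j\<in>{..k}. \<tau> i b j **\<^sub>K \<tau> i c (k - j))" if "c \<in> carrier N" for c k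
   using b that by (simp add: \<tau>_def U.taylor_mult)
  show "\<tau> i (embN x **\<^sub>N b) k = x **\<^sub>K \<tau> i b k" if "x \<in> carrier K" for x k
   using b that U.taylor_scalar_mult[of "\<eta> i b" x k] H.hom_mult[of "embN x" b] sc[OF that] by (simp add: \<tau>_def)
  show "\<tau> i (f (\<omega> i) **\<^sub>N b) 0 = \<zero>\<^sub>K" "\<tau> i (f (\<omega> i) **\<^sub>N b) (Suc k) = \<tau> i b k" for k
   using b w U.taylor_uniformizer_mult[of "\<eta> i b"] by (simp_all add: \<tau>_def)
 next
  fix i x k assume i: "i < m" and x: "x \<in> carrier K"
  interpret U: uniformized_algebra K "D i" "embD i" "e i (\<omega> i)" by (rule uniformized[OF i])
  show "\<tau> i (embN x) k = (if k = 0 then x else \<zero>\<^sub>K)"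
  proof -
   have "\<eta> i (embN x) = (embD i) x" using eta(2)[OF i, of "h (emb x)"] x by simp
   thus ?thesis unfolding \<tau>_def by (simp only: U.taylor_scalar[OF x])
  qed
 next
  fix i a assume i: "i < m" and a: "a \<in> nonunits L"
  have ac: "a \<in> carrier L" using a by (simp add: nonunits_def)
  obtain b s where b: "b \<in> carrier A" "s \<in> carrier A - P" "a **\<^sub>L g s = g b" using L.fraction[OF ac] by blast
  have "b \<in> P" using L.unit_fraction_iff[OF ac b] a by (simp add: nonunits_def)
  moreover have "\<psi> a **\<^sub>N f (h s) = f (h b)" using arg_cong[OF b(3), of \<psi>] ac b(1,2) by (simp add: psi_g)
  moreover have "h b \<in> Q i" using calculation(1) contraction[OF i] by blast
  ultimately show "\<tau> i (\<psi> a) 0 = \<zero>\<^sub>K" using tau_0_iff[OF i psi.hom_closed[OF ac] h.hom_closed[OF b(1)] b(2)] by blast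
 qed ((fact psi.homh psi_inj psi_scalar m_pos residue_L tau_distinct tau_local_divides tau_unitI delta) |
  (rule N.hom_closed, rule omega(4), assumption) | (rule tau_socle; blast))+
 show ?thesis by (rule completion_elliptic)
qed

end

section \<open>Stalks\<close>

locale presheaf_point =
 fixes Z :: "('p, 'r) ringed_space" and x :: 'p
 assumes presheaf: "presheaf_of_rings Z" and point: "x \<in> topspace (base Z)"
begin

abbreviation "nbhd U \<equiv> openin (base Z) U \<and> x \<in> U"
abbreviation "\<O> \<equiv> sections Z"
abbreviation "G \<equiv> germ Z x"

lemma sections_cring: "openin (base Z) U ==> cring (\<O> U)"
 and restr_hom: "openin (base Z) U ==> openin (base Z) V ==> V \<subseteq> U ==> restr Z U V \<in> ring_hom (\<O> U) (\<O> V)"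
 and restr_restr: "openin (base Z) U ==> openin (base Z) V ==> openin (base Z) W ==> V \<subseteq> U ==> W \<subseteq> V ==>
  s \<in> carrier (\<O> U) ==> restr Z V W (restr Z U V s) = restr Z U W s" using presheaf by (simp_all add: presheaf_of_rings_def)

lemma restr_closed: "openin (base Z) U ==> openin (base Z) V ==> V \<subseteq> U ==> s \<in> carrier (\<O> U) ==> restr Z U V s \<in> carrier (\<O> V)"
 using ring_hom_closed[OF restr_hom] .

lemma germ_restr:
 assumes U: "nbhd U" and V: "nbhd V" "V \<subseteq> U" and s: "s \<in> carrier (\<O> U)"
 shows "G V (restr Z U V s) = G U s"
proof -
 have "(V', t) \<in> G V (restr Z U V s) \<longleftrightarrow> (V', t) \<in> G U s" for V' t
 proof
  assume "(V', t) \<in> G V (restr Z U V s)"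
  then obtain W where W: "nbhd V'" "t \<in> carrier (\<O> V')" "nbhd W" "W \<subseteq> V \<inter> V'" "restr Z V W (restr Z U V s) = restr Z V' W t"
   by (auto simp: germ_def)
  hence "restr Z U W s = restr Z V' W t" using restr_restr[of U V W s] U V s by simp
  thus "(V', t) \<in> G U s" using W V(2) by (auto simp: germ_def)
 next
  assume "(V', t) \<in> G U s"
  then obtain W where W: "nbhd V'" "t \<in> carrier (\<O> V')" "nbhd W" "W \<subseteq> U \<inter> V'" "restr Z U W s = restr Z V' W t"
   by (auto simp: germ_def)
  have W': "nbhd (W \<inter> V)" "W \<inter> V \<subseteq> W" "W \<inter> V \<subseteq> V" using W V by auto
  have "restr Z V (W \<inter> V) (restr Z U V s) = restr Z W (W \<inter> V) (restr Z U W s)"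
   using restr_restr[of U V "W \<inter> V" s] restr_restr[of U W "W \<inter> V" s] U V W W' s by simp
  also have "... = restr Z V' (W \<inter> V) t" unfolding W(5) using restr_restr[of V' W "W \<inter> V" t] W W' by simp
  finally show "(V', t) \<in> G V (restr Z U V s)" using W(1,2,4) W' by (auto simp: germ_def)
 qed
 thus ?thesis by auto
qed

lemma germ_self: "nbhd U ==> s \<in> carrier (\<O> U) ==> (U, s) \<in> G U s" by (auto simp: germ_def)

lemma germ_memD:
 assumes "nbhd U" "s \<in> carrier (\<O> U)" "(V, t) \<in> G U s"
 obtains W where "nbhd V" "t \<in> carrier (\<O> V)" "G V t = G U s" "nbhd W" "W \<subseteq> U" "W \<subseteq> V" "restr Z U W s = restr Z V W t"
proof -
 obtain W where W: "nbhd V" "t \<in> carrier (\<O> V)" "nbhd W" "W \<subseteq> U \<inter> V" "restr Z U W s = restr Z V W t"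
  using assms(3) by (auto simp: germ_def)
 have "G V t = G U s" using germ_restr[of V W t] germ_restr[of U W s] W assms by simp
 thus ?thesis using that W by blast
qed

lemma germ_eqD:
 assumes "nbhd U" "s \<in> carrier (\<O> U)" "nbhd V" "t \<in> carrier (\<O> V)" "G U s = G V t"
 obtains W where "nbhd W" "W \<subseteq> U" "W \<subseteq> V" "restr Z U W s = restr Z V W t"
proof -
 have "(V, t) \<in> G U s" using germ_self[OF assms(3,4)] assms(5) by simp
 thus ?thesis using germ_memD[OF assms(1,2)] that by metis
qed

text \<open>Sum and product of germs at once, for a family \<open>p\<close> of operations compatible
  with restriction. All representatives on a common neighbourhood give the same germ, so the union
  runs over a single set.\<close>

lemma germ_operation:
 assumes U: "nbhd U" and s: "s \<in> carrier (\<O> U)" "t \<in> carrier (\<O> U)"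
  and closed: "\<And>V a b. openin (base Z) V ==> a \<in> carrier (\<O> V) ==> b \<in> carrier (\<O> V) ==> p V a b \<in> carrier (\<O> V)"
  and hom: "\<And>V W a b. openin (base Z) V ==> openin (base Z) W ==> W \<subseteq> V ==> a \<in> carrier (\<O> V) ==>
   b \<in> carrier (\<O> V) ==> restr Z V W (p V a b) = p W (restr Z V W a) (restr Z V W b)"
 shows "\<Union>{G V (p V a b) | V a b. (V, a) \<in> G U s \<and> (V, b) \<in> G U t} = G U (p U s t)"
proof -
 have "G V (p V a b) = G U (p U s t)" if mem: "(V, a) \<in> G U s" "(V, b) \<in> G U t" for V a b
 proof -
  obtain W1 where V: "nbhd V" "a \<in> carrier (\<O> V)" and W1: "nbhd W1" "W1 \<subseteq> U" "W1 \<subseteq> V" "restr Z U W1 s = restr Z V W1 a"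
   using germ_memD[OF U s(1) mem(1)] by metis
  obtain W2 where b: "b \<in> carrier (\<O> V)" and W2: "nbhd W2" "W2 \<subseteq> U" "W2 \<subseteq> V" "restr Z U W2 t = restr Z V W2 b"
   using germ_memD[OF U s(2) mem(2)] by metis
  define W where "W = W1 \<inter> W2"
  have W: "nbhd W" "W \<subseteq> U" "W \<subseteq> V" "W \<subseteq> W1" "W \<subseteq> W2" using W1 W2 by (auto simp: W_def)
  have "restr Z U W s = restr Z V W a" using restr_restr[of U W1 W s] restr_restr[of V W1 W a] U V W W1 s by simp
  moreover have "restr Z U W t = restr Z V W b" using restr_restr[of U W2 W t] restr_restr[of V W2 W b] U V b W W2 s by simp
  ultimately have "restr Z U W (p U s t) = restr Z V W (p V a b)" using hom U V b W s by simp
  thus ?thesis using germ_restr[OF U W(1,2), of "p U s t"] germ_restr[OF V(1) W(1,3), of "p V a b"] closed U V b s by simp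
 qed
 hence "{G V (p V a b) | V a b. (V, a) \<in> G U s \<and> (V, b) \<in> G U t} = {G U (p U s t)}"
  using germ_self[OF U s(1)] germ_self[OF U s(2)] by blast
 thus ?thesis by simp
qed

lemma stalk_mult:
 assumes "nbhd U" "s \<in> carrier (\<O> U)" "t \<in> carrier (\<O> U)"
 shows "G U s **\<^bsub>stalk Z x\<^esub> G U t = G U (s **\<^bsub>\<O> U\<^esub> t)"
proof -
 have "G U s **\<^bsub>stalk Z x\<^esub> G U t = \<Union>{G V (a **\<^bsub>\<O> V\<^esub> b) | V a b. (V, a) \<in> G U s \<and> (V, b) \<in> G U t}"
  by (simp add: stalk_def)
 also have "... = G U (s **\<^bsub>\<O> U\<^esub> t)"
  by (rule germ_operation[OF assms]) (simp_all add: cring.cring_simprules(5)[OF sections_cring] ring_hom_mult[OF restr_hom])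
 finally show ?thesis .
qed

lemma stalk_add:
 assumes "nbhd U" "s \<in> carrier (\<O> U)" "t \<in> carrier (\<O> U)"
 shows "G U s \<oplus>\<^bsub>stalk Z x\<^esub> G U t = G U (s \<oplus>\<^bsub>\<O> U\<^esub> t)"
proof -
 have "G U s \<oplus>\<^bsub>stalk Z x\<^esub> G U t = \<Union>{G V (a \<oplus>\<^bsub>\<O> V\<^esub> b) | V a b. (V, a) \<in> G U s \<and> (V, b) \<in> G U t}"
  by (simp add: stalk_def)
 also have "... = G U (s \<oplus>\<^bsub>\<O> U\<^esub> t)"
  by (rule germ_operation[OF assms]) (simp_all add: cring.cring_simprules(1)[OF sections_cring] ring_hom_add[OF restr_hom])
 finally show ?thesis .
qed

lemma top_nbhd: "nbhd (topspace (base Z))" using point by simp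

lemma stalk_one:
 assumes "nbhd U" shows "\<one>\<^bsub>stalk Z x\<^esub> = G U \<one>\<^bsub>\<O> U\<^esub>"
proof -
 let ?T = "topspace (base Z)"
 have sub: "U \<subseteq> ?T" using assms openin_subset by blast
 interpret T: cring "\<O> ?T" using sections_cring by simp
 show ?thesis using germ_restr[OF top_nbhd assms sub T.one_closed] ring_hom_one[OF restr_hom[of ?T U]] assms sub by (simp add: stalk_def)
qed

lemma stalk_zero:
 assumes "nbhd U" shows "\<zero>\<^bsub>stalk Z x\<^esub> = G U \<zero>\<^bsub>\<O> U\<^esub>"
proof -
 let ?T = "topspace (base Z)"
 have sub: "U \<subseteq> ?T" using assms openin_subset by blast
 interpret T: cring "\<O> ?T" using sections_cring by simp
 interpret U: cring "\<O> U" using sections_cring assms by simp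
 interpret r: ring_hom_cring "\<O> ?T" "\<O> U" "restr Z ?T U" by unfold_locales (use restr_hom[of ?T U] assms sub in simp)
 show ?thesis using germ_restr[OF top_nbhd assms sub T.zero_closed] r.hom_zero by (simp add: stalk_def)
qed

lemma germ_closed: "nbhd U ==> s \<in> carrier (\<O> U) ==> G U s \<in> carrier (stalk Z x)" by (auto simp: stalk_def)

lemma stalk_elem:
 assumes "a \<in> carrier (stalk Z x)"
 obtains U s where "nbhd U" "s \<in> carrier (\<O> U)" "a = G U s" using assms by (auto simp: stalk_def)

lemma stalk_elem_in:
 assumes "nbhd V" "a \<in> carrier (stalk Z x)"
 shows "\<exists>U. nbhd U \<and> U \<subseteq> V \<and> (\<forall>W. nbhd W --> W \<subseteq> U --> (\<exists>s\<in>carrier (\<O> W). a = G W s))"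
proof -
 obtain U s where U: "nbhd U" "s \<in> carrier (\<O> U)" "a = G U s" using stalk_elem[OF assms(2)] .
 have "\<exists>s\<in>carrier (\<O> W). a = G W s" if "nbhd W" "W \<subseteq> U \<inter> V" for W
  using germ_restr[OF U(1) that(1) _ U(2)] restr_closed[OF _ _ _ U(2)] that U by (metis le_inf_iff)
 thus ?thesis using U(1) assms(1) by (intro exI[of _ "U \<inter> V"]) auto
qed

text \<open>No ring axiom involves more than three elements, so representatives of three germs on
  one neighbourhood reduce every axiom of the stalk to the ring of sections there.\<close>

lemma stalk_elems:
 assumes "a \<in> carrier (stalk Z x)" "b \<in> carrier (stalk Z x)" "c \<in> carrier (stalk Z x)"
 obtains U r s t where "nbhd U" "r \<in> carrier (\<O> U)" "s \<in> carrier (\<O> U)" "t \<in> carrier (\<O> U)"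
  "a = G U r" "b = G U s" "c = G U t"
proof -
 obtain U where U: "nbhd U" "\<And>W. nbhd W ==> W \<subseteq> U ==> \<exists>s\<in>carrier (\<O> W). a = G W s"
  using stalk_elem_in[OF top_nbhd assms(1)] by blast
 obtain V where V: "nbhd V" "V \<subseteq> U" "\<And>W. nbhd W ==> W \<subseteq> V ==> \<exists>s\<in>carrier (\<O> W). b = G W s"
  using stalk_elem_in[OF U(1) assms(2)] by blast
 obtain W where W: "nbhd W" "W \<subseteq> V" "\<And>W'. nbhd W' ==> W' \<subseteq> W ==> \<exists>s\<in>carrier (\<O> W'). c = G W' s"
  using stalk_elem_in[OF V(1) assms(3)] by blast
 obtain r where "r \<in> carrier (\<O> W)" "a = G W r" using U(2)[of W] W V by blast
 moreover obtain s where "s \<in> carrier (\<O> W)" "b = G W s" using V(3)[of W] W by blast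
 moreover obtain t where "t \<in> carrier (\<O> W)" "c = G W t" using W(3)[of W] W by blast
 ultimately show ?thesis using that W(1) by blast
qed

lemma stalk_cring: "cring (stalk Z x)"
proof (rule cringI)
 let ?S = "stalk Z x"
 show "abelian_group ?S"
 proof (rule abelian_groupI)
  fix a b c assume abc: "a \<in> carrier ?S" "b \<in> carrier ?S" "c \<in> carrier ?S"
  obtain U r s t where U: "nbhd U" "r \<in> carrier (\<O> U)" "s \<in> carrier (\<O> U)" "t \<in> carrier (\<O> U)"
   "a = G U r" "b = G U s" "c = G U t" using stalk_elems[OF abc] .
  interpret cring "\<O> U" using sections_cring U(1) by simp
  show "a \<oplus>\<^sub>?S b \<oplus>\<^sub>?S c = a \<oplus>\<^sub>?S (b \<oplus>\<^sub>?S c)" using U by (simp add: stalk_add a_assoc)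
 next
  fix a b assume ab: "a \<in> carrier ?S" "b \<in> carrier ?S"
  obtain U r s t where U: "nbhd U" "r \<in> carrier (\<O> U)" "s \<in> carrier (\<O> U)" "t \<in> carrier (\<O> U)"
   "a = G U r" "b = G U s" "b = G U t" using stalk_elems[OF ab ab(2)] .
  interpret cring "\<O> U" using sections_cring U(1) by simp
  show "a \<oplus>\<^sub>?S b \<in> carrier ?S" "a \<oplus>\<^sub>?S b = b \<oplus>\<^sub>?S a"
   unfolding U(5,6) using U(1-3) germ_closed by (simp_all add: stalk_add a_comm)
 next
  fix a assume a: "a \<in> carrier ?S"
  obtain U s where U: "nbhd U" "s \<in> carrier (\<O> U)" "a = G U s" using stalk_elem[OF a] .
  interpret cring "\<O> U" using sections_cring U(1) by simp
  show "\<zero>\<^sub>?S \<oplus>\<^sub>?S a = a" using U by (simp add: stalk_zero[OF U(1)] stalk_add)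
  show "\<exists>b\<in>carrier ?S. b \<oplus>\<^sub>?S a = \<zero>\<^sub>?S"
   using U germ_closed by (intro bexI[of _ "G U (\<ominus>\<^bsub>\<O> U\<^esub> s)"]) (auto simp: stalk_zero[OF U(1)] stalk_add l_neg)
 next
  interpret cring "\<O> (topspace (base Z))" using sections_cring by simp
  show "\<zero>\<^sub>?S \<in> carrier ?S" unfolding stalk_zero[OF top_nbhd] using germ_closed[OF top_nbhd] by simp
 qed
 show "comm_monoid ?S"
 proof (rule comm_monoidI)
  fix a b c assume abc: "a \<in> carrier ?S" "b \<in> carrier ?S" "c \<in> carrier ?S"
  obtain U r s t where U: "nbhd U" "r \<in> carrier (\<O> U)" "s \<in> carrier (\<O> U)" "t \<in> carrier (\<O> U)"
   "a = G U r" "b = G U s" "c = G U t" using stalk_elems[OF abc] .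
  interpret cring "\<O> U" using sections_cring U(1) by simp
  show "a **\<^sub>?S b **\<^sub>?S c = a **\<^sub>?S (b **\<^sub>?S c)" using U by (simp add: stalk_mult m_assoc)
 next
  fix a b assume ab: "a \<in> carrier ?S" "b \<in> carrier ?S"
  obtain U r s t where U: "nbhd U" "r \<in> carrier (\<O> U)" "s \<in> carrier (\<O> U)" "t \<in> carrier (\<O> U)"
   "a = G U r" "b = G U s" "b = G U t" using stalk_elems[OF ab ab(2)] .
  interpret cring "\<O> U" using sections_cring U(1) by simp
  show "a **\<^sub>?S b \<in> carrier ?S" "a **\<^sub>?S b = b **\<^sub>?S a"
   unfolding U(5,6) using U(1-3) germ_closed by (simp_all add: stalk_mult m_comm)
 next
  fix a assume a: "a \<in> carrier ?S"
  obtain U s where U: "nbhd U" "s \<in> carrier (\<O> U)" "a = G U s" using stalk_elem[OF a] .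
  interpret cring "\<O> U" using sections_cring U(1) by simp
  show "\<one>\<^sub>?S **\<^sub>?S a = a" using U by (simp add: stalk_one[OF U(1)] stalk_mult)
 next
  interpret cring "\<O> (topspace (base Z))" using sections_cring by simp
  show "\<one>\<^sub>?S \<in> carrier ?S" unfolding stalk_one[OF top_nbhd] using germ_closed[OF top_nbhd] by simp
 qed
 fix a b c assume abc: "a \<in> carrier ?S" "b \<in> carrier ?S" "c \<in> carrier ?S"
 obtain U r s t where U: "nbhd U" "r \<in> carrier (\<O> U)" "s \<in> carrier (\<O> U)" "t \<in> carrier (\<O> U)"
  "a = G U r" "b = G U s" "c = G U t" using stalk_elems[OF abc] .
 interpret cring "\<O> U" using sections_cring U(1) by simp
 show "(a \<oplus>\<^sub>?S b) **\<^sub>?S c = a **\<^sub>?S c \<oplus>\<^sub>?S b **\<^sub>?S c" using U by (simp add: stalk_add stalk_mult l_distr)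
qed

lemma germ_hom: "nbhd U ==> ring_hom_cring (\<O> U) (stalk Z x) (G U)"
proof -
 assume U: "nbhd U"
 hence "G U \<in> ring_hom (\<O> U) (stalk Z x)" by (intro ring_hom_memI) (simp_all add: germ_closed stalk_mult stalk_add stalk_one)
 thus ?thesis using sections_cring U stalk_cring by (simp add: ring_hom_cring_def ring_hom_cring_axioms_def)
qed

text \<open>The universal property of the stalk as a direct limit. It provides the map from the
  local ring to its normalization as well as the maps to the branches.\<close>

lemma stalk_hom_exists:
 assumes hom: "\<And>U. nbhd U ==> \<phi> U \<in> ring_hom (\<O> U) R"
  and compat: "\<And>U V s. nbhd U ==> nbhd V ==> V \<subseteq> U ==> s \<in> carrier (\<O> U) ==> \<phi> V (restr Z U V s) = \<phi> U s"
 shows "\<exists>\<psi>\<in>ring_hom (stalk Z x) R. \<forall>U s. nbhd U --> s \<in> carrier (\<O> U) --> \<psi> (G U s) = \<phi> U s"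
proof -
 define \<psi> where "\<psi> a = (let p = (SOME p. p \<in> a) in \<phi> (fst p) (snd p))" for a
 have \<psi>: "\<psi> (G U s) = \<phi> U s" if U: "nbhd U" "s \<in> carrier (\<O> U)" for U s
 proof -
  obtain V t where Vt: "(SOME p. p \<in> G U s) = (V, t)" by (rule prod.exhaust)
  have "(V, t) \<in> G U s" using someI[of "\<lambda>p. p \<in> G U s", OF germ_self[OF U]] unfolding Vt .
  then obtain W where W: "nbhd V" "t \<in> carrier (\<O> V)" "nbhd W" "W \<subseteq> U" "W \<subseteq> V" "restr Z U W s = restr Z V W t"
   using germ_memD[OF U] by metis
  have "\<phi> V t = \<phi> U s" using compat[OF U(1) W(3,4) U(2)] compat[OF W(1,3,5,2)] W(6) by simp
  thus ?thesis by (simp add: \<psi>_def Vt)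
 qed
 have "\<psi> \<in> ring_hom (stalk Z x) R"
 proof (rule ring_hom_memI)
  fix a b assume ab: "a \<in> carrier (stalk Z x)" "b \<in> carrier (stalk Z x)"
  obtain U r s t where U: "nbhd U" "r \<in> carrier (\<O> U)" "s \<in> carrier (\<O> U)" "t \<in> carrier (\<O> U)"
   "a = G U r" "b = G U s" "b = G U t" using stalk_elems[OF ab ab(2)] .
  interpret cring "\<O> U" using sections_cring U(1) by simp
  show "\<psi> (a **\<^bsub>stalk Z x\<^esub> b) = \<psi> a **\<^sub>R \<psi> b" "\<psi> (a \<oplus>\<^bsub>stalk Z x\<^esub> b) = \<psi> a \<oplus>\<^sub>R \<psi> b"
   unfolding U(5,6) using U(1-3) ring_hom_mult[OF hom[OF U(1)]] ring_hom_add[OF hom[OF U(1)]] by (simp_all add: stalk_mult stalk_add \<psi>)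
 next
  fix a assume a: "a \<in> carrier (stalk Z x)"
  obtain U s where U: "nbhd U" "s \<in> carrier (\<O> U)" "a = G U s" using stalk_elem[OF a] .
  show "\<psi> a \<in> carrier R" unfolding U(3) \<psi>[OF U(1,2)] using ring_hom_closed[OF hom[OF U(1)] U(2)] .
 next
  interpret cring "\<O> (topspace (base Z))" using sections_cring by simp
  show "\<psi> \<one>\<^bsub>stalk Z x\<^esub> = \<one>\<^sub>R"
   unfolding stalk_one[OF top_nbhd] \<psi>[OF top_nbhd one_closed] using ring_hom_one[OF hom[OF top_nbhd]] .
 qed
 thus ?thesis using \<psi> by blast
qed

text \<open>Neighbourhoods and denominators are indexed separately so that two situations are
  covered: the stalk of a scheme, where \<open>D n\<close> is the locus where \<open>n\<close> does
  not vanish, and the stalk of the pushforward, where \<open>D n\<close> lies downstairs while the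
  denominator is the pullback of \<open>n\<close>.\<close>

lemma stalk_localization:
 assumes U: "nbhd U" and d: "\<And>n. n \<in> I ==> d n \<in> carrier (\<O> U)"
  and D: "\<And>n. n \<in> I ==> nbhd (D n)" "\<And>n. n \<in> I ==> D n \<subseteq> U"
  and loc: "\<And>n. n \<in> I ==> is_localization_away (\<O> U) (d n) (\<O> (D n)) (restr Z U (D n))"
  and basis: "\<And>V. nbhd V ==> V \<subseteq> U ==> \<exists>n\<in>I. D n \<subseteq> V"
  and one: "\<one>\<^bsub>\<O> U\<^esub> \<in> d ` I"
  and mult: "\<And>a b. a \<in> d ` I ==> b \<in> d ` I ==> a **\<^bsub>\<O> U\<^esub> b \<in> d ` I"
 shows "localization (\<O> U) (stalk Z x) (G U) (d ` I)"
proof -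
 interpret g: ring_hom_cring "\<O> U" "stalk Z x" "G U" by (rule germ_hom[OF U])
 have pow: "d n [^]\<^bsub>\<O> U\<^esub> (k::nat) \<in> d ` I" if n: "n \<in> I" for n k by (induction k) (use one mult n in auto)
 show ?thesis
 proof unfold_locales
  show "s \<in> d ` I ==> s \<in> carrier (\<O> U)" for s using d by blast
  show "\<one>\<^bsub>\<O> U\<^esub> \<in> d ` I" by (rule one)
  show "a \<in> d ` I ==> b \<in> d ` I ==> a **\<^bsub>\<O> U\<^esub> b \<in> d ` I" for a b by (rule mult)
 next
  fix s assume "s \<in> d ` I"
  then obtain n where n: "n \<in> I" "s = d n" by blast
  interpret gD: ring_hom_cring "\<O> (D n)" "stalk Z x" "G (D n)" by (rule germ_hom[OF D(1)[OF n(1)]])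
  have u: "restr Z U (D n) (d n) \<in> Units (\<O> (D n))" using loc[OF n(1)] by (simp add: is_localization_away_def)
  then obtain v where v: "v \<in> carrier (\<O> (D n))" "restr Z U (D n) (d n) **\<^bsub>\<O> (D n)\<^esub> v = \<one>\<^bsub>\<O> (D n)\<^esub>"
   using gD.R.Units_r_inv_ex by blast
  have "G (D n) (restr Z U (D n) (d n)) **\<^bsub>stalk Z x\<^esub> G (D n) v = \<one>\<^bsub>stalk Z x\<^esub>"
   using gD.hom_mult[OF gD.R.Units_closed[OF u] v(1)] v(2) by simp
  hence "G (D n) (restr Z U (D n) (d n)) \<in> Units (stalk Z x)"
   using g.S.unit_factor[OF _ gD.hom_closed[OF gD.R.Units_closed[OF u]] gD.hom_closed[OF v(1)]] by simp
  thus "G U s \<in> Units (stalk Z x)" unfolding n(2) germ_restr[OF U D(1)[OF n(1)] D(2)[OF n(1)] d[OF n(1)]] .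
 next
  fix z assume "z \<in> carrier (stalk Z x)"
  then obtain V s where V: "nbhd V" "s \<in> carrier (\<O> V)" "z = G V s" using stalk_elem by blast
  then obtain n where n: "n \<in> I" "D n \<subseteq> V \<inter> U" using basis[of "V \<inter> U"] U by auto
  note Dn = D[OF n(1)]
  interpret gD: ring_hom_cring "\<O> (D n)" "stalk Z x" "G (D n)" by (rule germ_hom[OF Dn(1)])
  have sc: "restr Z V (D n) s \<in> carrier (\<O> (D n))" using restr_closed V n(2) Dn(1) by simp
  obtain a k where a: "a \<in> carrier (\<O> U)"
   "restr Z V (D n) s **\<^bsub>\<O> (D n)\<^esub> (restr Z U (D n) (d n) [^]\<^bsub>\<O> (D n)\<^esub> (k::nat)) = restr Z U (D n) a"
   using loc[OF n(1)] sc unfolding is_localization_away_def by blast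
  have dc: "restr Z U (D n) (d n) \<in> carrier (\<O> (D n))" using restr_closed U Dn d[OF n(1)] by simp
  have "z **\<^bsub>stalk Z x\<^esub> (G U (d n) [^]\<^bsub>stalk Z x\<^esub> k) = G U a"
   using arg_cong[OF a(2), of "G (D n)"] sc dc germ_restr[OF V(1) Dn(1) _ V(2)] n(2)
    germ_restr[OF U Dn d[OF n(1)]] germ_restr[OF U Dn a(1)] V(3) by simp
  hence "z **\<^bsub>stalk Z x\<^esub> G U (d n [^]\<^bsub>\<O> U\<^esub> k) = G U a" using d[OF n(1)] by simp
  thus "\<exists>a\<in>carrier (\<O> U). \<exists>s\<in>d ` I. z **\<^bsub>stalk Z x\<^esub> G U s = G U a" using a(1) pow[OF n(1)] by blast
 next
  fix a assume a: "a \<in> carrier (\<O> U)" "G U a = \<zero>\<^bsub>stalk Z x\<^esub>"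
  hence "G U a = G U \<zero>\<^bsub>\<O> U\<^esub>" by simp
  then obtain W where W: "nbhd W" "W \<subseteq> U" "restr Z U W a = restr Z U W \<zero>\<^bsub>\<O> U\<^esub>"
   using germ_eqD[OF U a(1) U g.R.zero_closed] by metis
  obtain n where n: "n \<in> I" "D n \<subseteq> W" using basis[OF W(1,2)] by blast
  note Dn = D[OF n(1)]
  have "restr Z U (D n) a = restr Z U (D n) \<zero>\<^bsub>\<O> U\<^esub>"
   using restr_restr[of U W "D n" a] restr_restr[of U W "D n" "\<zero>\<^bsub>\<O> U\<^esub>"] U W n(2) Dn(1) a(1) by simp
  also have "... = \<zero>\<^bsub>\<O> (D n)\<^esub>"
  proof -
   interpret gD: cring "\<O> (D n)" using sections_cring Dn(1) by simp
   interpret r: ring_hom_cring "\<O> U" "\<O> (D n)" "restr Z U (D n)" by unfold_locales (use restr_hom[of U "D n"] U Dn in simp)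
   show ?thesis by simp
  qed
  finally obtain k :: nat where "(d n [^]\<^bsub>\<O> U\<^esub> k) **\<^bsub>\<O> U\<^esub> a = \<zero>\<^bsub>\<O> U\<^esub>"
   using loc[OF n(1)] a(1) unfolding is_localization_away_def by blast
  thus "\<exists>s\<in>d ` I. s **\<^bsub>\<O> U\<^esub> a = \<zero>\<^bsub>\<O> U\<^esub>" using pow[OF n(1)] by blast
 qed
qed

end

section \<open>Affine charts and morphisms\<close>

locale affine_chart =
 fixes Z :: "('p, 'r) ringed_space" and U
 assumes presheaf: "presheaf_of_rings Z" and affine: "affine_open Z U"
begin

abbreviation "v \<equiv> vanishing_ideal Z U"
abbreviation "D f \<equiv> {y \<in> U. f \<notin> v y}"

lemma U_open: "openin (base Z) U"
 and v_homeomorphic: "homeomorphic_map (subtopology (base Z) U) (spec_topology (sections Z U)) v"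
 and D_localization: "f \<in> carrier (sections Z U) ==> is_localization_away (sections Z U) f (sections Z (D f)) (restr Z U (D f))"
 using affine unfolding affine_open_def Let_def by auto

lemma U_subset: "U \<subseteq> topspace (base Z)" using U_open openin_subset by blast

lemma topspace_U: "topspace (subtopology (base Z) U) = U" using U_subset by auto

lemma chart_cring: "cring (sections Z U)" using presheaf U_open by (simp add: presheaf_of_rings_def)

lemma topspace_spec: "topspace (spec_topology (sections Z U)) = {P. primeideal P (sections Z U)}"
proof -
 interpret cring "sections Z U" by (rule chart_cring)
 have "\<exists>f\<in>carrier (sections Z U). f \<notin> P" if "primeideal P (sections Z U)" for P
 proof -
  interpret P: primeideal P "sections Z U" by fact
  show ?thesis using P.one_imp_carrier P.I_notcarr one_closed by auto
 qed
 thus ?thesis unfolding spec_topology_def topology_generated_by_topspace by blast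
qed

lemma v_image: "v ` U = {P. primeideal P (sections Z U)}"
 using homeomorphic_imp_surjective_map[OF v_homeomorphic] unfolding topspace_U topspace_spec .

lemma v_inj: "inj_on v U" using homeomorphic_imp_injective_map[OF v_homeomorphic] unfolding topspace_U .

lemma v_prime: "y \<in> U ==> primeideal (v y) (sections Z U)" using v_image by blast

lemma D_open:
 assumes f: "f \<in> carrier (sections Z U)"
 shows "openin (base Z) (D f)"
proof -
 have "openin (spec_topology (sections Z U)) {P. primeideal P (sections Z U) \<and> f \<notin> P}"
  unfolding spec_topology_def by (rule topology_generated_by_Basis) (use f in blast)
 hence "openin (subtopology (base Z) U) {y \<in> U. v y \<in> {P. primeideal P (sections Z U) \<and> f \<notin> P}}"
  using homeomorphic_imp_continuous_map[OF v_homeomorphic] unfolding continuous_map_def topspace_U by blast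
 moreover have "{y \<in> U. v y \<in> {P. primeideal P (sections Z U) \<and> f \<notin> P}} = D f" using v_prime by blast
 ultimately show ?thesis using openin_open_subtopology[OF U_open] by simp
qed

text \<open>The sets given by one function are only a generating family of the topology of the
  spectrum. The product \<open>f1 f2\<close> handles intersections, because a prime avoids it
  exactly when it avoids both factors; the homeomorphism then transports the basis to the
  chart.\<close>

lemma D_basis:
 assumes V: "openin (base Z) V" "V \<subseteq> U" and y: "y \<in> V"
 shows "\<exists>f\<in>carrier (sections Z U) - v y. D f \<subseteq> V"
proof -
 interpret cring "sections Z U" by (rule chart_cring)
 have "\<exists>f\<in>carrier (sections Z U) - P. {P'. primeideal P' (sections Z U) \<and> f \<notin> P'} \<subseteq> W"
  if "generate_topology_on {{P. primeideal P (sections Z U) \<and> f \<notin> P} | f. f \<in> carrier (sections Z U)} W" "P \<in> W"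
   "primeideal P (sections Z U)" for W P using that
 proof induction
  case (Int W1 W2)
  then obtain f1 f2 where f: "f1 \<in> carrier (sections Z U) - P" "{P'. primeideal P' (sections Z U) \<and> f1 \<notin> P'} \<subseteq> W1"
   "f2 \<in> carrier (sections Z U) - P" "{P'. primeideal P' (sections Z U) \<and> f2 \<notin> P'} \<subseteq> W2" by blast
  interpret P: primeideal P "sections Z U" by fact
  have "f1 **\<^bsub>sections Z U\<^esub> f2 \<in> carrier (sections Z U) - P" using f(1,3) P.I_prime[of f1 f2] by auto
  moreover have "f1 \<notin> P' \<and> f2 \<notin> P'" if "primeideal P' (sections Z U)" "f1 **\<^bsub>sections Z U\<^esub> f2 \<notin> P'" for P'
  proof -
   interpret P': primeideal P' "sections Z U" by fact
   show ?thesis using that(2) P'.I_l_closed[of f2 f1] P'.I_r_closed[of f1 f2] f(1,3) by blast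
  qed
  ultimately show ?case using f(2,4) by blast
 next
  case (UN k)
  then obtain W where W: "W \<in> k" "P \<in> W" by blast
  obtain f where "f \<in> carrier (sections Z U) - P" "{P'. primeideal P' (sections Z U) \<and> f \<notin> P'} \<subseteq> W"
   using UN.IH[OF W UN.prems(2)] by (elim bexE)
  thus ?case using W(1) by (intro bexI[of _ f]) auto
 next
  case (Basis W)
  thus ?case by blast
 qed simp
 note basis = this
 have "openin (subtopology (base Z) U) V" using V openin_open_subtopology[OF U_open] by simp
 hence "openin (spec_topology (sections Z U)) (v ` V)" using homeomorphic_imp_open_map[OF v_homeomorphic] unfolding open_map_def by blast
 hence "generate_topology_on {{P. primeideal P (sections Z U) \<and> f \<notin> P} | f. f \<in> carrier (sections Z U)} (v ` V)"
  unfolding spec_topology_def by (simp add: openin_topology_generated_by_iff)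
 then obtain f where f: "f \<in> carrier (sections Z U) - v y" "{P'. primeideal P' (sections Z U) \<and> f \<notin> P'} \<subseteq> v ` V"
  using basis[of "v ` V" "v y"] y V(2) v_prime by blast
 have "D f \<subseteq> V"
 proof
  fix z assume z: "z \<in> D f"
  hence "v z \<in> v ` V" using f(2) v_prime by blast
  thus "z \<in> V" using inj_on_image_mem_iff[OF v_inj _ V(2)] z by blast
 qed
 thus ?thesis using f(1) by blast
qed

lemma stalk_prime_localization:
 assumes y: "y \<in> U"
 shows "prime_localization (sections Z U) (stalk Z y) (germ Z y U) (v y)"
proof -
 interpret presheaf_point Z y by unfold_locales (use presheaf y U_subset in auto)
 interpret P: primeideal "v y" "sections Z U" by (rule v_prime[OF y])
 have "localization (sections Z U) (stalk Z y) (germ Z y U) ((\<lambda>n. n) ` (carrier (sections Z U) - v y))"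
 proof (rule stalk_localization[where D = D])
  show "\<one>\<^bsub>sections Z U\<^esub> \<in> (\<lambda>n. n) ` (carrier (sections Z U) - v y)" using P.one_imp_carrier P.I_notcarr by auto
  show "a **\<^bsub>sections Z U\<^esub> b \<in> (\<lambda>n. n) ` (carrier (sections Z U) - v y)"
   if "a \<in> (\<lambda>n. n) ` (carrier (sections Z U) - v y)" "b \<in> (\<lambda>n. n) ` (carrier (sections Z U) - v y)" for a b
   using that P.I_prime[of a b] by auto
  show "\<exists>n\<in>carrier (sections Z U) - v y. D n \<subseteq> V" if "nbhd V" "V \<subseteq> U" for V using D_basis that by blast
 qed (use y U_open D_open D_localization in auto)
 thus ?thesis using P.primeideal_axioms by (simp add: prime_localization_def)
qed

end

lemma localization_away_eq:
 assumes "is_localization_away A f B \<rho>" "cring A" "cring B" "f \<in> carrier A" "x \<in> carrier A" "y \<in> carrier A" "\<rho> x = \<rho> y"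
 shows "\<exists>n::nat. (f [^]\<^sub>A n) **\<^sub>A x = (f [^]\<^sub>A n) **\<^sub>A y"
proof -
 interpret \<rho>: ring_hom_cring A B \<rho> using assms(1-3) by (simp add: is_localization_away_def ring_hom_cring_def ring_hom_cring_axioms_def)
 have "\<rho> (x \<ominus>\<^sub>A y) = \<zero>\<^sub>B" using assms(5-7) by (simp add: a_minus_def \<rho>.S.r_neg)
 then obtain n :: nat where n: "(f [^]\<^sub>A n) **\<^sub>A (x \<ominus>\<^sub>A y) = \<zero>\<^sub>A"
  using assms(1,5,6) unfolding is_localization_away_def by (meson \<rho>.R.minus_closed)
 have c: "f [^]\<^sub>A n \<in> carrier A" using assms(4) by simp
 have "(f [^]\<^sub>A n) **\<^sub>A x = (f [^]\<^sub>A n) **\<^sub>A (x \<ominus>\<^sub>A y) \<oplus>\<^sub>A (f [^]\<^sub>A n) **\<^sub>A y"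
  by (rule \<rho>.R.distrib_diff_add[OF c assms(5,6)])
 hence "(f [^]\<^sub>A n) **\<^sub>A x = (f [^]\<^sub>A n) **\<^sub>A y" unfolding n using c assms(6) by simp
 thus ?thesis by blast
qed

lemma (in ring_hom_cring) hom_Units: "a \<in> Units R ==> h a \<in> Units S"
proof -
 assume a: "a \<in> Units R"
 hence c: "a \<in> carrier R" "inv\<^bsub>R\<^esub> a \<in> carrier R" using R.Units_closed R.Units_inv_closed by auto
 have "h a **\<^sub>S h (inv\<^bsub>R\<^esub> a) = \<one>\<^sub>S" using hom_mult[OF c] R.Units_r_inv[OF a] by simp
 thus ?thesis using S.unit_factor[of "h a" "h (inv\<^bsub>R\<^esub> a)"] c by simp
qed

section \<open>Morphisms on stalks and on vanishing ideals\<close>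

locale presheaf_morphism =
 fixes Y :: "('q, 's) ringed_space" and C :: "('p, 'r) ringed_space" and \<pi> :: "('q, 's, 'p, 'r) scheme_map"
 assumes presheaf_Y: "presheaf_of_rings Y" and presheaf_C: "presheaf_of_rings C" and morphism: "scheme_morphism Y C \<pi>"
begin

lemma preim_open: "openin (base C) V ==> openin (base Y) (preim Y \<pi> V)"
proof -
 assume V: "openin (base C) V"
 have "continuous_map (base Y) (base C) (pt \<pi>)" using morphism by (simp add: scheme_morphism_def)
 thus ?thesis using V by (simp add: continuous_map_def preim_def)
qed

lemma preim_mono: "V \<subseteq> V' ==> preim Y \<pi> V \<subseteq> preim Y \<pi> V'" by (auto simp: preim_def)

lemma pull_hom: "openin (base C) V ==> pull \<pi> V \<in> ring_hom (sections C V) (sections Y (preim Y \<pi> V))"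
 and pull_restr: "openin (base C) U ==> openin (base C) V ==> V \<subseteq> U ==> s \<in> carrier (sections C U) ==>
  pull \<pi> V (restr C U V s) = restr Y (preim Y \<pi> U) (preim Y \<pi> V) (pull \<pi> U s)" using morphism by (simp_all add: scheme_morphism_def)

lemma pushforward_presheaf: "presheaf_of_rings (pushforward Y \<pi> C)"
 using presheaf_Y preim_open preim_mono by (simp add: presheaf_of_rings_def pushforward_def)

text \<open>One direction is the locality demanded of a morphism of schemes. For the other, the
  induced map on stalks is a ring homomorphism and so preserves units.\<close>

lemma stalk_unit_iff:
 assumes U: "openin (base C) U" and y: "y \<in> preim Y \<pi> U" and a: "a \<in> carrier (sections C U)"
 shows "germ Y y (preim Y \<pi> U) (pull \<pi> U a) \<in> Units (stalk Y y) \<longleftrightarrow> germ C (pt \<pi> y) U a \<in> Units (stalk C (pt \<pi> y))"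
proof
 show "germ Y y (preim Y \<pi> U) (pull \<pi> U a) \<in> Units (stalk Y y) ==> germ C (pt \<pi> y) U a \<in> Units (stalk C (pt \<pi> y))"
  using morphism U y a by (simp add: scheme_morphism_def)
next
 assume u: "germ C (pt \<pi> y) U a \<in> Units (stalk C (pt \<pi> y))"
 have pU: "pt \<pi> y \<in> U" and yt: "y \<in> topspace (base Y)" using y by (auto simp: preim_def)
 interpret c: presheaf_point C "pt \<pi> y" by unfold_locales (use presheaf_C pU U openin_subset in blast)+
 interpret y: presheaf_point Y y by unfold_locales (use presheaf_Y yt in auto)
 have yV: "y \<in> preim Y \<pi> V" if "pt \<pi> y \<in> V" for V using that yt by (simp add: preim_def)
 have "\<exists>\<psi>\<in>ring_hom (stalk C (pt \<pi> y)) (stalk Y y). \<forall>V s. c.nbhd V --> s \<in> carrier (sections C V) -->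
   \<psi> (germ C (pt \<pi> y) V s) = (germ Y y (preim Y \<pi> V) \<circ> pull \<pi> V) s"
 proof (rule c.stalk_hom_exists)
  fix V assume V: "c.nbhd V"
  then interpret g: ring_hom_cring "sections Y (preim Y \<pi> V)" "stalk Y y" "germ Y y (preim Y \<pi> V)" using y.germ_hom preim_open yV by blast
  show "germ Y y (preim Y \<pi> V) \<circ> pull \<pi> V \<in> ring_hom (sections C V) (stalk Y y)" using ring_hom_trans[OF pull_hom g.homh] V by blast
 next
  fix U V s assume *: "c.nbhd U" "c.nbhd V" "V \<subseteq> U" "s \<in> carrier (sections C U)"
  have "pull \<pi> U s \<in> carrier (sections Y (preim Y \<pi> U))" using ring_hom_closed[OF pull_hom] * by blast
  thus "(germ Y y (preim Y \<pi> V) \<circ> pull \<pi> V) (restr C U V s) = (germ Y y (preim Y \<pi> U) \<circ> pull \<pi> U) s"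
   using * pull_restr[of U V s] y.germ_restr[of "preim Y \<pi> U" "preim Y \<pi> V"] preim_open yV preim_mono by simp
 qed
 then obtain \<psi> where \<psi>: "\<psi> \<in> ring_hom (stalk C (pt \<pi> y)) (stalk Y y)"
  "\<psi> (germ C (pt \<pi> y) U a) = germ Y y (preim Y \<pi> U) (pull \<pi> U a)" using U pU a by auto
 interpret \<psi>: ring_hom_cring "stalk C (pt \<pi> y)" "stalk Y y" \<psi>
  using \<psi>(1) c.stalk_cring y.stalk_cring by (simp add: ring_hom_cring_def ring_hom_cring_axioms_def)
 show "germ Y y (preim Y \<pi> U) (pull \<pi> U a) \<in> Units (stalk Y y)" using \<psi>.hom_Units[OF u] \<psi>(2) by simp
qed

lemma vanishing_ideal_pull_iff:
 assumes U: "openin (base C) U" and y: "y \<in> preim Y \<pi> U" and a: "a \<in> carrier (sections C U)"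
 shows "pull \<pi> U a \<in> vanishing_ideal Y (preim Y \<pi> U) y \<longleftrightarrow> a \<in> vanishing_ideal C U (pt \<pi> y)"
proof -
 have pU: "pt \<pi> y \<in> U" and yt: "y \<in> topspace (base Y)" using y by (auto simp: preim_def)
 interpret c: presheaf_point C "pt \<pi> y" by unfold_locales (use presheaf_C pU U openin_subset in blast)+
 interpret y: presheaf_point Y y by unfold_locales (use presheaf_Y yt in auto)
 have "pull \<pi> U a \<in> carrier (sections Y (preim Y \<pi> U))" using ring_hom_closed[OF pull_hom] U a by blast
 thus ?thesis using stalk_unit_iff[OF assms] a c.germ_closed y.germ_closed U y pU preim_open by (simp add: vanishing_ideal_def nonunits_def)
qed

end

lemma quotient_has_dim_cong:
 assumes "abelian_monoid M" "\<And>c. c \<in> carrier K ==> emb c = emb' c"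
  "\<And>c b. c \<in> carrier K ==> b \<in> carrier M ==> emb' c **\<^sub>M b \<in> carrier M" "quotient_has_dim K emb M W n"
 shows "quotient_has_dim K emb' M W n"
proof -
 interpret abelian_monoid M by fact
 obtain b where b: "b \<in> {..<n} \<rightarrow> carrier M" and ex: "\<forall>x\<in>carrier M. \<exists>!c. c \<in> {..<n} \<rightarrow>\<^sub>E carrier K \<and>
   x \<ominus>\<^sub>M finsum M (\<lambda>i. emb (c i) **\<^sub>M b i) {..<n} \<in> W"
  using assms(4) unfolding quotient_has_dim_def by (elim bexE) (rule that)
 have "finsum M (\<lambda>i. emb (c i) **\<^sub>M b i) {..<n} = finsum M (\<lambda>i. emb' (c i) **\<^sub>M b i) {..<n}" if "c \<in> {..<n} \<rightarrow>\<^sub>E carrier K" for c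
  using that b assms(2,3) by (intro finsum_cong') (auto simp: PiE_iff Pi_iff)
 hence "\<forall>x\<in>carrier M. \<exists>!c. c \<in> {..<n} \<rightarrow>\<^sub>E carrier K \<and> x \<ominus>\<^sub>M finsum M (\<lambda>i. emb' (c i) **\<^sub>M b i) {..<n} \<in> W"
  using ex by (simp cong: conj_cong)
 thus ?thesis unfolding quotient_has_dim_def using b by blast
qed

section \<open>The main theorem\<close>

locale normalized_affine_point =
 presheaf_morphism Y C \<pi> + C: affine_chart C U + Y: affine_chart Y "preim Y \<pi> U"
 for Y :: "('q, 's) ringed_space" and C :: "('p, 'r) ringed_space" and \<pi> :: "('q, 's, 'p, 'r) scheme_map" and U +
 fixes p
 assumes p: "p \<in> U" and norm: "normalization_at Y \<pi> C p"
begin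

abbreviation "W \<equiv> preim Y \<pi> U"
abbreviation "A \<equiv> sections C U"
abbreviation "B \<equiv> sections Y W"
abbreviation "h \<equiv> pull \<pi> U"
abbreviation "F \<equiv> pushforward Y \<pi> C"
abbreviation "T \<equiv> topspace (base C)"

lemma h_hom: "ring_hom_cring A B h"
 using pull_hom[OF C.U_open] C.chart_cring Y.chart_cring by (simp add: ring_hom_cring_def ring_hom_cring_axioms_def)

lemma W_iff: "y \<in> W \<longleftrightarrow> y \<in> topspace (base Y) \<and> pt \<pi> y \<in> U" by (simp add: preim_def)

lemma branch_in_W: "y \<in> branches Y \<pi> p ==> y \<in> W \<and> pt \<pi> y = p" using p by (simp add: branches_def preim_def)

lemma contraction:
 assumes "y \<in> W" shows "{a \<in> carrier A. h a \<in> Y.v y} = C.v (pt \<pi> y)"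
 using vanishing_ideal_pull_iff[OF C.U_open assms] by (auto simp: vanishing_ideal_def)

lemma preim_D:
 assumes "a \<in> carrier A" shows "preim Y \<pi> (C.D a) = Y.D (h a)" using vanishing_ideal_pull_iff[OF C.U_open _ assms] by (auto simp: preim_def)

lemma h_closed: "a \<in> carrier A ==> h a \<in> carrier B" using ring_hom_closed[OF pull_hom[OF C.U_open]] .

lemma D_iso:
 assumes x: "x \<in> C.v p" "x \<in> carrier A"
 shows "pull \<pi> (C.D x) \<in> ring_iso (sections C (C.D x)) (sections Y (Y.D (h x)))"
proof -
 have "\<forall>V. openin (base C) V --> p \<notin> V --> pull \<pi> V \<in> ring_iso (sections C V) (sections Y (preim Y \<pi> V))"
  using norm by (simp add: normalization_at_def)
 thus ?thesis using C.D_open[OF x(2)] x(1) preim_D[OF x(2)] by force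
qed

lemma pull_restr_D:
 assumes "x \<in> carrier A" "a \<in> carrier A"
 shows "pull \<pi> (C.D x) (restr C U (C.D x) a) = restr Y W (Y.D (h x)) (h a)"
 using pull_restr[OF C.U_open C.D_open[OF assms(1)] _ assms(2)] preim_D[OF assms(1)] by auto

text \<open>On the locus where \<open>x\<close> does not vanish the pullback is an isomorphism, so
  \<open>b\<close> comes there from a section over the open set below. Multiplication by a power of
  \<open>x\<close> extends that section to the chart, and a further power turns equality on the
  locus into equality in \<open>B\<close>.\<close>

lemma clear_denominator:
 assumes x: "x \<in> C.v p" and b: "b \<in> carrier B"
 shows "\<exists>a\<in>carrier A. \<exists>n::nat. h x [^]\<^sub>B n **\<^sub>B b = h a"
proof -
 have xc: "x \<in> carrier A" using x by (simp add: vanishing_ideal_def)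
 let ?V = "C.D x" and ?V' = "Y.D (h x)"
 interpret h: ring_hom_cring A B h by (rule h_hom)
 have cV: "cring (sections C ?V)" "cring (sections Y ?V')"
  using presheaf_C presheaf_Y C.D_open[OF xc] Y.D_open[OF h_closed[OF xc]] by (simp_all add: presheaf_of_rings_def)
 have iso: "pull \<pi> ?V \<in> ring_hom (sections C ?V) (sections Y ?V')"
  "pull \<pi> ?V ` carrier (sections C ?V) = carrier (sections Y ?V')" using D_iso[OF x xc] by (auto simp: ring_iso_def bij_betw_def)
 interpret j: ring_hom_cring "sections C ?V" "sections Y ?V'" "pull \<pi> ?V"
  using cV iso(1) by (simp add: ring_hom_cring_def ring_hom_cring_axioms_def)
 have lA: "is_localization_away A x (sections C ?V) (restr C U ?V)" by (rule C.D_localization[OF xc])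
 have lB: "is_localization_away B (h x) (sections Y ?V') (restr Y W ?V')" by (rule Y.D_localization[OF h_closed[OF xc]])
 interpret r: ring_hom_cring A "sections C ?V" "restr C U ?V"
  using lA C.chart_cring cV by (simp add: is_localization_away_def ring_hom_cring_def ring_hom_cring_axioms_def)
 interpret s: ring_hom_cring B "sections Y ?V'" "restr Y W ?V'"
  using lB Y.chart_cring cV by (simp add: is_localization_away_def ring_hom_cring_def ring_hom_cring_axioms_def)
 obtain z where z: "z \<in> carrier (sections C ?V)" "restr Y W ?V' b = pull \<pi> ?V z"
  using s.hom_closed[OF b] unfolding iso(2)[symmetric] by (elim imageE)
 obtain a n where a: "a \<in> carrier A" "z **\<^bsub>sections C ?V\<^esub> (restr C U ?V x [^]\<^bsub>sections C ?V\<^esub> (n::nat)) = restr C U ?V a"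
  using lA z(1) unfolding is_localization_away_def by blast
 have "restr Y W ?V' (b **\<^sub>B h x [^]\<^sub>B n) = pull \<pi> ?V (z **\<^bsub>sections C ?V\<^esub> (restr C U ?V x [^]\<^bsub>sections C ?V\<^esub> n))"
  using b z xc pull_restr_D[OF xc xc] h_closed[OF xc] by simp
 also have "... = restr Y W ?V' (h a)" unfolding a(2) by (rule pull_restr_D[OF xc a(1)])
 finally obtain k :: nat where "(h x [^]\<^sub>B k) **\<^sub>B (b **\<^sub>B h x [^]\<^sub>B n) = (h x [^]\<^sub>B k) **\<^sub>B h a"
  using localization_away_eq[OF lB Y.chart_cring cV(2) h_closed[OF xc], of "b **\<^sub>B h x [^]\<^sub>B n" "h a"]
   b h_closed xc a(1) by auto
 moreover have "(h x [^]\<^sub>B k) **\<^sub>B (b **\<^sub>B h x [^]\<^sub>B n) = h x [^]\<^sub>B (k + n) **\<^sub>B b"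
  using b h_closed[OF xc] by (simp add: h.S.nat_pow_mult[symmetric] h.S.m_ac)
 moreover have "(h x [^]\<^sub>B k) **\<^sub>B h a = h (x [^]\<^sub>A k **\<^sub>A a)" using xc a(1) by simp
 ultimately have "h x [^]\<^sub>B (k + n) **\<^sub>B b = h (x [^]\<^sub>A k **\<^sub>A a)" by simp
 moreover have "x [^]\<^sub>A k **\<^sub>A a \<in> carrier A" using xc a(1) by simp
 ultimately show ?thesis by blast
qed

lemma h_kernel:
 assumes x: "x \<in> C.v p" and a: "a \<in> carrier A" "h a = \<zero>\<^sub>B"
 shows "\<exists>n::nat. x [^]\<^sub>A n **\<^sub>A a = \<zero>\<^sub>A"
proof -
 have xc: "x \<in> carrier A" using x by (simp add: vanishing_ideal_def)
 let ?V = "C.D x" and ?V' = "Y.D (h x)"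
 interpret h: ring_hom_cring A B h by (rule h_hom)
 have lA: "is_localization_away A x (sections C ?V) (restr C U ?V)" by (rule C.D_localization[OF xc])
 have cV: "cring (sections C ?V)" using presheaf_C C.D_open[OF xc] by (simp add: presheaf_of_rings_def)
 interpret r: ring_hom_cring A "sections C ?V" "restr C U ?V"
  using lA C.chart_cring cV by (simp add: is_localization_away_def ring_hom_cring_def ring_hom_cring_axioms_def)
 have "pull \<pi> ?V (restr C U ?V a) = pull \<pi> ?V (restr C U ?V \<zero>\<^sub>A)"
  using pull_restr_D[OF xc a(1)] pull_restr_D[OF xc h.R.zero_closed] a(2) by simp
 moreover have "inj_on (pull \<pi> ?V) (carrier (sections C ?V))" using D_iso[OF x xc] by (simp add: ring_iso_def bij_betw_def)
 ultimately have "restr C U ?V a = restr C U ?V \<zero>\<^sub>A" using r.hom_closed a(1) h.R.zero_closed by (meson inj_onD)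
 then obtain n :: nat where "(x [^]\<^sub>A n) **\<^sub>A a = (x [^]\<^sub>A n) **\<^sub>A \<zero>\<^sub>A"
  using localization_away_eq[OF lA C.chart_cring cV xc a(1) h.R.zero_closed] by blast
 thus ?thesis using xc by auto
qed

text \<open>The neighbourhood of the branch point \<open>q\<close> where \<open>s\<close> does not
  vanish contains a point \<open>y\<close> outside the fibre over \<open>p\<close>, as such points
  are dense. Its prime avoids \<open>s\<close> and lies over a point other than \<open>p\<close>,
  hence over a prime other than that of \<open>p\<close>.\<close>

lemma dense:
 assumes q: "q \<in> branches Y \<pi> p" and s: "s \<in> carrier B" "s \<notin> Y.v q"
 shows "\<exists>J. primeideal J B \<and> s \<notin> J \<and> {a \<in> carrier A. h a \<in> J} \<noteq> C.v p"
proof -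
 have "q \<in> base Y closure_of (preim Y \<pi> (T - {p}))" using norm branch_in_W[OF q] by (simp add: normalization_at_def W_iff)
 hence "q \<in> Y.D s \<and> openin (base Y) (Y.D s) --> (\<exists>y. y \<in> preim Y \<pi> (T - {p}) \<and> y \<in> Y.D s)"
  unfolding in_closure_of by (elim conjE) (erule spec)
 moreover have "q \<in> Y.D s \<and> openin (base Y) (Y.D s)" using Y.D_open[OF s(1)] branch_in_W[OF q] s(2) by simp
 ultimately have "\<exists>y. y \<in> preim Y \<pi> (T - {p}) \<and> y \<in> Y.D s" by (rule mp)
 then obtain y where y: "y \<in> preim Y \<pi> (T - {p})" "y \<in> Y.D s" by (elim exE conjE)
 hence "pt \<pi> y \<in> U" "pt \<pi> y \<noteq> p" by (auto simp: preim_def)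
 hence "C.v (pt \<pi> y) \<noteq> C.v p" using inj_onD[OF C.v_inj, of "pt \<pi> y" p] p by blast
 thus ?thesis using y(2) contraction[of y] Y.v_prime[of y] by (intro exI[of _ "Y.v y"]) simp
qed

lemma lying_over:
 assumes J: "primeideal J B" and P: "{a \<in> carrier A. h a \<in> J} = C.v p"
 shows "\<exists>q\<in>branches Y \<pi> p. J = Y.v q"
proof -
 obtain y where y: "y \<in> W" "J = Y.v y" using J Y.v_image by blast
 hence "C.v (pt \<pi> y) = C.v p" using contraction[OF y(1)] P by simp
 hence "pt \<pi> y = p" using inj_onD[OF C.v_inj] p y(1) by (simp add: W_iff)
 thus ?thesis using y by (auto simp: branches_def preim_def)
qed

sublocale C': presheaf_point C p by unfold_locales (use presheaf_C p C.U_subset in auto)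

sublocale F: presheaf_point F p by unfold_locales (use pushforward_presheaf p C.U_subset in "auto simp: pushforward_def")

lemma F_simps [simp]: "base F = base C" "sections F V = sections Y (preim Y \<pi> V)"
 "restr F V V' = restr Y (preim Y \<pi> V) (preim Y \<pi> V')" by (simp_all add: pushforward_def)

text \<open>The basic neighbourhoods of \<open>p\<close> pull back to basic open sets upstairs, cut
  out by the pulled back functions. So the pushforward stalk inverts the pullbacks of functions that
  do not vanish at \<open>p\<close>.\<close>

lemma F_localization: "localization B (stalk F p) (germ F p U) (h ` (carrier A - C.v p))"
proof -
 interpret h: ring_hom_cring A B h by (rule h_hom)
 interpret P: primeideal "C.v p" A by (rule C.v_prime[OF p])
 have "localization (sections F U) (stalk F p) (germ F p U) (h ` (carrier A - C.v p))"
 proof (rule F.stalk_localization[where D = C.D])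
  show "\<one>\<^bsub>sections F U\<^esub> \<in> h ` (carrier A - C.v p)"
   using P.one_imp_carrier P.I_notcarr by (auto intro!: image_eqI[of _ _ "\<one>\<^sub>A"])
  show "a **\<^bsub>sections F U\<^esub> b \<in> h ` (carrier A - C.v p)"
   if mem: "a \<in> h ` (carrier A - C.v p)" "b \<in> h ` (carrier A - C.v p)" for a b
  proof -
   obtain a' b' where ab: "a' \<in> carrier A - C.v p" "b' \<in> carrier A - C.v p" "a = h a'" "b = h b'" using mem by blast
   hence "a' **\<^sub>A b' \<in> carrier A - C.v p" using P.I_prime[of a' b'] by auto
   moreover have "a **\<^sub>B b = h (a' **\<^sub>A b')" using ab by simp
   ultimately show ?thesis by auto
  qed
  show "\<exists>n\<in>carrier A - C.v p. C.D n \<subseteq> V" if "F.nbhd V" "V \<subseteq> U" for V using C.D_basis that by simp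
  show "is_localization_away (sections F U) (h n) (sections F (C.D n)) (restr F U (C.D n))"
   if "n \<in> carrier A - C.v p" for n using Y.D_localization[OF h_closed, of n] preim_D[of n] that by simp
 qed (use p C.U_open C.D_open h_closed in auto)
 thus ?thesis by simp
qed

lemma stalk_pull_exists:
 "\<exists>\<psi>\<in>ring_hom (stalk C p) (stalk F p). \<forall>V s. C'.nbhd V --> s \<in> carrier (sections C V) -->
   \<psi> (germ C p V s) = germ F p V (pull \<pi> V s)"
proof -
 have "\<exists>\<psi>\<in>ring_hom (stalk C p) (stalk F p). \<forall>V s. C'.nbhd V --> s \<in> carrier (sections C V) -->
   \<psi> (germ C p V s) = (germ F p V \<circ> pull \<pi> V) s"
 proof (rule C'.stalk_hom_exists)
  fix V assume V: "C'.nbhd V"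
  interpret g: ring_hom_cring "sections F V" "stalk F p" "germ F p V" using F.germ_hom V by simp
  show "germ F p V \<circ> pull \<pi> V \<in> ring_hom (sections C V) (stalk F p)"
   using ring_hom_trans[OF pull_hom[of V], of "germ F p V" "stalk F p"] g.homh V by simp
 next
  fix V V' s assume *: "C'.nbhd V" "C'.nbhd V'" "V' \<subseteq> V" "s \<in> carrier (sections C V)"
  have "pull \<pi> V s \<in> carrier (sections F V)" using ring_hom_closed[OF pull_hom] * by simp
  thus "(germ F p V' \<circ> pull \<pi> V') (restr C V V' s) = (germ F p V \<circ> pull \<pi> V) s"
   using * pull_restr[of V V' s] F.germ_restr[of V V' "pull \<pi> V s"] by simp
 qed
 thus ?thesis by simp
qed

lemma stalk_branch_exists:
 assumes q: "q \<in> branches Y \<pi> p"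
 shows "\<exists>\<eta>\<in>ring_hom (stalk F p) (stalk Y q). \<forall>V s. C'.nbhd V --> s \<in> carrier (sections Y (preim Y \<pi> V)) -->
   \<eta> (germ F p V s) = germ Y q (preim Y \<pi> V) s"
proof -
 interpret q: presheaf_point Y q by unfold_locales (use presheaf_Y branch_in_W[OF q] W_iff in auto)
 have qV: "q.nbhd (preim Y \<pi> V)" if "C'.nbhd V" for V using that preim_open branch_in_W[OF q] W_iff by (auto simp: preim_def)
 have "\<exists>\<eta>\<in>ring_hom (stalk F p) (stalk Y q). \<forall>V s. F.nbhd V --> s \<in> carrier (sections F V) -->
   \<eta> (germ F p V s) = germ Y q (preim Y \<pi> V) s"
 proof (rule F.stalk_hom_exists)
  fix V assume V: "F.nbhd V"
  interpret g: ring_hom_cring "sections Y (preim Y \<pi> V)" "stalk Y q" "germ Y q (preim Y \<pi> V)" using q.germ_hom qV V by simp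
  show "germ Y q (preim Y \<pi> V) \<in> ring_hom (sections F V) (stalk Y q)" using g.homh by simp
 next
  fix V V' s assume *: "F.nbhd V" "F.nbhd V'" "V' \<subseteq> V" "s \<in> carrier (sections F V)"
  thus "germ Y q (preim Y \<pi> V') (restr F V V' s) = germ Y q (preim Y \<pi> V) s" using q.germ_restr[OF qV qV preim_mono] by simp
 qed
 thus ?thesis by simp
qed

end

theorem propositionA3:
  fixes K :: "'k ring" and \<kappa> :: "'k \<Rightarrow> 'r"
    and C :: "('p, 'r) ringed_space" and p :: 'p
    and Y :: "('q, 's) ringed_space" and \<pi> :: "('q, 's, 'p, 'r) scheme_map"
    and m :: nat
  assumes "algebraically_closed K"
    and "curve_over K \<kappa> C"
    and "singular_point C p"
    and "normalization_at Y \<pi> C p"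
    and "gorenstein_at K \<kappa> C p"
    and "card (branches Y \<pi> p) = m"
    and "has_genus K \<kappa> C Y \<pi> p 1"
  shows "elliptic_fold_point K \<kappa> C p m"
proof -
 have pC: "presheaf_of_rings C" using assms(2) by (simp add: curve_over_def is_scheme_def sheaf_of_rings_def)
 have pY: "presheaf_of_rings Y" and fin: "finite_morphism Y C \<pi>"
  using assms(4) by (simp_all add: normalization_at_def is_scheme_def sheaf_of_rings_def)
 have mor: "scheme_morphism Y C \<pi>"
  and aff: "\<And>U. affine_open C U ==> affine_open Y (preim Y \<pi> U) \<and>
   finite_over (sections Y (preim Y \<pi> U)) (pull \<pi> U ` carrier (sections C U))" using fin by (simp_all add: finite_morphism_def)
 obtain U t where U: "affine_open C U" "p \<in> U" and t: "t \<in> carrier (sections C U)"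
  and gor: "ring.transcendental (sections C U) (scalar C \<kappa> U ` carrier K) t"
   "finite_over (sections C U) (ring.simple_extension (sections C U) (scalar C \<kappa> U ` carrier K) t)"
   "free_of_rank_one (sections C U) (dualizing_module (sections C U)
    (ring.simple_extension (sections C U) (scalar C \<kappa> U ` carrier K) t))" using assms(5) unfolding gorenstein_at_def Let_def by blast
 interpret X: normalized_affine_point Y C \<pi> U p by unfold_locales (use pC pY mor U aff[OF U(1)] assms(4) in auto)
 let ?A = "sections C U" and ?B = "sections Y (preim Y \<pi> U)" and ?F = "pushforward Y \<pi> C" and ?T = "topspace (base C)"
 let ?L = "stalk C p" and ?N = "stalk ?F p" and ?g = "germ C p U" and ?f = "germ ?F p U" and ?h = "pull \<pi> U"
 let ?emb = "scalar C \<kappa> U" and ?c = "\<lambda>J. {a \<in> carrier (sections C U). pull \<pi> U a \<in> J}"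
 let ?P = "vanishing_ideal C U p" and ?v = "vanishing_ideal Y (preim Y \<pi> U)"
 have T: "X.C'.nbhd ?T" by (rule X.C'.top_nbhd)
 have Un: "X.C'.nbhd U" using U X.C.U_open by simp
 have \<kappa>: "\<kappa> \<in> ring_hom K (sections C ?T)" using assms(2) by (simp add: curve_over_def)
 interpret K: algebraically_closed K by fact
 have "?emb \<in> ring_hom K ?A" using ring_hom_trans[OF \<kappa> X.C'.restr_hom[of ?T U]] T Un X.C.U_subset
  by (simp add: scalar_def[abs_def] comp_def)
 then interpret A: kalgebra K ?A ?emb using X.C.chart_cring K.is_cring K.field_axioms
  by (simp add: kalgebra_def ring_hom_cring_def ring_hom_cring_axioms_def)
 interpret h: ring_hom_cring ?A ?B ?h by (rule X.h_hom)
 interpret L: prime_localization ?A ?L ?g ?P by (rule X.C.stalk_prime_localization[OF U(2)])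
 interpret N: localization ?B ?N ?f "?h ` (carrier ?A - ?P)" by (rule X.F_localization)
 obtain \<psi> where \<psi>: "\<psi> \<in> ring_hom ?L ?N" "\<And>V s. X.C'.nbhd V ==> s \<in> carrier (sections C V) ==>
   \<psi> (germ C p V s) = germ ?F p V (pull \<pi> V s)" using X.stalk_pull_exists by blast
 interpret psi: ring_hom_cring ?L ?N \<psi> using \<psi>(1) by unfold_locales
 have scalar_germ: "?g (?emb c) = germ C p ?T (\<kappa> c)" if "c \<in> carrier K" for c
  using X.C'.germ_restr[OF T Un X.C.U_subset ring_hom_closed[OF \<kappa> that]] by (simp add: scalar_def)
 obtain d where br: "finite (branches Y \<pi> p)" and "has_delta_invariant K \<kappa> C Y \<pi> p d" "1 = int d - int m + 1"
  using assms(6,7) unfolding has_genus_def by blast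
 \<comment> \<open>Genus one reads \<open>d - m + 1 = 1\<close>, so the delta invariant equals the
   number of branches.\<close>
 hence "has_delta_invariant K \<kappa> C Y \<pi> p m" by simp
 moreover have "{germ ?F p V (pull \<pi> V s) | V s. openin (base C) V \<and> p \<in> V \<and> s \<in> carrier (sections C V)} = \<psi> ` carrier ?L"
 proof -
  have "germ ?F p V (pull \<pi> V s) \<in> \<psi> ` carrier ?L"
   if V: "openin (base C) V" "p \<in> V" "s \<in> carrier (sections C V)" for V s
   unfolding \<psi>(2)[OF conjI[OF V(1,2)] V(3), symmetric] using X.C'.germ_closed V by blast
  moreover have "\<exists>V s. \<psi> z = germ ?F p V (pull \<pi> V s) \<and> openin (base C) V \<and> p \<in> V \<and> s \<in> carrier (sections C V)"
   if z: "z \<in> carrier ?L" for z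
  proof -
   obtain V s where V: "X.C'.nbhd V" "s \<in> carrier (sections C V)" "z = germ C p V s" using X.C'.stalk_elem[OF z] .
   thus ?thesis using \<psi>(2)[OF V(1,2)] by blast
  qed
  ultimately show ?thesis by (intro equalityI subsetI) (elim CollectE exE conjE imageE; simp)+
 qed
 ultimately have "quotient_has_dim K (\<lambda>c. germ ?F p ?T (pull \<pi> ?T (\<kappa> c))) ?N (\<psi> ` carrier ?L) m"
  by (simp add: has_delta_invariant_def Let_def)
 moreover have "germ ?F p ?T (pull \<pi> ?T (\<kappa> c)) = (?f \<circ> (?h \<circ> ?emb)) c" if "c \<in> carrier K" for c
  using \<psi>(2)[OF T ring_hom_closed[OF \<kappa> that]] \<psi>(2)[OF Un A.hom_closed[OF that]] scalar_germ[OF that] by simp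
 ultimately have delta: "quotient_has_dim K (?f \<circ> (?h \<circ> ?emb)) ?N (\<psi> ` carrier ?L) m"
  by (intro quotient_has_dim_cong[where emb' = "?f \<circ> (?h \<circ> ?emb)"]) (auto intro: N.S.abelian_monoid_axioms)
 obtain q where q: "bij_betw q {0..<m} (branches Y \<pi> p)" using ex_bij_betw_nat_finite[OF br] assms(6) by blast
 hence qb: "q i \<in> branches Y \<pi> p" if "i < m" for i using that by (auto dest: bij_betwE)
 have qW: "q i \<in> preim Y \<pi> U" "pt \<pi> (q i) = p" if "i < m" for i using X.branch_in_W[OF qb[OF that]] by auto
 define branch_hom where "branch_hom i \<eta> \<longleftrightarrow> \<eta> \<in> ring_hom ?N (stalk Y (q i)) \<and> (\<forall>V s. X.C'.nbhd V -->
  s \<in> carrier (sections Y (preim Y \<pi> V)) --> \<eta> (germ ?F p V s) = germ Y (q i) (preim Y \<pi> V) s)" for i \<eta>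
 define \<eta> where "\<eta> i = (SOME \<eta>. branch_hom i \<eta>)" for i
 have "branch_hom i (\<eta> i)" if i: "i < m" for i
 proof -
  have "\<exists>\<eta>. branch_hom i \<eta>" unfolding branch_hom_def using X.stalk_branch_exists[OF qb[OF i]] by (elim bexE) (intro exI conjI)
  thus ?thesis unfolding \<eta>_def by (rule someI_ex)
 qed
 hence \<eta>: "\<And>i. i < m ==> \<eta> i \<in> ring_hom ?N (stalk Y (q i))"
  "\<And>i V s. i < m ==> X.C'.nbhd V ==> s \<in> carrier (sections Y (preim Y \<pi> V)) ==>
   \<eta> i (germ ?F p V s) = germ Y (q i) (preim Y \<pi> V) s" by (simp_all add: branch_hom_def)
 interpret E: normalization_chart K ?A ?emb ?B ?h ?L ?g ?P ?N ?f \<psi> m "\<lambda>i. stalk Y (q i)"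
  "\<lambda>i. ?v (q i)" "\<lambda>i. germ Y (q i) (preim Y \<pi> U)" \<eta> t
 proof (intro normalization_chart.intro normalization_chart_axioms.intro)
  show "\<psi> (?g a) = ?f (?h a)" if "a \<in> carrier ?A" for a using \<psi>(2)[OF Un that] .
  show "prime_localization ?B (stalk Y (q i)) (germ Y (q i) (preim Y \<pi> U)) (?v (q i))" if "i < m" for i
   using X.Y.stalk_prime_localization[OF qW(1)[OF that]] .
  show "\<eta> i (?f b) = germ Y (q i) (preim Y \<pi> U) b" if "i < m" "b \<in> carrier ?B" for i b using \<eta>(2)[OF that(1) Un that(2)] .
  show "\<exists>i<m. J = ?v (q i)"
   if J: "primeideal J ?B" "?c J = ?P" for J
  proof -
   obtain y where y: "y \<in> branches Y \<pi> p" "J = ?v y" using X.lying_over[OF J] by blast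
   hence "y \<in> q ` {0..<m}" using q by (simp add: bij_betw_def)
   then obtain i where "i < m" "y = q i" by auto
   thus ?thesis using y(2) by blast
  qed
  show "?c (?v (q i)) = ?P" if "i < m" for i using X.contraction[OF qW(1)[OF that]] qW(2)[OF that] by simp
  show "inj_on (\<lambda>i. ?v (q i)) {..<m}"
  proof (rule inj_onI)
   fix i j assume ij: "i \<in> {..<m}" "j \<in> {..<m}" "?v (q i) = ?v (q j)"
   hence "q i = q j" using inj_onD[OF X.Y.v_inj] qW(1) by simp
   thus "i = j" using ij q by (auto simp: bij_betw_def inj_on_def)
  qed
  show "\<exists>J. primeideal J ?B \<and> s \<notin> J \<and> ?c J \<noteq> ?P"
   if "i < m" "s \<in> carrier ?B" "s \<notin> ?v (q i)" for i s using X.dense[OF qb[OF that(1)] that(2,3)] .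
  show "integrally_closed_domain (stalk Y (q i))" if "i < m" for i using assms(4) qb[OF that] by (simp add: normalization_at_def branches_def)
  show "a = \<zero>\<^sub>?A" if "a \<in> carrier ?A" "a [^]\<^sub>?A n = \<zero>\<^sub>?A" for a and n :: nat
  proof -
   have "reduced_scheme C" using assms(2) by (simp add: curve_over_def)
   thus ?thesis using X.C.U_open that unfolding reduced_scheme_def by blast
  qed
  show "\<not> regular_local_ring ?L" using assms(3) by (simp add: singular_point_def)
 qed (fact assms(1) \<eta>(1) X.clear_denominator X.h_kernel conjunct2[OF aff[OF U(1)]] delta t gor
  A.kalgebra_axioms X.h_hom L.prime_localization_axioms N.localization_axioms psi.ring_hom_cring_axioms)+
 obtain \<phi> where \<phi>: "\<phi> \<in> ring_iso (completion ?L (nonunits ?L)) (power_series K (elliptic_vars m) Quot elliptic_ideal K m)"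
  "\<And>c. c \<in> carrier K ==> \<phi> (\<lambda>n. ideal_power ?L (nonunits ?L) n +>\<^sub>?L (?g \<circ> ?emb) c) =
    elliptic_ideal K m +>\<^bsub>power_series K (elliptic_vars m)\<^esub> ps_const K c" using E.elliptic by blast
 have "\<phi> (completed_scalar C \<kappa> p c) = elliptic_ideal K m +>\<^bsub>power_series K (elliptic_vars m)\<^esub> ps_const K c"
  if "c \<in> carrier K" for c using \<phi>(2)[OF that] scalar_germ[OF that] by (simp add: completed_scalar_def)
 thus ?thesis using \<phi>(1) E.m_pos unfolding elliptic_fold_point_def Let_def completed_local_ring_def by auto
qed

end
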